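(* Let $\Phi=\mathbf C_2=\{\pm e_1\pm e_2,\pm 2e_1,\pm 2e_2\}$, let $R$ be an arbitrary commutative ring with $1$, and suppose that either $\pi=\mathrm{ad}$ (i.e. the Chevalley group is adjoint) or $1/2\in R$. Let $G$ be a large subgroup of $G_\pi(\mathbf C_2,R)$. Then for every $\gamma\in\Phi$ the subgroup $X_\gamma=\{x_\gamma(t)\mid t\in R\}$ is Diophantine in $G$.
   Context: Let $\mathcal L$ be the complex semisimple Lie algebra with root system $\Phi$, with Chevalley basis $\{h_i;x_\alpha\}$, and let $\pi$ be a faithful finite-dimensional representation of $\mathcal L$ with weight lattice $\Lambda_\pi$ (a lattice between the root lattice and the lattice of all weights); $\pi=\mathrm{ad}$ means that $\Lambda_\pi$ is the root lattice. $G_\pi(\Phi,R)$ denotes the Chevalley group of type $(\Phi,\Lambda_\pi)$ over $R$, i.e. the group of $R$-points of the Chevalley--Demazure group scheme, realized as the subgroup of $\mathrm{SL}_n(R)$, $n=\dim\pi$, given by polynomial equations with integer coefficients in the matrix entries. For $\alpha\in\Phi$, $t\in R$, $x_\alpha(t)=\exp(t\pi(x_\alpha))$ is the elementary root unipotent; $E_\pi(\Phi,R)$ is the subgroup generated by all $x_\alpha(t)$; a subgroup of $G_\pi(\Phi,R)$ is large if it contains $E_\pi(\Phi,R)$. "$1/2\in R$" means that $2$ is invertible in $R$. A subset $H$ of a group $G$ is Diophantine in $G$ if it is definable in $G$ by a formula $\exists y_1\dots\exists y_n\bigwedge_{i=1}^k w_i(x,y_1,\dots,y_n)=1$, where each $w_i$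 is a group word in $x,y_1,\dots,y_n$ and constants from $G$. *)

theory Defs
  imports
    "HOL-Analysis.Analysis"
    "HOL-Algebra.Generated_Groups"
    "HOL-Computational_Algebra.Group_Closure"
    "HOL-Library.Poly_Mapping"
begin

section \<open>Diophantine subsets of a group\<close>

text \<open>Group words in the variables \<open>Var 0, Var 1, \<dots>\<close> with constants from a group.\<close>

datatype (gw_consts: 'a) gword =
    Const 'a
  | Var nat
  | Mul "'a gword" "'a gword"
  | Inv "'a gword"

primrec gw_vars :: "'a gword \<Rightarrow> nat set" where
  "gw_vars (Const a) = {}"
| "gw_vars (Var i) = {i}"
| "gw_vars (Mul u v) = gw_vars u \<union> gw_vars v"
| "gw_vars (Inv u) = gw_vars u"

primrec gw_eval :: "('a, 'b) monoid_scheme \<Rightarrow> (nat \<Rightarrow> 'a) \<Rightarrow> 'a gword \<Rightarrow> 'a" where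
  "gw_eval G y (Const a) = a"
| "gw_eval G y (Var i) = y i"
| "gw_eval G y (Mul u v) = gw_eval G y u \<otimes>\<^bsub>G\<^esub> gw_eval G y v"
| "gw_eval G y (Inv u) = inv\<^bsub>G\<^esub> gw_eval G y u"

text \<open>The free variable \<open>x\<close> of the defining formula is \<open>Var 0\<close>, the quantified variables
  \<open>y\<^sub>1, \<dots>, y\<^sub>n\<close> are \<open>Var 1, \<dots>, Var n\<close>.\<close>

definition diophantine_in :: "'a set \<Rightarrow> ('a, 'b) monoid_scheme \<Rightarrow> bool" where
  "diophantine_in H G \<longleftrightarrow>
     (\<exists>(n::nat) (ws :: 'a gword list).
        (\<forall>w\<in>set ws. gw_consts w \<subseteq> carrier G \<and> gw_vars w \<subseteq> {0..n}) \<and>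
        H = {g \<in> carrier G. \<exists>y. (\<forall>i\<in>{1..n}. y i \<in> carrier G) \<and>
                                  (\<forall>w\<in>set ws. gw_eval G (y(0 := g)) w = \<one>\<^bsub>G\<^esub>)})"


section \<open>Complex Lie algebras and Chevalley bases\<close>

locale complex_lie_algebra = vector_space smul
  for smul :: "complex \<Rightarrow> 'l::ab_group_add \<Rightarrow> 'l" +
  fixes lie :: "'l \<Rightarrow> 'l \<Rightarrow> 'l"
  assumes lie_linear_right: "Vector_Spaces.linear smul smul (\<lambda>b. lie a b)"
    and lie_linear_left: "Vector_Spaces.linear smul smul (\<lambda>a. lie a b)"
    and lie_self: "lie a a = 0"
    and jacobi: "lie a (lie b c) + lie b (lie c a) + lie c (lie a b) = 0"
begin

definition lie_ideal :: "'l set \<Rightarrow> bool" where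
  "lie_ideal I \<longleftrightarrow> subspace I \<and> (\<forall>a. \<forall>b\<in>I. lie a b \<in> I)"

definition derived_algebra :: "'l set \<Rightarrow> 'l set" where
  "derived_algebra A = span {lie a b | a b. a \<in> A \<and> b \<in> A}"

definition semisimple :: bool where
  "semisimple \<longleftrightarrow>
     (\<forall>I. lie_ideal I \<and> (\<exists>k. (derived_algebra ^^ k) I = {0}) \<longrightarrow> I = {0})"

end

definition coroot :: "'v::euclidean_space \<Rightarrow> 'v" where
  "coroot \<alpha> = (2 / (\<alpha> \<bullet> \<alpha>)) *\<^sub>R \<alpha>"

text \<open>A Chevalley basis of the semisimple Lie algebra with root system \<open>\<Phi>\<close> and base \<open>\<Delta>\<close>:
  \<open>h \<delta>\<close> for simple roots \<open>\<delta>\<close> and \<open>x \<alpha>\<close> for roots \<open>\<alpha>\<close>, where the \<open>h \<delta>\<close> span a Cartan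
  subalgebra on which \<open>\<mu> \<bullet> coroot \<delta>\<close> is the value at \<open>h \<delta>\<close> of the linear functional given
  by the vector \<open>\<mu>\<close>. In \<open>lie_root_root\<close>, \<open>r\<close> is the length of the part
  \<open>\<beta>, \<beta> - \<alpha>, \<dots>, \<beta> - r \<alpha>\<close> of the \<open>\<alpha>\<close>-string through \<open>\<beta>\<close>.\<close>

locale chevalley_basis = complex_lie_algebra smul lie
  for smul :: "complex \<Rightarrow> 'l::ab_group_add \<Rightarrow> 'l" and lie :: "'l \<Rightarrow> 'l \<Rightarrow> 'l" +
  fixes \<Phi> \<Delta> :: "'v::euclidean_space set" and h x :: "'v \<Rightarrow> 'l"
  assumes semisimple: semisimple
    and inj_basis: "inj_on (case_sum h x) (\<Delta> <+> \<Phi>)"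
    and independent_basis: "independent (case_sum h x ` (\<Delta> <+> \<Phi>))"
    and span_basis: "span (case_sum h x ` (\<Delta> <+> \<Phi>)) = UNIV"
    and lie_h_h: "\<lbrakk>\<delta> \<in> \<Delta>; \<epsilon> \<in> \<Delta>\<rbrakk> \<Longrightarrow> lie (h \<delta>) (h \<epsilon>) = 0"
    and lie_h_root:
      "\<lbrakk>\<delta> \<in> \<Delta>; \<alpha> \<in> \<Phi>\<rbrakk> \<Longrightarrow> lie (h \<delta>) (x \<alpha>) = smul (of_real (\<alpha> \<bullet> coroot \<delta>)) (x \<alpha>)"
    and lie_opposite:
      "\<alpha> \<in> \<Phi> \<Longrightarrow> \<exists>c :: 'v \<Rightarrow> int.
         coroot \<alpha> = (\<Sum>\<delta>\<in>\<Delta>. of_int (c \<delta>) *\<^sub>R coroot \<delta>) \<and>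
         lie (x \<alpha>) (x (- \<alpha>)) = (\<Sum>\<delta>\<in>\<Delta>. smul (of_int (c \<delta>)) (h \<delta>))"
    and lie_root_root:
      "\<lbrakk>\<alpha> \<in> \<Phi>; \<beta> \<in> \<Phi>; \<alpha> + \<beta> \<in> \<Phi>; r = (GREATEST k::nat. \<beta> - of_nat k *\<^sub>R \<alpha> \<in> \<Phi>)\<rbrakk> \<Longrightarrow>
         lie (x \<alpha>) (x \<beta>) = smul (of_nat (r + 1)) (x (\<alpha> + \<beta>)) \<or>
         lie (x \<alpha>) (x \<beta>) = smul (- of_nat (r + 1)) (x (\<alpha> + \<beta>))"
    and lie_root_nonroot:
      "\<lbrakk>\<alpha> \<in> \<Phi>; \<beta> \<in> \<Phi>; \<alpha> + \<beta> \<notin> \<Phi>; \<alpha> + \<beta> \<noteq> 0\<rbrakk> \<Longrightarrow> lie (x \<alpha>) (x \<beta>) = 0"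

definition C2 :: "(real^2) set" where
  "C2 = (let e\<^sub>1 = axis 1 1; e\<^sub>2 = axis 2 1 in
     {e\<^sub>1 + e\<^sub>2, e\<^sub>1 - e\<^sub>2, - e\<^sub>1 + e\<^sub>2, - e\<^sub>1 - e\<^sub>2,
      2 *\<^sub>R e\<^sub>1, - (2 *\<^sub>R e\<^sub>1), 2 *\<^sub>R e\<^sub>2, - (2 *\<^sub>R e\<^sub>2)})"

definition C2_base :: "(real^2) set" where
  "C2_base = {axis 1 1 - axis 2 1, 2 *\<^sub>R axis 2 1}"


section \<open>Representations and their weight lattices\<close>

definition lie_representation ::
  "(complex \<Rightarrow> 'l::ab_group_add \<Rightarrow> 'l) \<Rightarrow> ('l \<Rightarrow> 'l \<Rightarrow> 'l) \<Rightarrow> ('l \<Rightarrow> complex^'n^'n) \<Rightarrow> bool" where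
  "lie_representation smul lie \<pi> \<longleftrightarrow>
     Vector_Spaces.linear smul (\<lambda>c A. \<chi> i j. c * A $ i $ j) \<pi> \<and>
     (\<forall>a b. \<pi> (lie a b) = \<pi> a ** \<pi> b - \<pi> b ** \<pi> a)"

definition weights ::
  "'v::euclidean_space set \<Rightarrow> ('v \<Rightarrow> 'l) \<Rightarrow> ('l \<Rightarrow> complex^'n^'n) \<Rightarrow> 'v set" where
  "weights \<Delta> h \<pi> =
     {\<mu>. \<exists>v. v \<noteq> 0 \<and> (\<forall>\<delta>\<in>\<Delta>. \<pi> (h \<delta>) *v v = of_real (\<mu> \<bullet> coroot \<delta>) *s v)}"

definition weight_lattice ::
  "'v::euclidean_space set \<Rightarrow> ('v \<Rightarrow> 'l) \<Rightarrow> ('l \<Rightarrow> complex^'n^'n) \<Rightarrow> 'v set" where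
  "weight_lattice \<Delta> h \<pi> = group_closure (weights \<Delta> h \<pi>)"

definition root_lattice :: "'v::euclidean_space set \<Rightarrow> 'v set" where
  "root_lattice \<Phi> = group_closure \<Phi>"


section \<open>Chevalley groups\<close>

text \<open>The class operation \<open>^\<close> on matrices is entrywise; this is the power for \<open>**\<close>.\<close>

definition mat_power :: "'a::semiring_1^'n^'n \<Rightarrow> nat \<Rightarrow> 'a^'n^'n" where
  "mat_power A k = (((**) A) ^^ k) (mat 1)"

definition divided_power :: "complex^'n^'n \<Rightarrow> nat \<Rightarrow> complex^'n^'n" where
  "divided_power A k = (1 / fact k) *\<^sub>R mat_power A k"

text \<open>Integrality of all the divided powers says that the standard basis of the representation
  space spans an admissible lattice, i.e. one stable under the Kostant form of the enveloping
  algebra. This is what gives \<open>exp (t \<pi>(x\<^sub>\<alpha>))\<close> a meaning over an arbitrary ring.\<close>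

definition admissible :: "'v set \<Rightarrow> ('v \<Rightarrow> complex^'n^'n) \<Rightarrow> bool" where
  "admissible \<Phi> X \<longleftrightarrow> (\<forall>\<alpha>\<in>\<Phi>. \<forall>k i j. divided_power (X \<alpha>) k $ i $ j \<in> \<int>)"

text \<open>\<open>exp (t A)\<close> over the ring of \<open>t\<close>, for a nilpotent \<open>A\<close> whose divided powers are integral:
  the floor merely reads a complex number lying in \<open>\<int>\<close> as an element of type \<open>int\<close>, and the
  powers of exponent at least \<open>CARD('n)\<close> vanish.\<close>

definition unipotent :: "complex^'n^'n \<Rightarrow> 'r::comm_ring_1 \<Rightarrow> 'r^'n^'n" where
  "unipotent A t =
     (\<chi> i j. \<Sum>k<CARD('n). t ^ k * of_int \<lfloor>Re (divided_power A k $ i $ j)\<rfloor>)"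

definition SL :: "('r::comm_ring_1^'n^'n) monoid" where
  "SL = \<lparr>carrier = {g. det g = 1}, mult = (**), one = mat 1\<rparr>"

definition root_subgroup :: "complex^'n^'n \<Rightarrow> ('r::comm_ring_1^'n^'n) set" where
  "root_subgroup A = range (unipotent A)"

definition elementary_group ::
  "'v set \<Rightarrow> ('v \<Rightarrow> complex^'n^'n) \<Rightarrow> ('r::comm_ring_1^'n^'n) set" where
  "elementary_group \<Phi> X = generate SL (\<Union>\<alpha>\<in>\<Phi>. root_subgroup (X \<alpha>))"

text \<open>Polynomials with integer coefficients in the matrix entries: finitely supported functions
  from monomials to coefficients, the variables being the index pairs \<open>(i, j)\<close>.\<close>

type_synonym 'n entry_poly = "(('n \<times> 'n) \<Rightarrow>\<^sub>0 nat) \<Rightarrow>\<^sub>0 int"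

definition entry_poly_eval :: "'n entry_poly \<Rightarrow> 'r::comm_ring_1^'n^'n \<Rightarrow> 'r" where
  "entry_poly_eval p g =
     (\<Sum>m\<in>Poly_Mapping.keys p. of_int (Poly_Mapping.lookup p m) *
        (\<Prod>v\<in>Poly_Mapping.keys m. (g $ fst v $ snd v) ^ Poly_Mapping.lookup m v))"

text \<open>The \<open>R\<close>-points of the Chevalley--Demazure scheme. Its coordinate ring is the ring of
  functions on the complex group \<open>G\<^sub>\<pi>(\<complex>) = E\<^sub>\<pi>(\<complex>)\<close> generated over \<open>\<int>\<close> by the matrix
  entries, so a matrix is an \<open>R\<close>-point iff it satisfies all integer polynomial equations
  valid on \<open>E\<^sub>\<pi>(\<complex>)\<close>.\<close>

definition chevalley_group ::
  "'v set \<Rightarrow> ('v \<Rightarrow> complex^'n^'n) \<Rightarrow> ('r::comm_ring_1^'n^'n) monoid" where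
  "chevalley_group \<Phi> X = SL\<lparr>carrier :=
     {g \<in> carrier SL. \<forall>p. (\<forall>c \<in> elementary_group \<Phi> X :: (complex^'n^'n) set.
        entry_poly_eval p c = 0) \<longrightarrow> entry_poly_eval p g = 0}\<rparr>"

definition large_subgroup ::
  "'v set \<Rightarrow> ('v \<Rightarrow> complex^'n^'n) \<Rightarrow> ('r::comm_ring_1^'n^'n) set \<Rightarrow> bool" where
  "large_subgroup \<Phi> X G \<longleftrightarrow>
     subgroup G (chevalley_group \<Phi> X) \<and> elementary_group \<Phi> X \<subseteq> G"

end

theory Submission
  imports Defs
begin

text \<open>Write \<open>D, A, C, E\<close> for root vectors of \<open>2 e\<^sub>1, 2 e\<^sub>2, e\<^sub>1 + e\<^sub>2, e\<^sub>1 - e\<^sub>2\<close> and primes for the opposite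
  roots. Let \<open>y \<in> G\<close> commute with the elements \<open>x(1)\<close> for \<open>A, A', C, E, D\<close>. The entries of \<open>Ad y\<close> are
  integer polynomials in those of \<open>y\<close>, so their shape is known from the complex group, and comparing
  coefficients gives \<open>y = x\<^sub>D(b) z\<close> with \<open>z\<close> fixing \<open>C, C', D, D'\<close>. Density of the big cell over the
  complex numbers, together with the values of \<open>Ad z\<close>, shows that all unipotent coordinates of \<open>z\<close>
  vanish and that \<open>z\<close> behaves like a torus element on which all roots are trivial. Hence \<open>z = 1\<close> if
  all weights lie in the root lattice, and \<open>z\<^sup>2 = 1\<close> always. So \<open>X\<^sub>D\<close> is the set of the \<open>y\<close>, or, when
  \<open>2\<close> is invertible, of the \<open>y\<^sup>2\<close>, since then \<open>x\<^sub>D(t) = x\<^sub>D(t/2)\<^sup>2\<close>. This settles the long roots.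
  The commutator of \<open>x\<^sub>E(1)\<close> and \<open>x\<^sub>A(t)\<close> is \<open>x\<^sub>C(t) x\<^sub>D(t)\<close>, that of \<open>x\<^sub>E\<^sub>'(1)\<close> and \<open>x\<^sub>D(t)\<close> is
  \<open>x\<^sub>C(t) x\<^sub>A(t)\<close>, and \<open>X\<^sub>C X\<^sub>D \<inter> X\<^sub>C X\<^sub>A = X\<^sub>C\<close>, which settles the short roots.\<close>

text \<open>The ring \<open>R\<close> may have zero divisors, torsion and characteristic 2, and a
  point over \<open>R\<close> need not lie in the big cell. Root vectors are therefore kept as
  integer matrices, and facts reach \<open>R\<close> in two ways: as identities between integer
  matrices, or as integer polynomial equations checked on the complex group. For the second way
  everything read off a matrix must be an integer polynomial in its entries. Inverses become
  adjugates, and the coordinate along a root vector comes from an integral functional with value 1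
  there, which exists because root vectors are primitive. The parameters of the big cell get values
  at a point over \<open>R\<close> through cross-multiplied polynomial equations. The Cartan part
  causes the dichotomy in the theorem: the basis dual to the simple roots consists of the coweights
  \<open>H1\<close> and \<open>(H1 + H2) / 2\<close>. The second is an integer matrix when all
  weights lie in the root lattice; otherwise 2 has to be inverted. The same parity of weights
  decides whether the leftover factor \<open>z\<close> is shown to be trivial or only to have square
  1.\<close>

section \<open>The ring of square matrices\<close>

text \<open>On the vector type the operation \<open>*\<close> is entrywise.\<close>

typedef ('a, 'n) sqm = "UNIV :: ('a^'n^'n) set" ..

setup_lifting type_definition_sqm

lift_definition ent :: "('a, 'n::finite) sqm \<Rightarrow> 'n \<Rightarrow> 'n \<Rightarrow> 'a" is "\<lambda>A i j. A $ i $ j" .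

lift_definition msqm :: "('n \<Rightarrow> 'n \<Rightarrow> 'a) \<Rightarrow> ('a, 'n::finite) sqm" is "\<lambda>f. \<chi> i j. f i j" .

lemma ent_msqm [simp]: "ent (msqm f) i j = f i j"
  by transfer simp

lemma sqm_eqI: "(\<And>i j. ent A i j = ent B i j) \<Longrightarrow> A = B"
  by transfer (simp add: vec_eq_iff)

lemma sqm_eq_iff: "A = B \<longleftrightarrow> (\<forall>i j. ent A i j = ent B i j)"
  using sqm_eqI by blast

instantiation sqm :: (comm_ring_1, finite) ring_1
begin

lift_definition zero_sqm :: "('a, 'b) sqm" is 0 .
lift_definition one_sqm :: "('a, 'b) sqm" is "mat 1" .
lift_definition plus_sqm :: "('a, 'b) sqm \<Rightarrow> ('a, 'b) sqm \<Rightarrow> ('a, 'b) sqm" is "(+)" .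
lift_definition minus_sqm :: "('a, 'b) sqm \<Rightarrow> ('a, 'b) sqm \<Rightarrow> ('a, 'b) sqm" is "(-)" .
lift_definition uminus_sqm :: "('a, 'b) sqm \<Rightarrow> ('a, 'b) sqm" is uminus .
lift_definition times_sqm :: "('a, 'b) sqm \<Rightarrow> ('a, 'b) sqm \<Rightarrow> ('a, 'b) sqm" is "(**)" .

instance
proof
  fix a b c :: "('a, 'b) sqm"
  show "a * b * c = a * (b * c)" by transfer (simp add: matrix_mul_assoc)
  show "a + b + c = a + (b + c)" by transfer simp
  show "a + b = b + a" by transfer simp
  show "0 + a = a" by transfer simp
  show "- a + a = 0" by transfer simp
  show "a - b = a + - b" by transfer simp
  show "1 * a = a" by transfer simp
  show "a * 1 = a" by transfer simp
  show "(a + b) * c = a * c + b * c"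
    by transfer (simp add: matrix_matrix_mult_def vec_eq_iff algebra_simps sum.distrib)
  show "a * (b + c) = a * b + a * c"
    by transfer (simp add: matrix_matrix_mult_def vec_eq_iff algebra_simps sum.distrib)
  show "(0 :: ('a, 'b) sqm) \<noteq> 1"
  proof transfer
    have "(mat 1 :: 'a^'b^'b) $ undefined $ undefined = 1" by (simp add: mat_def)
    then show "(0 :: 'a^'b^'b) \<noteq> mat 1" by (metis zero_index zero_neq_one)
  qed
qed

end

lemma ent_0 [simp]: "ent 0 i j = 0" by transfer simp
lemma ent_1: "ent 1 i j = (if i = j then 1 else 0)" by transfer (simp add: mat_def)
lemma ent_add [simp]: "ent (A + B) i j = ent A i j + ent B i j" by transfer simp
lemma ent_diff [simp]: "ent (A - B) i j = ent A i j - ent B i j" by transfer simp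
lemma ent_minus [simp]: "ent (- A) i j = - ent A i j" by transfer simp
lemma ent_mult: "ent (A * B) i j = (\<Sum>k\<in>UNIV. ent A i k * ent B k j)"
  by transfer (simp add: matrix_matrix_mult_def)
lemma ent_sum [simp]: "ent (sum f S) i j = (\<Sum>s\<in>S. ent (f s) i j)"
  by (induction S rule: infinite_finite_induct) auto

definition scal :: "'a::comm_ring_1 \<Rightarrow> ('a, 'n::finite) sqm \<Rightarrow> ('a, 'n) sqm" (infixr "\<cdot>" 75) where
  "c \<cdot> A = msqm (\<lambda>i j. c * ent A i j)"

lemma ent_scal [simp]: "ent (c \<cdot> A) i j = c * ent A i j"
  by (simp add: scal_def)

interpretation scal: module scal
  by unfold_locales (auto intro!: sqm_eqI simp: algebra_simps)

lemma scal_mult_left [simp]: "(c \<cdot> A) * B = c \<cdot> (A * B)"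
  by (rule sqm_eqI) (simp add: ent_mult sum_distrib_left mult.assoc)

lemma scal_mult_right [simp]: "A * (c \<cdot> B) = c \<cdot> (A * B)"
  by (rule sqm_eqI) (simp add: ent_mult sum_distrib_left algebra_simps)

lemma scal_power: "(c \<cdot> A) ^ k = (c ^ k) \<cdot> (A ^ k)"
  by (induction k) (simp_all add: scal.scale_scale algebra_simps)

lemma of_nat_sqm: "of_nat m * A = of_nat m \<cdot> (A :: ('a::comm_ring_1, 'n::finite) sqm)"
  by (induction m) (simp_all add: scal.scale_left_distrib algebra_simps)

lemma numeral_sqm: "numeral m * A = numeral m \<cdot> (A :: ('a::comm_ring_1, 'n::finite) sqm)"
  by (metis of_nat_numeral of_nat_sqm)

text \<open>Base change from the integers to any commutative ring: an identity between integer
  matrices is proved once and then holds over \<open>R\<close> and over the complex numbers.\<close>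

definition iot :: "(int, 'n::finite) sqm \<Rightarrow> ('a::comm_ring_1, 'n) sqm" where
  "iot A = msqm (\<lambda>i j. of_int (ent A i j))"

lemma ent_iot [simp]: "ent (iot A) i j = of_int (ent A i j)"
  by (simp add: iot_def)

lemma iot_0 [simp]: "iot 0 = 0" by (rule sqm_eqI) simp
lemma iot_1 [simp]: "iot 1 = 1" by (rule sqm_eqI) (simp add: ent_1)
lemma iot_add [simp]: "iot (A + B) = iot A + iot B" by (rule sqm_eqI) simp
lemma iot_diff [simp]: "iot (A - B) = iot A - iot B" by (rule sqm_eqI) simp
lemma iot_minus [simp]: "iot (- A) = - iot A" by (rule sqm_eqI) simp
lemma iot_mult [simp]: "iot (A * B) = iot A * iot B" by (rule sqm_eqI) (simp add: ent_mult)
lemma iot_power [simp]: "iot (A ^ k) = iot A ^ k" by (induction k) simp_all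
lemma iot_sum [simp]: "iot (sum f S) = (\<Sum>s\<in>S. iot (f s))"
  by (induction S rule: infinite_finite_induct) auto
lemma iot_of_nat [simp]: "iot (of_nat m) = of_nat m" by (induction m) simp_all
lemma iot_of_int [simp]: "iot (of_int m) = of_int m" by (cases m rule: int_cases2) simp_all
lemma iot_numeral [simp]: "iot (numeral m) = numeral m" by (metis iot_of_nat of_nat_numeral)
lemma iot_scal [simp]: "iot (c \<cdot> A) = of_int c \<cdot> iot A" by (rule sqm_eqI) simp

lemma iot_inj: "iot A = (iot B :: ('a::{comm_ring_1,ring_char_0}, 'n::finite) sqm) \<longleftrightarrow> A = B"
  by (simp add: sqm_eq_iff)

lemma iot_eq_0: "iot A = (0 :: ('a::{comm_ring_1,ring_char_0}, 'n::finite) sqm) \<longleftrightarrow> A = 0"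
  using iot_inj[of A 0] by simp

lemma iot_int [simp]: "iot A = A" by (rule sqm_eqI) simp

lemma scal_cancel: "c \<noteq> 0 \<Longrightarrow> c \<cdot> A = c \<cdot> B \<longleftrightarrow> A = (B :: ('a::idom, 'n::finite) sqm)"
  by (simp add: sqm_eq_iff)

lemma scal_eq_0: "c \<cdot> A = 0 \<longleftrightarrow> c = 0 \<or> A = (0 :: ('a::idom, 'n::finite) sqm)"
  by (auto simp: sqm_eq_iff)

section \<open>Brackets\<close>

definition br :: "'a::ring_1 \<Rightarrow> 'a \<Rightarrow> 'a" where "br a b = a * b - b * a"

lemma br_self [simp]: "br a a = 0" by (simp add: br_def)
lemma br_0 [simp]: "br a 0 = 0" "br 0 a = 0" by (simp_all add: br_def)
lemma br_add_left: "br (a + b) c = br a c + br b c" by (simp add: br_def algebra_simps)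
lemma br_add_right: "br a (b + c) = br a b + br a c" by (simp add: br_def algebra_simps)
lemma br_diff_left: "br (a - b) c = br a c - br b c" by (simp add: br_def algebra_simps)
lemma br_diff_right: "br a (b - c) = br a b - br a c" by (simp add: br_def algebra_simps)
lemma br_minus_left: "br (- a) c = - br a c" by (simp add: br_def algebra_simps)
lemma br_minus_right: "br a (- c) = - br a c" by (simp add: br_def algebra_simps)
lemma br_anti: "br b a = - br a b" by (simp add: br_def)
lemma br_scal_left: "br (c \<cdot> a) b = c \<cdot> br a b" by (simp add: br_def scal.scale_right_diff_distrib)
lemma br_scal_right: "br a (c \<cdot> b) = c \<cdot> br a b" by (simp add: br_def scal.scale_right_diff_distrib)
lemmas br_simps = br_add_left br_add_right br_diff_left br_diff_right br_minus_left br_minus_right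
  br_scal_left br_scal_right

lemma jacobi_right: "br a (br b c) = br (br a b) c + br b (br a c)"
  by (simp add: br_def algebra_simps)

lemma jacobi_left: "br (br a b) c = br a (br b c) - br b (br a c)"
  by (simp add: br_def algebra_simps)

lemma iot_br: "iot (br a b) = br (iot a) (iot b)" by (simp add: br_def)

section \<open>Nilpotent matrices\<close>

text \<open>The kernels of the powers of \<open>Z\<close> grow strictly until they fill the space,
  so if \<open>Z ^ CARD('n)\<close> were nonzero there would be \<open>CARD('n) + 1\<close> strict
  steps, more than the dimension. This justifies cutting all exponential sums off at
  \<open>CARD('n)\<close>.\<close>

lemma nilpotent_power_CARD_field:
  fixes Z :: "('a::field, 'n::finite) sqm"
  assumes "Z ^ m = 0"
  shows "Z ^ CARD('n) = 0"
proof (rule ccontr)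
  assume nz: "Z ^ CARD('n) \<noteq> 0"
  define V where "V k = {v. Rep_sqm (Z ^ k) *v v = 0}" for k
  have step: "v \<in> V (Suc k) \<longleftrightarrow> Rep_sqm Z *v v \<in> V k" for v k
    by (simp add: V_def power_Suc2 times_sqm.rep_eq matrix_vector_mul_assoc del: power_Suc)
  have sub: "vec.subspace (V k)" for k
    unfolding V_def by (rule vec.subspaceI)
      (simp_all add: matrix_vector_right_distrib matrix_vector_mult_scaleR vec.linear_scale)
  have mono: "V k \<subseteq> V (Suc k)" for k
  proof
    fix v assume "v \<in> V k"
    then show "v \<in> V (Suc k)"
      by (simp add: V_def times_sqm.rep_eq flip: matrix_vector_mul_assoc)
  qed
  have strict: "V k \<subset> V (Suc k)" if "k \<le> CARD('n)" for k
  proof (rule ccontr)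
    assume "\<not> V k \<subset> V (Suc k)"
    then have eq: "V (Suc k) = V k" using mono by blast
    have "V (k + j) = V k" for j
    proof (induction j)
      case (Suc j)
      have "v \<in> V (Suc (k + j)) \<longleftrightarrow> v \<in> V k" for v
        using step[of v "k + j"] step[of v k] Suc eq by simp
      then show ?case by auto
    qed simp
    moreover have "Z ^ (k + m) = 0" using assms by (simp add: power_add)
    then have "V (k + m) = UNIV" by (simp add: V_def zero_sqm.rep_eq)
    ultimately have "V k = UNIV" by simp
    then have "Rep_sqm (Z ^ k) = 0"
      by (auto simp: V_def matrix_eq set_eq_iff)
    then have "Z ^ k = 0" by (metis Rep_sqm_inverse zero_sqm_def)
    then have "Z ^ CARD('n) = 0"
      using that by (metis le_add_diff_inverse mult_zero_left power_add)
    with nz show False by simp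
  qed
  have "k \<le> Suc (CARD('n)) \<Longrightarrow> k \<le> vec.dim (V k)" for k
  proof (induction k)
    case (Suc k)
    have "vec.span (V k) \<subset> vec.span (V (Suc k))"
      using strict[of k] Suc.prems sub by (metis Suc_le_mono vec.span_eq_iff)
    then have "vec.dim (V k) < vec.dim (V (Suc k))" by (rule vec.dim_psubset)
    with Suc show ?case by simp
  qed simp
  from this[of "Suc CARD('n)"] have "CARD('n) < vec.dim (V (Suc CARD('n)))" by simp
  moreover have "vec.dim (V (Suc CARD('n))) \<le> CARD('n)" by (rule dim_subset_UNIV_cart_gen)
  ultimately show False by simp
qed

lemma nilpotent_power_CARD_int:
  fixes Z :: "(int, 'n::finite) sqm"
  assumes "Z ^ m = 0"
  shows "Z ^ CARD('n) = 0"
proof -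
  have "iot Z ^ m = (0 :: (complex, 'n) sqm)" using assms by (metis iot_0 iot_power)
  then have "iot Z ^ CARD('n) = (0 :: (complex, 'n) sqm)" by (rule nilpotent_power_CARD_field)
  then have "iot (Z ^ CARD('n)) = (0 :: (complex, 'n) sqm)" by simp
  then show ?thesis by (simp only: iot_eq_0)
qed

definition nilp :: "('a::comm_ring_1, 'n::finite) sqm \<Rightarrow> bool" where
  "nilp Z \<longleftrightarrow> Z ^ CARD('n) = 0"

lemma commuting_power: "a * b = b * a \<Longrightarrow> a ^ k * b = b * (a::'a::monoid_mult) ^ k"
  by (induction k) (simp_all add: mult.assoc, metis mult.assoc)

section \<open>Divided powers and exponentials\<close>

text \<open>Over the integers this is integrality of all divided powers; over the complex numbers it
  always holds. One set of lemmas on \<open>dp\<close> thus serves both rings.\<close>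

definition adm :: "('a::{idom,ring_char_0}, 'n::finite) sqm \<Rightarrow> bool" where
  "adm Z \<longleftrightarrow> (\<forall>k. \<exists>W. fact k \<cdot> W = Z ^ k)"

text \<open>\<open>Z\<^sup>k / k!\<close>, an unspecified matrix if this is not integral.\<close>

definition dp :: "('a::{idom,ring_char_0}, 'n::finite) sqm \<Rightarrow> nat \<Rightarrow> ('a, 'n) sqm" where
  "dp Z k = (THE W. fact k \<cdot> W = Z ^ k)"

lemma fact_scal_cancel:
  "fact k \<cdot> A = fact k \<cdot> B \<longleftrightarrow> A = (B :: ('a::{idom,ring_char_0}, 'n::finite) sqm)"
  by (simp add: scal_cancel)

lemma dp_unique: "fact k \<cdot> W = Z ^ k \<Longrightarrow> dp Z k = W"
  unfolding dp_def by (rule the_equality) (simp_all, metis fact_scal_cancel)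

lemma fact_dp: "adm Z \<Longrightarrow> fact k \<cdot> dp Z k = Z ^ k"
  unfolding adm_def using dp_unique by metis

lemma adm_complex [simp]: "adm (Z :: (complex, 'n::finite) sqm)"
  unfolding adm_def
proof
  fix k
  have "fact k \<cdot> ((1 / fact k) \<cdot> Z ^ k) = Z ^ k" by simp
  then show "\<exists>W. fact k \<cdot> W = Z ^ k" by blast
qed

lemma dp_0 [simp]: "dp Z 0 = 1" by (rule dp_unique) simp
lemma dp_1 [simp]: "dp Z (Suc 0) = Z" by (rule dp_unique) simp
lemma dp_of_zero: "dp 0 k = (if k = 0 then 1 else 0)" by (rule dp_unique) (simp add: power_0_left)

lemma dp_Suc:
  assumes "adm Z"
  shows "of_nat (Suc k) \<cdot> dp Z (Suc k) = Z * dp Z k"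
proof -
  have "fact k \<cdot> (of_nat (Suc k) \<cdot> dp Z (Suc k)) = fact k \<cdot> (Z * dp Z k)"
    using fact_dp[OF assms, of "Suc k"] fact_dp[OF assms, of k]
    by (simp add: algebra_simps flip: scal_mult_right)
  then show ?thesis by (simp only: fact_scal_cancel)
qed

lemma dp_2: "adm Z \<Longrightarrow> 2 * dp Z 2 = Z * Z"
  using dp_Suc[of Z 1] by (simp add: numeral_2_eq_2 numeral_sqm)

lemma dp_nil: "nilp (Z :: ('a::{idom,ring_char_0}, 'n::finite) sqm) \<Longrightarrow> CARD('n) \<le> k \<Longrightarrow> dp Z k = 0"
  by (rule dp_unique) (metis le_add_diff_inverse mult_zero_left nilp_def power_add scal.scale_zero_right)

lemma dp_mult:
  fixes Z :: "('a::{idom,ring_char_0}, 'n::finite) sqm"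
  assumes "adm Z"
  shows "dp Z i * dp Z j = of_nat ((i + j) choose i) \<cdot> dp Z (i + j)"
proof -
  have "(fact i * fact j) \<cdot> (dp Z i * dp Z j) = (fact i \<cdot> dp Z i) * (fact j \<cdot> dp Z j)"
    by (simp add: mult.commute)
  also have "\<dots> = Z ^ (i + j)" by (simp only: fact_dp assms power_add)
  also have "\<dots> = fact (i + j) \<cdot> dp Z (i + j)" by (simp only: fact_dp assms)
  also have "(fact (i + j) :: 'a) = (fact i * fact j) * of_nat ((i + j) choose i)"
    by (metis add_diff_cancel_left' binomial_fact_lemma le_add1 of_nat_fact of_nat_mult)
  finally have "(fact i * fact j) \<cdot> (dp Z i * dp Z j)
      = (fact i * fact j) \<cdot> (of_nat ((i + j) choose i) \<cdot> dp Z (i + j))"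
    by simp
  then show ?thesis by (subst (asm) scal_cancel) simp_all
qed

lemma dp_commute:
  assumes "adm Z" "Z * W = W * Z"
  shows "dp Z k * W = W * dp Z k"
proof -
  have "fact k \<cdot> (dp Z k * W) = (fact k \<cdot> dp Z k) * W" by simp
  also have "\<dots> = W * (fact k \<cdot> dp Z k)" by (simp only: fact_dp[OF assms(1)] commuting_power[OF assms(2)])
  also have "\<dots> = fact k \<cdot> (W * dp Z k)" by simp
  finally show ?thesis by (simp only: fact_scal_cancel)
qed

lemma fact_dp_scal: "adm Z \<Longrightarrow> fact k \<cdot> (c ^ k \<cdot> dp Z k) = (c \<cdot> Z) ^ k"
  by (simp add: scal_power mult.commute flip: fact_dp)

lemma dp_scal: "adm Z \<Longrightarrow> dp (c \<cdot> Z) k = c ^ k \<cdot> dp Z k"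
  by (rule dp_unique) (rule fact_dp_scal)

lemma adm_scal: "adm Z \<Longrightarrow> adm (c \<cdot> Z)"
  unfolding adm_def[of "c \<cdot> Z"] using fact_dp_scal by blast

lemma nilp_scal: "nilp Z \<Longrightarrow> nilp (c \<cdot> Z)"
  by (simp add: nilp_def scal_power)

lemma conj_power:
  assumes "g' * g = (1::'a::monoid_mult)" "g * g' = 1"
  shows "(g * Z * g') ^ k = g * Z ^ k * g'"
proof (induction k)
  case (Suc k)
  have "(g * Z * g') ^ Suc k = g * Z * (g' * g) * Z ^ k * g'"
    unfolding power_Suc Suc by (simp only: mult.assoc)
  then show ?case by (simp add: assms mult.assoc)
qed (simp add: assms)

lemma
  assumes "g' * g = 1" "g * g' = 1" "adm Z"
  shows dp_conj: "dp (g * Z * g') k = g * dp Z k * g'" and adm_conj: "adm (g * Z * g')"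
proof -
  have "fact k \<cdot> (g * dp Z k * g') = (g * Z * g') ^ k" for k
    by (subst conj_power[OF assms(1,2)]) (simp flip: fact_dp[OF assms(3)])
  then show "dp (g * Z * g') k = g * dp Z k * g'" "adm (g * Z * g')"
    by (auto simp: adm_def intro: dp_unique)
qed

lemma
  fixes Y Z :: "('a::{idom,ring_char_0}, 'n::finite) sqm"
  assumes "adm Y" "adm Z" "Y * Z = Z * Y"
  shows dp_add: "dp (Y + Z) k = (\<Sum>i\<le>k. dp Y i * dp Z (k - i))"
    and adm_add: "adm (Y + Z)"
proof -
  define S where "S k = (\<Sum>i\<le>k. dp Y i * dp Z (k - i))" for k
  \<comment> \<open>Write the factor \<open>k + 1\<close> as \<open>i + (k + 1 - i)\<close>. Each
    part turns one divided power into \<open>Y\<close> or \<open>Z\<close> times the preceding one,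
    so the sums obey the recursion of \<open>(Y + Z) ^ k / k!\<close>.\<close>
  have step: "of_nat (Suc k) \<cdot> S (Suc k) = (Y + Z) * S k" for k
  proof -
    have "of_nat (Suc k) \<cdot> S (Suc k)
        = (\<Sum>i\<le>Suc k. of_nat (Suc k) \<cdot> (dp Y i * dp Z (Suc k - i)))"
      by (simp only: S_def scal.scale_sum_right)
    also have "\<dots> = (\<Sum>i\<le>Suc k. (of_nat i \<cdot> dp Y i) * dp Z (Suc k - i)
        + dp Y i * (of_nat (Suc k - i) \<cdot> dp Z (Suc k - i)))"
      by (intro sum.cong refl) (simp add: of_nat_diff flip: scal.scale_left_distrib)
    also have "\<dots> = (\<Sum>i\<le>Suc k. (of_nat i \<cdot> dp Y i) * dp Z (Suc k - i))
        + (\<Sum>i\<le>Suc k. dp Y i * (of_nat (Suc k - i) \<cdot> dp Z (Suc k - i)))"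
      by (rule sum.distrib)
    also have "(\<Sum>i\<le>Suc k. (of_nat i \<cdot> dp Y i) * dp Z (Suc k - i)) = Y * S k"
      by (subst sum.atMost_Suc_shift)
        (simp add: S_def sum_distrib_left dp_Suc[OF assms(1)] mult.assoc del: of_nat_Suc scal_mult_left)
    also have "(\<Sum>i\<le>Suc k. dp Y i * (of_nat (Suc k - i) \<cdot> dp Z (Suc k - i))) = Z * S k"
    proof -
      have "dp Y i * (of_nat (Suc k - i) \<cdot> dp Z (Suc k - i)) = Z * (dp Y i * dp Z (k - i))"
        if "i \<le> k" for i
        using dp_Suc[OF assms(2), of "k - i"] dp_commute[OF assms(1,3), of i] that
        by (simp add: Suc_diff_le mult.assoc[symmetric] del: of_nat_Suc scal_mult_right)
      then show ?thesis by (simp add: S_def sum_distrib_left)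
    qed
    finally show ?thesis by (simp add: distrib_right)
  qed
  have "fact k \<cdot> S k = (Y + Z) ^ k" for k
  proof (induction k)
    case (Suc k)
    have "fact (Suc k) \<cdot> S (Suc k) = fact k \<cdot> (of_nat (Suc k) \<cdot> S (Suc k))"
      by (simp add: mult.commute)
    also have "\<dots> = (Y + Z) * (fact k \<cdot> S k)" by (simp add: step del: of_nat_Suc)
    finally show ?case by (simp add: Suc)
  qed (simp add: S_def)
  then show "dp (Y + Z) k = S k" "adm (Y + Z)"
    by (auto simp: adm_def intro: dp_unique)
qed

text \<open>In degree \<open>2 * CARD('n)\<close> every product of divided powers has an index that
  is at least \<open>CARD('n)\<close>. The dimension argument then brings the exponent back to
  \<open>CARD('n)\<close>.\<close>

lemma nilpotent_add:
  fixes Y Z :: "('a::{idom,ring_char_0}, 'n::finite) sqm"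
  assumes "adm Y" "adm Z" "Y * Z = Z * Y" "nilp Y" "nilp Z"
  shows "(Y + Z) ^ (2 * CARD('n)) = 0"
proof -
  have "dp Y i * dp Z (2 * CARD('n) - i) = 0" for i
    using dp_nil[OF assms(4), of i] dp_nil[OF assms(5), of "2 * CARD('n) - i"]
    by (cases "CARD('n) \<le> i") simp_all
  then have "dp (Y + Z) (2 * CARD('n)) = 0"
    by (simp add: dp_add[OF assms(1-3)])
  then show ?thesis
    by (simp add: adm_add assms flip: fact_dp)
qed

lemma nilp_add_complex:
  fixes Y Z :: "(complex, 'n::finite) sqm"
  shows "Y * Z = Z * Y \<Longrightarrow> nilp Y \<Longrightarrow> nilp Z \<Longrightarrow> nilp (Y + Z)"
  unfolding nilp_def[of "Y + Z"]
  using nilpotent_power_CARD_field nilpotent_add adm_complex by metis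

lemma nilp_add_int:
  fixes Y Z :: "(int, 'n::finite) sqm"
  shows "adm Y \<Longrightarrow> adm Z \<Longrightarrow> Y * Z = Z * Y \<Longrightarrow> nilp Y \<Longrightarrow> nilp Z \<Longrightarrow> nilp (Y + Z)"
  unfolding nilp_def[of "Y + Z"]
  using nilpotent_power_CARD_int nilpotent_add by metis

lemma nilp_iot: "nilp Z \<Longrightarrow> nilp (iot Z)"
  by (simp add: nilp_def flip: iot_power)

lemma dp_iot:
  "adm Z \<Longrightarrow> dp (iot Z) k = (iot (dp Z k) :: ('a::{idom,ring_char_0}, 'n::finite) sqm)"
proof (rule dp_unique)
  assume "adm Z"
  have "fact k \<cdot> (iot (dp Z k) :: ('a, 'n) sqm) = iot (fact k \<cdot> dp Z k)" by simp
  also have "\<dots> = iot Z ^ k" by (simp only: fact_dp[OF \<open>adm Z\<close>] iot_power)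
  finally show "fact k \<cdot> (iot (dp Z k) :: ('a, 'n) sqm) = iot Z ^ k" .
qed

text \<open>The exponential of \<open>t X\<close> over an arbitrary ring; the denominators are
  absorbed in the integral divided powers.\<close>

definition xe :: "(int, 'n::finite) sqm \<Rightarrow> 'a::comm_ring_1 \<Rightarrow> ('a, 'n) sqm" where
  "xe X t = (\<Sum>k<CARD('n). t ^ k \<cdot> iot (dp X k))"

lemma sum_lessThan_CARD_0:
  "(\<Sum>k<CARD('n::finite). if k = 0 then a else 0) = (a :: 'a::comm_monoid_add)"
  by (simp add: sum.delta)

lemma xe_0 [simp]: "xe (X :: (int, 'n::finite) sqm) 0 = 1"
  unfolding xe_def
  by (subst sum_lessThan_CARD_0[where 'n='n, symmetric], rule sum.cong) (auto simp: power_0_left)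

lemma xe_of_zero [simp]: "xe (0 :: (int, 'n::finite) sqm) t = 1"
  unfolding xe_def
  by (subst sum_lessThan_CARD_0[where 'n='n, symmetric], rule sum.cong) (auto simp: dp_of_zero)

lemma xe_upper:
  assumes "nilp (X :: (int, 'n::finite) sqm)" "CARD('n) \<le> m"
  shows "xe X t = (\<Sum>k<m. t ^ k \<cdot> iot (dp X k))"
  unfolding xe_def using assms dp_nil[OF assms(1)]
  by (intro sum.mono_neutral_left) auto

text \<open>The triangle \<open>i + j < 2 * n\<close> contains the square of the pairs below
  \<open>n\<close>, and outside of the square one factor vanishes.\<close>

lemma sum_mult_convolution:
  fixes a b :: "nat \<Rightarrow> 'a::semiring_0"
  assumes "\<And>i. n \<le> i \<Longrightarrow> a i = 0" "\<And>i. n \<le> i \<Longrightarrow> b i = 0"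
  shows "(\<Sum>i<n. a i) * (\<Sum>j<n. b j) = (\<Sum>k<2*n. \<Sum>i\<le>k. a i * b (k - i))"
proof -
  have "(\<Sum>k<2*n. \<Sum>i\<le>k. a i * b (k - i)) = (\<Sum>(i, j)\<in>{(i, j). i + j < 2 * n}. a i * b j)"
    by (simp add: sum.nat_group sum.triangle_reindex)
  also have "\<dots> = (\<Sum>(i, j)\<in>{..<n} \<times> {..<n}. a i * b j)"
  proof (rule sum.mono_neutral_right)
    have "{(i, j). i + j < 2 * n} \<subseteq> {..<2*n} \<times> {..<2*n}" by auto
    then show "finite {(i, j). i + j < 2 * n}" by (rule finite_subset) simp
    show "{..<n} \<times> {..<n} \<subseteq> {(i, j). i + j < 2 * n}" by auto
    show "\<forall>i\<in>{(i, j). i + j < 2 * n} - {..<n} \<times> {..<n}. (case i of (i, j) \<Rightarrow> a i * b j) = 0"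
      using assms by (clarsimp) (metis mult_zero_left mult_zero_right not_less)
  qed
  finally show ?thesis by (simp add: sum_product sum.cartesian_product)
qed

lemma xe_add:
  fixes X :: "(int, 'n::finite) sqm"
  assumes "adm X" "nilp X"
  shows "xe X (s + t) = xe X s * xe X t"
proof -
  have "xe X s * xe X t = (\<Sum>k<2*CARD('n). \<Sum>i\<le>k. (s ^ i \<cdot> iot (dp X i)) * (t ^ (k - i) \<cdot> iot (dp X (k - i))))"
    unfolding xe_def by (rule sum_mult_convolution) (simp_all add: dp_nil[OF assms(2)])
  also have "\<dots> = (\<Sum>k<2*CARD('n). (s + t) ^ k \<cdot> iot (dp X k))"
  proof (rule sum.cong[OF refl])
    fix k
    have "(\<Sum>i\<le>k. (s ^ i \<cdot> iot (dp X i)) * (t ^ (k - i) \<cdot> iot (dp X (k - i))))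
      = (\<Sum>i\<le>k. (of_nat (k choose i) * s ^ i * t ^ (k - i)) \<cdot> iot (dp X k))"
      by (rule sum.cong[OF refl]) (simp add: dp_mult[OF assms(1)] mult.commute mult.left_commute flip: iot_mult)
    also have "\<dots> = (s + t) ^ k \<cdot> iot (dp X k)"
      by (simp only: binomial_ring scal.scale_sum_left)
    finally show "(\<Sum>i\<le>k. (s ^ i \<cdot> iot (dp X i)) * (t ^ (k - i) \<cdot> iot (dp X (k - i))))
      = (s + t) ^ k \<cdot> iot (dp X k)" .
  qed
  also have "\<dots> = xe X (s + t)" using assms by (intro xe_upper[symmetric]) simp_all
  finally show ?thesis ..
qed

lemma xe_inverse:
  assumes "adm X" "nilp X"
  shows "xe X t * xe X (- t) = 1" "xe X (- t) * xe X t = 1"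
  by (simp_all flip: xe_add[OF assms])

lemma xe_plus:
  fixes Y Z :: "(int, 'n::finite) sqm"
  assumes "adm Y" "adm Z" "Y * Z = Z * Y" "nilp Y" "nilp Z"
  shows "xe (Y + Z) t = xe Y t * xe Z t"
proof -
  have "xe Y t * xe Z t = (\<Sum>k<2*CARD('n). \<Sum>i\<le>k. (t ^ i \<cdot> iot (dp Y i)) * (t ^ (k - i) \<cdot> iot (dp Z (k - i))))"
    unfolding xe_def by (rule sum_mult_convolution) (simp_all add: dp_nil assms)
  also have "\<dots> = (\<Sum>k<2*CARD('n). t ^ k \<cdot> iot (dp (Y + Z) k))"
    by (intro sum.cong refl)
      (simp add: dp_add[OF assms(1-3)] scal.scale_sum_right mult.commute flip: power_add)
  also have "\<dots> = xe (Y + Z) t" using nilp_add_int assms by (intro xe_upper[symmetric]) simp_all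
  finally show ?thesis ..
qed

lemma xe_scal: "adm X \<Longrightarrow> xe (m \<cdot> X) t = xe X (of_int m * t)"
  by (simp add: xe_def dp_scal power_mult_distrib mult.commute)

lemma xe_commute:
  assumes "adm X" "X * Y = Y * X"
  shows "xe X t * iot Y = iot Y * xe X t"
  unfolding xe_def sum_distrib_left sum_distrib_right
  by (rule sum.cong) (simp_all add: dp_commute[OF assms] flip: iot_mult)

lemma xe_xe_commute:
  assumes "adm X" "adm Y" "X * Y = Y * X"
  shows "xe X s * xe Y t = xe Y t * xe X s"
  unfolding xe_def[of Y] sum_distrib_left sum_distrib_right
  by (rule sum.cong) (simp_all add: xe_commute assms dp_commute[symmetric])

text \<open>Over the complex numbers the parameter can be absorbed into the matrix, so that complex
  combinations and conjugates of root vectors can be exponentiated too.\<close>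

definition Ex :: "(complex, 'n::finite) sqm \<Rightarrow> (complex, 'n) sqm" where
  "Ex Z = (\<Sum>k<CARD('n). dp Z k)"

lemma xe_eq_Ex: "adm X \<Longrightarrow> xe X t = Ex (t \<cdot> iot X)"
  by (simp add: xe_def Ex_def dp_scal dp_iot)

lemma Ex_add:
  fixes Y Z :: "(complex, 'n::finite) sqm"
  assumes "Y * Z = Z * Y" "nilp Y" "nilp Z"
  shows "Ex (Y + Z) = Ex Y * Ex Z"
proof -
  have "Ex Y * Ex Z = (\<Sum>k<2*CARD('n). \<Sum>i\<le>k. dp Y i * dp Z (k - i))"
    unfolding Ex_def by (rule sum_mult_convolution) (simp_all add: dp_nil assms)
  also have "\<dots> = (\<Sum>k<2*CARD('n). dp (Y + Z) k)"
    by (simp add: dp_add assms)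
  also have "\<dots> = Ex (Y + Z)"
    unfolding Ex_def using nilp_add_complex[OF assms] dp_nil
    by (intro sum.mono_neutral_right) auto
  finally show ?thesis ..
qed

lemma Ex_conj: "g' * g = 1 \<Longrightarrow> g * g' = 1 \<Longrightarrow> Ex (g * Z * g') = g * Ex Z * g'"
  by (simp add: Ex_def dp_conj sum_distrib_left sum_distrib_right)

lemma xe_conj:
  assumes "g' * g = 1" "g * g' = 1" "adm X"
  shows "xe (g * X * g') t = iot g * xe X t * iot g'"
  by (simp add: xe_def dp_conj assms sum_distrib_left sum_distrib_right)

lemma iot_xe_1: "iot (xe X 1) = xe X 1"
  by (simp add: xe_def)

section \<open>Conjugation by root unipotents\<close>

text \<open>The degree \<open>k\<close> part of \<open>exp(X) Y = (Y + Y1 + Y2) exp(X)\<close>. The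
  second bracket is given as \<open>2 * Y2\<close>, which keeps every matrix integral; the induction
  multiplies by \<open>k + 1\<close> and cancels it over the integers.\<close>

lemma dp_mult_conj:
  fixes X Y Y1 Y2 :: "(int, 'n::finite) sqm"
  assumes X: "adm X" and "br X Y = Y1" "br X Y1 = 2 * Y2" "br X Y2 = 0"
  defines "d \<equiv> \<lambda>j k. if j \<le> k then dp X (k - j) else 0"
  shows "dp X k * Y = Y * d 0 k + Y1 * d 1 k + Y2 * d 2 k"
proof (induction k)
  case 0 then show ?case by (simp add: d_def)
next
  case (Suc k)
  have c: "X * Y = Y * X + Y1" "X * Y1 = Y1 * X + 2 * Y2" "X * Y2 = Y2 * X"
    using assms(2-4) by (auto simp: br_def algebra_simps)
  have two: "2 \<cdot> V = V + V" for V :: "(int, 'n) sqm" by (metis mult_2 numeral_sqm)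
  have dS: "X * d j k = (of_nat (Suc k) - of_nat j) \<cdot> d j (Suc k)" if "j \<le> k" for j
    using dp_Suc[OF X, of "k - j", symmetric] that by (simp add: d_def Suc_diff_le of_nat_diff add_diff_eq)
  \<comment> \<open>For \<open>j = Suc k\<close> the left side vanishes by the definition of
    \<open>d\<close>, the right side by its scalar factor.\<close>
  have dS': "X * d j k = (of_nat (Suc k) - of_nat j) \<cdot> d j (Suc k)" for j
    using dS[of j] by (cases "j \<le> k"; cases "j = Suc k") (auto simp: d_def)
  have "of_nat (Suc k) \<cdot> (dp X (Suc k) * Y) = X * (dp X k * Y)"
    using dp_Suc[OF X, of k] by (simp add: mult.assoc flip: scal_mult_left)
  also have "\<dots> = (X * Y) * d 0 k + (X * Y1) * d 1 k + (X * Y2) * d 2 k"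
    by (simp add: Suc algebra_simps)
  also have "\<dots> = Y * (X * d 0 k) + Y1 * d 0 k + Y1 * (X * d 1 k) + 2 * Y2 * d 1 k + Y2 * (X * d 2 k)"
    by (simp add: c algebra_simps)
  also have "\<dots> = of_nat (Suc k) \<cdot> (Y * d 0 (Suc k)) + Y1 * d 0 k + (of_nat (Suc k) - 1) \<cdot> (Y1 * d 1 (Suc k))
     + 2 * Y2 * d 1 k + (of_nat (Suc k) - 2) \<cdot> (Y2 * d 2 (Suc k))"
    by (simp add: dS' del: of_nat_Suc One_nat_def)
  also have "d 0 k = d 1 (Suc k)" by (auto simp: d_def)
  also have "d 1 k = d 2 (Suc k)" by (auto simp: d_def numeral_2_eq_2)
  also have "2 * Y2 * d 2 (Suc k) = Y2 * d 2 (Suc k) + Y2 * d 2 (Suc k)" by (simp add: mult_2 distrib_right)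
  finally have "of_nat (Suc k) \<cdot> (dp X (Suc k) * Y)
     = of_nat (Suc k) \<cdot> (Y * d 0 (Suc k) + Y1 * d 1 (Suc k) + Y2 * d 2 (Suc k))"
    by (simp add: scal.scale_right_distrib scal.scale_left_diff_distrib scal.scale_left_distrib algebra_simps two)
  then show ?case by (subst (asm) scal_cancel) simp_all
qed

text \<open>The adjoint action of \<open>exp(t X)\<close> on a vector killed by the third power of
  \<open>ad X\<close>. The coefficient of \<open>t^2\<close>, half of the double bracket, is
  supplied as an integer matrix, so characteristic 2 is allowed.\<close>

lemma xe_mult_conj:
  fixes X Y Y1 Y2 :: "(int, 'n::finite) sqm" and t :: "'b::comm_ring_1"
  assumes X: "adm X" "nilp X" and Y: "br X Y = Y1" "br X Y1 = 2 * Y2" "br X Y2 = 0"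
  shows "xe X t * iot Y = (iot Y + t \<cdot> iot Y1 + t^2 \<cdot> iot Y2) * xe X t"
proof -
  let ?N = "CARD('n)"
  have e: "xe X t = (\<Sum>k<m. t ^ k \<cdot> iot (dp X k))" if "?N \<le> m" for m
    by (rule xe_upper[OF X(2) that])
  let ?d = "\<lambda>j k. if j \<le> k then dp X (k - j) else 0"
  have shift: "(\<Sum>k<Suc m. f k) = f 0 + (\<Sum>k<m. f (Suc k))" for m and f :: "nat \<Rightarrow> ('b, 'n) sqm"
    by (rule sum.lessThan_Suc_shift)
  have "xe X t * iot Y = (\<Sum>k<?N + 2. t ^ k \<cdot> iot (dp X k * Y))"
    by (subst e[of "?N + 2"], simp, simp only: sum_distrib_right scal_mult_left iot_mult)
  also have "\<dots> = (\<Sum>k<?N + 2. t ^ k \<cdot> (iot Y * iot (?d 0 k)))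
     + (\<Sum>k<?N + 2. t ^ k \<cdot> (iot Y1 * iot (?d 1 k)))
     + (\<Sum>k<?N + 2. t ^ k \<cdot> (iot Y2 * iot (?d 2 k)))"
    unfolding sum.distrib[symmetric]
    by (intro sum.cong refl, subst dp_mult_conj[OF X(1) Y])
      (simp only: iot_add iot_mult scal.scale_right_distrib)
  also have "(\<Sum>k<?N + 2. t ^ k \<cdot> (iot Y * iot (?d 0 k))) = iot Y * xe X t"
    by (subst e[of "?N + 2"]) (simp_all add: sum_distrib_left distrib_left)
  also have "(\<Sum>k<?N + 2. t ^ k \<cdot> (iot Y1 * iot (?d 1 k))) = t \<cdot> iot Y1 * xe X t"
    unfolding add_2_eq_Suc' shift[of _ "Suc ?N"]
    by (subst e[of "Suc ?N"])
      (simp_all add: sum_distrib_left scal.scale_sum_right distrib_left mult.commute del: sum.lessThan_Suc)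
  also have "(\<Sum>k<?N + 2. t ^ k \<cdot> (iot Y2 * iot (?d 2 k))) = t^2 \<cdot> iot Y2 * xe X t"
    unfolding add_2_eq_Suc' shift[of _ "Suc ?N"] shift[of _ ?N]
    by (subst e[of "?N"])
      (simp_all add: sum_distrib_left scal.scale_sum_right distrib_left power2_eq_square mult_ac del: sum.lessThan_Suc)
  finally show ?thesis by (simp add: distrib_right)
qed

text \<open>Chevalley's commutator formula: conjugating \<open>exp(t Y)\<close> by
  \<open>exp(s X)\<close> exponentiates the conjugate of \<open>t Y\<close>, which is a sum of three
  commuting nilpotent terms.\<close>

lemma xe_mult_xe:
  fixes X Y Z1 Z2 :: "(int, 'n::finite) sqm" and s t :: complex
  assumes an: "adm X" "nilp X" "adm Y" "nilp Y" "adm Z1" "nilp Z1" "adm Z2" "nilp Z2"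
    and b: "br X Y = m1 \<cdot> Z1" "br X (m1 \<cdot> Z1) = 2 * (m2 \<cdot> Z2)" "br X (m2 \<cdot> Z2) = 0"
    and c: "br Y Z1 = 0" "br Y Z2 = 0" "br Z1 Z2 = 0"
  shows "xe X s * xe Y t = xe Y t * xe Z1 (of_int m1 * s * t) * xe Z2 (of_int m2 * s^2 * t) * xe X s"
proof -
  let ?g = "xe X s" and ?g' = "xe X (- s)"
  note inv = xe_inverse[OF an(1,2), of s]
  have c': "Y * Z1 = Z1 * Y" "Y * Z2 = Z2 * Y" "Z1 * Z2 = Z2 * Z1"
    using c by (simp_all add: br_def)
  then have ci: "iot Y * iot Z1 = (iot Z1 * iot Y :: (complex, 'n) sqm)"
     "iot Y * iot Z2 = (iot Z2 * iot Y :: (complex, 'n) sqm)"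
     "iot Z1 * iot Z2 = (iot Z2 * iot Z1 :: (complex, 'n) sqm)" by (metis iot_mult)+
  define P :: "(complex, 'n) sqm" where "P = t \<cdot> iot Y"
  define Q :: "(complex, 'n) sqm" where "Q = (of_int m1 * s * t) \<cdot> iot Z1"
  define R :: "(complex, 'n) sqm" where "R = (of_int m2 * s^2 * t) \<cdot> iot Z2"
  have n: "nilp P" "nilp Q" "nilp R" unfolding P_def Q_def R_def by (intro nilp_scal nilp_iot an)+
  have cm: "P * Q = Q * P" "P * R = R * P" "Q * R = R * Q"
    by (simp_all add: P_def Q_def R_def ci mult_ac)
  have "?g * P * ?g' = P + Q + R"
    using xe_mult_conj[OF an(1,2) b, of s] inv
    by (simp add: P_def Q_def R_def distrib_left distrib_right mult.assoc scal.scale_right_distrib mult_ac)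
  then have "?g * Ex P * ?g' = Ex (P + Q + R)" by (metis Ex_conj inv)
  also have "\<dots> = Ex (P + (Q + R))" by (simp add: add.assoc)
  also have "\<dots> = Ex P * Ex (Q + R)"
    by (rule Ex_add) (auto simp: n cm distrib_left distrib_right intro: nilp_add_complex)
  also have "Ex (Q + R) = Ex Q * Ex R" by (rule Ex_add) (auto simp: n cm)
  finally have "?g * Ex P * ?g' * ?g = Ex P * Ex Q * Ex R * ?g" by (simp add: mult.assoc)
  then have "?g * Ex P * (?g' * ?g) = Ex P * Ex Q * Ex R * ?g" by (simp only: mult.assoc)
  then show ?thesis by (simp only: inv mult_1_right) (simp add: xe_eq_Ex an P_def Q_def R_def mult.assoc)
qed

text \<open>For \<open>s = 1\<close> the conjugating matrix is integral, so the conjugate of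
  \<open>Y\<close> is an integer matrix and the commutator formula holds over every ring by base
  change.\<close>

lemma xe_1_mult_xe:
  fixes X Y Z1 Z2 :: "(int, 'n::finite) sqm" and t :: "'a::comm_ring_1"
  assumes an: "adm X" "nilp X" "adm Y" "nilp Y" "adm Z1" "nilp Z1" "adm Z2" "nilp Z2"
    and b: "br X Y = Z1" "br X Z1 = 2 * Z2" "br X Z2 = 0"
    and c: "br Y Z1 = 0" "br Y Z2 = 0" "br Z1 Z2 = 0"
  shows "xe X 1 * xe Y t = xe Y t * xe Z1 t * xe Z2 t * xe X (1::'a)"
proof -
  let ?g = "xe X 1 :: (int, 'n) sqm" and ?g' = "xe X (- 1) :: (int, 'n) sqm"
  note inv = xe_inverse[OF an(1,2), of "1::int"]
  have c': "Y * Z1 = Z1 * Y" "Y * Z2 = Z2 * Y" "Z1 * Z2 = Z2 * Z1"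
    using c by (simp_all add: br_def)
  have "?g * Y * ?g' = Y + (Z1 + Z2)"
    using xe_mult_conj[OF an(1,2) b, of "1::int"] inv by (simp add: mult.assoc add.assoc)
  then have "iot ?g * xe Y t * iot ?g' = xe (Y + (Z1 + Z2)) t"
    using xe_conj[OF inv(2,1) an(3), of t] by simp
  also have "\<dots> = xe Y t * xe (Z1 + Z2) t"
    by (rule xe_plus) (auto simp: an c' distrib_left distrib_right intro: nilp_add_int adm_add)
  also have "xe (Z1 + Z2) t = xe Z1 t * xe Z2 t" by (rule xe_plus) (auto simp: an c')
  finally have "iot ?g * xe Y t * iot ?g' * iot ?g = xe Y t * xe Z1 t * xe Z2 t * iot ?g"
    by (simp only: mult.assoc)
  then have "iot ?g * xe Y t * (iot ?g' * iot ?g) = xe Y t * xe Z1 t * xe Z2 t * iot ?g"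
    by (simp only: mult.assoc)
  moreover have "iot ?g' * iot ?g = (1 :: ('a, 'n) sqm)" by (metis inv(2) iot_1 iot_mult)
  ultimately show ?thesis by (simp add: iot_xe_1)
qed

section \<open>The Chevalley table of type C2\<close>

text \<open>\<open>E, A, C, D\<close> are root vectors for \<open>e\<^sub>1 - e\<^sub>2, 2 e\<^sub>2, e\<^sub>1 + e\<^sub>2, 2 e\<^sub>1\<close>, primes
  denote the opposite roots, and the signs are those of the symplectic Lie algebra with
  \<open>X\<^bsub>-\<alpha>\<^esub>\<close> the transpose of \<open>X\<^bsub>\<alpha>\<^esub>\<close>.\<close>

lemma br_flip: "br a b = c \<Longrightarrow> br b a = - c"
  by (auto simp: br_def)

locale c2_table =
  fixes A A' C C' D D' E E' :: "'a::ring_1"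
  assumes EA: "br E A = C" and EC: "br E C = 2 * D" and ED: "br E D = 0"
    and AC: "br A C = 0" and AD: "br A D = 0" and CD: "br C D = 0"
    and EA'_opp: "br E' A' = - C'" and EC'_opp: "br E' C' = - (2 * D')" and ED'_opp: "br E' D' = 0"
    and AC'_opp: "br A' C' = 0" and AD'_opp: "br A' D' = 0" and CD'_opp: "br C' D' = 0"
    and EA': "br E A' = 0" and EC': "br E C' = - (2 * A')" and ED': "br E D' = - C'"
    and AE': "br A E' = 0" and AC': "br A C' = E'" and AD': "br A D' = 0"
    and CE': "br C E' = - (2 * A)" and CA': "br C A' = E" and CD': "br C D' = E'"
    and DE': "br D E' = - C" and DA': "br D A' = 0" and DC': "br D C' = E"
    and CC': "br C C' = br D D' + br A A'" and EE': "br E E' = br D D' - br A A'"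
    and HD: "br (br D D') D = 2 * D" and HD': "br (br D D') D' = - (2 * D')"
    and HA: "br (br A A') A = 2 * A" and HA': "br (br A A') A' = - (2 * A')"
begin

definition H1 where "H1 = br D D'"
definition H2 where "H2 = br A A'"

lemmas upper = EA EC ED AC AD CD EA'_opp EC'_opp ED'_opp AC'_opp AD'_opp CD'_opp
  EA' EC' ED' AE' AC' AD' CE' CA' CD' DE' DA' DC'

lemmas table0 = upper upper[THEN br_flip, unfolded minus_minus minus_zero]

lemma opposite:
  "br D D' = H1" "br A A' = H2" "br C C' = H1 + H2" "br E E' = H1 - H2"
  "br D' D = - H1" "br A' A = - H2" "br C' C = - (H1 + H2)" "br E' E = - (H1 - H2)"
  using CC'[THEN br_flip] EE'[THEN br_flip] by (auto simp: H1_def H2_def CC' EE' intro: br_flip)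

lemma br_double: "br (2 * a) b = 2 * br a b" "br a (2 * b) = 2 * br a (b::'b::ring_1)"
  by (simp_all add: br_def mult_2 algebra_simps)

lemma cartan:
  "br H1 D = 2 * D" "br H1 D' = - (2 * D')" "br H1 A = 0" "br H1 A' = 0"
  "br H1 C = C" "br H1 C' = - C'" "br H1 E = E" "br H1 E' = - E'"
  "br H2 A = 2 * A" "br H2 A' = - (2 * A')" "br H2 D = 0" "br H2 D' = 0"
  "br H2 C = C" "br H2 C' = - C'" "br H2 E = - E" "br H2 E' = E'"
  using HD HD' HA HA' by (simp_all add: H1_def H2_def jacobi_left[of _ _ C] jacobi_left[of _ _ C'] jacobi_left[of _ _ E] jacobi_left[of _ _ E']
    jacobi_left[of D D' A] jacobi_left[of D D' A'] jacobi_left[of A A' D] jacobi_left[of A A' D'] table0 br_minus_right)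

lemmas cartan_rev = cartan[THEN br_flip, unfolded minus_minus minus_zero]

lemma H1_H2: "br H1 H2 = 0" "br H2 H1 = 0"
proof -
  show "br H1 H2 = 0" using cartan by (simp add: H2_def jacobi_right[of H1])
  then show "br H2 H1 = 0" using br_flip by fastforce
qed

lemmas table = table0 opposite cartan cartan_rev H1_H2

end

lemma c2_table_iot:
  fixes A A' C C' D D' E E' :: "(int, 'n::finite) sqm"
  assumes "c2_table A A' C C' D D' E E'"
  shows "c2_table (iot A) (iot A') (iot C) (iot C') (iot D) (iot D') (iot E) (iot E' :: ('a::comm_ring_1, 'n) sqm)"
proof -
  interpret c2_table A A' C C' D D' E E' by fact
  show ?thesis
    by unfold_locales (simp_all add: table flip: iot_br)
qed

section \<open>Primitivity of root vectors\<close>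

definition lf :: "('n \<Rightarrow> 'n \<Rightarrow> int) \<Rightarrow> ('a::comm_ring_1, 'n::finite) sqm \<Rightarrow> 'a" where
  "lf u Y = (\<Sum>i\<in>UNIV. \<Sum>j\<in>UNIV. of_int (u i j) * ent Y i j)"

lemma lf_add [simp]: "lf u (Y + Z) = lf u Y + lf u Z"
  by (simp add: lf_def distrib_left sum.distrib)
lemma lf_diff [simp]: "lf u (Y - Z) = lf u Y - lf u Z"
  by (simp add: lf_def right_diff_distrib sum_subtractf)
lemma lf_minus [simp]: "lf u (- Y) = - lf u Y"
  by (simp add: lf_def sum_negf)
lemma lf_0 [simp]: "lf u 0 = 0"
  by (simp add: lf_def)
lemma lf_scal [simp]: "lf u (c \<cdot> Y) = c * lf u Y"
  by (simp add: lf_def sum_distrib_left algebra_simps)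
lemma lf_iot: "lf u (iot Y) = of_int (lf u Y)"
  by (simp add: lf_def)

text \<open>Let \<open>m\<close> be the gcd of the entries of \<open>X\<close>. The double bracket
  \<open>[X', [X', X]]\<close> equals \<open>- 2 X'\<close>, and half of it is \<open>m\<close>
  times an integer matrix because \<open>X'^2 / 2\<close> is integral; so \<open>m\<close> divides
  \<open>X'\<close> too. Hence \<open>2 X = [[X, X'], X]\<close> is divisible by \<open>m^3\<close>,
  so \<open>m^2\<close> divides 2 and \<open>m = 1\<close>.\<close>

lemma primitive_functional:
  fixes X X' :: "(int, 'n::finite) sqm"
  assumes adm: "adm X'" and X: "X \<noteq> 0" and HX: "br (br X X') X = 2 * X"
    and HX': "br (br X X') X' = - (2 * X')"
  obtains u where "lf u X = 1"
proof -
  let ?P = "\<lambda>m. 0 < m \<and> (\<exists>u. lf u X = int m)"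
  define \<delta> :: "'n \<Rightarrow> 'n \<Rightarrow> 'n \<Rightarrow> 'n \<Rightarrow> int" where "\<delta> = (\<lambda>i j i' j'. if i' = i \<and> j' = j then 1 else 0)"
  have \<delta>: "lf (\<delta> i j) Y = ent Y i j" for i j and Y :: "(int, 'n) sqm"
  proof -
    have "lf (\<delta> i j) Y = (\<Sum>i'\<in>UNIV. \<Sum>j'\<in>UNIV. if i' = i then if j' = j then ent Y i j else 0 else 0)"
      unfolding lf_def \<delta>_def by (intro sum.cong) auto
    also have "\<dots> = (\<Sum>i'\<in>UNIV. if i' = i then ent Y i j else 0)"
      by (rule sum.cong) (auto simp: sum.delta)
    finally show ?thesis by (simp add: sum.delta)
  qed
  have lin: "lf (\<lambda>i j. a * u i j + b * v i j) Y = a * lf u Y + b * lf v Y" for a b u v and Y :: "(int, 'n) sqm"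
    by (simp add: lf_def sum.distrib sum_distrib_left algebra_simps)
  from X obtain i j where ij: "ent X i j \<noteq> 0" by (auto simp: sqm_eq_iff)
  have "lf (\<lambda>i' j'. sgn (ent X i j) * \<delta> i j i' j' + 0 * \<delta> i j i' j') X = \<bar>ent X i j\<bar>"
    unfolding lin \<delta> by (simp add: abs_sgn mult.commute)
  then have "?P (nat \<bar>ent X i j\<bar>)" using ij by auto
  then have ex: "\<exists>m. ?P m" by blast
  \<comment> \<open>The least positive value that integral functionals take on \<open>X\<close> is
    the gcd of its entries.\<close>
  define m where "m = (LEAST m. ?P m)"
  have Pm: "?P m" unfolding m_def by (rule LeastI_ex[OF ex])
  then obtain u where u: "lf u X = int m" and m0: "m > 0" by blast
  have dvd: "int m dvd ent X i j" for i j
  proof (rule ccontr)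
    assume nd: "\<not> int m dvd ent X i j"
    define r where "r = ent X i j mod int m"
    have "lf (\<lambda>i' j'. 1 * \<delta> i j i' j' + (- (ent X i j div int m)) * u i' j') X = r"
      unfolding lin \<delta> u r_def by (simp add: minus_div_mult_eq_mod)
    moreover have "r \<ge> 0" "r < int m" using m0 by (simp_all add: r_def)
    moreover have "r \<noteq> 0" using nd by (simp only: r_def dvd_eq_mod_eq_0 not_False_eq_True)
    ultimately have "?P (nat r)" and r: "r < int m" "r \<ge> 0" by auto
    from this(1) have "m \<le> nat r" unfolding m_def by (rule Least_le)
    with r show False by linarith
  qed
  define Y where "Y = msqm (\<lambda>i j. ent X i j div int m)"
  have XY: "X = int m \<cdot> Y" by (rule sqm_eqI) (simp add: Y_def dvd)
  \<comment> \<open>Half of the double bracket of \<open>X'\<close> with \<open>Y\<close>, written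
    with the divided square of \<open>X'\<close>.\<close>
  define W where "W = dp X' 2 * Y - X' * Y * X' + Y * dp X' 2"
  have "2 * (int m \<cdot> W) = (2 * dp X' 2) * X - 2 * (X' * X * X') + X * (2 * dp X' 2)"
    by (simp add: XY W_def algebra_simps numeral_sqm scal.scale_right_distrib scal.scale_right_diff_distrib mult.commute)
  also have "\<dots> = br X' (br X' X)"
    by (simp only: dp_2[OF adm]) (simp add: br_def algebra_simps mult_2)
  also have "br X' X = - br X X'" by (rule br_anti)
  also have "br X' (- br X X') = br (br X X') X'" by (simp add: br_def algebra_simps)
  also have "\<dots> = 2 * (- X')" using HX' by simp
  finally have mW: "int m \<cdot> W = - X'"
    by (simp only: numeral_sqm scal_cancel[of 2, simplified])
  then have X': "X' = - (int m \<cdot> W)" by simp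
  have "2 * X = br (br X X') X" using HX by simp
  also have "\<dots> = - ((int m * int m * int m) \<cdot> br (br Y W) Y)"
    by (simp add: XY X' br_minus_left br_minus_right br_scal_left br_scal_right mult.assoc)
  finally have "int m \<cdot> (2 \<cdot> Y) = int m \<cdot> (- ((int m * int m) \<cdot> br (br Y W) Y))"
    by (simp add: XY numeral_sqm mult_ac)
  then have "2 \<cdot> Y = - ((int m * int m) \<cdot> br (br Y W) Y)"
    using m0 by (subst (asm) scal_cancel) simp_all
  then have "lf u (2 \<cdot> Y) = lf u (- ((int m * int m) \<cdot> br (br Y W) Y))" by (rule arg_cong)
  moreover have "lf u Y = 1" using u m0 by (simp add: XY)
  ultimately have "2 = int m * int m * (- lf u (br (br Y W) Y))" by simp
  then have "int m * int m dvd 2" by (metis dvd_triv_left)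
  then have "int m * int m \<le> 2" by (rule zdvd_imp_le) simp
  then have "int (m * m) \<le> int 2" by simp
  then have "m * m \<le> 2" by (simp only: of_nat_le_iff)
  have "m = 1"
  proof (rule ccontr)
    assume "m \<noteq> 1"
    with m0 have "2 \<le> m" by simp
    then have "2 * 2 \<le> m * m" by (rule mult_le_mono) fact
    with \<open>m * m \<le> 2\<close> show False by simp
  qed
  with u show thesis by (intro that[of u]) simp
qed

section \<open>Weight projections\<close>

text \<open>Projections to the eigenspaces of \<open>H\<close> that are integer matrices.
  \<open>P\<close> is extended by zero outside \<open>S\<close>, so that index shifts need no side
  conditions.\<close>

locale weight_projections =
  fixes H :: "(int, 'n::finite) sqm" and P :: "int \<Rightarrow> (int, 'n) sqm" and S :: "int set"
  assumes fin: "finite S" and supp: "\<And>k. k \<notin> S \<Longrightarrow> P k = 0"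
    and eig: "\<And>k. H * P k = k \<cdot> P k" and sum1: "(\<Sum>k\<in>S. P k) = 1"

text \<open>Applying \<open>H - a\<close> to the relation removes the term of \<open>a\<close> and
  multiplies the others by nonzero integers.\<close>

lemma eigen_independent:
  fixes H :: "(int, 'n::finite) sqm"
  assumes "finite S" "\<And>j. j \<in> S \<Longrightarrow> H * W j = j \<cdot> W j" "(\<Sum>j\<in>S. W j) = 0"
  shows "\<forall>j\<in>S. W j = 0"
  using assms
proof (induction S arbitrary: W rule: finite_induct)
  case (insert a S)
  have "(\<Sum>j\<in>S. (j - a) \<cdot> W j) = (\<Sum>j\<in>insert a S. (j - a) \<cdot> W j)"
    using insert.hyps by simp
  also have "\<dots> = (\<Sum>j\<in>insert a S. H * W j) - a \<cdot> (\<Sum>j\<in>insert a S. W j)"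
    unfolding scal.scale_sum_right sum_subtractf[symmetric] using insert.prems(1)
    by (intro sum.cong) (auto simp: scal.scale_left_diff_distrib)
  also have "\<dots> = H * (\<Sum>j\<in>insert a S. W j) - a \<cdot> (\<Sum>j\<in>insert a S. W j)"
    by (simp only: sum_distrib_left)
  also have "\<dots> = 0" using insert.prems(2) by simp
  finally have "(\<Sum>j\<in>S. (j - a) \<cdot> W j) = 0" .
  then have "\<forall>j\<in>S. (j - a) \<cdot> W j = 0"
    using insert.prems(1) by (intro insert.IH) (auto simp: mult.commute)
  then have 0: "\<forall>j\<in>S. W j = 0" using insert.hyps by (auto simp: scal_eq_0)
  then have "W a = 0" using insert.prems(2) insert.hyps by simp
  with 0 show ?case by simp
qed simp

context weight_projections
begin

lemma proj_eig:
  assumes "H * V = m \<cdot> V"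
  shows "P k * V = (if k = m then V else 0)"
proof -
  \<comment> \<open>These differences are eigenmatrices for distinct eigenvalues, and they add up to
    zero because the projections sum to 1; so each of them vanishes.\<close>
  let ?W = "\<lambda>k. P k * V - (if k = m then V else 0)"
  let ?S = "insert k (insert m S)"
  have "(\<Sum>k\<in>?S. ?W k) = (\<Sum>k\<in>?S. P k) * V - V"
    using fin by (simp add: sum_subtractf sum_distrib_right sum.delta del: sum.insert)
  also have "(\<Sum>k\<in>?S. P k) = (\<Sum>k\<in>S. P k)"
    by (rule sum.mono_neutral_right) (use fin supp in auto)
  finally have "(\<Sum>k\<in>?S. ?W k) = 0" by (simp add: sum1)
  then have "\<forall>k\<in>?S. ?W k = 0"
    using fin by (intro eigen_independent[of _ H])
      (auto simp: assms eig right_diff_distrib scal.scale_right_diff_distrib mult.assoc[symmetric])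
  then show ?thesis by auto
qed

lemma proj_shift:
  assumes "br H Y = m \<cdot> Y"
  shows "P k * Y = Y * P (k - m)"
proof -
  have "H * (Y * P l) = (l + m) \<cdot> (Y * P l)" for l
  proof -
    have "H * Y = Y * H + m \<cdot> Y" using assms by (simp add: br_def algebra_simps)
    then have "H * (Y * P l) = Y * (H * P l) + m \<cdot> (Y * P l)"
      by (simp add: distrib_right mult.assoc[symmetric])
    then show ?thesis by (simp add: eig scal.scale_left_distrib)
  qed
  from proj_eig[OF this] have c: "P k * (Y * P l) = (if l = k - m then Y * P (k - m) else 0)" for l
    by auto
  have "P k * Y = P k * (Y * (\<Sum>l\<in>insert (k - m) S. P l))"
    using fin supp by (cases "k - m \<in> S") (simp_all add: sum1 insert_absorb)
  also have "\<dots> = (\<Sum>l\<in>insert (k - m) S. if l = k - m then Y * P (k - m) else 0)"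
    by (simp only: sum_distrib_left c)
  also have "\<dots> = Y * P (k - m)" using fin by (simp add: sum.delta del: sum.insert)
  finally show ?thesis .
qed

lemma proj_H: "P k * H = k \<cdot> P k"
  using proj_shift[of H 0 k] by (simp add: eig)

lemma proj_proj: "P k * P l = (if k = l then P l else 0)"
  by (rule proj_eig) (rule eig)

end

section \<open>One-parameter tori\<close>

definition mD :: "(complex \<Rightarrow> (complex, 'n::finite) sqm) \<Rightarrow> (complex, 'n) sqm \<Rightarrow> complex \<Rightarrow> bool" where
  "mD F F' t \<longleftrightarrow> (\<forall>i j. ((\<lambda>t. ent (F t) i j) has_field_derivative ent F' i j) (at t))"

lemma mD_const: "mD (\<lambda>t. A) 0 t"
  by (simp add: mD_def)

lemma mD_add: "mD F F' t \<Longrightarrow> mD G G' t \<Longrightarrow> mD (\<lambda>t. F t + G t) (F' + G') t"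
  by (auto simp: mD_def intro!: derivative_intros)

lemma mD_sum: "(\<And>k. k \<in> S \<Longrightarrow> mD (F k) (F' k) t) \<Longrightarrow> mD (\<lambda>t. \<Sum>k\<in>S. F k t) (\<Sum>k\<in>S. F' k) t"
  by (induction S rule: infinite_finite_induct) (auto intro: mD_const mD_add)

lemma mD_mult: "mD F F' t \<Longrightarrow> mD G G' t \<Longrightarrow> mD (\<lambda>t. F t * G t) (F' * G t + F t * G') t"
  unfolding mD_def ent_mult ent_add sum.distrib[symmetric]
  by (auto intro!: DERIV_sum DERIV_mult' simp: algebra_simps)
    (rule DERIV_cong[OF DERIV_mult'], auto)

lemma mD_scal:
  "(f has_field_derivative f') (at t) \<Longrightarrow> mD F F' t \<Longrightarrow> mD (\<lambda>t. f t \<cdot> F t) (f' \<cdot> F t + f t \<cdot> F') t"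
  unfolding mD_def ent_scal ent_add
  by (auto intro!: DERIV_cong[OF DERIV_mult'])

lemma mD_cong: "mD F F' t \<Longrightarrow> F' = F'' \<Longrightarrow> mD F F'' t"
  by simp

lemma mD_unique: "mD F F' t \<Longrightarrow> mD F F'' t \<Longrightarrow> F' = F''"
  unfolding mD_def by (intro sqm_eqI) (metis DERIV_unique)

lemma mD_transform:
  "mD F F' t \<Longrightarrow> open U \<Longrightarrow> t \<in> U \<Longrightarrow> (\<And>s. s \<in> U \<Longrightarrow> F s = G s) \<Longrightarrow> mD G F' t"
  unfolding mD_def
proof (intro allI)
  fix i j
  assume a: "\<forall>i j. ((\<lambda>t. ent (F t) i j) has_field_derivative ent F' i j) (at t)"
    "open U" "t \<in> U" "\<And>s. s \<in> U \<Longrightarrow> F s = G s"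
  show "((\<lambda>t. ent (G t) i j) has_field_derivative ent F' i j) (at t)"
    by (rule has_field_derivative_transform_within_open[of "\<lambda>t. ent (F t) i j" _ _ U])
      (use a in auto)
qed

lemma mD_zero_constant:
  assumes "convex U" "\<And>t. t \<in> U \<Longrightarrow> mD F 0 t" "s \<in> U" "t \<in> U"
  shows "F s = F t"
proof (rule sqm_eqI)
  fix i j
  have "\<exists>c. \<forall>t\<in>U. ent (F t) i j = c"
    using assms(1,2) by (intro has_field_derivative_zero_constant)
      (auto simp: mD_def intro: has_field_derivative_at_within)
  then show "ent (F s) i j = ent (F t) i j" using assms(3,4) by auto
qed

lemma mD_xe:
  fixes X :: "(int, 'n::finite) sqm"
  assumes "adm X" "nilp X" and u: "(u has_field_derivative u') (at t)"
  shows "mD (\<lambda>t. xe X (u t)) (u' \<cdot> (iot X * xe X (u t))) t"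
proof -
  let ?N = "CARD('n)"
  have "mD (\<lambda>t. \<Sum>k<Suc ?N. u t ^ k \<cdot> iot (dp X k))
     (\<Sum>k<Suc ?N. (of_nat k * u t ^ (k - 1) * u') \<cdot> iot (dp X k) + u t ^ k \<cdot> 0) t"
    by (intro mD_sum mD_scal mD_const) (auto intro!: derivative_eq_intros u)
  moreover have "(\<Sum>k<Suc ?N. (of_nat k * u t ^ (k - 1) * u') \<cdot> iot (dp X k) + u t ^ k \<cdot> 0)
      = u' \<cdot> (iot X * xe X (u t))"
  proof -
    have c: "of_nat (Suc k) \<cdot> iot (dp X (Suc k)) = (iot X * iot (dp X k) :: (complex, 'n) sqm)" for k
      using dp_Suc[OF assms(1), of k] by (metis iot_mult iot_scal of_int_of_nat_eq)
    have "(\<Sum>k<Suc ?N. (of_nat k * u t ^ (k - 1) * u') \<cdot> iot (dp X k) + u t ^ k \<cdot> 0)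
       = (\<Sum>k<?N. (u' * u t ^ k) \<cdot> (of_nat (Suc k) \<cdot> iot (dp X (Suc k))))"
      by (subst sum.lessThan_Suc_shift) (simp add: mult_ac)
    also have "\<dots> = u' \<cdot> (iot X * xe X (u t))"
      by (simp only: c) (simp add: xe_def sum_distrib_left scal.scale_sum_right)
    finally show ?thesis .
  qed
  moreover have e: "(\<lambda>t. xe X (u t)) = (\<lambda>t. \<Sum>k<Suc ?N. u t ^ k \<cdot> iot (dp X k))"
    by (rule ext, rule xe_upper[OF assms(2)]) simp
  ultimately show ?thesis unfolding e by (simp only:)
qed

text \<open>Multiplying an entry by a high power of \<open>c\<close> gives a polynomial that
  vanishes at every nonzero \<open>c\<close>.\<close>

lemma laurent_coeffs_0:
  fixes W :: "int \<Rightarrow> (int, 'n::finite) sqm"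
  assumes "finite S" "\<And>c::complex. c \<noteq> 0 \<Longrightarrow> (\<Sum>k\<in>S. (c powi k) \<cdot> iot (W k)) = (0 :: (complex, 'n) sqm)"
    and "k \<in> S"
  shows "W k = 0"
proof -
  obtain N :: nat where N: "\<And>k. k \<in> S \<Longrightarrow> \<bar>k\<bar> \<le> int N"
  proof
    fix k assume "k \<in> S"
    then have "nat \<bar>k\<bar> \<le> (\<Sum>k\<in>S. nat \<bar>k\<bar>)" using assms(1) by (intro member_le_sum) auto
    then show "\<bar>k\<bar> \<le> int (\<Sum>k\<in>S. nat \<bar>k\<bar>)" by linarith
  qed
  have "ent (W k) i j = 0" for i j
  proof (rule ccontr)
    assume nz: "ent (W k) i j \<noteq> 0"
    define a :: "nat \<Rightarrow> complex" where "a m = (if int m - int N \<in> S then of_int (ent (W (int m - int N)) i j) else 0)" for m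
    have "(\<Sum>m\<le>2*N. a m * c ^ m) = 0" if "c \<noteq> 0" for c
    proof -
      have "(\<Sum>m\<le>2*N. a m * c ^ m) = (\<Sum>m\<in>(\<lambda>k. nat (k + int N)) ` S. a m * c ^ m)"
      proof (rule sum.mono_neutral_right)
        show "(\<lambda>k. nat (k + int N)) ` S \<subseteq> {..2 * N}" using N by fastforce
        show "\<forall>m\<in>{..2 * N} - (\<lambda>k. nat (k + int N)) ` S. a m * c ^ m = 0"
        proof
          fix m assume m: "m \<in> {..2 * N} - (\<lambda>k. nat (k + int N)) ` S"
          have "int m - int N \<notin> S" 
          proof
            assume "int m - int N \<in> S"
            then have "nat (int m - int N + int N) \<in> (\<lambda>k. nat (k + int N)) ` S" by (rule imageI)
            then show False using m by simp
          qed
          then show "a m * c ^ m = 0" by (simp add: a_def)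
        qed
      qed simp
      also have "\<dots> = (\<Sum>k\<in>S. a (nat (k + int N)) * c ^ nat (k + int N))"
        by (rule sum.reindex_cong[of "\<lambda>k. nat (k + int N)" S])
          (auto intro!: inj_onI dest!: N)
      also have "\<dots> = (\<Sum>k\<in>S. c ^ N * (c powi k * of_int (ent (W k) i j)))"
      proof (rule sum.cong[OF refl])
        fix k assume k: "k \<in> S"
        then have nn: "k + int N \<ge> 0" using N by fastforce
        have "c ^ nat (k + int N) = c powi (k + int N)" using nn by (simp add: power_int_def)
        also have "\<dots> = c ^ N * c powi k" using that by (simp add: power_int_add)
        finally show "a (nat (k + int N)) * c ^ nat (k + int N) = c ^ N * (c powi k * of_int (ent (W k) i j))"
          using nn k by (simp add: a_def)
      qed
      also have "\<dots> = c ^ N * ent (\<Sum>k\<in>S. (c powi k) \<cdot> iot (W k)) i j"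
        by (simp add: sum_distrib_left)
      finally show ?thesis using assms(2)[OF that] by simp
    qed
    then have sub: "- {0} \<subseteq> {c. (\<Sum>m\<le>2*N. a m * c ^ m) = 0}" by auto
    have "a (nat (k + int N)) \<noteq> 0" "nat (k + int N) \<le> 2 * N"
      using nz assms(3) N[OF assms(3)] by (auto simp: a_def)
    then have "finite {c. (\<Sum>m\<le>2*N. a m * c ^ m) = 0}"
      unfolding Transcendental.polyfun_finite_roots[where c = a and n = "2 * N"] by blast
    with sub have "finite (- {0::complex})" by (rule finite_subset)
    then show False by (simp add: finite_compl infinite_UNIV_char_0)
  qed
  then show ?thesis by (intro sqm_eqI) simp
qed

text \<open>Laurent polynomials with integer matrices as coefficients; for a torus element the
  exponents will be the weights.\<close>

definition laurent :: "(complex \<Rightarrow> (complex, 'n::finite) sqm) \<Rightarrow> bool" where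
  "laurent F \<longleftrightarrow> (\<exists>S W. finite S \<and> (\<forall>k. k \<notin> S \<longrightarrow> W k = 0) \<and>
     (\<forall>c. c \<noteq> 0 \<longrightarrow> F c = (\<Sum>k\<in>S. (c powi k) \<cdot> iot (W k))))"

lemma laurent_monom: "laurent (\<lambda>c. (c powi m) \<cdot> iot A)"
  unfolding laurent_def
  by (rule exI[of _ "{m}"], rule exI[of _ "\<lambda>k. if k = m then A else 0"]) auto

lemma laurent_const: "laurent (\<lambda>c. iot A)"
  using laurent_monom[of 0 A] by simp

lemma laurent_add:
  assumes "laurent F" "laurent G" shows "laurent (\<lambda>c. F c + G c)"
proof -
  from assms obtain S W S' W' where a: "finite S" "\<forall>k. k \<notin> S \<longrightarrow> W k = 0"
    "\<forall>c. c \<noteq> 0 \<longrightarrow> F c = (\<Sum>k\<in>S. (c powi k) \<cdot> iot (W k))"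
    "finite S'" "\<forall>k. k \<notin> S' \<longrightarrow> W' k = 0"
    "\<forall>c. c \<noteq> 0 \<longrightarrow> G c = (\<Sum>k\<in>S'. (c powi k) \<cdot> iot (W' k))"
    unfolding laurent_def by blast
  have "(\<Sum>k\<in>S. (c powi k) \<cdot> iot (W k)) + (\<Sum>k\<in>S'. (c powi k) \<cdot> iot (W' k))
      = (\<Sum>k\<in>S \<union> S'. (c powi k) \<cdot> iot (W k + W' k))" for c :: complex
  proof -
    have "(\<Sum>k\<in>S. (c powi k) \<cdot> iot (W k)) = (\<Sum>k\<in>S \<union> S'. (c powi k) \<cdot> iot (W k))"
      by (rule sum.mono_neutral_left) (use a in auto)
    moreover have "(\<Sum>k\<in>S'. (c powi k) \<cdot> iot (W' k)) = (\<Sum>k\<in>S \<union> S'. (c powi k) \<cdot> iot (W' k))"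
      by (rule sum.mono_neutral_left) (use a in auto)
    ultimately show ?thesis by (simp add: scal.scale_right_distrib sum.distrib)
  qed
  then show ?thesis unfolding laurent_def using a
    by (intro exI[of _ "S \<union> S'"] exI[of _ "\<lambda>k. W k + W' k"]) auto
qed

lemma laurent_sum: "(\<And>k. k \<in> S \<Longrightarrow> laurent (F k)) \<Longrightarrow> laurent (\<lambda>c. \<Sum>k\<in>S. F k c)"
proof (induction S rule: infinite_finite_induct)
  case (insert x S) then show ?case by (simp add: laurent_add)
qed (use laurent_const[of 0] in simp_all)

lemma laurent_cong: "laurent F \<Longrightarrow> (\<And>c. c \<noteq> 0 \<Longrightarrow> F c = G c) \<Longrightarrow> laurent G"
  unfolding laurent_def by metis

lemma laurent_mult:
  assumes "laurent F" "laurent G" shows "laurent (\<lambda>c. F c * G c)"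
proof -
  from assms obtain S W S' W' where a: 
    "\<forall>c. c \<noteq> 0 \<longrightarrow> F c = (\<Sum>k\<in>S. (c powi k) \<cdot> iot (W k))"
    "\<forall>c. c \<noteq> 0 \<longrightarrow> G c = (\<Sum>k\<in>S'. (c powi k) \<cdot> iot (W' k))"
    unfolding laurent_def by blast
  have "laurent (\<lambda>c. \<Sum>k\<in>S. \<Sum>l\<in>S'. (c powi (k + l)) \<cdot> iot (W k * W' l))"
    by (intro laurent_sum laurent_monom)
  then show ?thesis
    by (rule laurent_cong) (simp add: a sum_product power_int_add mult.commute)
qed

lemma laurent_xe: "laurent (\<lambda>c. xe X (of_int a * c powi m))"
proof -
  have "laurent (\<lambda>c. \<Sum>k<CARD('a). (c powi (m * int k)) \<cdot> iot (a ^ k \<cdot> dp X k))" for X :: "(int, 'a) sqm"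
    by (intro laurent_sum laurent_monom)
  then show ?thesis
    by (rule laurent_cong) (simp add: xe_def power_mult_distrib power_int_mult mult.commute)
qed

section \<open>Rank one: the torus of an \<open>SL2\<close> and its Gauss decomposition\<close>

locale sl2 =
  fixes X Y :: "(int, 'n::finite) sqm"
  assumes adm: "adm X" "adm Y" and nil: "nilp X" "nilp Y"
    and HX: "br (br X Y) X = 2 * X" and HY: "br (br X Y) Y = - (2 * Y)"
begin

definition H where "H = br X Y"

lemma XH: "br X H = 2 * (- X)" and YH: "br Y H = 2 * Y" and YX: "br Y X = - H"
  using HX HY by (simp_all add: H_def br_def algebra_simps)

lemma conj_X_Y: "xe X s * iot Y = (iot Y + s \<cdot> iot H - s^2 \<cdot> iot X) * xe X s"
  using xe_mult_conj[OF adm(1) nil(1) _ XH, of Y s] by (simp add: H_def br_minus_right)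

lemma conj_X_H: "xe X s * iot H = (iot H - (2 * s) \<cdot> iot X) * xe X s"
  using xe_mult_conj[OF adm(1) nil(1) XH, of 0 s] by (simp add: br_def numeral_sqm mult.commute)

lemma conj_Y_X: "xe Y s * iot X = (iot X - s \<cdot> iot H - s^2 \<cdot> iot Y) * xe Y s"
  using xe_mult_conj[OF adm(2) nil(2) YX, of "- Y" s] YH by (simp add: br_minus_right)

lemma conj_Y_H: "xe Y s * iot H = (iot H + (2 * s) \<cdot> iot Y) * xe Y s"
  using xe_mult_conj[OF adm(2) nil(2) YH, of 0 s] by (simp add: br_def numeral_sqm mult.commute)

definition B :: "complex \<Rightarrow> complex \<Rightarrow> (complex, 'n) sqm" where
  "B s t = xe Y (- t / (1 + s * t)) * xe X s * xe Y t * xe X (- s / (1 + s * t))"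

text \<open>In \<open>SL\<^sub>2\<close>, \<open>B s t\<close> is \<open>diag (1 + s t, 1 / (1 + s t))\<close>; the differential equation transfers
  this to the representation.\<close>

lemma mD_B:
  assumes c: "1 + s * t \<noteq> 0"
  shows "mD (B s) ((s / (1 + s * t)) \<cdot> (iot H * B s t)) t"
proof -
  define c where "c = 1 + s * t"
  have c0: "c \<noteq> 0" using assms by (simp add: c_def)
  define \<tau> where "\<tau> = - t / c"
  define a b g d where "a = (xe Y \<tau> :: (complex, 'n) sqm)" and "b = (xe X s :: (complex, 'n) sqm)"
    and "g = (xe Y t :: (complex, 'n) sqm)" and "d = (xe X (- s / c) :: (complex, 'n) sqm)"
  define x y h where "x = (iot X :: (complex, 'n) sqm)" and "y = (iot Y :: (complex, 'n) sqm)"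
    and "h = (iot H :: (complex, 'n) sqm)"
  have st: "s * t = c - 1" by (simp add: c_def)
  have \<tau>1: "1 + s * \<tau> = 1 / c" using c0 st by (simp add: \<tau>_def field_simps)
  have bx: "b * y = (y + s \<cdot> h - s^2 \<cdot> x) * b" "b * h = (h - (2 * s) \<cdot> x) * b" "b * x = x * b"
    unfolding b_def x_def y_def h_def by (rule conj_X_Y conj_X_H xe_commute[OF adm(1) refl])+
  have ax: "a * x = (x - \<tau> \<cdot> h - \<tau>^2 \<cdot> y) * a" "a * h = (h + (2 * \<tau>) \<cdot> y) * a" "a * y = y * a"
    unfolding a_def x_def y_def h_def by (rule conj_Y_X conj_Y_H xe_commute[OF adm(2) refl])+
  have gx: "g * x = (x - t \<cdot> h - t^2 \<cdot> y) * g"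
    unfolding g_def x_def y_def h_def by (rule conj_Y_X)
  \<comment> \<open>The product rule puts a factor \<open>y\<close> between \<open>b\<close> and
    \<open>g\<close> and a factor \<open>x\<close> in front of \<open>d\<close>. \<open>P\<close>
    and \<open>Q\<close> move these factors to the left end.\<close>
  have P: "a * b * y = (((1 + s * \<tau>)^2) \<cdot> y + (s * (1 + s * \<tau>)) \<cdot> h - s^2 \<cdot> x) * (a * b)"
  proof -
    have "a * b * y = ((a * y) + s \<cdot> (a * h) - s^2 \<cdot> (a * x)) * b"
      by (simp add: mult.assoc bx algebra_simps)
    also have "\<dots> = (y + s \<cdot> (h + (2 * \<tau>) \<cdot> y) - s^2 \<cdot> (x - \<tau> \<cdot> h - \<tau>^2 \<cdot> y)) * (a * b)"
      by (simp add: ax algebra_simps)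
    also have "y + s \<cdot> (h + (2 * \<tau>) \<cdot> y) - s^2 \<cdot> (x - \<tau> \<cdot> h - \<tau>^2 \<cdot> y)
      = ((1 + s * \<tau>)^2) \<cdot> y + (s * (1 + s * \<tau>)) \<cdot> h - s^2 \<cdot> x"
      by (rule sqm_eqI) (simp add: algebra_simps power2_eq_square)
    finally show ?thesis .
  qed
  have Q: "a * b * g * x = (c^2) \<cdot> x * (a * b * g)"
  proof -
    have "a * b * g * x = a * (b * (x - t \<cdot> h - t^2 \<cdot> y)) * g"
      by (simp add: mult.assoc gx)
    also have "b * (x - t \<cdot> h - t^2 \<cdot> y) = (x - t \<cdot> (h - (2 * s) \<cdot> x) - t^2 \<cdot> (y + s \<cdot> h - s^2 \<cdot> x)) * b"
      by (simp add: bx algebra_simps)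
    also have "x - t \<cdot> (h - (2 * s) \<cdot> x) - t^2 \<cdot> (y + s \<cdot> h - s^2 \<cdot> x) = c^2 \<cdot> x - (t * c) \<cdot> h - t^2 \<cdot> y"
      by (rule sqm_eqI) (simp add: algebra_simps power2_eq_square c_def)
    also have "a * ((c^2 \<cdot> x - (t * c) \<cdot> h - t^2 \<cdot> y) * b)
       = (c^2 \<cdot> (a * x) - (t * c) \<cdot> (a * h) - t^2 \<cdot> (a * y)) * b"
      by (simp add: algebra_simps)
    also have "\<dots> = (c^2 \<cdot> (x - \<tau> \<cdot> h - \<tau>^2 \<cdot> y) - (t * c) \<cdot> (h + (2 * \<tau>) \<cdot> y) - t^2 \<cdot> y) * a * b"
      by (simp add: ax algebra_simps)
    also have "c^2 \<cdot> (x - \<tau> \<cdot> h - \<tau>^2 \<cdot> y) - (t * c) \<cdot> (h + (2 * \<tau>) \<cdot> y) - t^2 \<cdot> y = c^2 \<cdot> x"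
      using c0 by (intro sqm_eqI) (simp add: \<tau>_def field_simps power2_eq_square)
    finally show ?thesis by (simp add: mult.assoc)
  qed
  have u1: "((\<lambda>t. - t / (1 + s * t)) has_field_derivative (- (1 / c^2))) (at t)"
    using assms unfolding c_def
    by (auto intro!: derivative_eq_intros simp: field_simps power2_eq_square)
  have u2: "((\<lambda>t. - s / (1 + s * t)) has_field_derivative s^2 / c^2) (at t)"
    using assms unfolding c_def
    by (auto intro!: derivative_eq_intros simp: field_simps power2_eq_square)
  have u: "((\<lambda>t. t) has_field_derivative 1) (at t)" by simp
  from mD_mult[OF mD_mult[OF mD_mult[OF mD_xe[OF adm(2) nil(2) u1] mD_const[of "xe X s"]]
    mD_xe[OF adm(2) nil(2) u]] mD_xe[OF adm(1) nil(1) u2]]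
  have "mD (B s) (((((- (1 / c^2)) \<cdot> (y * a)) * b + a * 0) * g + a * b * (1 \<cdot> (y * g))) * d
      + a * b * g * ((s^2 / c^2) \<cdot> (x * d))) t"
    by (simp add: B_def[abs_def] a_def b_def g_def d_def \<tau>_def c_def x_def y_def)
  moreover have "((((- (1 / c^2)) \<cdot> (y * a)) * b + a * 0) * g + a * b * (1 \<cdot> (y * g))) * d
      + a * b * g * ((s^2 / c^2) \<cdot> (x * d)) = (s / c) \<cdot> (h * (a * b * g * d))"
  proof -
    have "((((- (1 / c^2)) \<cdot> (y * a)) * b + a * 0) * g + a * b * (1 \<cdot> (y * g))) * d
      + a * b * g * ((s^2 / c^2) \<cdot> (x * d))
      = (- (1 / c^2)) \<cdot> (y * (a * b * g * d)) + (a * b * y) * g * d + (s^2 / c^2) \<cdot> ((a * b * g * x) * d)"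
      by (simp add: mult.assoc distrib_right left_diff_distrib)
    also have "\<dots> = ((- (1 / c^2)) \<cdot> y + ((1 / c)^2 \<cdot> y + (s * (1 / c)) \<cdot> h - s^2 \<cdot> x) + (s^2 / c^2 * c^2) \<cdot> x) * (a * b * g * d)"
      unfolding P Q \<tau>1 by (simp add: algebra_simps)
    \<comment> \<open>At the left end the multiples of \<open>x\<close> and \<open>y\<close> cancel
      and only \<open>h\<close> survives.\<close>
    also have "(- (1 / c^2)) \<cdot> y + ((1 / c)^2 \<cdot> y + (s * (1 / c)) \<cdot> h - s^2 \<cdot> x) + (s^2 / c^2 * c^2) \<cdot> x = (s / c) \<cdot> h"
      using c0 by (intro sqm_eqI) (simp add: field_simps power2_eq_square)
    finally show ?thesis by simp
  qed
  ultimately show ?thesis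
    by (simp add: B_def a_def b_def g_def d_def \<tau>_def c_def h_def)
qed

text \<open>The torus element is a Laurent polynomial in \<open>c\<close> with integral coefficients; these coefficients
  are the projections to the weight spaces, which are therefore integral.\<close>

lemma torus:
  obtains S P where "weight_projections H P S"
    "\<And>c. c \<noteq> 0 \<Longrightarrow> B 1 (c - 1) = (\<Sum>k\<in>S. (c powi k) \<cdot> iot (P k))"
proof -
  define T where "T c = B 1 (c - 1)" for c
  \<comment> \<open>For \<open>s = 1\<close> and \<open>t = c - 1\<close> the four parameters are
    \<open>1/c - 1\<close>, \<open>1\<close>, \<open>c - 1\<close> and \<open>- 1/c\<close>;
    splitting off the constants leaves monomials in \<open>c\<close>.\<close>
  have "laurent (\<lambda>c. xe Y (of_int 1 * c powi (- 1)) * iot (xe Y (- 1)) * iot (xe X 1)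
     * (xe Y (of_int 1 * c powi 1) * iot (xe Y (- 1))) * xe X (of_int (- 1) * c powi (- 1)))"
    by (intro laurent_mult laurent_xe laurent_const)
  then have "laurent T"
  proof (rule laurent_cong)
    fix c :: complex assume "c \<noteq> 0"
    have i: "iot (xe X s) = xe X (of_int s)" for s and X :: "(int, 'n) sqm"
      by (simp add: xe_def)
    have "- (c - 1) / (1 + 1 * (c - 1)) = of_int 1 * c powi (- 1) + - 1"
      using \<open>c \<noteq> 0\<close> by (simp add: field_simps power_int_minus)
    moreover have "c - 1 = of_int 1 * c powi 1 + - 1" by simp
    moreover have "- 1 / (1 + 1 * (c - 1)) = of_int (- 1) * c powi (- 1)"
      using \<open>c \<noteq> 0\<close> by (simp add: field_simps power_int_minus)
    ultimately show "xe Y (of_int 1 * c powi (- 1)) * iot (xe Y (- 1)) * iot (xe X 1)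
     * (xe Y (of_int 1 * c powi 1) * iot (xe Y (- 1))) * xe X (of_int (- 1) * c powi (- 1)) = T c"
      unfolding T_def B_def by (simp only: xe_add adm nil i of_int_minus of_int_1)
  qed
  then obtain S P where SP: "finite S" "\<forall>k. k \<notin> S \<longrightarrow> P k = 0"
    "\<And>c. c \<noteq> 0 \<Longrightarrow> T c = (\<Sum>k\<in>S. (c powi k) \<cdot> iot (P k))"
    unfolding laurent_def by blast
  \<comment> \<open>The differential equation reads \<open>c T' = H T\<close>. Comparing Laurent
    coefficients gives \<open>H * P k = k P k\<close>, and \<open>T 1 = 1\<close> makes the
    coefficients sum to 1.\<close>
  have "(\<Sum>k\<in>S. (c powi k) \<cdot> iot (k \<cdot> P k - H * P k)) = (0 :: (complex, 'n) sqm)" if c: "c \<noteq> 0" for c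
  proof -
    have "mD (B 1) ((1 / (1 + 1 * (c - 1))) \<cdot> (iot H * B 1 (c - 1))) (c - 1)"
      by (rule mD_B) (use c in simp)
    then have 1: "mD T ((1 / c) \<cdot> (iot H * T c)) c"
      using DERIV_shift[of _ _ c "- 1"] by (simp add: mD_def T_def)
    have "mD (\<lambda>c. \<Sum>k\<in>S. (c powi k) \<cdot> iot (P k)) (\<Sum>k\<in>S. (of_int k * c powi (k - 1)) \<cdot> iot (P k) + (c powi k) \<cdot> 0) c"
      by (intro mD_sum mD_scal mD_const) (auto intro!: derivative_eq_intros c)
    then have "mD T (\<Sum>k\<in>S. (of_int k * c powi (k - 1)) \<cdot> iot (P k)  + (c powi k) \<cdot> 0) c"
      by (rule mD_transform[of _ _ _ "- {0}"]) (use c SP in auto)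
    from mD_unique[OF 1 this]
    have "c \<cdot> ((1 / c) \<cdot> (iot H * T c)) = c \<cdot> (\<Sum>k\<in>S. (of_int k * c powi (k - 1)) \<cdot> iot (P k))" by simp
    then have "iot H * T c = c \<cdot> (\<Sum>k\<in>S. (of_int k * c powi (k - 1)) \<cdot> iot (P k))" using c by simp
    also have "\<dots> = (\<Sum>k\<in>S. (c powi k) \<cdot> iot (k \<cdot> P k))"
      unfolding scal.scale_sum_right using c
      by (intro sum.cong refl) (simp add: power_int_diff field_simps)
    also have "iot H * T c = (\<Sum>k\<in>S. (c powi k) \<cdot> iot (H * P k))"
      by (simp add: SP(3)[OF c] sum_distrib_left)
    finally show ?thesis
      by (simp add: scal.scale_right_diff_distrib sum_subtractf)
  qed
  then have "k \<cdot> P k - H * P k = 0" if "k \<in> S" for k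
    using laurent_coeffs_0[OF SP(1) _ that, of "\<lambda>k. k \<cdot> P k - H * P k"] by blast
  then have eig: "H * P k = k \<cdot> P k" for k using SP(2) by (cases "k \<in> S") auto
  have "T 1 = 1" by (simp add: T_def B_def xe_inverse adm nil)
  then have "iot (\<Sum>k\<in>S. P k) = (iot 1 :: (complex, 'n) sqm)" using SP(3)[of 1] by simp
  then have "(\<Sum>k\<in>S. P k) = 1" by (simp only: iot_inj)
  then have "weight_projections H P S" using SP eig by unfold_locales auto
  with SP(3) show thesis by (intro that) (auto simp: T_def)
qed

text \<open>\<open>torus\<close> treats \<open>s = 1\<close>. For general \<open>s\<close> the
  function \<open>(1 + s t)^(-k) P k B s t\<close> of \<open>t\<close> has derivative zero on the
  convex set \<open>norm (s * t) < 1\<close>, where \<open>1 + s t\<close> has no zero, and its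
  value at \<open>t = 0\<close> is \<open>P k\<close>.\<close>

lemma rank_one:
  assumes "weight_projections H P S" and st: "norm (s * t) < 1"
  shows "B s t = (\<Sum>k\<in>S. ((1 + s * t) powi k) \<cdot> iot (P k))"
proof -
  interpret weight_projections H P S by fact
  define U where "U = {t. norm (s * t) < 1}"
  have c0: "1 + s * t \<noteq> 0" if "t \<in> U" for t
  proof
    assume "1 + s * t = 0"
    then have "s * t = - 1" by (simp add: add_eq_0_iff)
    with that show False by (simp add: U_def)
  qed
  have U: "convex U"
  proof -
    have "U = (*) s -` ball 0 1" by (auto simp: U_def)
    then show ?thesis
      by (simp only:) (rule convex_linear_vimage, auto intro: linearI simp: algebra_simps)
  qed
  have "iot (P k) * B s t = ((1 + s * t) powi k) \<cdot> iot (P k)" for k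
  proof -
    have "mD (\<lambda>t. ((1 + s * t) powi (- k)) \<cdot> (iot (P k) * B s t)) 0 t" if t: "t \<in> U" for t
    proof -
      define c where "c = 1 + s * t"
      have c: "c \<noteq> 0" using c0[OF t] by (simp add: c_def)
      have 1: "mD (\<lambda>t. iot (P k) * B s t) (0 * B s t + iot (P k) * ((s / c) \<cdot> (iot H * B s t))) t"
        unfolding c_def by (intro mD_mult mD_const mD_B c0 t)
      have 2: "((\<lambda>t. (1 + s * t) powi (- k)) has_field_derivative (of_int (- k) * c powi (- k - 1) * s)) (at t)"
        unfolding c_def using c0[OF t] by (auto intro!: derivative_eq_intros)
      have PH: "iot (P k) * iot H = (of_int k \<cdot> iot (P k) :: (complex, 'n) sqm)"
        using proj_H[of k] by (metis iot_mult iot_scal)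
      have "iot (P k) * ((s / c) \<cdot> (iot H * B s t)) = (s / c * of_int k) \<cdot> (iot (P k) * B s t)"
        by (simp add: PH mult.assoc[symmetric])
      then show ?thesis
        using mD_scal[OF 2 1] c
        by (elim mD_cong) (simp add: c_def[symmetric] power_int_diff field_simps flip: scal.scale_left_distrib)
    qed
    from mD_zero_constant[OF U this, of t 0]
    have "((1 + s * t) powi (- k)) \<cdot> (iot (P k) * B s t) = iot (P k) * B s 0"
      using st by (simp add: U_def)
    also have "B s 0 = 1" by (simp add: B_def xe_inverse adm nil)
    finally have "(1 + s * t) powi k \<cdot> (((1 + s * t) powi (- k)) \<cdot> (iot (P k) * B s t)) = (1 + s * t) powi k \<cdot> iot (P k)"
      by simp
    then show ?thesis using c0[of t] st by (simp add: U_def power_int_minus)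
  qed
  then have "(\<Sum>k\<in>S. ((1 + s * t) powi k) \<cdot> iot (P k)) = iot (\<Sum>k\<in>S. P k) * B s t"
    by (simp add: sum_distrib_right)
  then show ?thesis by (simp add: sum1)
qed

end

section \<open>The big cell over the complex numbers\<close>

lemma dp_twist:
  fixes g :: "(complex, 'n::finite) sqm"
  assumes "adm Y" "g * iot Y = r \<cdot> (iot Y * g)"
  shows "g * iot (dp Y k) = r ^ k \<cdot> (iot (dp Y k) * g)"
proof -
  have p: "g * iot Y ^ k = r ^ k \<cdot> (iot Y ^ k * g)" for k
  proof (induction k)
    case (Suc k)
    have "g * iot Y ^ Suc k = (g * iot Y) * iot Y ^ k" by (simp add: mult.assoc)
    also have "\<dots> = r \<cdot> (iot Y * (g * iot Y ^ k))" by (simp add: assms(2) mult.assoc)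
    also have "\<dots> = r ^ Suc k \<cdot> (iot Y ^ Suc k * g)" by (simp add: Suc mult.assoc)
    finally show ?case .
  qed simp
  have f: "fact k \<cdot> iot (dp Y k) = (iot Y ^ k :: (complex, 'n) sqm)"
    using fact_dp[OF assms(1), of k] by (metis iot_power iot_scal of_int_fact)
  have "fact k \<cdot> (g * iot (dp Y k)) = g * (fact k \<cdot> iot (dp Y k))" by simp
  also have "\<dots> = r ^ k \<cdot> ((fact k \<cdot> iot (dp Y k)) * g)" by (simp only: f p)
  also have "\<dots> = fact k \<cdot> (r ^ k \<cdot> (iot (dp Y k) * g))" by (simp add: mult.commute)
  finally show ?thesis by (simp only: fact_scal_cancel)
qed

lemma xe_twist:
  fixes g :: "(complex, 'n::finite) sqm"
  assumes "adm Y" "g * iot Y = r \<cdot> (iot Y * g)"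
  shows "g * xe Y s = xe Y (r * s) * g"
  unfolding xe_def sum_distrib_left sum_distrib_right
  by (rule sum.cong[OF refl]) (simp add: dp_twist[OF assms] power_mult_distrib mult.commute)

context weight_projections
begin

text \<open>The value at \<open>c\<close> of the one-parameter torus generated by \<open>H\<close>:
  it acts by \<open>c^k\<close> on weight \<open>k\<close>.\<close>

definition tor :: "complex \<Rightarrow> (complex, 'n) sqm" where
  "tor c = (\<Sum>k\<in>S. (c powi k) \<cdot> iot (P k))"

lemma tor_1 [simp]: "tor 1 = 1"
  using sum1 by (simp add: tor_def flip: iot_sum)

lemma tor_mult:
  shows "tor c * tor d = tor (c * d)"
proof -
  have "tor c * tor d = (\<Sum>k\<in>S. \<Sum>l\<in>S. if k = l then (c * d) powi k \<cdot> iot (P k) else 0)"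
    unfolding tor_def sum_product
    by (intro sum.cong refl) (auto simp: power_int_mult_distrib mult.commute proj_proj simp flip: iot_mult)
  then show ?thesis using fin by (simp add: tor_def sum.delta)
qed

lemma tor_twist:
  assumes "br H Y = m \<cdot> Y" "c \<noteq> 0"
  shows "tor c * iot Y = (c powi m) \<cdot> (iot Y * tor c)"
proof -
  have s: "P k * Y = Y * P (k - m)" for k by (rule proj_shift[OF assms(1)])
  \<comment> \<open>Both \<open>S\<close> and its shift by \<open>m\<close> are enlarged to their
    union; the added terms vanish because a projection on one side of \<open>Y\<close> does.\<close>
  let ?T = "S \<union> (\<lambda>k. k + m) ` S"
  have "tor c * iot Y = (\<Sum>k\<in>S. (c powi k) \<cdot> iot (Y * P (k - m)))"
    by (simp add: tor_def sum_distrib_right s flip: iot_mult)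
  also have "\<dots> = (\<Sum>k\<in>?T. (c powi k) \<cdot> iot (Y * P (k - m)))"
    by (rule sum.mono_neutral_left) (use fin supp s in \<open>auto simp flip: s\<close>)
  also have "\<dots> = (\<Sum>k\<in>(\<lambda>k. k + m) ` S. (c powi k) \<cdot> iot (Y * P (k - m)))"
  proof (rule sum.mono_neutral_right)
    show "\<forall>i\<in>?T - (\<lambda>k. k + m) ` S. (c powi i) \<cdot> iot (Y * P (i - m)) = 0"
    proof
      fix i assume i: "i \<in> ?T - (\<lambda>k. k + m) ` S"
      have "i - m \<notin> S"
      proof
        assume "i - m \<in> S"
        then have "(i - m) + m \<in> (\<lambda>k. k + m) ` S" by (rule imageI)
        then show False using i by simp
      qed
      then show "(c powi i) \<cdot> iot (Y * P (i - m)) = 0" by (simp add: supp)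
    qed
  qed (use fin in auto)
  also have "\<dots> = (\<Sum>k\<in>S. (c powi (k + m)) \<cdot> iot (Y * P k))"
    by (subst sum.reindex) (auto intro: inj_onI)
  also have "\<dots> = (c powi m) \<cdot> (iot Y * tor c)"
    using assms(2) by (simp add: tor_def sum_distrib_left scal.scale_sum_right power_int_add mult.commute)
  finally show ?thesis .
qed

end

section \<open>Commutation of the root unipotents\<close>

locale c2_sys = c2_table A A' C C' D D' E E'
  for A A' C C' D D' E E' :: "(int, 'n::finite) sqm" +
  assumes adm: "adm A" "adm A'" "adm C" "adm C'" "adm D" "adm D'" "adm E" "adm E'"
    and nil: "nilp A" "nilp A'" "nilp C" "nilp C'" "nilp D" "nilp D'" "nilp E" "nilp E'"
    and nz: "A \<noteq> 0" "A' \<noteq> 0" "C \<noteq> 0" "C' \<noteq> 0" "D \<noteq> 0" "D' \<noteq> 0" "E \<noteq> 0" "E' \<noteq> 0"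
begin

lemma sl2_D: "sl2 D D'" and sl2_A: "sl2 A A'" and sl2_E: "sl2 E E'" and sl2_C: "sl2 C C'"
  by (unfold_locales; simp add: adm nil table br_simps mult_2)+

lemma commute:
  "br X Y = 0 \<Longrightarrow> X * Y = Y * (X :: (int, 'n) sqm)"
  by (simp add: br_def)

lemma xe_minus_cancel:
  "adm X \<Longrightarrow> nilp X \<Longrightarrow> xe X t * (xe X (- t) * Z) = Z"
  "adm X \<Longrightarrow> nilp X \<Longrightarrow> xe X (- t) * (xe X t * Z) = Z"
  by (simp_all add: xe_inverse flip: mult.assoc)

lemma E_A: "xe E s * xe A t = xe A t * xe C (s * t) * xe D (s^2 * t) * xe E (s :: complex)"
  using xe_mult_xe[of E A C D 1 1 s t] by (simp add: adm nil table)

lemma E_C: "xe E s * xe C t = xe C t * xe D (2 * s * t) * xe E (s :: complex)"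
  using xe_mult_xe[of E C D D 2 0 s t] by (simp add: adm nil table numeral_sqm br_scal_right)

lemma C_A': "xe C s * xe A' t = xe A' t * xe E (s * t) * xe D (- (s^2 * t)) * xe C (s :: complex)"
  using xe_mult_xe[of C A' E D 1 "- 1" s t] by (simp add: adm nil table br_minus_right)

lemma E'_C: "xe E' s * xe C t = xe C t * xe A (2 * s * t) * xe E' (s :: complex)"
  using xe_mult_xe[of E' C A A 2 0 s t] by (simp add: adm nil table numeral_sqm br_scal_right)

lemma E'_D: "xe E' s * xe D t = xe D t * xe C (s * t) * xe A (s^2 * t) * xe E' (s :: complex)"
  using xe_mult_xe[of E' D C A 1 1 s t] by (simp add: adm nil table)

lemma E'_A': "xe E' s * xe A' t = xe A' t * xe C' (- (s * t)) * xe D' (s^2 * t) * xe E' (s :: complex)"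
  using xe_mult_xe[of E' A' C' D' "- 1" 1 s t] by (simp add: adm nil table br_minus_right)

lemma E'_C': "xe E' s * xe C' t = xe C' t * xe D' (- (2 * s * t)) * xe E' (s :: complex)"
  using xe_mult_xe[of E' C' D' D' "- 2" 0 s t] by (simp add: adm nil table numeral_sqm br_scal_right br_minus_right)

lemma comm:
  "xe A s * xe C t = xe C t * xe A (s :: complex)" "xe A s * xe D t = xe D t * xe A s"
  "xe C s * xe D t = xe D t * xe C s" "xe E s * xe D t = xe D t * xe E s"
  "xe A' s * xe C' t = xe C' t * xe A' s" "xe A' s * xe D' t = xe D' t * xe A' s"
  "xe C' s * xe D' t = xe D' t * xe C' s" "xe E' s * xe D' t = xe D' t * xe E' s"
  "xe E s * xe A' t = xe A' t * xe E s" "xe D s * xe A' t = xe A' t * xe D s"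
  "xe E' s * xe A t = xe A t * xe E' s"
  by (rule xe_xe_commute; simp add: adm commute table)+

text \<open>Coordinates on the unipotent group of the positive roots, of which \<open>A\<close> and
  \<open>E\<close> are the simple ones.\<close>

definition up :: "complex \<Rightarrow> complex \<Rightarrow> complex \<Rightarrow> complex \<Rightarrow> (complex, 'n) sqm" where
  "up a e c d = xe A a * xe E e * xe C c * xe D d"

definition lo :: "complex \<Rightarrow> complex \<Rightarrow> complex \<Rightarrow> complex \<Rightarrow> (complex, 'n) sqm" where
  "lo d c e a = xe D' d * xe C' c * xe E' e * xe A' a"

lemma swap: "a * b = b * a \<Longrightarrow> a * (b * Z) = b * (a * (Z :: (complex, 'n) sqm))"
  by (metis mult.assoc)

lemma C_E: "xe C (c :: complex) * xe E t = xe E t * (xe C c * xe D (- (2 * t * c)))"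
proof -
  have "xe E t * (xe C c * xe D (- (2 * t * c))) = xe C c * xe D (2 * t * c) * xe E t * xe D (- (2 * t * c))"
    using E_C[of t c] by (simp flip: mult.assoc)
  also have "\<dots> = xe C c * (xe D (2 * t * c) * xe D (- (2 * t * c))) * xe E t"
    by (simp add: mult.assoc comm(4))
  finally show ?thesis by (simp add: adm nil xe_inverse)
qed

lemma A_E: "xe A (a :: complex) * xe E e = xe E e * (xe A a * (xe C (- (e * a)) * xe D (e^2 * a)))"
proof -
  have "xe E e * (xe A a * (xe C (- (e * a)) * xe D (e^2 * a)))
      = xe A a * xe C (e * a) * xe D (e^2 * a) * (xe E e * xe C (- (e * a))) * xe D (e^2 * a)"
    using E_A[of e a] by (simp flip: mult.assoc)
  also have "\<dots> = xe A a * (xe C (e * a) * xe D (e^2 * a) * xe C (- (e * a)) * xe D (- (2 * e^2 * a)) * xe D (e^2 * a) * xe E e)"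
    by (simp add: E_C mult.assoc comm(4) power2_eq_square mult_ac)
  also have "\<dots> = xe A a * ((xe C (e * a) * xe C (- (e * a))) * (xe D (e^2 * a) * xe D (- (2 * e^2 * a)) * xe D (e^2 * a)) * xe E e)"
    by (simp add: comm(3)[symmetric] swap[OF comm(3)[symmetric]] mult.assoc)
  also have "xe D (e^2 * a) * xe D (- (2 * e^2 * a)) * xe D (e^2 * a) = 1"
    by (simp add: adm nil flip: xe_add)
  finally show ?thesis by (simp add: adm nil xe_inverse)
qed

lemma up_D: "up a e c d * xe D t = up a e c (d + t)"
  by (simp add: up_def mult.assoc xe_add adm nil)

lemma up_C: "up a e c d * xe C t = up a e (c + t) d"
  by (simp add: up_def mult.assoc xe_add adm nil comm(3)[symmetric])

lemma up_E: "up a e c d * xe E t = up a (e + t) c (d - 2 * t * c)"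
proof -
  have "up a e c d * xe E t = xe A a * xe E e * (xe C c * xe E t) * xe D d"
    by (simp add: up_def mult.assoc comm(4))
  also have "\<dots> = xe A a * (xe E e * xe E t) * xe C c * (xe D (- (2 * t * c)) * xe D d)"
    by (simp add: C_E mult.assoc)
  finally show ?thesis by (simp add: up_def adm nil flip: xe_add)
qed

text \<open>With the factor of a simple root at the right end, multiplication by an element of the
  opposite root becomes a rank one problem. \<open>up_eq_E_last\<close> does the same for the other
  simple root.\<close>

lemma up_eq_A_last: "up a e c d = xe E e * xe C (c - e * a) * xe D (d + e^2 * a) * xe A a"
proof -
  have "up a e c d = xe E e * (xe A a * (xe C (- (e * a)) * (xe D (e^2 * a) * xe C c)) * xe D d)"
    by (simp add: up_def A_E mult.assoc)
  also have "\<dots> = xe E e * (xe A a * (xe C (- (e * a)) * xe C c) * (xe D (e^2 * a) * xe D d))"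
    by (simp add: comm(3)[symmetric] mult.assoc)
  also have "\<dots> = xe E e * (xe A a * (xe C (c - e * a) * xe D (d + e^2 * a)))"
    by (simp add: adm nil mult.assoc add.commute flip: xe_add)
  also have "\<dots> = xe E e * (xe C (c - e * a) * xe D (d + e^2 * a) * xe A a)"
    by (simp add: comm(1,2) swap[OF comm(1)] mult.assoc)
  finally show ?thesis by (simp add: mult.assoc)
qed

lemma up_eq_E_last: "up a e c d = xe A a * xe C c * xe D (d + 2 * e * c) * xe E e"
proof -
  have "up a e c d = xe A a * (xe C c * xe D (2 * e * c) * (xe E e * xe D d))"
    using E_C[of e c] by (simp add: up_def mult.assoc)
  also have "\<dots> = xe A a * (xe C c * (xe D (2 * e * c) * xe D d) * xe E e)"
    by (simp add: comm(4) mult.assoc)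
  finally show ?thesis by (simp add: adm nil mult.assoc add.commute flip: xe_add)
qed

lemma up_A: "\<exists>e' c' d'. up a e c d * xe A t = up (a + t) e' c' d'"
proof -
  have "up a e c d * xe A t = xe E e * xe C (c - e * a) * xe D (d + e^2 * a) * xe A (a + t)"
    by (simp add: up_eq_A_last mult.assoc adm nil xe_add)
  also have "\<dots> = up (a + t) e (c + e * t) (d - e^2 * t)"
    by (simp add: up_eq_A_last algebra_simps)
  finally show ?thesis by blast
qed

lemma lo_A': "lo d c e a * xe A' t = lo d c e (a + t)"
  by (simp add: lo_def mult.assoc xe_add adm nil)

lemma lo_E': "\<exists>d' c'. lo d c e a * xe E' t = lo d' c' (e + t) a"
proof -
  have 1: "xe A' a * xe E' t = xe E' t * (xe A' a * (xe C' (t * a) * xe D' (t^2 * a)))"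
  proof -
    have "xe A' a * xe E' t = xe E' t * ((xe E' (- t) * xe A' a) * xe E' t)"
      by (simp add: xe_minus_cancel adm nil mult.assoc)
    also have "\<dots> = xe E' t * (xe A' a * (xe C' (t * a) * xe D' (t^2 * a)))"
      by (simp add: E'_A' mult.assoc xe_inverse adm nil)
    finally show ?thesis .
  qed
  have "lo d c e a * xe E' t = xe D' d * xe C' c * (xe E' e * xe E' t) * (xe A' a * (xe C' (t * a) * xe D' (t^2 * a)))"
    by (simp add: lo_def 1 mult.assoc)
  also have "xe A' a * (xe C' (t * a) * xe D' (t^2 * a)) = xe C' (t * a) * (xe D' (t^2 * a) * xe A' a)"
    by (simp add: comm(5,6) swap[OF comm(5)])
  also have "xe E' e * xe E' t = xe E' (e + t)" by (simp add: adm nil xe_add)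
  also have "xe D' d * xe C' c * xe E' (e + t) * (xe C' (t * a) * (xe D' (t^2 * a) * xe A' a))
     = xe D' d * xe C' c * (xe E' (e + t) * xe C' (t * a)) * (xe D' (t^2 * a) * xe A' a)"
    by (simp add: mult.assoc)
  also have "\<dots> = xe D' d * (xe C' c * xe C' (t * a)) * xe D' (- (2 * (e + t) * (t * a))) * (xe E' (e + t) * xe D' (t^2 * a)) * xe A' a"
    by (simp add: E'_C' mult.assoc)
  also have "\<dots> = xe D' d * xe C' (c + t * a) * (xe D' (- (2 * (e + t) * (t * a))) * xe D' (t^2 * a)) * xe E' (e + t) * xe A' a"
    by (simp add: comm(8) swap[OF comm(8)] mult.assoc adm nil xe_add)
  also have "xe D' (- (2 * (e + t) * (t * a))) * xe D' (t^2 * a) = xe D' (- (2 * (e + t) * (t * a)) + t^2 * a)"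
    by (simp only: adm nil xe_add)
  also have "xe D' d * xe C' (c + t * a) * xe D' (- (2 * (e + t) * (t * a)) + t^2 * a) * xe E' (e + t) * xe A' a
    = lo (d + (- (2 * (e + t) * (t * a)) + t^2 * a)) (c + t * a) (e + t) a"
    by (simp only: lo_def xe_add[OF adm(6) nil(6)] comm(7) swap[OF comm(7)] mult.assoc)
  finally show ?thesis by blast
qed

end

text \<open>The definition of \<open>B\<close> solved for \<open>xe X s * xe Y t\<close>; in
  \<open>SL2\<close> this is the passage from upper times lower to lower times diagonal times
  upper.\<close>

lemma sl2_rank_one:
  assumes "sl2 X Y" "weight_projections (br X Y) P S" "norm (s * t) < 1"
  shows "xe X s * xe Y t = xe Y (t / (1 + s * t)) * weight_projections.tor P S (1 + s * t) * xe X (s / (1 + s * t))"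
proof -
  interpret sl2 X Y by fact
  interpret weight_projections "br X Y" P S by fact
  have "B s t = tor (1 + s * t)"
    using rank_one[OF _ assms(3), of P S] assms(2) by (simp add: H_def tor_def)
  then have "xe Y (t / (1 + s * t)) * tor (1 + s * t) * xe X (s / (1 + s * t))
     = (xe Y (t / (1 + s * t)) * xe Y (- (t / (1 + s * t)))) * xe X s * xe Y t *
       (xe X (- (s / (1 + s * t))) * xe X (s / (1 + s * t)))"
    by (simp add: B_def mult.assoc flip: \<open>B s t = tor (1 + s * t)\<close>)
  then show ?thesis by (simp add: xe_inverse adm nil)
qed

text \<open>Adds integral weight projections for the coroots \<open>H1\<close> and
  \<open>H2\<close>; the rank one torus of \<open>D, D'\<close> and that of \<open>A, A'\<close>
  supply them.\<close>

locale c2_wt = c2_sys A A' C C' D D' E E' + W1: weight_projections "br D D'" P1 S1 + W2: weight_projections "br A A'" P2 S2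
  for A A' C C' D D' E E' :: "(int, 'n::finite) sqm" and P1 S1 P2 S2
begin

lemma P1_P2: "P1 a * P2 b = P2 b * P1 a"
proof -
  have "br (br A A') H1 = 0 \<cdot> H1" using H1_H2 by (simp add: H2_def)
  from W2.proj_shift[OF this, of b] have "P2 b * H1 = H1 * P2 b" by simp
  then have "br (br D D') (P2 b) = 0 \<cdot> P2 b" by (simp add: br_def H1_def)
  from W1.proj_shift[OF this, of a] show ?thesis by simp
qed

lemma tor_commute: "W2.tor d * W1.tor c = W1.tor c * W2.tor d"
proof -
  have c: "iot (P2 b) * iot (P1 a) = (iot (P1 a) * iot (P2 b) :: (complex, 'n) sqm)" for a b
    using P1_P2[of a b] by (metis iot_mult)
  show ?thesis
    unfolding W1.tor_def W2.tor_def sum_product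
    by (subst sum.swap) (simp add: c mult.commute)
qed

definition tr :: "complex \<Rightarrow> complex \<Rightarrow> (complex, 'n) sqm" where
  "tr c d = W1.tor c * W2.tor d"

lemma tr_mult: "tr c d * tr c' d' = tr (c * c') (d * d')"
proof -
  have "tr c d * tr c' d' = W1.tor c * (W2.tor d * W1.tor c') * W2.tor d'" by (simp add: tr_def mult.assoc)
  also have "\<dots> = (W1.tor c * W1.tor c') * (W2.tor d * W2.tor d')" by (simp add: tor_commute mult.assoc)
  finally show ?thesis by (simp add: W1.tor_mult W2.tor_mult tr_def)
qed

lemma tr_1 [simp]: "tr 1 1 = 1" by (simp add: tr_def)

lemma tr_inverse: "c \<noteq> 0 \<Longrightarrow> d \<noteq> 0 \<Longrightarrow> tr c d * tr (1 / c) (1 / d) = 1"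
   "c \<noteq> 0 \<Longrightarrow> d \<noteq> 0 \<Longrightarrow> tr (1 / c) (1 / d) * tr c d = 1"
  by (simp_all add: tr_mult)

lemma tr_twist:
  assumes "br H1 Y = m \<cdot> Y" "br H2 Y = l \<cdot> Y" "c \<noteq> 0" "d \<noteq> 0"
  shows "tr c d * iot Y = (c powi m * d powi l) \<cdot> (iot Y * tr c d)"
proof -
  have "tr c d * iot Y = W1.tor c * (W2.tor d * iot Y)" by (simp add: tr_def mult.assoc)
  also have "\<dots> = (d powi l) \<cdot> ((W1.tor c * iot Y) * W2.tor d)"
    using W2.tor_twist[of Y l d] assms by (simp add: H2_def mult.assoc)
  also have "\<dots> = (c powi m * d powi l) \<cdot> (iot Y * tr c d)"
    using W1.tor_twist[of Y m c] assms by (simp add: H1_def mult.assoc tr_def mult.commute)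
  finally show ?thesis .
qed

lemma tr_xe:
  assumes "br H1 Y = m \<cdot> Y" "br H2 Y = l \<cdot> Y" "c \<noteq> 0" "d \<noteq> 0" "adm Y"
  shows "tr c d * xe Y s = xe Y (c powi m * d powi l * s) * tr c d"
  by (rule xe_twist[OF assms(5) tr_twist[OF assms(1-4)]])

lemma xe_tr:
  assumes "br H1 Y = m \<cdot> Y" "br H2 Y = l \<cdot> Y" "c \<noteq> 0" "d \<noteq> 0" "adm Y"
  shows "xe Y s * tr c d = tr c d * xe Y (s / (c powi m * d powi l))"
  using tr_xe[OF assms, of "s / (c powi m * d powi l)"] assms(3,4) by simp

lemma xe_tr_assoc:
  assumes "br H1 Y = m \<cdot> Y" "br H2 Y = l \<cdot> Y" "c \<noteq> 0" "d \<noteq> 0" "adm Y"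
    and "s / (c powi m * d powi l) = s'"
  shows "xe Y s * (tr c d * Z) = tr c d * (xe Y s' * Z)"
  using xe_tr[OF assms(1-5), of s] assms(6) by (simp flip: mult.assoc)

lemma weight_scal:
  "br H1 A = 0 \<cdot> A" "br H2 A = 2 \<cdot> A" "br H1 A' = 0 \<cdot> A'" "br H2 A' = (- 2) \<cdot> A'"
  "br H1 C = 1 \<cdot> C" "br H2 C = 1 \<cdot> C" "br H1 C' = (- 1) \<cdot> C'" "br H2 C' = (- 1) \<cdot> C'"
  "br H1 D = 2 \<cdot> D" "br H2 D = 0 \<cdot> D" "br H1 D' = (- 2) \<cdot> D'" "br H2 D' = 0 \<cdot> D'"
  "br H1 E = 1 \<cdot> E" "br H2 E = (- 1) \<cdot> E" "br H1 E' = (- 1) \<cdot> E'" "br H2 E' = 1 \<cdot> E'"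
  by (simp_all add: cartan numeral_sqm)

definition Om :: "(complex, 'n) sqm set" where
  "Om = {lo d c e a * tr k l * up a' e' c' d' | d c e a k l a' e' c' d'. k \<noteq> 0 \<and> l \<noteq> 0}"

lemma OmI: "k \<noteq> 0 \<Longrightarrow> l \<noteq> 0 \<Longrightarrow> lo d c e a * tr k l * up a' e' c' d' \<in> Om"
  unfolding Om_def by blast

text \<open>Rank one rewrites the \<open>A\<close> factor times \<open>xe A' t\<close> as an
  \<open>A'\<close> factor, a torus element and an \<open>A\<close> factor. On its way left the
  \<open>A'\<close> factor commutes with those of \<open>D\<close> and \<open>E\<close>, and passing
  that of \<open>C\<close> it creates only factors of \<open>E\<close> and \<open>D\<close>, so the
  product returns to the form of the cell.\<close>

lemma Om_A': 
  assumes n: "norm (a' * t) < 1" and that: "k \<noteq> 0" "l \<noteq> 0"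
  shows "lo d c e a * tr k l * up a' e' c' d' * xe A' t \<in> Om"
proof -
  define z where "z = 1 + a' * t"
  have z0: "z \<noteq> 0"
  proof
    assume "z = 0"
    then have "a' * t = - 1" by (simp add: z_def add_eq_0_iff)
    with n show False by simp
  qed
  define c1 d1 where "c1 = c' - e' * a'" and "d1 = d' + e'^2 * a'"
  define r where "r = t / z"
  have "up a' e' c' d' * xe A' t = xe E e' * xe C c1 * xe D d1 * (xe A a' * xe A' t)"
    by (simp add: up_eq_A_last c1_def d1_def mult.assoc)
  also have "xe A a' * xe A' t = xe A' r * W2.tor z * xe A (a' / z)"
    unfolding z_def r_def by (rule sl2_rank_one[OF sl2_A _ n]) (rule W2.weight_projections_axioms)
  also have "W2.tor z = tr 1 z" by (simp add: tr_def)
  also have "xe E e' * xe C c1 * xe D d1 * (xe A' r * tr 1 z * xe A (a' / z))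
    = xe E e' * (xe C c1 * xe A' r) * xe D d1 * tr 1 z * xe A (a' / z)"
    by (simp add: comm(10) swap[OF comm(10)] mult.assoc)
  also have "\<dots> = xe A' r * (xe E e' * xe E (c1 * r)) * (xe D (- (c1^2 * r)) * xe C c1) * xe D d1 * tr 1 z * xe A (a' / z)"
    by (simp add: C_A' swap[OF comm(9)] mult.assoc)
  also have "xe E e' * xe E (c1 * r) = xe E (e' + c1 * r)" by (simp add: adm nil xe_add)
  also have "xe A' r * xe E (e' + c1 * r) * (xe D (- (c1^2 * r)) * xe C c1) * xe D d1 * tr 1 z * xe A (a' / z)
     = xe A' r * (xe E (e' + c1 * r) * (xe D (- (c1^2 * r)) * (xe C c1 * (xe D d1 * tr 1 z)))) * xe A (a' / z)"
    by (simp only: mult.assoc)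
  also have "xe D d1 * tr 1 z = tr 1 z * xe D d1"
    using xe_tr[OF weight_scal(9,10), of 1 z] z0 by (simp add: adm)
  also have "xe C c1 * (tr 1 z * xe D d1) = tr 1 z * (xe C (c1 / z) * xe D d1)"
    using z0 by (intro xe_tr_assoc[OF weight_scal(5,6)]) (simp_all add: adm)
  also have "xe D (- (c1^2 * r)) * (tr 1 z * (xe C (c1 / z) * xe D d1)) = tr 1 z * (xe D (- (c1^2 * r)) * (xe C (c1 / z) * xe D d1))"
    using z0 by (intro xe_tr_assoc[OF weight_scal(9,10)]) (simp_all add: adm)
  also have "xe E (e' + c1 * r) * (tr 1 z * (xe D (- (c1^2 * r)) * (xe C (c1 / z) * xe D d1)))
     = tr 1 z * (xe E ((e' + c1 * r) * z) * (xe D (- (c1^2 * r)) * (xe C (c1 / z) * xe D d1)))"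
    using z0 by (intro xe_tr_assoc[OF weight_scal(13,14)]) (simp_all add: adm power_int_minus field_simps)
  also have "xe D (- (c1^2 * r)) * (xe C (c1 / z) * xe D d1) = xe C (c1 / z) * xe D (d1 - c1^2 * r)"
    by (simp add: comm(3)[symmetric] swap[OF comm(3)[symmetric]] adm nil xe_add[symmetric])
  finally have "up a' e' c' d' * xe A' t = xe A' r * tr 1 z * (up 0 ((e' + c1 * r) * z) (c1 / z) (d1 - c1^2 * r) * xe A (a' / z))"
    by (simp add: up_def mult.assoc)
  moreover obtain e2 c2 d2 where "up 0 ((e' + c1 * r) * z) (c1 / z) (d1 - c1^2 * r) * xe A (a' / z) = up (0 + a' / z) e2 c2 d2"
    using up_A by blast
  ultimately have "lo d c e a * tr k l * up a' e' c' d' * xe A' t = lo d c e a * (tr k l * xe A' r) * tr 1 z * up (a' / z) e2 c2 d2"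
    by (simp add: mult.assoc)
  also have "tr k l * xe A' r = xe A' (r / l^2) * tr k l"
    using tr_xe[OF weight_scal(3,4), of k l r] that by (simp add: adm power_int_minus field_simps)
  also have "lo d c e a * (xe A' (r / l^2) * tr k l) * tr 1 z * up (a' / z) e2 c2 d2
    = (lo d c e a * xe A' (r / l^2)) * (tr k l * tr 1 z) * up (a' / z) e2 c2 d2" by (simp add: mult.assoc)
  also have "\<dots> \<in> Om" unfolding lo_A' tr_mult using that z0 by (intro OmI) simp_all
  finally show ?thesis .
qed

text \<open>Weight projections for the coroot \<open>H1 - H2\<close> of \<open>E\<close>, assembled
  from the joint projections so that the torus of \<open>E\<close> is visibly
  \<open>tr c (1 / c)\<close>.\<close>

definition PE :: "int \<Rightarrow> (int, 'n) sqm" where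
  "PE k = (\<Sum>a\<in>S1. \<Sum>b\<in>S2. if a - b = k then P1 a * P2 b else 0)"

definition SE :: "int set" where "SE = (\<lambda>(a, b). a - b) ` (S1 \<times> S2)"

lemma SE: "finite SE" "a \<in> S1 \<Longrightarrow> b \<in> S2 \<Longrightarrow> a - b \<in> SE"
  unfolding SE_def using W1.fin W2.fin by auto

lemma weight_projections_E: "weight_projections (br E E') PE SE"
proof
  show "finite SE" by (rule SE)
  show "PE k = 0" if "k \<notin> SE" for k
    unfolding PE_def using that SE(2) by (intro sum.neutral ballI) auto
  have "P1 a * H2 = H2 * P1 a" for a
  proof -
    have "br (br D D') H2 = 0 \<cdot> H2" using H1_H2 by (simp add: H1_def)
    from W1.proj_shift[OF this, of a] show ?thesis by simp
  qed
  then have "br E E' * (P1 a * P2 b) = (a - b) \<cdot> (P1 a * P2 b)" for a b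
  proof -
    have "br E E' * (P1 a * P2 b) = (H1 * P1 a) * P2 b - P1 a * (H2 * P2 b)"
      using \<open>P1 a * H2 = H2 * P1 a\<close> by (simp add: table left_diff_distrib mult.assoc[symmetric])
    then show ?thesis
      using W1.eig[of a] W2.eig[of b] by (simp add: H1_def H2_def scal.scale_left_diff_distrib)
  qed
  then show "br E E' * PE k = k \<cdot> PE k" for k
    unfolding PE_def sum_distrib_left scal.scale_sum_right
    by (intro sum.cong refl) auto
  have "(\<Sum>k\<in>SE. PE k) = (\<Sum>a\<in>S1. \<Sum>b\<in>S2. \<Sum>k\<in>SE. if a - b = k then P1 a * P2 b else 0)"
    unfolding PE_def by (subst sum.swap, subst (2) sum.swap) (rule refl)
  also have "\<dots> = (\<Sum>a\<in>S1. \<Sum>b\<in>S2. P1 a * P2 b)"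
    using SE by (intro sum.cong refl) (simp add: sum.delta')
  also have "\<dots> = 1" using W1.sum1 W2.sum1 by (simp flip: sum_product)
  finally show "(\<Sum>k\<in>SE. PE k) = 1" .
qed

lemma tor_E: "c \<noteq> 0 \<Longrightarrow> weight_projections.tor PE SE c = tr c (1 / c)"
proof -
  assume c: "c \<noteq> 0"
  interpret WE: weight_projections "br E E'" PE SE by (rule weight_projections_E)
  have "WE.tor c = (\<Sum>k\<in>SE. \<Sum>a\<in>S1. \<Sum>b\<in>S2. if a - b = k then (c powi (a - b)) \<cdot> iot (P1 a * P2 b) else 0)"
    unfolding WE.tor_def PE_def iot_sum scal.scale_sum_right
    by (intro sum.cong refl) auto
  also have "\<dots> = (\<Sum>a\<in>S1. \<Sum>b\<in>S2. \<Sum>k\<in>SE. if a - b = k then (c powi (a - b)) \<cdot> iot (P1 a * P2 b) else 0)"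
    by (subst sum.swap, subst (2) sum.swap) (rule refl)
  also have "\<dots> = (\<Sum>a\<in>S1. \<Sum>b\<in>S2. (c powi a * (1 / c) powi b) \<cdot> iot (P1 a * P2 b))"
    using SE c by (intro sum.cong refl) (simp add: sum.delta' power_int_diff power_int_divide_distrib)
  also have "\<dots> = tr c (1 / c)"
    by (simp add: tr_def W1.tor_def W2.tor_def sum_product mult.commute)
  finally show ?thesis .
qed

lemma D_E': "xe D d * xe E' r = xe E' r * (xe A (r^2 * d) * xe C (- (r * d)) * xe D (d :: complex))"
proof -
  have "xe D d * xe E' r = xe E' r * ((xe E' (- r) * xe D d) * xe E' r)"
    by (simp add: xe_minus_cancel adm nil mult.assoc)
  also have "\<dots> = xe E' r * (xe D d * (xe C (- (r * d)) * xe A (r^2 * d)))"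
    by (simp add: E'_D mult.assoc xe_inverse adm nil)
  also have "xe D d * (xe C (- (r * d)) * xe A (r^2 * d)) = xe A (r^2 * d) * xe C (- (r * d)) * xe D d"
    by (simp add: comm(1,2,3) swap[OF comm(1)] swap[OF comm(2)] swap[OF comm(3)] mult.assoc)
  finally show ?thesis .
qed

lemma C_E': "xe C c * xe E' r = xe E' r * (xe A (- (2 * r * c)) * xe C (c :: complex))"
proof -
  have "xe C c * xe E' r = xe E' r * ((xe E' (- r) * xe C c) * xe E' r)"
    by (simp add: xe_minus_cancel adm nil mult.assoc)
  also have "\<dots> = xe E' r * (xe C c * xe A (- (2 * r * c)))"
    by (simp add: E'_C mult.assoc xe_inverse adm nil)
  finally show ?thesis by (simp add: comm(1))
qed

text \<open>As for \<open>A'\<close>, with the \<open>E\<close> factor moved to the end. The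
  \<open>E'\<close> factor commutes with that of \<open>A\<close>, and passing those of
  \<open>D\<close> and \<open>C\<close> it creates only factors of \<open>A\<close> and
  \<open>C\<close>.\<close>

lemma Om_E': 
  assumes n: "norm (e' * t) < 1" and that: "k \<noteq> 0" "l \<noteq> 0"
  shows "lo d c e a * tr k l * up a' e' c' d' * xe E' t \<in> Om"
proof -
  define z where "z = 1 + e' * t"
  have z0: "z \<noteq> 0"
  proof
    assume "z = 0"
    then have "e' * t = - 1" by (simp add: z_def add_eq_0_iff)
    with n show False by simp
  qed
  define d1 where "d1 = d' + 2 * e' * c'"
  define r where "r = t / z"
  define a2 c2 where "a2 = a' + (- (2 * r * c') + r^2 * d1)" and "c2 = c' + - (r * d1)"
  have "up a' e' c' d' * xe E' t = xe A a' * xe C c' * xe D d1 * (xe E e' * xe E' t)"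
    by (simp add: up_eq_E_last d1_def mult.assoc)
  also have "xe E e' * xe E' t = xe E' r * weight_projections.tor PE SE z * xe E (e' / z)"
    unfolding z_def r_def by (rule sl2_rank_one[OF sl2_E weight_projections_E n])
  also have "weight_projections.tor PE SE z = tr z (1 / z)" by (rule tor_E[OF z0])
  also have "xe A a' * xe C c' * xe D d1 * (xe E' r * tr z (1 / z) * xe E (e' / z))
    = xe A a' * (xe C c' * (xe D d1 * xe E' r)) * tr z (1 / z) * xe E (e' / z)"
    by (simp add: mult.assoc)
  also have "xe C c' * (xe D d1 * xe E' r) = (xe C c' * xe E' r) * (xe A (r^2 * d1) * xe C (- (r * d1)) * xe D d1)"
    by (simp only: D_E' mult.assoc)
  also have "\<dots> = xe E' r * (xe A (- (2 * r * c')) * (xe C c' * (xe A (r^2 * d1) * (xe C (- (r * d1)) * xe D d1))))"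
    by (simp only: C_E' mult.assoc)
  also have "xe C c' * (xe A (r^2 * d1) * (xe C (- (r * d1)) * xe D d1))
     = xe A (r^2 * d1) * ((xe C c' * xe C (- (r * d1))) * xe D d1)"
    by (simp only: swap[OF comm(1)] mult.assoc)
  also have "xe C c' * xe C (- (r * d1)) = xe C c2" by (simp only: adm nil xe_add c2_def)
  also have "xe A a' * (xe E' r * (xe A (- (2 * r * c')) * (xe A (r^2 * d1) * (xe C c2 * xe D d1)))) * tr z (1 / z) * xe E (e' / z)
     = xe E' r * (xe A a' * (xe A (- (2 * r * c')) * xe A (r^2 * d1))) * (xe C c2 * (xe D d1 * tr z (1 / z))) * xe E (e' / z)"
    by (simp only: mult.assoc swap[OF comm(11)])
  also have "xe A a' * (xe A (- (2 * r * c')) * xe A (r^2 * d1)) = xe A a2"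
    by (simp only: xe_add[OF adm(1) nil(1)] a2_def)
  also have "xe D d1 * tr z (1 / z) = tr z (1 / z) * xe D (d1 / z^2)"
    using xe_tr[OF weight_scal(9,10), of z "1 / z" d1] z0 by (simp add: adm)
  also have "xe C c2 * (tr z (1 / z) * xe D (d1 / z^2)) = tr z (1 / z) * (xe C c2 * xe D (d1 / z^2))"
    using z0 by (intro xe_tr_assoc[OF weight_scal(5,6)]) (simp_all add: adm)
  also have "xe E' r * xe A a2 * (tr z (1 / z) * (xe C c2 * xe D (d1 / z^2))) * xe E (e' / z)
     = xe E' r * (xe A a2 * (tr z (1 / z) * (xe C c2 * xe D (d1 / z^2)))) * xe E (e' / z)"
    by (simp only: mult.assoc)
  also have "xe A a2 * (tr z (1 / z) * (xe C c2 * xe D (d1 / z^2))) = tr z (1 / z) * (xe A (a2 * z^2) * (xe C c2 * xe D (d1 / z^2)))"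
    using z0 by (intro xe_tr_assoc[OF weight_scal(1,2)]) (simp_all add: adm field_simps)
  finally have "up a' e' c' d' * xe E' t = xe E' r * tr z (1 / z) * (up (a2 * z^2) 0 c2 (d1 / z^2) * xe E (e' / z))"
    by (simp add: up_def mult.assoc)
  then have "lo d c e a * tr k l * up a' e' c' d' * xe E' t
     = lo d c e a * (tr k l * xe E' r) * tr z (1 / z) * up (a2 * z^2) (0 + e' / z) c2 (d1 / z^2 - 2 * (e' / z) * c2)"
    by (simp add: mult.assoc up_E)
  also have "tr k l * xe E' r = xe E' (l / k * r) * tr k l"
    using tr_xe[OF weight_scal(15,16), of k l r] that by (simp add: adm power_int_minus field_simps)
  also have "lo d c e a * (xe E' (l / k * r) * tr k l) * tr z (1 / z) * up (a2 * z^2) (0 + e' / z) c2 (d1 / z^2 - 2 * (e' / z) * c2)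
    = (lo d c e a * xe E' (l / k * r)) * (tr k l * tr z (1 / z)) * up (a2 * z^2) (0 + e' / z) c2 (d1 / z^2 - 2 * (e' / z) * c2)"
    by (simp only: mult.assoc)
  also have "\<dots> \<in> Om"
  proof -
    obtain d2 c3 where "lo d c e a * xe E' (l / k * r) = lo d2 c3 (e + l / k * r) a" using lo_E' by blast
    then show ?thesis unfolding tr_mult using that z0 by (simp only:) (intro OmI, simp_all)
  qed
  finally show ?thesis .
qed

end

section \<open>Density of the big cell\<close>

inductive cpoly :: "((complex, 'n::finite) sqm \<Rightarrow> complex) \<Rightarrow> bool" where
  const: "cpoly (\<lambda>g. c)"
| entry: "cpoly (\<lambda>g. ent g i j)"
| add: "cpoly f \<Longrightarrow> cpoly f' \<Longrightarrow> cpoly (\<lambda>g. f g + f' g)"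
| mult: "cpoly f \<Longrightarrow> cpoly f' \<Longrightarrow> cpoly (\<lambda>g. f g * f' g)"

lemma cpoly_sum: "(\<And>k. k \<in> K \<Longrightarrow> cpoly (f k)) \<Longrightarrow> cpoly (\<lambda>g. \<Sum>k\<in>K. f k g)"
  by (induction K rule: infinite_finite_induct) (auto intro: cpoly.intros)

lemma cpoly_prod: "(\<And>k. k \<in> K \<Longrightarrow> cpoly (f k)) \<Longrightarrow> cpoly (\<lambda>g. \<Prod>k\<in>K. f k g)"
  by (induction K rule: infinite_finite_induct) (auto intro: cpoly.intros)

lemma cpoly_power: "cpoly f \<Longrightarrow> cpoly (\<lambda>g. f g ^ k)"
  by (induction k) (auto intro: cpoly.intros)

lemma cpoly_translate: "cpoly f \<Longrightarrow> cpoly (\<lambda>g. f (g * h))"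
  by (induction rule: cpoly.induct) (auto simp: ent_mult intro!: cpoly_sum cpoly.intros)

lemma poly_function_sum:
  "(\<And>k. k \<in> K \<Longrightarrow> \<exists>p. \<forall>t. f k t = poly p t) \<Longrightarrow> \<exists>p. \<forall>t. (\<Sum>k\<in>K. f k t) = poly p (t::complex)"
proof -
  assume "\<And>k. k \<in> K \<Longrightarrow> \<exists>p. \<forall>t. f k t = poly p t"
  then obtain p where "\<And>k. k \<in> K \<Longrightarrow> \<forall>t. f k t = poly (p k) t" by metis
  then show ?thesis by (intro exI[of _ "\<Sum>k\<in>K. p k"]) (simp add: poly_sum)
qed

lemma cpoly_curve:
  assumes "cpoly f" shows "\<exists>p. \<forall>t. f (g * xe X t) = poly p t"
  using assms
proof (induction rule: cpoly.induct)
  case (const c) show ?case by (rule exI[of _ "[:c:]"]) simp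
next
  case (entry i j)
  have "\<exists>p. \<forall>t. ent g i k * (t ^ m * of_int (ent (dp X m) k j)) = poly p t" for k m
    by (rule exI[of _ "monom (ent g i k * of_int (ent (dp X m) k j)) m"]) (simp add: poly_monom mult_ac)
  then show ?case
    unfolding ent_mult xe_def ent_sum ent_scal ent_iot sum_distrib_left
    by (intro poly_function_sum) auto
next
  case (add f f')
  then obtain p q where "\<forall>t. f (g * xe X t) = poly p t" "\<forall>t. f' (g * xe X t) = poly q t" by blast
  then show ?case by (intro exI[of _ "p + q"]) simp
next
  case (mult f f')
  then obtain p q where "\<forall>t. f (g * xe X t) = poly p t" "\<forall>t. f' (g * xe X t) = poly q t" by blast
  then show ?case by (intro exI[of _ "p * q"]) simp
qed

section \<open>Zariski closure and right translations\<close>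

definition Zcl :: "(complex, 'n::finite) sqm set \<Rightarrow> (complex, 'n) sqm set" where
  "Zcl U = {g. \<forall>f. cpoly f \<longrightarrow> (\<forall>u\<in>U. f u = 0) \<longrightarrow> f g = 0}"

lemma Zcl_subset: "U \<subseteq> Zcl U"
  by (auto simp: Zcl_def)

text \<open>Right translations carrying \<open>U\<close> into its closure. Translates of polynomials
  are polynomials, so these carry the closure into itself and are closed under products.\<close>

definition stab :: "(complex, 'n::finite) sqm set \<Rightarrow> (complex, 'n) sqm set" where
  "stab U = {h. \<forall>u\<in>U. u * h \<in> Zcl U}"

lemma stab_Zcl:
  assumes "h \<in> stab U" "g \<in> Zcl U" shows "g * h \<in> Zcl U"
proof -
  have "f (g * h) = 0" if "cpoly f" "\<forall>u\<in>U. f u = 0" for f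
  proof -
    have "\<forall>u\<in>U. f (u * h) = 0" using assms(1) that by (auto simp: stab_def Zcl_def)
    then show ?thesis using assms(2) cpoly_translate[OF that(1), of h] by (auto simp: Zcl_def)
  qed
  then show ?thesis by (auto simp: Zcl_def)
qed

lemma stab_mult: "h \<in> stab U \<Longrightarrow> k \<in> stab U \<Longrightarrow> h * k \<in> stab U"
  using stab_Zcl[of k U] by (auto simp: stab_def mult.assoc[symmetric])

text \<open>A curve with an open piece in \<open>U\<close> lies in the closure of \<open>U\<close>.\<close>

lemma stab_curve:
  assumes "\<And>u. u \<in> U \<Longrightarrow> \<exists>s. \<forall>t. norm (s * t) < 1 \<longrightarrow> u * xe X t \<in> U"
  shows "xe X t \<in> stab U"
  unfolding stab_def Zcl_def
proof (intro CollectI ballI allI impI)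
  fix u f assume u: "u \<in> U" and f: "cpoly f" "\<forall>u\<in>U. f u = 0"
  obtain s where s: "\<And>t. norm (s * t) < 1 \<Longrightarrow> u * xe X t \<in> U" using assms[OF u] by blast
  obtain p where p: "\<And>t. f (u * xe X t) = poly p t" using cpoly_curve[OF f(1)] by blast
  have "ball (0::complex) (1 / (1 + norm s)) \<subseteq> {t. poly p t = 0}"
  proof
    fix t :: complex assume "t \<in> ball 0 (1 / (1 + norm s))"
    then have "norm t < 1 / (1 + norm s)" by simp
    then have "(1 + norm s) * norm t < 1"
      by (metis add_pos_nonneg mult.commute norm_ge_zero pos_less_divide_eq zero_less_one)
    moreover have "norm s * norm t \<le> (1 + norm s) * norm t" by (intro mult_right_mono) auto
    ultimately have "norm (s * t) < 1" by (simp add: norm_mult)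
    then show "t \<in> {t. poly p t = 0}" using s f(2) p by (metis mem_Collect_eq)
  qed
  moreover have "infinite (ball (0::complex) (1 / (1 + norm s)))"
    by (intro uncountable_infinite uncountable_ball) (simp add: add_pos_nonneg)
  ultimately have "infinite {t. poly p t = 0}" by (metis finite_subset)
  then have "p = 0" by (metis poly_roots_finite)
  then show "f (u * xe X t) = 0" by (simp add: p)
qed

context c2_wt
begin

lemma Om_cases:
  assumes "g \<in> Om"
  obtains d c e a k l a' e' c' d' where "k \<noteq> 0" "l \<noteq> 0" "g = lo d c e a * tr k l * up a' e' c' d'"
  using assms unfolding Om_def by blast

text \<open>Positive root elements preserve the cell. For negative simple roots the curve stays in
  the cell near \<open>t = 0\<close>. The other two negative roots come from commutators of
  these.\<close>

lemma stab_Om: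
  "xe A t \<in> stab Om" "xe E t \<in> stab Om" "xe C t \<in> stab Om" "xe D t \<in> stab Om"
  "xe A' t \<in> stab Om" "xe E' t \<in> stab Om" "xe C' t \<in> stab Om" "xe D' t \<in> stab Om"
proof -
  have up: "h \<in> stab Om" if "\<And>a e c d. \<exists>a' e' c' d'. up a e c d * h = up a' e' c' d'" for h
  proof -
    have "u * h \<in> Om" if u: "u \<in> Om" for u
    proof -
      from u obtain d c e a k l a' e' c' d' where u: "k \<noteq> 0" "l \<noteq> 0" "u = lo d c e a * tr k l * up a' e' c' d'"
        by (rule Om_cases)
      from \<open>\<And>a e c d. \<exists>a' e' c' d'. up a e c d * h = up a' e' c' d'\<close>
      obtain a2 e2 c2 d2 where "up a' e' c' d' * h = up a2 e2 c2 d2" by blast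
      then show ?thesis using u by (simp add: mult.assoc) (simp add: OmI flip: mult.assoc)
    qed
    then show ?thesis using Zcl_subset by (auto simp: stab_def)
  qed
  show "xe A t \<in> stab Om" by (rule up) (use up_A in blast)
  show "xe E t \<in> stab Om" by (rule up) (use up_E in blast)
  show "xe C t \<in> stab Om" by (rule up) (use up_C in blast)
  show "xe D t \<in> stab Om" by (rule up) (use up_D in blast)
  show A': "xe A' t \<in> stab Om" for t
  proof (rule stab_curve)
    fix u assume "u \<in> Om"
    then obtain d c e a k l a' e' c' d' where "k \<noteq> 0" "l \<noteq> 0" "u = lo d c e a * tr k l * up a' e' c' d'"
      by (rule Om_cases)
    then show "\<exists>s. \<forall>t. norm (s * t) < 1 \<longrightarrow> u * xe A' t \<in> Om"
      by (intro exI[of _ a']) (simp add: Om_A')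
  qed
  show E': "xe E' t \<in> stab Om" for t
  proof (rule stab_curve)
    fix u assume "u \<in> Om"
    then obtain d c e a k l a' e' c' d' where "k \<noteq> 0" "l \<noteq> 0" "u = lo d c e a * tr k l * up a' e' c' d'"
      by (rule Om_cases)
    then show "\<exists>s. \<forall>t. norm (s * t) < 1 \<longrightarrow> u * xe E' t \<in> Om"
      by (intro exI[of _ e']) (simp add: Om_E')
  qed
  have q: "xe C' (- (s * t)) * xe D' (s^2 * t) \<in> stab Om" for s t
  proof -
    have "xe A' t * (xe C' (- (s * t)) * xe D' (s^2 * t)) * xe E' s * xe E' (- s) * xe A' (- t)
       = xe E' s * xe A' t * xe E' (- s) * xe A' (- t)"
      by (simp add: E'_A' mult.assoc)
    also have "xe A' t * (xe C' (- (s * t)) * xe D' (s^2 * t)) = (xe C' (- (s * t)) * xe D' (s^2 * t)) * xe A' t"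
      by (simp add: comm(5,6) swap[OF comm(5)] mult.assoc)
    finally have "xe C' (- (s * t)) * xe D' (s^2 * t) = xe E' s * xe A' t * xe E' (- s) * xe A' (- t)"
      by (simp add: mult.assoc xe_minus_cancel adm nil xe_inverse)
    then show ?thesis by (simp add: stab_mult A' E')
  qed
  show D': "xe D' t \<in> stab Om" for t
  proof -
    \<comment> \<open>The choices \<open>s = 1\<close> and \<open>s = - 1\<close> have opposite
      \<open>C'\<close> parts and equal \<open>D'\<close> parts.\<close>
    have "(xe C' (- (1 * (t / 2))) * xe D' (1^2 * (t / 2))) * (xe C' (- (- 1 * (t / 2))) * xe D' ((- 1)^2 * (t / 2)))
      = (xe C' (- (t / 2)) * xe C' (t / 2)) * (xe D' (t / 2) * xe D' (t / 2))"
      by (simp add: mult.assoc swap[OF comm(7)])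
    also have "\<dots> = xe D' t" by (simp add: xe_inverse adm nil flip: xe_add)
    finally show ?thesis using stab_mult[OF q[of 1 "t / 2"] q[of "- 1" "t / 2"]] by simp
  qed
  have "(xe C' (- (1 * - t)) * xe D' (1^2 * - t)) * xe D' t = xe C' t"
    by (simp add: mult.assoc xe_inverse adm nil)
  then show "xe C' t \<in> stab Om" using stab_mult[OF q[of 1 "- t"] D'[of t]] by simp
qed

text \<open>The complex group \<open>E\<^sub>\<pi>\<close>.\<close>

inductive_set words :: "(complex, 'n) sqm set" where
  one: "1 \<in> words"
| step: "w \<in> words \<Longrightarrow> X \<in> {A, A', C, C', D, D', E, E'} \<Longrightarrow> w * xe X t \<in> words"

lemma words_Zcl: "w \<in> words \<Longrightarrow> w \<in> Zcl Om"
proof (induction rule: words.induct)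
  case one
  have "lo 0 0 0 0 * tr 1 1 * up 0 0 0 0 \<in> Om" by (rule OmI) simp_all
  then have "1 \<in> Om" by (simp add: lo_def up_def)
  then show ?case using Zcl_subset by blast
next
  case (step w X t)
  then show ?case using stab_Om by (auto intro: stab_Zcl)
qed

end

section \<open>Integer polynomials in the matrix entries\<close>

definition mon_eval :: "(('n \<times> 'n) \<Rightarrow>\<^sub>0 nat) \<Rightarrow> 'r::comm_ring_1^'n^'n \<Rightarrow> 'r" where
  "mon_eval m g = (\<Prod>v\<in>Poly_Mapping.keys m. (g $ fst v $ snd v) ^ Poly_Mapping.lookup m v)"

lemma mon_eval_superset:
  assumes "finite F" "Poly_Mapping.keys m \<subseteq> F"
  shows "mon_eval m g = (\<Prod>v\<in>F. (g $ fst v $ snd v) ^ Poly_Mapping.lookup m v)"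
  unfolding mon_eval_def using assms
  by (intro prod.mono_neutral_left) (auto simp: in_keys_iff)

lemma mon_eval_add: "mon_eval (m + m') g = mon_eval m g * mon_eval m' g"
proof -
  let ?F = "Poly_Mapping.keys m \<union> Poly_Mapping.keys m'"
  have "mon_eval (m + m') g = (\<Prod>v\<in>?F. (g $ fst v $ snd v) ^ Poly_Mapping.lookup (m + m') v)"
    by (rule mon_eval_superset) (simp_all add: Poly_Mapping.keys_add)
  also have "\<dots> = mon_eval m g * mon_eval m' g"
    by (subst (1 2) mon_eval_superset[of ?F]) (simp_all add: lookup_add power_add prod.distrib)
  finally show ?thesis .
qed

lemma entry_poly_eval_superset:
  assumes "finite F" "Poly_Mapping.keys p \<subseteq> F"
  shows "entry_poly_eval p g = (\<Sum>m\<in>F. of_int (Poly_Mapping.lookup p m) * mon_eval m g)"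
  unfolding entry_poly_eval_def mon_eval_def[symmetric] using assms
  by (intro sum.mono_neutral_left) (auto simp: in_keys_iff)

lemma entry_poly_eval_add: "entry_poly_eval (p + q) g = entry_poly_eval p g + entry_poly_eval q g"
proof -
  let ?F = "Poly_Mapping.keys p \<union> Poly_Mapping.keys q"
  have "entry_poly_eval (p + q) g = (\<Sum>m\<in>?F. of_int (Poly_Mapping.lookup (p + q) m) * mon_eval m g)"
    by (rule entry_poly_eval_superset) (simp_all add: Poly_Mapping.keys_add)
  also have "\<dots> = entry_poly_eval p g + entry_poly_eval q g"
    by (subst (1 2) entry_poly_eval_superset[of ?F]) (simp_all add: lookup_add distrib_right sum.distrib)
  finally show ?thesis .
qed

lemma entry_poly_eval_0: "entry_poly_eval 0 g = 0"
  by (simp add: entry_poly_eval_def)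

lemma entry_poly_eval_sum: "entry_poly_eval (sum f S) g = (\<Sum>s\<in>S. entry_poly_eval (f s) g)"
  by (induction S rule: infinite_finite_induct) (simp_all add: entry_poly_eval_0 entry_poly_eval_add)

lemma entry_poly_eval_single: "entry_poly_eval (Poly_Mapping.single m c) g = of_int c * mon_eval m g"
  by (subst entry_poly_eval_superset[of "{m}"]) simp_all

lemma entry_poly_eval_mult:
  fixes p q :: "'n::finite entry_poly"
  shows "entry_poly_eval (p * q) g = entry_poly_eval p g * entry_poly_eval q g"
proof -
  have s: "p = (\<Sum>m\<in>Poly_Mapping.keys p. Poly_Mapping.single m (Poly_Mapping.lookup p m))" for p :: "'n entry_poly"
    by (rule poly_mapping_eqI)
      (auto simp: lookup_sum lookup_single when_def in_keys_iff sum.delta)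
  have "p * q = (\<Sum>m\<in>Poly_Mapping.keys p. \<Sum>m'\<in>Poly_Mapping.keys q.
      Poly_Mapping.single (m + m') (Poly_Mapping.lookup p m * Poly_Mapping.lookup q m'))"
    by (subst s[of p], subst s[of q]) (simp only: sum_product mult_single)
  then have "entry_poly_eval (p * q) g = (\<Sum>m\<in>Poly_Mapping.keys p. \<Sum>m'\<in>Poly_Mapping.keys q.
      (of_int (Poly_Mapping.lookup p m) * mon_eval m g) * (of_int (Poly_Mapping.lookup q m') * mon_eval m' g))"
    by (simp add: entry_poly_eval_sum entry_poly_eval_single mon_eval_add mult_ac)
  also have "\<dots> = entry_poly_eval p g * entry_poly_eval q g"
    by (simp add: sum_product entry_poly_eval_superset[OF finite_keys subset_refl])
  finally show ?thesis .
qed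

text \<open>One integer polynomial evaluated over two rings. Pairing the functions allows equations
  to be transferred without displaying the polynomial.\<close>

definition ipoly :: "(('c::comm_ring_1, 'n::finite) sqm \<Rightarrow> 'c) \<Rightarrow> (('r::comm_ring_1, 'n) sqm \<Rightarrow> 'r) \<Rightarrow> bool" where
  "ipoly f f' \<longleftrightarrow> (\<exists>p. (\<forall>g. f g = entry_poly_eval p (Rep_sqm g)) \<and> (\<forall>g. f' g = entry_poly_eval p (Rep_sqm g)))"

lemma ipoly_const: "ipoly (\<lambda>g. of_int c) (\<lambda>g. of_int c)"
  unfolding ipoly_def
  by (rule exI[of _ "Poly_Mapping.single 0 c"]) (simp add: entry_poly_eval_single mon_eval_def)

lemma ipoly_ent: "ipoly (\<lambda>g. ent g i j) (\<lambda>g. ent g i j)"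
  unfolding ipoly_def
  by (rule exI[of _ "Poly_Mapping.single (Poly_Mapping.single (i, j) 1) 1"])
    (simp add: entry_poly_eval_single mon_eval_def ent.rep_eq)

lemma ipoly_add: "ipoly f f' \<Longrightarrow> ipoly g g' \<Longrightarrow> ipoly (\<lambda>x. f x + g x) (\<lambda>x. f' x + g' x)"
  unfolding ipoly_def by (metis entry_poly_eval_add)

lemma ipoly_mult: "ipoly f f' \<Longrightarrow> ipoly g g' \<Longrightarrow> ipoly (\<lambda>x. f x * g x) (\<lambda>x. f' x * g' x)"
  unfolding ipoly_def by (metis entry_poly_eval_mult)

lemma ipoly_sum: "(\<And>k. k \<in> K \<Longrightarrow> ipoly (f k) (f' k)) \<Longrightarrow> ipoly (\<lambda>x. \<Sum>k\<in>K. f k x) (\<lambda>x. \<Sum>k\<in>K. f' k x)"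
  using ipoly_const[of 0]
  by (induction K rule: infinite_finite_induct) (auto intro: ipoly_add)

lemma ipoly_prod: "(\<And>k. k \<in> K \<Longrightarrow> ipoly (f k) (f' k)) \<Longrightarrow> ipoly (\<lambda>x. \<Prod>k\<in>K. f k x) (\<lambda>x. \<Prod>k\<in>K. f' k x)"
  using ipoly_const[of 1]
  by (induction K rule: infinite_finite_induct) (auto intro: ipoly_mult)

lemma ipoly_cmult: "ipoly f f' \<Longrightarrow> ipoly (\<lambda>x. of_int c * f x) (\<lambda>x. of_int c * f' x)"
  by (intro ipoly_mult ipoly_const)

lemma ipoly_uminus: "ipoly f f' \<Longrightarrow> ipoly (\<lambda>x. - f x) (\<lambda>x. - f' x)"
  using ipoly_cmult[of f f' "- 1"] by simp

lemma ipoly_diff: "ipoly f f' \<Longrightarrow> ipoly g g' \<Longrightarrow> ipoly (\<lambda>x. f x - g x) (\<lambda>x. f' x - g' x)"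
  using ipoly_add[OF _ ipoly_uminus] by fastforce

lemma ipoly_power: "ipoly f f' \<Longrightarrow> ipoly (\<lambda>x. f x ^ k) (\<lambda>x. f' x ^ k)"
  using ipoly_const[of 1] by (induction k) (auto intro: ipoly_mult)

lemma ipoly_cpoly:
  assumes "ipoly f f'" shows "cpoly f"
proof -
  from assms obtain p where p: "f = (\<lambda>g. entry_poly_eval p (Rep_sqm g))" unfolding ipoly_def by auto
  show ?thesis
    unfolding p entry_poly_eval_def ent.rep_eq[symmetric]
    by (intro cpoly_sum cpoly_prod cpoly_power cpoly.intros cpoly.entry[unfolded ent.rep_eq])
qed

definition ipolyM :: "(('c::comm_ring_1, 'n::finite) sqm \<Rightarrow> ('c, 'n) sqm) \<Rightarrow> (('r::comm_ring_1, 'n) sqm \<Rightarrow> ('r, 'n) sqm) \<Rightarrow> bool" where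
  "ipolyM F F' \<longleftrightarrow> (\<forall>i j. ipoly (\<lambda>g. ent (F g) i j) (\<lambda>g. ent (F' g) i j))"

lemma ipolyM_id: "ipolyM (\<lambda>g. g) (\<lambda>g. g)" by (simp add: ipolyM_def ipoly_ent)
lemma ipolyM_const: "ipolyM (\<lambda>g. iot A) (\<lambda>g. iot A)" by (simp add: ipolyM_def ipoly_const)
lemma ipolyM_add: "ipolyM F F' \<Longrightarrow> ipolyM G G' \<Longrightarrow> ipolyM (\<lambda>g. F g + G g) (\<lambda>g. F' g + G' g)"
  by (simp add: ipolyM_def ipoly_add)
lemma ipolyM_diff: "ipolyM F F' \<Longrightarrow> ipolyM G G' \<Longrightarrow> ipolyM (\<lambda>g. F g - G g) (\<lambda>g. F' g - G' g)"
  by (simp add: ipolyM_def ipoly_diff)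
lemma ipolyM_mult: "ipolyM F F' \<Longrightarrow> ipolyM G G' \<Longrightarrow> ipolyM (\<lambda>g. F g * G g) (\<lambda>g. F' g * G' g)"
  by (simp add: ipolyM_def ent_mult) (intro allI ipoly_sum ipoly_mult, auto)
lemma ipolyM_scal: "ipoly f f' \<Longrightarrow> ipolyM G G' \<Longrightarrow> ipolyM (\<lambda>g. f g \<cdot> G g) (\<lambda>g. f' g \<cdot> G' g)"
  by (simp add: ipolyM_def ipoly_mult)
lemma ipoly_lf: "ipolyM F F' \<Longrightarrow> ipoly (\<lambda>g. lf u (F g)) (\<lambda>g. lf u (F' g))"
  unfolding lf_def ipolyM_def by (intro ipoly_sum ipoly_cmult) auto

section \<open>Determinant and adjugate\<close>

definition sdet :: "('r::comm_ring_1, 'n::finite) sqm \<Rightarrow> 'r" where "sdet A = det (Rep_sqm A)"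

text \<open>Cramer's rule: a substitute for the inverse whose entries are integer
  polynomials.\<close>

definition adjm :: "('r::comm_ring_1, 'n::finite) sqm \<Rightarrow> ('r, 'n) sqm" where
  "adjm A = msqm (\<lambda>i j. det (\<chi> k. if k = j then axis i 1 else Rep_sqm A $ k))"

lemma sdet_mult: "sdet (A * B) = sdet A * sdet B"
  by (simp add: sdet_def times_sqm.rep_eq det_mul)

lemma sdet_1 [simp]: "sdet 1 = 1"
  by (simp add: sdet_def one_sqm.rep_eq)

text \<open>By linearity in row \<open>j\<close>, the entry at \<open>(i, j)\<close> is the
  determinant of \<open>A\<close> with row \<open>j\<close> replaced by row
  \<open>i\<close>.\<close>

lemma mult_adjm: "A * adjm A = sdet A \<cdot> 1"
proof (rule sqm_eqI)
  fix i j
  have "ent (A * adjm A) i j = (\<Sum>k\<in>UNIV. det (\<chi> l. if l = j then Rep_sqm A $ i $ k *s axis k 1 else Rep_sqm A $ l))"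
    unfolding ent_mult adjm_def ent_msqm by (simp add: ent.rep_eq det_row_mul)
  also have "\<dots> = det (\<chi> l. if l = j then (\<Sum>k\<in>UNIV. Rep_sqm A $ i $ k *s axis k 1) else Rep_sqm A $ l)"
    by (rule det_linear_row_sum[symmetric]) simp
  also have "(\<Sum>k\<in>UNIV. Rep_sqm A $ i $ k *s axis k 1) = Rep_sqm A $ i"
    by (simp add: vec_eq_iff axis_def if_distrib cong: if_cong)
  also have "det (\<chi> l. if l = j then Rep_sqm A $ i else Rep_sqm A $ l) = ent (sdet A \<cdot> 1) i j"
  proof (cases "i = j")
    case True
    then have "(\<chi> l. if l = j then Rep_sqm A $ i else Rep_sqm A $ l) = Rep_sqm A" by (auto simp: vec_eq_iff)
    then show ?thesis using True by (simp add: sdet_def ent_1)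
  next
    case False
    then have "det (\<chi> l. if l = j then Rep_sqm A $ i else Rep_sqm A $ l) = 0"
      by (intro det_identical_rows[of i j]) (auto simp: row_def vec_eq_iff)
    then show ?thesis using False by (simp add: ent_1)
  qed
  finally show "ent (A * adjm A) i j = ent (sdet A \<cdot> 1) i j" .
qed

text \<open>The determinants of \<open>A\<close> and \<open>B\<close> are mutually inverse units, so
  the adjugate gives \<open>B\<close> a right inverse, and this must be \<open>A\<close>.\<close>

lemma right_inverse_imp_left_inverse:
  fixes A B :: "('r::comm_ring_1, 'n::finite) sqm"
  assumes "A * B = 1" shows "B * A = 1"
proof -
  have d: "sdet A * sdet B = 1" using assms by (metis sdet_mult sdet_1)
  have "B * (sdet A \<cdot> adjm B) = 1" using d by (simp add: mult_adjm)
  then have "A = (A * B) * (sdet A \<cdot> adjm B)" by (simp only: mult.assoc mult_1_right)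
  then have "A = sdet A \<cdot> adjm B" by (simp only: assms mult_1_left)
  with \<open>B * (sdet A \<cdot> adjm B) = 1\<close> show ?thesis by (simp only:)
qed

lemma adjm_eq_inverse: "A * B = 1 \<Longrightarrow> adjm A = sdet A \<cdot> (B :: ('r::comm_ring_1, 'n::finite) sqm)"
proof -
  assume ab: "A * B = 1"
  have "adjm A = (B * A) * adjm A" by (simp add: right_inverse_imp_left_inverse[OF ab])
  then show ?thesis by (simp add: mult_adjm mult.assoc)
qed

lemma adjm_mult: "adjm A * A = sdet A \<cdot> (1 :: ('r::comm_ring_1, 'n::finite) sqm)" if "sdet A = 1"
  using right_inverse_imp_left_inverse[of A "adjm A"] mult_adjm[of A] that by simp

lemma ipoly_det:
  assumes "\<And>i j. ipoly (\<lambda>g. F g $ i $ j) (\<lambda>g. F' g $ i $ j)"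
  shows "ipoly (\<lambda>g. det (F g)) (\<lambda>g. det (F' g))"
  unfolding det_def by (intro ipoly_sum ipoly_cmult ipoly_prod assms)

lemma ipoly_sdet: "ipolyM F F' \<Longrightarrow> ipoly (\<lambda>g. sdet (F g)) (\<lambda>g. sdet (F' g))"
  unfolding sdet_def by (rule ipoly_det) (simp add: ipolyM_def ent.rep_eq)

lemma ipolyM_adjm: "ipolyM F F' \<Longrightarrow> ipolyM (\<lambda>g. adjm (F g)) (\<lambda>g. adjm (F' g))"
  unfolding ipolyM_def adjm_def ent_msqm
proof (intro allI ipoly_det)
  fix i j k l
  assume a: "\<forall>i j. ipoly (\<lambda>g. ent (F g) i j) (\<lambda>g. ent (F' g) i j)"
  show "ipoly (\<lambda>g. (\<chi> k. if k = j then axis i 1 else Rep_sqm (F g) $ k) $ k $ l)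
        (\<lambda>g. (\<chi> k. if k = j then axis i 1 else Rep_sqm (F' g) $ k) $ k $ l)"
  proof (cases "k = j")
    case True then show ?thesis using ipoly_const[of "if l = i then 1 else 0"] by (cases "l = i") (simp_all add: axis_def)
  next
    case False then show ?thesis using a by (simp add: ent.rep_eq)
  qed
qed

text \<open>The determinant is a polynomial \<open>p\<close> in \<open>t\<close> with
  \<open>p(t) p(- t) = 1\<close>; hence it is constant, and its value at 0 is 1.\<close>

lemma sdet_xe:
  fixes X :: "(int, 'n::finite) sqm"
  assumes "adm X" "nilp X" shows "sdet (xe X (t :: complex)) = 1"
proof -
  have "ipoly (\<lambda>g::(complex, 'n) sqm. sdet g) (\<lambda>g::(complex, 'n) sqm. sdet g)"
    by (rule ipoly_sdet[OF ipolyM_id])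
  then have "cpoly (sdet :: (complex, 'n) sqm \<Rightarrow> complex)" by (rule ipoly_cpoly)
  from cpoly_curve[OF this, of 1 X] obtain p where "\<forall>t::complex. sdet (1 * xe X t) = poly p t" by (elim exE)
  then have p: "sdet (xe X t) = poly p t" for t by simp
  have "poly (p * pcompose p [:0, - 1:]) t = 1" for t
  proof -
    have "poly p t * poly p (- t) = sdet (xe X t * xe X (- t))" by (simp add: p sdet_mult)
    then show ?thesis by (simp add: poly_pcompose xe_inverse assms)
  qed
  then have "p * pcompose p [:0, - 1:] = 1"
    by (intro poly_eq_poly_eq_iff[THEN iffD1] ext) simp
  then have "p dvd 1" by (metis dvd_triv_left)
  then obtain c where "p = [:c:]" using is_unit_polyE by blast
  then show ?thesis using p[of 0] p[of t] by simp
qed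

section \<open>The adjoint action\<close>

lemma ipolyM_sum: "(\<And>k. k \<in> K \<Longrightarrow> ipolyM (F k) (F' k)) \<Longrightarrow> ipolyM (\<lambda>g. \<Sum>k\<in>K. F k g) (\<lambda>g. \<Sum>k\<in>K. F' k g)"
  by (simp add: ipolyM_def ipoly_sum)

lemma scal_two: "2 \<cdot> Z = Z + (Z :: ('a::comm_ring_1, 'n::finite) sqm)"
  by (metis mult_2 numeral_sqm)

section \<open>Adjoint action of the root unipotents on the Chevalley basis\<close>

context c2_sys
begin

lemmas conj_simps = table br_simps br_double numeral_sqm mult_ac
  scal.scale_right_distrib scal.scale_right_diff_distrib algebra_simps

lemma conj_linear:
  assumes "adm X" "nilp X" "br X (br X Y) = (0 :: (int, 'n) sqm)"
  shows "xe X t * iot Y = (iot Y + t \<cdot> iot (br X Y)) * xe X (t :: 'b::comm_ring_1)"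
  using xe_mult_conj[OF assms(1,2), of Y "br X Y" 0 t] assms(3) by simp

lemma conj_A:
  fixes t :: "'b::comm_ring_1"
  shows "xe A t * iot A = iot A * xe A t"
    "xe A t * iot A' = (iot A' + t \<cdot> iot H2 - t^2 \<cdot> iot A) * xe A t"
    "xe A t * iot C = iot C * xe A t"
    "xe A t * iot C' = (iot C' + t \<cdot> iot E') * xe A t"
    "xe A t * iot D = iot D * xe A t"
    "xe A t * iot D' = iot D' * xe A t"
    "xe A t * iot E = (iot E - t \<cdot> iot C) * xe A t"
    "xe A t * iot E' = iot E' * xe A t"
    "xe A t * iot H1 = iot H1 * xe A t"
    "xe A t * iot H2 = (iot H2 - (2 * t) \<cdot> iot A) * xe A t"
proof -
  show "xe A t * iot A' = (iot A' + t \<cdot> iot H2 - t^2 \<cdot> iot A) * xe A t"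
    using xe_mult_conj[OF adm(1) nil(1), of A' "H2" "- A" t] by (simp add: conj_simps)
qed (simp_all add: conj_linear[OF adm(1) nil(1)] conj_simps)

lemma conj_A':
  fixes t :: "'b::comm_ring_1"
  shows "xe A' t * iot A = (iot A - t \<cdot> iot H2 - t^2 \<cdot> iot A') * xe A' t"
    "xe A' t * iot A' = iot A' * xe A' t"
    "xe A' t * iot C = (iot C - t \<cdot> iot E) * xe A' t"
    "xe A' t * iot C' = iot C' * xe A' t"
    "xe A' t * iot D = iot D * xe A' t"
    "xe A' t * iot D' = iot D' * xe A' t"
    "xe A' t * iot E = iot E * xe A' t"
    "xe A' t * iot E' = (iot E' + t \<cdot> iot C') * xe A' t"
    "xe A' t * iot H1 = iot H1 * xe A' t"
    "xe A' t * iot H2 = (iot H2 + (2 * t) \<cdot> iot A') * xe A' t"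
proof -
  show "xe A' t * iot A = (iot A - t \<cdot> iot H2 - t^2 \<cdot> iot A') * xe A' t"
    using xe_mult_conj[OF adm(2) nil(2), of A "- H2" "- A'" t] by (simp add: conj_simps)
qed (simp_all add: conj_linear[OF adm(2) nil(2)] conj_simps)

lemma conj_C:
  fixes t :: "'b::comm_ring_1"
  shows "xe C t * iot A = iot A * xe C t"
    "xe C t * iot A' = (iot A' + t \<cdot> iot E - t^2 \<cdot> iot D) * xe C t"
    "xe C t * iot C = iot C * xe C t"
    "xe C t * iot C' = (iot C' + t \<cdot> iot H1 + t \<cdot> iot H2 - t^2 \<cdot> iot C) * xe C t"
    "xe C t * iot D = iot D * xe C t"
    "xe C t * iot D' = (iot D' + t \<cdot> iot E' - t^2 \<cdot> iot A) * xe C t"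
    "xe C t * iot E = (iot E - (2 * t) \<cdot> iot D) * xe C t"
    "xe C t * iot E' = (iot E' - (2 * t) \<cdot> iot A) * xe C t"
    "xe C t * iot H1 = (iot H1 - t \<cdot> iot C) * xe C t"
    "xe C t * iot H2 = (iot H2 - t \<cdot> iot C) * xe C t"
proof -
  show "xe C t * iot A' = (iot A' + t \<cdot> iot E - t^2 \<cdot> iot D) * xe C t"
    using xe_mult_conj[OF adm(3) nil(3), of A' "E" "- D" t] by (simp add: conj_simps)
  show "xe C t * iot C' = (iot C' + t \<cdot> iot H1 + t \<cdot> iot H2 - t^2 \<cdot> iot C) * xe C t"
    using xe_mult_conj[OF adm(3) nil(3), of C' "H1 + H2" "- C" t] by (simp add: conj_simps scal_two)
  show "xe C t * iot D' = (iot D' + t \<cdot> iot E' - t^2 \<cdot> iot A) * xe C t"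
    using xe_mult_conj[OF adm(3) nil(3), of D' "E'" "- A" t] by (simp add: conj_simps)
qed (simp_all add: conj_linear[OF adm(3) nil(3)] conj_simps)

lemma conj_C':
  fixes t :: "'b::comm_ring_1"
  shows "xe C' t * iot A = (iot A - t \<cdot> iot E' - t^2 \<cdot> iot D') * xe C' t"
    "xe C' t * iot A' = iot A' * xe C' t"
    "xe C' t * iot C = (iot C - t \<cdot> iot H1 - t \<cdot> iot H2 - t^2 \<cdot> iot C') * xe C' t"
    "xe C' t * iot C' = iot C' * xe C' t"
    "xe C' t * iot D = (iot D - t \<cdot> iot E - t^2 \<cdot> iot A') * xe C' t"
    "xe C' t * iot D' = iot D' * xe C' t"
    "xe C' t * iot E = (iot E + (2 * t) \<cdot> iot A') * xe C' t"
    "xe C' t * iot E' = (iot E' + (2 * t) \<cdot> iot D') * xe C' t"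
    "xe C' t * iot H1 = (iot H1 + t \<cdot> iot C') * xe C' t"
    "xe C' t * iot H2 = (iot H2 + t \<cdot> iot C') * xe C' t"
proof -
  show "xe C' t * iot A = (iot A - t \<cdot> iot E' - t^2 \<cdot> iot D') * xe C' t"
    using xe_mult_conj[OF adm(4) nil(4), of A "- E'" "- D'" t] by (simp add: conj_simps)
  show "xe C' t * iot C = (iot C - t \<cdot> iot H1 - t \<cdot> iot H2 - t^2 \<cdot> iot C') * xe C' t"
    using xe_mult_conj[OF adm(4) nil(4), of C "- H1 - H2" "- C'" t] by (simp add: conj_simps scal_two)
  show "xe C' t * iot D = (iot D - t \<cdot> iot E - t^2 \<cdot> iot A') * xe C' t"
    using xe_mult_conj[OF adm(4) nil(4), of D "- E" "- A'" t] by (simp add: conj_simps)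
qed (simp_all add: conj_linear[OF adm(4) nil(4)] conj_simps)

lemma conj_D:
  fixes t :: "'b::comm_ring_1"
  shows "xe D t * iot A = iot A * xe D t"
    "xe D t * iot A' = iot A' * xe D t"
    "xe D t * iot C = iot C * xe D t"
    "xe D t * iot C' = (iot C' + t \<cdot> iot E) * xe D t"
    "xe D t * iot D = iot D * xe D t"
    "xe D t * iot D' = (iot D' + t \<cdot> iot H1 - t^2 \<cdot> iot D) * xe D t"
    "xe D t * iot E = iot E * xe D t"
    "xe D t * iot E' = (iot E' - t \<cdot> iot C) * xe D t"
    "xe D t * iot H1 = (iot H1 - (2 * t) \<cdot> iot D) * xe D t"
    "xe D t * iot H2 = iot H2 * xe D t"
proof -
  show "xe D t * iot D' = (iot D' + t \<cdot> iot H1 - t^2 \<cdot> iot D) * xe D t"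
    using xe_mult_conj[OF adm(5) nil(5), of D' "H1" "- D" t] by (simp add: conj_simps)
qed (simp_all add: conj_linear[OF adm(5) nil(5)] conj_simps)

lemma conj_D':
  fixes t :: "'b::comm_ring_1"
  shows "xe D' t * iot A = iot A * xe D' t"
    "xe D' t * iot A' = iot A' * xe D' t"
    "xe D' t * iot C = (iot C - t \<cdot> iot E') * xe D' t"
    "xe D' t * iot C' = iot C' * xe D' t"
    "xe D' t * iot D = (iot D - t \<cdot> iot H1 - t^2 \<cdot> iot D') * xe D' t"
    "xe D' t * iot D' = iot D' * xe D' t"
    "xe D' t * iot E = (iot E + t \<cdot> iot C') * xe D' t"
    "xe D' t * iot E' = iot E' * xe D' t"
    "xe D' t * iot H1 = (iot H1 + (2 * t) \<cdot> iot D') * xe D' t"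
    "xe D' t * iot H2 = iot H2 * xe D' t"
proof -
  show "xe D' t * iot D = (iot D - t \<cdot> iot H1 - t^2 \<cdot> iot D') * xe D' t"
    using xe_mult_conj[OF adm(6) nil(6), of D "- H1" "- D'" t] by (simp add: conj_simps)
qed (simp_all add: conj_linear[OF adm(6) nil(6)] conj_simps)

lemma conj_E:
  fixes t :: "'b::comm_ring_1"
  shows "xe E t * iot A = (iot A + t \<cdot> iot C + t^2 \<cdot> iot D) * xe E t"
    "xe E t * iot A' = iot A' * xe E t"
    "xe E t * iot C = (iot C + (2 * t) \<cdot> iot D) * xe E t"
    "xe E t * iot C' = (iot C' - (2 * t) \<cdot> iot A') * xe E t"
    "xe E t * iot D = iot D * xe E t"
    "xe E t * iot D' = (iot D' - t \<cdot> iot C' + t^2 \<cdot> iot A') * xe E t"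
    "xe E t * iot E = iot E * xe E t"
    "xe E t * iot E' = (iot E' + t \<cdot> iot H1 - t \<cdot> iot H2 - t^2 \<cdot> iot E) * xe E t"
    "xe E t * iot H1 = (iot H1 - t \<cdot> iot E) * xe E t"
    "xe E t * iot H2 = (iot H2 + t \<cdot> iot E) * xe E t"
proof -
  show "xe E t * iot A = (iot A + t \<cdot> iot C + t^2 \<cdot> iot D) * xe E t"
    using xe_mult_conj[OF adm(7) nil(7), of A "C" "D" t] by (simp add: conj_simps)
  show "xe E t * iot D' = (iot D' - t \<cdot> iot C' + t^2 \<cdot> iot A') * xe E t"
    using xe_mult_conj[OF adm(7) nil(7), of D' "- C'" "A'" t] by (simp add: conj_simps)
  show "xe E t * iot E' = (iot E' + t \<cdot> iot H1 - t \<cdot> iot H2 - t^2 \<cdot> iot E) * xe E t"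
    using xe_mult_conj[OF adm(7) nil(7), of E' "H1 - H2" "- E" t] by (simp add: conj_simps scal_two)
qed (simp_all add: conj_linear[OF adm(7) nil(7)] conj_simps)

lemma conj_E':
  fixes t :: "'b::comm_ring_1"
  shows "xe E' t * iot A = iot A * xe E' t"
    "xe E' t * iot A' = (iot A' - t \<cdot> iot C' + t^2 \<cdot> iot D') * xe E' t"
    "xe E' t * iot C = (iot C + (2 * t) \<cdot> iot A) * xe E' t"
    "xe E' t * iot C' = (iot C' - (2 * t) \<cdot> iot D') * xe E' t"
    "xe E' t * iot D = (iot D + t \<cdot> iot C + t^2 \<cdot> iot A) * xe E' t"
    "xe E' t * iot D' = iot D' * xe E' t"
    "xe E' t * iot E = (iot E - t \<cdot> iot H1 + t \<cdot> iot H2 - t^2 \<cdot> iot E') * xe E' t"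
    "xe E' t * iot E' = iot E' * xe E' t"
    "xe E' t * iot H1 = (iot H1 + t \<cdot> iot E') * xe E' t"
    "xe E' t * iot H2 = (iot H2 - t \<cdot> iot E') * xe E' t"
proof -
  show "xe E' t * iot A' = (iot A' - t \<cdot> iot C' + t^2 \<cdot> iot D') * xe E' t"
    using xe_mult_conj[OF adm(8) nil(8), of A' "- C'" "D'" t] by (simp add: conj_simps)
  show "xe E' t * iot D = (iot D + t \<cdot> iot C + t^2 \<cdot> iot A) * xe E' t"
    using xe_mult_conj[OF adm(8) nil(8), of D "C" "A" t] by (simp add: conj_simps)
  show "xe E' t * iot E = (iot E - t \<cdot> iot H1 + t \<cdot> iot H2 - t^2 \<cdot> iot E') * xe E' t"
    using xe_mult_conj[OF adm(8) nil(8), of E "- H1 + H2" "- E'" t] by (simp add: conj_simps scal_two)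
qed (simp_all add: conj_linear[OF adm(8) nil(8)] conj_simps)

end

section \<open>Integral coordinates on the Lie algebra and their transfer to
  \<open>R\<close>\<close>

context c2_wt
begin

text \<open>The component of \<open>Y\<close> of weight \<open>(m, l)\<close> under the adjoint
  action: the part mapping each joint weight space \<open>(a, b)\<close> to
  \<open>(a + m, b + l)\<close>. It exists over every ring because the projections are
  integral.\<close>

definition wpart :: "int \<Rightarrow> int \<Rightarrow> ('b::comm_ring_1, 'n) sqm \<Rightarrow> ('b, 'n) sqm" where
  "wpart m l Y = (\<Sum>a\<in>S1. \<Sum>b\<in>S2. iot (P1 (a + m) * P2 (b + l)) * Y * iot (P1 a * P2 b))"

lemma wpart_add [simp]: "wpart m l (Y + Z) = wpart m l Y + wpart m l Z"
  by (simp add: wpart_def distrib_left distrib_right sum.distrib)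
lemma wpart_scal [simp]: "wpart m l (c \<cdot> Y) = c \<cdot> wpart m l Y"
  by (simp add: wpart_def scal.scale_sum_right)

lemma proj_proj2: "(P1 a * P2 b) * (P1 c * P2 d) = (if a = c \<and> b = d then P1 a * P2 b else 0)"
proof -
  have "(P1 a * P2 b) * (P1 c * P2 d) = P1 a * (P2 b * P1 c) * P2 d" by (simp add: mult.assoc)
  also have "\<dots> = (P1 a * P1 c) * (P2 b * P2 d)" by (simp add: P1_P2[symmetric] mult.assoc)
  finally show ?thesis by (simp add: W1.proj_proj W2.proj_proj)
qed

lemma wpart_iot:
  assumes "br H1 Z = m' \<cdot> Z" "br H2 Z = l' \<cdot> Z"
  shows "wpart m l (iot Z) = (if m = m' \<and> l = l' then iot Z else 0)"
proof -
  have "P1 (a + m) * P2 (b + l) * Z * (P1 a * P2 b) = (if m = m' \<and> l = l' then Z * (P1 a * P2 b) else 0)" for a b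
  proof -
    have "P1 (a + m) * P2 (b + l) * Z = P1 (a + m) * (Z * P2 (b + l - l'))"
      using W2.proj_shift[of Z l' "b + l"] assms(2) by (simp add: H2_def mult.assoc)
    also have "\<dots> = Z * (P1 (a + m - m') * P2 (b + l - l'))"
      using W1.proj_shift[of Z m' "a + m"] assms(1) by (simp add: H1_def flip: mult.assoc)
    finally show ?thesis by (simp add: mult.assoc proj_proj2 proj_proj2[unfolded mult.assoc])
  qed
  then have "wpart m l (iot Z) = (\<Sum>a\<in>S1. \<Sum>b\<in>S2. if m = m' \<and> l = l' then iot (Z * (P1 a * P2 b)) else 0)"
    unfolding wpart_def by (intro sum.cong refl) (simp flip: iot_mult)
  also have "\<dots> = (if m = m' \<and> l = l' then iot (Z * ((\<Sum>a\<in>S1. P1 a) * (\<Sum>b\<in>S2. P2 b))) else 0)"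
  proof -
    have "(\<Sum>a\<in>S1. \<Sum>b\<in>S2. iot (Z * (P1 a * P2 b))) = iot (Z * ((\<Sum>a\<in>S1. P1 a) * (\<Sum>b\<in>S2. P2 b)))"
      by (subst sum_product) (simp only: sum_distrib_left iot_sum)
    then show ?thesis by (cases "m = m' \<and> l = l'") auto
  qed
  finally show ?thesis unfolding W1.sum1 W2.sum1 mult_1_right .
qed

definition fn :: "(int, 'n) sqm \<Rightarrow> 'n \<Rightarrow> 'n \<Rightarrow> int" where "fn X = (SOME u. lf u X = 1)"

lemma lf_fn:
  assumes "adm X'" "X \<noteq> 0" "br (br X X') X = 2 * X" "br (br X X') X' = - (2 * X')"
  shows "lf (fn X) X = 1"
proof -
  obtain u where "lf u X = 1" using primitive_functional[OF assms] .
  then show ?thesis unfolding fn_def by (rule someI[where P = "\<lambda>u. lf u X = 1"])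
qed

lemma fn:
  "lf (fn A) A = 1" "lf (fn A') A' = 1" "lf (fn C) C = 1" "lf (fn C') C' = 1"
  "lf (fn D) D = 1" "lf (fn D') D' = 1" "lf (fn E) E = 1" "lf (fn E') E' = 1"
  by (rule lf_fn[OF adm(2) nz(1)] lf_fn[OF adm(1) nz(2)] lf_fn[OF adm(4) nz(3)] lf_fn[OF adm(3) nz(4)]
      lf_fn[OF adm(6) nz(5)] lf_fn[OF adm(5) nz(6)] lf_fn[OF adm(8) nz(7)] lf_fn[OF adm(7) nz(8)];
      simp add: table br_simps mult_2)+

text \<open>The coordinate along \<open>X\<close> of the part of weight \<open>(m, l)\<close> under the adjoint action of \<open>H1, H2\<close>.\<close>

definition cf :: "(int, 'n) sqm \<Rightarrow> int \<Rightarrow> int \<Rightarrow> ('b::comm_ring_1, 'n) sqm \<Rightarrow> 'b" where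
  "cf X m l Y = lf (fn X) (wpart m l Y)"

lemma cf_iot:
  assumes "br H1 Z = m' \<cdot> Z" "br H2 Z = l' \<cdot> Z"
  shows "cf X m l (iot Z) = (if m = m' \<and> l = l' then of_int (lf (fn X) Z) else 0)"
  by (simp add: cf_def wpart_iot[OF assms] lf_iot)

lemma cf_add [simp]: "cf X m l (Y + Z) = cf X m l Y + cf X m l Z" by (simp add: cf_def)
lemma cf_scal [simp]: "cf X m l (c \<cdot> Y) = c * cf X m l Y" by (simp add: cf_def)
lemma cf_minus [simp]: "cf X m l (- Y) = - cf X m l Y" using cf_scal[of X m l "- 1" Y] by simp
lemma cf_diff [simp]: "cf X m l (Y - Z) = cf X m l Y - cf X m l Z" using cf_add[of X m l Y "- Z"] by simp
lemma cf_0 [simp]: "cf X m l 0 = 0" using cf_scal[of X m l 0 0] by simp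

lemma weight_H: "br H1 H1 = 0 \<cdot> H1" "br H2 H1 = 0 \<cdot> H1" "br H1 H2 = 0 \<cdot> H2" "br H2 H2 = 0 \<cdot> H2"
  by (simp_all add: H1_H2)

definition cA where "cA = cf A (0) (2)"
definition cA' where "cA' = cf A' (0) (-2)"
definition cC where "cC = cf C (1) (1)"
definition cC' where "cC' = cf C' (-1) (-1)"
definition cD where "cD = cf D (2) (0)"
definition cD' where "cD' = cf D' (-2) (0)"
definition cE where "cE = cf E (1) (-1)"
definition cE' where "cE' = cf E' (-1) (1)"

lemmas c_defs = cA_def cA'_def cC_def cC'_def cD_def cD'_def cE_def cE'_def

lemma c_table:
  "cA (iot A) = 1" "cA' (iot A) = 0" "cC (iot A) = 0" "cC' (iot A) = 0"
  "cD (iot A) = 0" "cD' (iot A) = 0" "cE (iot A) = 0" "cE' (iot A) = 0"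
  "cA (iot A') = 0" "cA' (iot A') = 1" "cC (iot A') = 0" "cC' (iot A') = 0"
  "cD (iot A') = 0" "cD' (iot A') = 0" "cE (iot A') = 0" "cE' (iot A') = 0"
  "cA (iot C) = 0" "cA' (iot C) = 0" "cC (iot C) = 1" "cC' (iot C) = 0"
  "cD (iot C) = 0" "cD' (iot C) = 0" "cE (iot C) = 0" "cE' (iot C) = 0"
  "cA (iot C') = 0" "cA' (iot C') = 0" "cC (iot C') = 0" "cC' (iot C') = 1"
  "cD (iot C') = 0" "cD' (iot C') = 0" "cE (iot C') = 0" "cE' (iot C') = 0"
  "cA (iot D) = 0" "cA' (iot D) = 0" "cC (iot D) = 0" "cC' (iot D) = 0"
  "cD (iot D) = 1" "cD' (iot D) = 0" "cE (iot D) = 0" "cE' (iot D) = 0"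
  "cA (iot D') = 0" "cA' (iot D') = 0" "cC (iot D') = 0" "cC' (iot D') = 0"
  "cD (iot D') = 0" "cD' (iot D') = 1" "cE (iot D') = 0" "cE' (iot D') = 0"
  "cA (iot E) = 0" "cA' (iot E) = 0" "cC (iot E) = 0" "cC' (iot E) = 0"
  "cD (iot E) = 0" "cD' (iot E) = 0" "cE (iot E) = 1" "cE' (iot E) = 0"
  "cA (iot E') = 0" "cA' (iot E') = 0" "cC (iot E') = 0" "cC' (iot E') = 0"
  "cD (iot E') = 0" "cD' (iot E') = 0" "cE (iot E') = 0" "cE' (iot E') = 1"
  "cA (iot H1) = 0" "cA' (iot H1) = 0" "cC (iot H1) = 0" "cC' (iot H1) = 0"
  "cD (iot H1) = 0" "cD' (iot H1) = 0" "cE (iot H1) = 0" "cE' (iot H1) = 0"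
  "cA (iot H2) = 0" "cA' (iot H2) = 0" "cC (iot H2) = 0" "cC' (iot H2) = 0"
  "cD (iot H2) = 0" "cD' (iot H2) = 0" "cE (iot H2) = 0" "cE' (iot H2) = 0"
  unfolding c_defs
  by (simp_all add: cf_iot[OF weight_scal(1,2)] cf_iot[OF weight_scal(3,4)] cf_iot[OF weight_scal(5,6)] cf_iot[OF weight_scal(7,8)]
    cf_iot[OF weight_scal(9,10)] cf_iot[OF weight_scal(11,12)] cf_iot[OF weight_scal(13,14)] cf_iot[OF weight_scal(15,16)]
    cf_iot[OF weight_H(1,2)] cf_iot[OF weight_H(3,4)] fn)

lemma c_linear [simp]:
  "cA (Y + Z) = cA Y + cA Z" "cA (Y - Z) = cA Y - cA Z" "cA (- Y) = - cA Y" "cA (r \<cdot> Y) = r * cA Y" "cA 0 = 0"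
  "cA' (Y + Z) = cA' Y + cA' Z" "cA' (Y - Z) = cA' Y - cA' Z" "cA' (- Y) = - cA' Y" "cA' (r \<cdot> Y) = r * cA' Y" "cA' 0 = 0"
  "cC (Y + Z) = cC Y + cC Z" "cC (Y - Z) = cC Y - cC Z" "cC (- Y) = - cC Y" "cC (r \<cdot> Y) = r * cC Y" "cC 0 = 0"
  "cC' (Y + Z) = cC' Y + cC' Z" "cC' (Y - Z) = cC' Y - cC' Z" "cC' (- Y) = - cC' Y" "cC' (r \<cdot> Y) = r * cC' Y" "cC' 0 = 0"
  "cD (Y + Z) = cD Y + cD Z" "cD (Y - Z) = cD Y - cD Z" "cD (- Y) = - cD Y" "cD (r \<cdot> Y) = r * cD Y" "cD 0 = 0"
  "cD' (Y + Z) = cD' Y + cD' Z" "cD' (Y - Z) = cD' Y - cD' Z" "cD' (- Y) = - cD' Y" "cD' (r \<cdot> Y) = r * cD' Y" "cD' 0 = 0"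
  "cE (Y + Z) = cE Y + cE Z" "cE (Y - Z) = cE Y - cE Z" "cE (- Y) = - cE Y" "cE (r \<cdot> Y) = r * cE Y" "cE 0 = 0"
  "cE' (Y + Z) = cE' Y + cE' Z" "cE' (Y - Z) = cE' Y - cE' Z" "cE' (- Y) = - cE' Y" "cE' (r \<cdot> Y) = r * cE' Y" "cE' 0 = 0"
  by (simp_all add: c_defs)

text \<open>\<open>p H1 + q (H1 + H2) / 2\<close> has \<open>pE = p\<close> and \<open>qA = q\<close>.\<close>

definition pE where "pE Y = cE (br Y (iot E))"
definition qA where "qA Y = cA (br Y (iot A))"

lemma pq_linear [simp]:
  "pE (Y + Z) = pE Y + pE Z" "pE (Y - Z) = pE Y - pE Z" "pE (- Y) = - pE Y" "pE (r \<cdot> Y) = r * pE Y" "pE 0 = 0"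
  "qA (Y + Z) = qA Y + qA Z" "qA (Y - Z) = qA Y - qA Z" "qA (- Y) = - qA Y" "qA (r \<cdot> Y) = r * qA Y" "qA 0 = 0"
  by (simp_all add: pE_def qA_def br_simps)

lemma pq_table:
  "pE (iot A) = 0" "pE (iot A') = 0" "pE (iot C) = 0" "pE (iot C') = 0" "pE (iot D) = 0" "pE (iot D') = 0"
  "pE (iot E) = 0" "pE (iot E') = 0" "pE (iot H1) = 1" "pE (iot H2) = - 1"
  "qA (iot A) = 0" "qA (iot A') = 0" "qA (iot C) = 0" "qA (iot C') = 0" "qA (iot D) = 0" "qA (iot D') = 0"
  "qA (iot E) = 0" "qA (iot E') = 0" "qA (iot H1) = 0" "qA (iot H2) = 2"
  by (simp_all add: pE_def qA_def c_table table numeral_sqm flip: iot_br)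

definition root_part :: "('b::comm_ring_1, 'n) sqm \<Rightarrow> ('b, 'n) sqm" where
  "root_part Y = cA Y \<cdot> iot A + cA' Y \<cdot> iot A' + cC Y \<cdot> iot C + cC' Y \<cdot> iot C'
     + cD Y \<cdot> iot D + cD' Y \<cdot> iot D' + cE Y \<cdot> iot E + cE' Y \<cdot> iot E'"

text \<open>Twice the expansion of a Lie algebra element in root vectors and in
  \<open>H1, (H1 + H2) / 2\<close>, the basis of the Cartan part dual to the simple roots of
  \<open>E\<close> and \<open>A\<close>.\<close>

definition twice :: "('b::comm_ring_1, 'n) sqm \<Rightarrow> ('b, 'n) sqm" where
  "twice Y = 2 \<cdot> root_part Y + (2 * pE Y) \<cdot> iot H1 + qA Y \<cdot> (iot H1 + iot H2)"

text \<open>The complex Lie algebra; the factor \<open>2\<close> keeps the equation integral.\<close>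

definition Lc :: "(complex, 'n) sqm set" where "Lc = {Y. twice Y = 2 \<cdot> Y}"

lemma twice_add: "twice (Y + Z) = twice Y + twice Z"
  by (rule sqm_eqI) (simp add: twice_def root_part_def algebra_simps)

lemma twice_scal: "twice (c \<cdot> Y) = c \<cdot> twice Y"
  by (rule sqm_eqI) (simp add: twice_def root_part_def algebra_simps)

lemma Lc_add: "Y \<in> Lc \<Longrightarrow> Z \<in> Lc \<Longrightarrow> Y + Z \<in> Lc"
  by (simp add: Lc_def twice_add scal.scale_right_distrib)
lemma Lc_scal: "Y \<in> Lc \<Longrightarrow> c \<cdot> Y \<in> Lc"
  by (simp add: Lc_def twice_scal mult.commute)
lemma Lc_diff: "Y \<in> Lc \<Longrightarrow> Z \<in> Lc \<Longrightarrow> Y - Z \<in> Lc"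
  using Lc_add[of Y "(- 1) \<cdot> Z"] Lc_scal[of Z "- 1"] by simp

definition basis :: "(int, 'n) sqm set" where "basis = {A, A', C, C', D, D', E, E', H1, H2}"

lemma Lc_basis: "Z \<in> basis \<Longrightarrow> iot Z \<in> Lc"
  unfolding basis_def Lc_def
  by (auto simp: twice_def root_part_def c_table pq_table intro!: sqm_eqI)

lemma Lc_cases:
  assumes "Y \<in> Lc" obtains f where "Y = (\<Sum>Z\<in>basis. f Z \<cdot> iot Z)"
proof -
  let ?R = "{Y :: (complex, 'n) sqm. \<exists>f. Y = (\<Sum>Z\<in>basis. f Z \<cdot> iot Z)}"
  have add: "Y + Z \<in> ?R" if "Y \<in> ?R" "Z \<in> ?R" for Y Z
  proof -
    from that obtain f g where "Y = (\<Sum>Z\<in>basis. f Z \<cdot> iot Z)" "Z = (\<Sum>Z\<in>basis. g Z \<cdot> iot Z)" by blast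
    then show ?thesis
      by (auto intro!: exI[of _ "\<lambda>Z. f Z + g Z"] simp: scal.scale_left_distrib sum.distrib)
  qed
  have scal: "c \<cdot> Y \<in> ?R" if "Y \<in> ?R" for Y c
  proof -
    from that obtain f where "Y = (\<Sum>Z\<in>basis. f Z \<cdot> iot Z)" by blast
    then show ?thesis
      by (auto intro!: exI[of _ "\<lambda>Z. c * f Z"] simp: scal.scale_sum_right)
  qed
  have basis: "iot Z \<in> ?R" if "Z \<in> basis" for Z
  proof -
    have "(\<Sum>W\<in>basis. (if W = Z then 1 else 0) \<cdot> iot W) = (\<Sum>W\<in>basis. if W = Z then iot Z else (0 :: (complex, 'n) sqm))"
      by (rule sum.cong) auto
    also have "\<dots> = iot Z" using that by (simp add: sum.delta basis_def)
    finally show ?thesis by (auto intro!: exI[of _ "\<lambda>W. if W = Z then 1 else 0"])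
  qed
  have "Y = (1 / 2) \<cdot> twice Y" using assms by (simp add: Lc_def)
  also have "\<dots> \<in> ?R"
    unfolding twice_def root_part_def by (intro scal add basis) (simp_all add: basis_def)
  finally show thesis using that by blast
qed

text \<open>Invariance of the Lie algebra under conjugation, put as an intertwining relation so that
  no inverse occurs.\<close>

lemma xe_Lc_basis:
  assumes "X \<in> {A, A', C, C', D, D', E, E'}" "Z \<in> basis"
  shows "\<exists>V\<in>Lc. xe X t * iot Z = V * xe X t"
proof -
  note b = Lc_basis[unfolded basis_def]
  have *: "\<exists>U\<in>Lc. V * xe X t = U * xe X t" if "V \<in> Lc" for V and X
    using that by blast
  have A: "\<exists>V\<in>Lc. xe A t * iot Z = V * xe A t"
    using assms(2) unfolding basis_def
    by (auto simp only: insert_iff empty_iff conj_A intro!: * Lc_add Lc_diff Lc_scal b)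
  have Ap: "\<exists>V\<in>Lc. xe A' t * iot Z = V * xe A' t"
    using assms(2) unfolding basis_def
    by (auto simp only: insert_iff empty_iff conj_A' intro!: * Lc_add Lc_diff Lc_scal b)
  have C: "\<exists>V\<in>Lc. xe C t * iot Z = V * xe C t"
    using assms(2) unfolding basis_def
    by (auto simp only: insert_iff empty_iff conj_C intro!: * Lc_add Lc_diff Lc_scal b)
  have Cp: "\<exists>V\<in>Lc. xe C' t * iot Z = V * xe C' t"
    using assms(2) unfolding basis_def
    by (auto simp only: insert_iff empty_iff conj_C' intro!: * Lc_add Lc_diff Lc_scal b)
  have D: "\<exists>V\<in>Lc. xe D t * iot Z = V * xe D t"
    using assms(2) unfolding basis_def
    by (auto simp only: insert_iff empty_iff conj_D intro!: * Lc_add Lc_diff Lc_scal b)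
  have Dp: "\<exists>V\<in>Lc. xe D' t * iot Z = V * xe D' t"
    using assms(2) unfolding basis_def
    by (auto simp only: insert_iff empty_iff conj_D' intro!: * Lc_add Lc_diff Lc_scal b)
  have E: "\<exists>V\<in>Lc. xe E t * iot Z = V * xe E t"
    using assms(2) unfolding basis_def
    by (auto simp only: insert_iff empty_iff conj_E intro!: * Lc_add Lc_diff Lc_scal b)
  have Ep: "\<exists>V\<in>Lc. xe E' t * iot Z = V * xe E' t"
    using assms(2) unfolding basis_def
    by (auto simp only: insert_iff empty_iff conj_E' intro!: * Lc_add Lc_diff Lc_scal b)
  show ?thesis using assms(1) A Ap C Cp D Dp E Ep by auto
qed

lemma xe_Lc:
  assumes "X \<in> {A, A', C, C', D, D', E, E'}" "Y \<in> Lc"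
  shows "\<exists>V\<in>Lc. xe X t * Y = V * xe X t"
proof -
  obtain f where f: "Y = (\<Sum>Z\<in>basis. f Z \<cdot> iot Z)" using Lc_cases[OF assms(2)] .
  have "\<forall>Z\<in>basis. \<exists>V. V \<in> Lc \<and> xe X t * iot Z = V * xe X t"
    using xe_Lc_basis[OF assms(1), of _ t] by blast
  then obtain V where V: "\<forall>Z\<in>basis. V Z \<in> Lc \<and> xe X t * iot Z = V Z * xe X t"
    by (elim bchoice[THEN exE])
  have "(\<Sum>Z\<in>B. f Z \<cdot> V Z) \<in> Lc" if "B \<subseteq> basis" for B
    using that
  proof (induction B rule: infinite_finite_induct)
    case (insert Z B)
    then show ?case using V by (simp add: Lc_add Lc_scal)
  qed (simp_all add: Lc_def twice_def root_part_def)
  moreover have "xe X t * Y = (\<Sum>Z\<in>basis. f Z \<cdot> V Z) * xe X t"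
    unfolding f sum_distrib_left sum_distrib_right using V by (intro sum.cong) auto
  ultimately show ?thesis by blast
qed

lemma words_Lc: "w \<in> words \<Longrightarrow> Y \<in> Lc \<Longrightarrow> \<exists>V\<in>Lc. w * Y = V * w"
proof (induction arbitrary: Y rule: words.induct)
  case (step w X t)
  obtain V where V: "V \<in> Lc" "xe X t * Y = V * xe X t" using xe_Lc[OF step(2,4)] by blast
  obtain U where U: "U \<in> Lc" "w * V = U * w" using step.IH[OF V(1)] by blast
  have "w * xe X t * Y = w * V * xe X t" by (simp add: V mult.assoc)
  also have "\<dots> = U * (w * xe X t)" by (simp add: U mult.assoc)
  finally show ?case using U(1) by blast
qed auto

text \<open>Points over \<open>R\<close> of the Zariski closure of the complex group.\<close>

definition rpoint :: "('r::comm_ring_1, 'n) sqm \<Rightarrow> bool" where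
  "rpoint g \<longleftrightarrow> sdet g = 1 \<and>
     (\<forall>(f :: (complex, 'n) sqm \<Rightarrow> complex) f'. ipoly f f' \<longrightarrow> (\<forall>w\<in>words. f w = 0) \<longrightarrow> f' g = 0)"

text \<open>Density at work: a polynomial vanishing on the cell vanishes on the complex group, hence
  at the point over \<open>R\<close>.\<close>

lemma rpoint_Om:
  fixes f :: "(complex, 'n) sqm \<Rightarrow> complex"
  assumes "rpoint g" "ipoly f f'" "\<And>w. w \<in> Om \<Longrightarrow> f w = 0"
  shows "f' g = 0"
proof -
  have "f w = 0" if "w \<in> words" for w
    using words_Zcl[OF that] ipoly_cpoly[OF assms(2)] assms(3) by (auto simp: Zcl_def)
  then show ?thesis using assms(1,2) unfolding rpoint_def by blast
qed

lemma ipolyM_wpart: "ipolyM F F' \<Longrightarrow> ipolyM (\<lambda>g. wpart m l (F g)) (\<lambda>g. wpart m l (F' g))"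
proof -
  assume "ipolyM F F'"
  then show ?thesis unfolding wpart_def by (intro ipolyM_sum ipolyM_mult ipolyM_const)
qed

lemma ipoly_cf: "ipolyM F F' \<Longrightarrow> ipoly (\<lambda>g. cf X m l (F g)) (\<lambda>g. cf X m l (F' g))"
  unfolding cf_def by (intro ipoly_lf ipolyM_wpart)

lemma ipoly_c:
  assumes "ipolyM F F'"
  shows "ipoly (\<lambda>g. cA (F g)) (\<lambda>g. cA (F' g))"
    "ipoly (\<lambda>g. cA' (F g)) (\<lambda>g. cA' (F' g))"
    "ipoly (\<lambda>g. cC (F g)) (\<lambda>g. cC (F' g))"
    "ipoly (\<lambda>g. cC' (F g)) (\<lambda>g. cC' (F' g))"
    "ipoly (\<lambda>g. cD (F g)) (\<lambda>g. cD (F' g))"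
    "ipoly (\<lambda>g. cD' (F g)) (\<lambda>g. cD' (F' g))"
    "ipoly (\<lambda>g. cE (F g)) (\<lambda>g. cE (F' g))"
    "ipoly (\<lambda>g. cE' (F g)) (\<lambda>g. cE' (F' g))"
  unfolding c_defs by (intro ipoly_cf assms)+

lemma ipoly_pE: "ipolyM F F' \<Longrightarrow> ipoly (\<lambda>g. pE (F g)) (\<lambda>g. pE (F' g))"
  unfolding pE_def br_def by (intro ipoly_c ipolyM_diff ipolyM_mult ipolyM_const)

lemma ipoly_qA: "ipolyM F F' \<Longrightarrow> ipoly (\<lambda>g. qA (F g)) (\<lambda>g. qA (F' g))"
  unfolding qA_def br_def by (intro ipoly_c ipolyM_diff ipolyM_mult ipolyM_const)

lemma ipolyM_root_part: "ipolyM F F' \<Longrightarrow> ipolyM (\<lambda>g. root_part (F g)) (\<lambda>g. root_part (F' g))"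
  unfolding root_part_def by (intro ipolyM_add ipolyM_scal ipoly_c ipolyM_const)

definition Ad :: "('b::comm_ring_1, 'n) sqm \<Rightarrow> (int, 'n) sqm \<Rightarrow> ('b, 'n) sqm" where
  "Ad g X = g * iot X * adjm g"

lemma ipolyM_Ad: "ipolyM (\<lambda>g. Ad g X) (\<lambda>g. Ad g X)"
  unfolding Ad_def by (intro ipolyM_mult ipolyM_adjm ipolyM_id ipolyM_const)

text \<open>\<open>w * adjm w\<close> is a scalar matrix, and \<open>Lc\<close> is closed under
  scaling.\<close>

lemma Ad_words: "w \<in> words \<Longrightarrow> Z \<in> basis \<Longrightarrow> Ad w Z \<in> Lc"
proof -
  assume "w \<in> words" "Z \<in> basis"
  then obtain V where V: "V \<in> Lc" "w * iot Z = V * w" using words_Lc Lc_basis by blast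
  have "Ad w Z = V * (w * adjm w)" by (simp add: Ad_def V mult.assoc)
  then show ?thesis using V(1) by (simp add: mult_adjm Lc_scal)
qed

lemma rpoint_eq:
  fixes F G :: "(complex, 'n) sqm \<Rightarrow> (complex, 'n) sqm"
  assumes "rpoint g" "ipolyM F F'" "ipolyM G G'" "\<And>w. w \<in> words \<Longrightarrow> F w = G w"
  shows "F' g = G' g"
proof (rule sqm_eqI)
  fix i j
  have i: "ipoly (\<lambda>g. ent (F g) i j - ent (G g) i j) (\<lambda>g. ent (F' g) i j - ent (G' g) i j)"
    using assms(2,3) by (auto simp: ipolyM_def intro: ipoly_diff)
  moreover have "\<forall>w\<in>words. ent (F w) i j - ent (G w) i j = 0" using assms(4) by simp
  ultimately have "ent (F' g) i j - ent (G' g) i j = 0"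
    using assms(1) unfolding rpoint_def by blast
  then show "ent (F' g) i j = ent (G' g) i j" by simp
qed

text \<open>The expansion arrives over \<open>R\<close> in doubled form; whether 2 can be cancelled
  there depends on \<open>R\<close>.\<close>

lemma Ad_twice:
  assumes "rpoint g" "Z \<in> basis"
  shows "2 \<cdot> Ad g Z = 2 \<cdot> root_part (Ad g Z) + (2 * pE (Ad g Z)) \<cdot> iot H1 + qA (Ad g Z) \<cdot> (iot H1 + iot H2)"
proof -
  have two: "ipoly (\<lambda>g. 2) (\<lambda>g. 2)" using ipoly_const[of 2] by simp
  have H: "ipolyM (\<lambda>g. iot H1 + iot H2) (\<lambda>g. iot H1 + iot H2)" by (intro ipolyM_add ipolyM_const)
  show ?thesis
  proof (rule rpoint_eq[OF assms(1)])
    show "ipolyM (\<lambda>g. 2 \<cdot> Ad g Z) (\<lambda>g. 2 \<cdot> Ad g Z)" by (intro ipolyM_scal two ipolyM_Ad)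
    show "ipolyM (\<lambda>g. 2 \<cdot> root_part (Ad g Z) + (2 * pE (Ad g Z)) \<cdot> iot H1 + qA (Ad g Z) \<cdot> (iot H1 + iot H2))
       (\<lambda>g. 2 \<cdot> root_part (Ad g Z) + (2 * pE (Ad g Z)) \<cdot> iot H1 + qA (Ad g Z) \<cdot> (iot H1 + iot H2))"
      by (intro ipolyM_add[OF ipolyM_add] ipolyM_scal two ipolyM_root_part ipolyM_Ad ipoly_mult ipoly_pE ipoly_qA H ipolyM_const)
    show "2 \<cdot> Ad w Z = 2 \<cdot> root_part (Ad w Z) + (2 * pE (Ad w Z)) \<cdot> iot H1 + qA (Ad w Z) \<cdot> (iot H1 + iot H2)"
      if "w \<in> words" for w using Ad_words[OF that assms(2)] by (simp add: Lc_def twice_def)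
  qed
qed

text \<open>When \<open>(H1 + H2) / 2\<close> is an integer matrix, the 2 is cancelled over the
  complex numbers, before the transfer to \<open>R\<close>.\<close>

lemma Ad_adjoint:
  assumes "rpoint g" "Z \<in> basis" and hf: "2 * hf = H1 + H2"
  shows "Ad g Z = root_part (Ad g Z) + pE (Ad g Z) \<cdot> iot H1 + qA (Ad g Z) \<cdot> iot hf"
proof (rule rpoint_eq[OF assms(1)])
  show "ipolyM (\<lambda>g. Ad g Z) (\<lambda>g. Ad g Z)" by (rule ipolyM_Ad)
  show "ipolyM (\<lambda>g. root_part (Ad g Z) + pE (Ad g Z) \<cdot> iot H1 + qA (Ad g Z) \<cdot> iot hf)
     (\<lambda>g. root_part (Ad g Z) + pE (Ad g Z) \<cdot> iot H1 + qA (Ad g Z) \<cdot> iot hf)"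
    by (intro ipolyM_add ipolyM_scal ipolyM_root_part ipolyM_Ad ipoly_pE ipoly_qA ipolyM_const)
  fix w assume "w \<in> words"
  from Ad_words[OF this assms(2)]
  have "2 \<cdot> Ad w Z = 2 \<cdot> root_part (Ad w Z) + (2 * pE (Ad w Z)) \<cdot> iot H1 + qA (Ad w Z) \<cdot> (iot H1 + iot H2)"
    by (simp add: Lc_def twice_def)
  also have "iot H1 + iot H2 = (2 \<cdot> iot hf :: (complex, 'n) sqm)"
    using hf by (metis iot_add iot_mult iot_numeral numeral_sqm)
  finally have "2 \<cdot> Ad w Z = 2 \<cdot> (root_part (Ad w Z) + pE (Ad w Z) \<cdot> iot H1 + qA (Ad w Z) \<cdot> iot hf)"
    by (simp add: scal.scale_right_distrib mult.commute)
  then show "Ad w Z = root_part (Ad w Z) + pE (Ad w Z) \<cdot> iot H1 + qA (Ad w Z) \<cdot> iot hf"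
    by (subst (asm) scal_cancel) simp_all
qed

end

section \<open>Points acting trivially on the root vectors\<close>

text \<open>For invertible \<open>g\<close>: conjugation by \<open>g\<close> takes \<open>Y\<close>
  to \<open>V\<close>.\<close>

definition cj :: "'a::ring_1 \<Rightarrow> 'a \<Rightarrow> 'a \<Rightarrow> bool" where "cj g Y V \<longleftrightarrow> g * Y = V * g"

lemma cj_mult: "cj h Y U \<Longrightarrow> cj g U V \<Longrightarrow> cj (g * h) Y V"
  by (metis cj_def mult.assoc)

lemma cj_mult_same: "cj g Y Y \<Longrightarrow> cj h Y Y \<Longrightarrow> cj (g * h) Y Y"
  by (rule cj_mult)

section \<open>Values at a point of rational functions on the big cell\<close>

context c2_wt
begin

definition om :: "(nat \<Rightarrow> complex) \<Rightarrow> (complex, 'n) sqm" where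
  "om \<theta> = lo (\<theta> 0) (\<theta> 1) (\<theta> 2) (\<theta> 3) * tr (\<theta> 4) (\<theta> 5) * up (\<theta> 6) (\<theta> 7) (\<theta> 8) (\<theta> 9)"

definition TH :: "(nat \<Rightarrow> complex) set" where "TH = {\<theta>. \<theta> 4 \<noteq> 0 \<and> \<theta> 5 \<noteq> 0}"

lemma Om_eq: "Om = om ` TH"
proof
  show "om ` TH \<subseteq> Om" by (auto simp: om_def TH_def intro: OmI)
  show "Om \<subseteq> om ` TH"
  proof
    fix g assume "g \<in> Om"
    then obtain d c e a k l a' e' c' d' where g: "k \<noteq> 0" "l \<noteq> 0" "g = lo d c e a * tr k l * up a' e' c' d'"
      by (rule Om_cases)
    define \<theta> where "\<theta> = (\<lambda>_::nat. 0)(0 := d, 1 := c, 2 := e, 3 := a, 4 := k, 5 := l, 6 := a', 7 := e', 8 := c', 9 := d')"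
    have "om \<theta> = g" "\<theta> \<in> TH" using g by (simp_all add: om_def TH_def \<theta>_def)
    then show "g \<in> om ` TH" by blast
  qed
qed

text \<open>\<open>f\<close> is a rational function on the big cell, regular at the point \<open>z\<close> with value \<open>r\<close>. By
  density of the big cell the value is unique, although \<open>z\<close> lives over another ring.\<close>

definition val :: "('r::comm_ring_1, 'n) sqm \<Rightarrow> ((nat \<Rightarrow> complex) \<Rightarrow> complex) \<Rightarrow> 'r \<Rightarrow> bool" where
  "val z f r \<longleftrightarrow> (\<exists>p p' q q'. ipoly p p' \<and> ipoly q q' \<and> q' z = 1 \<and> p' z = r \<and>
     (\<forall>\<theta>\<in>TH. q (om \<theta>) \<noteq> 0 \<and> f \<theta> * q (om \<theta>) = p (om \<theta>)))"

lemma val_ipoly: "ipoly p p' \<Longrightarrow> val z (\<lambda>\<theta>. p (om \<theta>)) (p' z)"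
  unfolding val_def using ipoly_const[of 1]
  by (intro exI[of _ p] exI[of _ p'] exI[of _ "\<lambda>_. 1"]) simp

lemma val_of_int: "val z (\<lambda>\<theta>. of_int c) (of_int c)"
  using val_ipoly[OF ipoly_const] .

lemma val_add: "val z f r \<Longrightarrow> val z g s \<Longrightarrow> val z (\<lambda>\<theta>. f \<theta> + g \<theta>) (r + s)"
proof -
  assume "val z f r" "val z g s"
  then obtain p p' q q' P P' Q Q' where
    a: "ipoly p p'" "ipoly q q'" "q' z = 1" "p' z = r" "\<forall>\<theta>\<in>TH. q (om \<theta>) \<noteq> 0 \<and> f \<theta> * q (om \<theta>) = p (om \<theta>)"
    and b: "ipoly P P'" "ipoly Q Q'" "Q' z = 1" "P' z = s" "\<forall>\<theta>\<in>TH. Q (om \<theta>) \<noteq> 0 \<and> g \<theta> * Q (om \<theta>) = P (om \<theta>)"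
    unfolding val_def by blast
  have "(f \<theta> + g \<theta>) * (q (om \<theta>) * Q (om \<theta>)) = p (om \<theta>) * Q (om \<theta>) + P (om \<theta>) * q (om \<theta>)"
    if "\<theta> \<in> TH" for \<theta> using a(5) b(5) that by (simp add: algebra_simps flip: a(5)[rule_format, THEN conjunct2] b(5)[rule_format, THEN conjunct2])
  then show ?thesis unfolding val_def
    by (intro exI[of _ "\<lambda>x. p x * Q x + P x * q x"] exI[of _ "\<lambda>x. p' x * Q' x + P' x * q' x"]
        exI[of _ "\<lambda>x. q x * Q x"] exI[of _ "\<lambda>x. q' x * Q' x"])
      (use a b in \<open>auto intro!: ipoly_add ipoly_mult\<close>)
qed

lemma val_mult: "val z f r \<Longrightarrow> val z g s \<Longrightarrow> val z (\<lambda>\<theta>. f \<theta> * g \<theta>) (r * s)"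
proof -
  assume "val z f r" "val z g s"
  then obtain p p' q q' P P' Q Q' where
    a: "ipoly p p'" "ipoly q q'" "q' z = 1" "p' z = r" "\<forall>\<theta>\<in>TH. q (om \<theta>) \<noteq> 0 \<and> f \<theta> * q (om \<theta>) = p (om \<theta>)"
    and b: "ipoly P P'" "ipoly Q Q'" "Q' z = 1" "P' z = s" "\<forall>\<theta>\<in>TH. Q (om \<theta>) \<noteq> 0 \<and> g \<theta> * Q (om \<theta>) = P (om \<theta>)"
    unfolding val_def by blast
  have "(f \<theta> * g \<theta>) * (q (om \<theta>) * Q (om \<theta>)) = p (om \<theta>) * P (om \<theta>)"
    if "\<theta> \<in> TH" for \<theta> using a(5) b(5) that by (simp add: mult_ac flip: a(5)[rule_format, THEN conjunct2] b(5)[rule_format, THEN conjunct2])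
  then show ?thesis unfolding val_def
    by (intro exI[of _ "\<lambda>x. p x * P x"] exI[of _ "\<lambda>x. p' x * P' x"]
        exI[of _ "\<lambda>x. q x * Q x"] exI[of _ "\<lambda>x. q' x * Q' x"])
      (use a b in \<open>auto intro!: ipoly_mult\<close>)
qed

text \<open>Denominators are normalized to have the exact value 1 at \<open>z\<close>, so numerator
  and denominator may be exchanged when the value of \<open>f\<close> is 1.\<close>

lemma val_inverse: "val z f 1 \<Longrightarrow> \<forall>\<theta>\<in>TH. f \<theta> \<noteq> 0 \<Longrightarrow> val z (\<lambda>\<theta>. 1 / f \<theta>) 1"
proof -
  assume "val z f 1" and nz: "\<forall>\<theta>\<in>TH. f \<theta> \<noteq> 0"
  then obtain p p' q q' where
    a: "ipoly p p'" "ipoly q q'" "q' z = 1" "p' z = 1" "\<forall>\<theta>\<in>TH. q (om \<theta>) \<noteq> 0 \<and> f \<theta> * q (om \<theta>) = p (om \<theta>)"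
    unfolding val_def by blast
  then show ?thesis unfolding val_def using nz
    by (intro exI[of _ q] exI[of _ q'] exI[of _ p] exI[of _ p'])
      (auto simp flip: a(5)[rule_format, THEN conjunct2])
qed

lemma val_cong: "val z f r \<Longrightarrow> (\<And>\<theta>. \<theta> \<in> TH \<Longrightarrow> f \<theta> = g \<theta>) \<Longrightarrow> val z g r"
  unfolding val_def by metis

text \<open>Two fractions for \<open>f\<close> satisfy \<open>p Q = P q\<close> on the cell, hence
  also at \<open>z\<close>, where both denominators are 1.\<close>

lemma val_unique:
  assumes "rpoint z" "val z f r" "val z f s" shows "r = s"
proof -
  from assms(2,3) obtain p p' q q' P P' Q Q' where
    a: "ipoly p p'" "ipoly q q'" "q' z = 1" "p' z = r" "\<forall>\<theta>\<in>TH. q (om \<theta>) \<noteq> 0 \<and> f \<theta> * q (om \<theta>) = p (om \<theta>)"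
    and b: "ipoly P P'" "ipoly Q Q'" "Q' z = 1" "P' z = s" "\<forall>\<theta>\<in>TH. Q (om \<theta>) \<noteq> 0 \<and> f \<theta> * Q (om \<theta>) = P (om \<theta>)"
    unfolding val_def by blast
  have "p w * Q w - P w * q w = 0" if "w \<in> Om" for w
  proof -
    from that obtain \<theta> where "\<theta> \<in> TH" "w = om \<theta>" unfolding Om_eq by blast
    then have "p w = f \<theta> * q w" "P w = f \<theta> * Q w" using a(5) b(5) by auto
    then show ?thesis by simp
  qed
  then have "p' z * Q' z - P' z * q' z = 0"
    using a b by (intro rpoint_Om[OF assms(1), of "\<lambda>w. p w * Q w - P w * q w" "\<lambda>w. p' w * Q' w - P' w * q' w"])
      (auto intro!: ipoly_diff ipoly_mult)
  then show ?thesis using a b by simp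
qed

lemma val_minus: "val z f r \<Longrightarrow> val z (\<lambda>\<theta>. - f \<theta>) (- r)"
  using val_mult[OF val_of_int[of z "- 1"], of f r] by simp

lemma val_sum: "(\<And>k. k \<in> K \<Longrightarrow> val z (f k) (r k)) \<Longrightarrow> val z (\<lambda>\<theta>. \<Sum>k\<in>K. f k \<theta>) (\<Sum>k\<in>K. r k)"
  using val_of_int[of z 0]
  by (induction K rule: infinite_finite_induct) (auto intro: val_add)

lemma val_power: "val z f r \<Longrightarrow> val z (\<lambda>\<theta>. f \<theta> ^ k) (r ^ k)"
  using val_of_int[of z 1] by (induction k) (auto intro: val_mult)

lemma val_powi: "val z f 1 \<Longrightarrow> \<forall>\<theta>\<in>TH. f \<theta> \<noteq> 0 \<Longrightarrow> val z (\<lambda>\<theta>. f \<theta> powi m) 1"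
proof (cases "m \<ge> 0")
  case True
  assume "val z f 1"
  from val_power[OF this, of "nat m"] show ?thesis using True by (simp add: power_int_def)
next
  case False
  assume "val z f 1" and "\<forall>\<theta>\<in>TH. f \<theta> \<noteq> 0"
  from val_power[OF val_inverse[OF this], of "nat (- m)"] show ?thesis
    using False by (simp add: power_int_def inverse_eq_divide)
qed

definition valM :: "('r::comm_ring_1, 'n) sqm \<Rightarrow> ((nat \<Rightarrow> complex) \<Rightarrow> (complex, 'n) sqm) \<Rightarrow> ('r, 'n) sqm \<Rightarrow> bool" where
  "valM z F Z \<longleftrightarrow> (\<forall>i j. val z (\<lambda>\<theta>. ent (F \<theta>) i j) (ent Z i j))"

lemma valM_const: "valM z (\<lambda>\<theta>. iot M) (iot M)"
  unfolding valM_def by (simp add: val_of_int)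
lemma valM_mult: "valM z F Z \<Longrightarrow> valM z G W \<Longrightarrow> valM z (\<lambda>\<theta>. F \<theta> * G \<theta>) (Z * W)"
  unfolding valM_def ent_mult by (intro allI val_sum val_mult) auto
lemma valM_add: "valM z F Z \<Longrightarrow> valM z G W \<Longrightarrow> valM z (\<lambda>\<theta>. F \<theta> + G \<theta>) (Z + W)"
  unfolding valM_def by (simp add: val_add)
lemma valM_minus: "valM z F Z \<Longrightarrow> valM z (\<lambda>\<theta>. - F \<theta>) (- Z)"
  unfolding valM_def by (simp add: val_minus)
lemma valM_diff: "valM z F Z \<Longrightarrow> valM z G W \<Longrightarrow> valM z (\<lambda>\<theta>. F \<theta> - G \<theta>) (Z - W)"
  using valM_add[OF _ valM_minus, of z F Z G W] by simp
lemma valM_scal: "val z f r \<Longrightarrow> valM z F Z \<Longrightarrow> valM z (\<lambda>\<theta>. f \<theta> \<cdot> F \<theta>) (r \<cdot> Z)"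
  unfolding valM_def by (simp add: val_mult)
lemma valM_sum: "(\<And>k. k \<in> K \<Longrightarrow> valM z (F k) (Z k)) \<Longrightarrow> valM z (\<lambda>\<theta>. \<Sum>k\<in>K. F k \<theta>) (\<Sum>k\<in>K. Z k)"
  unfolding valM_def by (simp add: val_sum)
lemma valM_cong: "valM z F Z \<Longrightarrow> (\<And>\<theta>. \<theta> \<in> TH \<Longrightarrow> F \<theta> = G \<theta>) \<Longrightarrow> valM z G Z"
  unfolding valM_def using val_cong by (metis (no_types, lifting))
lemma valM_unique: "rpoint z \<Longrightarrow> valM z F Z \<Longrightarrow> valM z F W \<Longrightarrow> Z = W"
  unfolding valM_def using val_unique by (intro sqm_eqI) blast
lemma valM_xe: "val z f r \<Longrightarrow> valM z (\<lambda>\<theta>. xe X (f \<theta>)) (xe X r)"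
  unfolding xe_def by (intro valM_sum valM_scal val_power valM_const)
lemma valM_ipolyM: "ipolyM F F' \<Longrightarrow> valM z (\<lambda>\<theta>. F (om \<theta>)) (F' z)"
  unfolding valM_def ipolyM_def using val_ipoly by blast
lemma valM_id: "valM z om z"
  using valM_ipolyM[OF ipolyM_id, of z] by simp

lemma val_lf: "valM z F Z \<Longrightarrow> val z (\<lambda>\<theta>. lf u (F \<theta>)) (lf u Z)"
  unfolding lf_def valM_def by (intro val_sum val_mult val_of_int) auto
lemma valM_wpart: "valM z F Z \<Longrightarrow> valM z (\<lambda>\<theta>. wpart m l (F \<theta>)) (wpart m l Z)"
  unfolding wpart_def by (intro valM_sum valM_mult valM_const)
lemma val_cf: "valM z F Z \<Longrightarrow> val z (\<lambda>\<theta>. cf X m l (F \<theta>)) (cf X m l Z)"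
  unfolding cf_def by (intro val_lf valM_wpart)
lemma val_c:
  assumes "valM z F Z"
  shows "val z (\<lambda>\<theta>. cA (F \<theta>)) (cA Z)"
    "val z (\<lambda>\<theta>. cA' (F \<theta>)) (cA' Z)"
    "val z (\<lambda>\<theta>. cC (F \<theta>)) (cC Z)"
    "val z (\<lambda>\<theta>. cC' (F \<theta>)) (cC' Z)"
    "val z (\<lambda>\<theta>. cD (F \<theta>)) (cD Z)"
    "val z (\<lambda>\<theta>. cD' (F \<theta>)) (cD' Z)"
    "val z (\<lambda>\<theta>. cE (F \<theta>)) (cE Z)"
    "val z (\<lambda>\<theta>. cE' (F \<theta>)) (cE' Z)"
  unfolding c_defs by (intro val_cf assms)+
lemma val_pE: "valM z F Z \<Longrightarrow> val z (\<lambda>\<theta>. pE (F \<theta>)) (pE Z)"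
  unfolding pE_def br_def by (intro val_c valM_diff valM_mult valM_const)

section \<open>Reading the cell parameters off the adjoint action\<close>

definition omi :: "(nat \<Rightarrow> complex) \<Rightarrow> (complex, 'n) sqm" where
  "omi \<theta> = (xe D (- \<theta> 9) * xe C (- \<theta> 8) * xe E (- \<theta> 7) * xe A (- \<theta> 6)) * tr (1 / \<theta> 4) (1 / \<theta> 5)
     * (xe A' (- \<theta> 3) * xe E' (- \<theta> 2) * xe C' (- \<theta> 1) * xe D' (- \<theta> 0))"

lemma tr_inverse_assoc: "c \<noteq> 0 \<Longrightarrow> d \<noteq> 0 \<Longrightarrow> tr c d * (tr (1 / c) (1 / d) * Z) = Z"
  by (simp add: tr_inverse flip: mult.assoc)

lemma om_omi: "\<theta> \<in> TH \<Longrightarrow> om \<theta> * omi \<theta> = 1" 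
  by (simp add: om_def omi_def lo_def up_def TH_def mult.assoc xe_minus_cancel adm nil xe_inverse tr_inverse_assoc)

lemma omi_om: "\<theta> \<in> TH \<Longrightarrow> omi \<theta> * om \<theta> = 1"
  by (rule right_inverse_imp_left_inverse[OF om_omi])

lemma sdet_om: "\<theta> \<in> TH \<Longrightarrow> sdet (om \<theta>) \<noteq> 0"
proof
  assume "\<theta> \<in> TH" "sdet (om \<theta>) = 0"
  then have "sdet (1 :: (complex, 'n) sqm) = 0" using om_omi[of \<theta>] sdet_mult[of "om \<theta>" "omi \<theta>"] by simp
  then show False by simp
qed

text \<open>On the cell the inverse is the adjugate divided by the determinant, and the determinant
  has value 1 at \<open>z\<close>.\<close>

lemma valM_omi: "sdet z = 1 \<Longrightarrow> valM z omi (adjm z)"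
proof -
  assume z: "sdet z = 1"
  have "val z (\<lambda>\<theta>. sdet (om \<theta>)) 1"
    using val_ipoly[OF ipoly_sdet[OF ipolyM_id], of z] by (simp add: z)
  moreover have "\<forall>\<theta>\<in>TH. sdet (om \<theta>) \<noteq> 0" by (simp add: sdet_om)
  ultimately have "val z (\<lambda>\<theta>. 1 / sdet (om \<theta>)) 1" by (rule val_inverse)
  from valM_scal[OF this valM_ipolyM[OF ipolyM_adjm[OF ipolyM_id], of z]]
  have "valM z (\<lambda>\<theta>. (1 / sdet (om \<theta>)) \<cdot> adjm (om \<theta>)) (adjm z)" by simp
  then show ?thesis
    by (rule valM_cong) (simp add: adjm_eq_inverse[OF om_omi] sdet_om)
qed

text \<open>\<open>D\<close> is the highest root vector. Its image has coordinate 1 along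
  \<open>D\<close>, and the coordinates along \<open>C\<close>, \<open>E\<close> and
  \<open>H1\<close> are the parameters \<open>e\<close>, \<open>c\<close> and \<open>d\<close> up to
  sign. The parameter \<open>a\<close> stays invisible because \<open>xe A' a\<close> fixes
  \<open>D\<close>.\<close>

lemma lo_D:
  "\<exists>V. cj (lo d c e a) (iot D) V \<and> cD V = 1 \<and> cC V = e \<and> cE V = - c \<and> pE V = - d"
proof -
  let ?V3 = "iot D - c \<cdot> iot E - c^2 \<cdot> iot A' + e \<cdot> (iot C - c \<cdot> (iot H1 + iot H2) - c^2 \<cdot> iot C')
     + e^2 \<cdot> (iot A - c \<cdot> iot E' - c^2 \<cdot> iot D')"
  let ?V4 = "(iot D - d \<cdot> iot H1 - d^2 \<cdot> iot D') - c \<cdot> (iot E + d \<cdot> iot C') - c^2 \<cdot> iot A'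
    + e \<cdot> (iot C - d \<cdot> iot E' - c \<cdot> (iot H1 + (2 * d) \<cdot> iot D' + iot H2) - c^2 \<cdot> iot C')
     + e^2 \<cdot> (iot A - c \<cdot> iot E' - c^2 \<cdot> iot D')"
  have "cj (xe A' a) (iot D) (iot D)" by (simp add: cj_def conj_A')
  moreover have "cj (xe E' e) (iot D) (iot D + e \<cdot> iot C + e^2 \<cdot> iot A)" by (simp add: cj_def conj_E')
  moreover have "cj (xe C' c) (iot D + e \<cdot> iot C + e^2 \<cdot> iot A) ?V3"
    by (simp add: cj_def distrib_left conj_C' algebra_simps)
  moreover have "cj (xe D' d) ?V3 ?V4"
    by (simp add: cj_def distrib_left right_diff_distrib conj_D') (simp add: algebra_simps)
  ultimately have "cj (lo d c e a) (iot D) ?V4" unfolding lo_def mult.assoc by (intro cj_mult)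
  moreover have "cD ?V4 = 1" "cC ?V4 = e" "cE ?V4 = - c" "pE ?V4 = - d"
    by (simp_all add: c_table pq_table)
  ultimately show ?thesis by blast
qed

text \<open>The mirror image of \<open>lo_D\<close>: the inverse of an upper element acts on the
  lowest root vector and shows every parameter except that of \<open>A\<close>.\<close>

lemma up_inverse_D':
  "\<exists>V. cj (xe D d * xe C c * xe E e * xe A a) (iot D') V \<and> cD' V = 1 \<and> cC' V = - e \<and> cE' V = c \<and> pE V = d"
proof -
  let ?V3 = "(iot D' + c \<cdot> iot E' - c^2 \<cdot> iot A) - e \<cdot> (iot C' + c \<cdot> (iot H1 + iot H2) - c^2 \<cdot> iot C)
     + e^2 \<cdot> (iot A' + c \<cdot> iot E - c^2 \<cdot> iot D)"
  let ?V4 = "(iot D' + d \<cdot> iot H1 - d^2 \<cdot> iot D + c \<cdot> (iot E' - d \<cdot> iot C) - c^2 \<cdot> iot A)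
    - e \<cdot> (iot C' + d \<cdot> iot E + c \<cdot> (iot H1 - (2 * d) \<cdot> iot D + iot H2) - c^2 \<cdot> iot C)
     + e^2 \<cdot> (iot A' + c \<cdot> iot E - c^2 \<cdot> iot D)"
  have "cj (xe A a) (iot D') (iot D')" by (simp add: cj_def conj_A)
  moreover have "cj (xe E e) (iot D') (iot D' - e \<cdot> iot C' + e^2 \<cdot> iot A')" by (simp add: cj_def conj_E)
  moreover have "cj (xe C c) (iot D' - e \<cdot> iot C' + e^2 \<cdot> iot A') ?V3"
    by (simp add: cj_def distrib_left right_diff_distrib conj_C) (simp add: algebra_simps)
  moreover have "cj (xe D d) ?V3 ?V4"
    by (simp add: cj_def distrib_left right_diff_distrib conj_D) (simp add: algebra_simps)
  ultimately have "cj (xe D d * xe C c * xe E e * xe A a) (iot D') ?V4" unfolding mult.assoc by (intro cj_mult)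
  moreover have "cD' ?V4 = 1" "cC' ?V4 = - e" "cE' ?V4 = c" "pE ?V4 = d"
    by (simp_all add: c_table pq_table)
  ultimately show ?thesis by blast
qed

lemma cj_inverse_form: "cj g Y V \<Longrightarrow> g * g' = 1 \<Longrightarrow> g * Y * g' = (V :: ('b::comm_ring_1, 'n) sqm)"
  by (simp add: cj_def mult.assoc)

lemma om_D:
  assumes "\<theta> \<in> TH"
  defines "W \<equiv> om \<theta> * iot D * omi \<theta>"
  shows "cD W = (\<theta> 4)^2" "cC W = (\<theta> 4)^2 * \<theta> 2" "cE W = - ((\<theta> 4)^2 * \<theta> 1)" "pE W = - ((\<theta> 4)^2 * \<theta> 0)"
proof -
  obtain V where V: "cj (lo (\<theta> 0) (\<theta> 1) (\<theta> 2) (\<theta> 3)) (iot D) V" "cD V = 1" "cC V = \<theta> 2" "cE V = - \<theta> 1" "pE V = - \<theta> 0"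
    using lo_D by blast
  have "cj (up (\<theta> 6) (\<theta> 7) (\<theta> 8) (\<theta> 9)) (iot D) (iot D)"
    unfolding up_def by (intro cj_mult_same) (simp_all add: cj_def conj_A conj_C conj_D conj_E)
  moreover have "cj (tr (\<theta> 4) (\<theta> 5)) (iot D) ((\<theta> 4)^2 \<cdot> iot D)"
    using tr_twist[OF weight_scal(9,10), of "\<theta> 4" "\<theta> 5"] assms(1) by (simp add: cj_def TH_def)
  moreover have "cj (lo (\<theta> 0) (\<theta> 1) (\<theta> 2) (\<theta> 3)) ((\<theta> 4)^2 \<cdot> iot D) ((\<theta> 4)^2 \<cdot> V)"
    using V(1) by (simp add: cj_def)
  ultimately have "cj (om \<theta>) (iot D) ((\<theta> 4)^2 \<cdot> V)" unfolding om_def mult.assoc by (intro cj_mult)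
  then have "W = (\<theta> 4)^2 \<cdot> V" unfolding W_def by (rule cj_inverse_form) (rule om_omi[OF assms(1)])
  then show "cD W = (\<theta> 4)^2" "cC W = (\<theta> 4)^2 * \<theta> 2" "cE W = - ((\<theta> 4)^2 * \<theta> 1)" "pE W = - ((\<theta> 4)^2 * \<theta> 0)"
    by (simp_all add: V)
qed

lemma omi_D':
  assumes "\<theta> \<in> TH"
  defines "W \<equiv> omi \<theta> * iot D' * om \<theta>"
  shows "cC' W = (\<theta> 4)^2 * \<theta> 7" "cE' W = - ((\<theta> 4)^2 * \<theta> 8)" "pE W = - ((\<theta> 4)^2 * \<theta> 9)"
proof -
  obtain V where V: "cj (xe D (- \<theta> 9) * xe C (- \<theta> 8) * xe E (- \<theta> 7) * xe A (- \<theta> 6)) (iot D') V" "cD' V = 1" "cC' V = - (- \<theta> 7)" "cE' V = - \<theta> 8" "pE V = - \<theta> 9"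
    using up_inverse_D' by blast
  have "cj (xe A' (- \<theta> 3) * xe E' (- \<theta> 2) * xe C' (- \<theta> 1) * xe D' (- \<theta> 0)) (iot D') (iot D')"
    by (intro cj_mult_same) (simp_all add: cj_def conj_A' conj_C' conj_D' conj_E')
  moreover have "cj (tr (1 / \<theta> 4) (1 / \<theta> 5)) (iot D') ((\<theta> 4)^2 \<cdot> iot D')"
    using tr_twist[OF weight_scal(11,12), of "1 / \<theta> 4" "1 / \<theta> 5"] assms(1)
    by (simp add: cj_def TH_def power_int_minus power_divide field_simps)
  moreover have "cj (xe D (- \<theta> 9) * xe C (- \<theta> 8) * xe E (- \<theta> 7) * xe A (- \<theta> 6)) ((\<theta> 4)^2 \<cdot> iot D') ((\<theta> 4)^2 \<cdot> V)"
    using V(1) by (simp add: cj_def)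
  ultimately have "cj (omi \<theta>) (iot D') ((\<theta> 4)^2 \<cdot> V)" unfolding omi_def by (rule cj_mult[OF _ cj_mult])
  then have "W = (\<theta> 4)^2 \<cdot> V" unfolding W_def by (rule cj_inverse_form) (rule omi_om[OF assms(1)])
  then show "cC' W = (\<theta> 4)^2 * \<theta> 7" "cE' W = - ((\<theta> 4)^2 * \<theta> 8)" "pE W = - ((\<theta> 4)^2 * \<theta> 9)"
    by (simp_all add: V)
qed

text \<open>What is left of the cell after stripping the six unipotent parameters visible on
  \<open>D\<close> and \<open>D'\<close>. Its own two unipotent parameters are visible on
  \<open>C\<close> and \<open>C'\<close>.\<close>

definition mid :: "(nat \<Rightarrow> complex) \<Rightarrow> (complex, 'n) sqm" where
  "mid \<theta> = xe A' (\<theta> 3) * tr (\<theta> 4) (\<theta> 5) * xe A (\<theta> 6)"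

definition midi :: "(nat \<Rightarrow> complex) \<Rightarrow> (complex, 'n) sqm" where
  "midi \<theta> = xe A (- \<theta> 6) * tr (1 / \<theta> 4) (1 / \<theta> 5) * xe A' (- \<theta> 3)"

lemma mid_eq:
  "mid \<theta> = xe E' (- \<theta> 2) * xe C' (- \<theta> 1) * xe D' (- \<theta> 0) * om \<theta> * xe D (- \<theta> 9) * xe C (- \<theta> 8) * xe E (- \<theta> 7)"
  by (simp add: om_def lo_def up_def mid_def mult.assoc xe_minus_cancel adm nil xe_inverse)

lemma midi_eq:
  "midi \<theta> = xe E (\<theta> 7) * xe C (\<theta> 8) * xe D (\<theta> 9) * omi \<theta> * xe D' (\<theta> 0) * xe C' (\<theta> 1) * xe E' (\<theta> 2)"
  by (simp add: omi_def midi_def mult.assoc xe_minus_cancel adm nil xe_inverse)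

lemma mid_midi: "\<theta> \<in> TH \<Longrightarrow> mid \<theta> * midi \<theta> = 1"
  by (simp add: mid_def midi_def TH_def mult.assoc xe_minus_cancel adm nil xe_inverse tr_inverse_assoc)

lemma mid_C:
  assumes "\<theta> \<in> TH"
  shows "mid \<theta> * iot C * midi \<theta> = (\<theta> 4 * \<theta> 5) \<cdot> (iot C - \<theta> 3 \<cdot> iot E)"
proof (rule cj_inverse_form[OF _ mid_midi[OF assms]])
  have "cj (xe A (\<theta> 6)) (iot C) (iot C)" by (simp add: cj_def conj_A)
  moreover have "cj (tr (\<theta> 4) (\<theta> 5)) (iot C) ((\<theta> 4 * \<theta> 5) \<cdot> iot C)"
    using tr_twist[OF weight_scal(5,6), of "\<theta> 4" "\<theta> 5"] assms(1) by (simp add: cj_def TH_def)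
  moreover have "cj (xe A' (\<theta> 3)) ((\<theta> 4 * \<theta> 5) \<cdot> iot C) ((\<theta> 4 * \<theta> 5) \<cdot> (iot C - \<theta> 3 \<cdot> iot E))"
    by (simp add: cj_def conj_A')
  ultimately show "cj (mid \<theta>) (iot C) ((\<theta> 4 * \<theta> 5) \<cdot> (iot C - \<theta> 3 \<cdot> iot E))"
    unfolding mid_def mult.assoc by (intro cj_mult)
qed

lemma midi_C':
  assumes "\<theta> \<in> TH"
  shows "midi \<theta> * iot C' * mid \<theta> = (\<theta> 4 * \<theta> 5) \<cdot> (iot C' - \<theta> 6 \<cdot> iot E')"
proof (rule cj_inverse_form[OF _ right_inverse_imp_left_inverse[OF mid_midi[OF assms]]])
  have "cj (xe A' (- \<theta> 3)) (iot C') (iot C')" by (simp add: cj_def conj_A')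
  moreover have "cj (tr (1 / \<theta> 4) (1 / \<theta> 5)) (iot C') ((\<theta> 4 * \<theta> 5) \<cdot> iot C')"
    using tr_twist[OF weight_scal(7,8), of "1 / \<theta> 4" "1 / \<theta> 5"] assms(1)
    by (simp add: cj_def TH_def power_int_minus field_simps)
  moreover have "cj (xe A (- \<theta> 6)) ((\<theta> 4 * \<theta> 5) \<cdot> iot C') ((\<theta> 4 * \<theta> 5) \<cdot> (iot C' - \<theta> 6 \<cdot> iot E'))"
    by (simp add: cj_def conj_A)
  ultimately show "cj (midi \<theta>) (iot C') ((\<theta> 4 * \<theta> 5) \<cdot> (iot C' - \<theta> 6 \<cdot> iot E'))"
    unfolding midi_def mult.assoc by (intro cj_mult)
qed

lemma val_divide:
  assumes "val z f 1" "\<forall>\<theta>\<in>TH. f \<theta> \<noteq> 0" "val z g r" "\<forall>\<theta>\<in>TH. g \<theta> = f \<theta> * h \<theta>"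
  shows "val z h r"
proof -
  have "val z (\<lambda>\<theta>. 1 / f \<theta> * g \<theta>) r" using val_mult[OF val_inverse[OF assms(1,2)] assms(3)] by simp
  then show ?thesis by (rule val_cong) (simp add: assms(2,4))
qed

text \<open>The torus characters and their products with the unipotent parameters occur as
  coordinates of conjugates of vectors fixed by \<open>z\<close>. So the characters have value 1 and
  the parameters value 0, and stripping the unipotent factors from \<open>om\<close> leaves the
  torus part with value \<open>z\<close>.\<close>

lemma val_trivial:
  assumes z: "rpoint z" and fx: "z * iot D = iot D * z" "z * iot D' = iot D' * z" "z * iot C = iot C * z" "z * iot C' = iot C' * z"
  shows "val z (\<lambda>\<theta>. (\<theta> 4)^2) 1" "val z (\<lambda>\<theta>. \<theta> 4 * \<theta> 5) 1" "valM z (\<lambda>\<theta>. tr (\<theta> 4) (\<theta> 5)) z"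
proof -
  have s1: "sdet z = 1" using z by (simp add: rpoint_def)
  have inv: "z * adjm z = 1" "adjm z * z = 1" using mult_adjm[of z] adjm_mult[OF s1] s1 by simp_all
  have Z: "z * iot Y * adjm z = iot Y" "adjm z * iot Y * z = iot Y" if "z * iot Y = iot Y * z" for Y
  proof -
    show "z * iot Y * adjm z = iot Y" by (simp add: that mult.assoc inv)
    show "adjm z * iot Y * z = iot Y" by (simp add: that[symmetric] mult.assoc inv) (simp add: inv flip: mult.assoc)
  qed
  have nz: "\<forall>\<theta>\<in>TH. (\<theta> 4)^2 \<noteq> 0" "\<forall>\<theta>\<in>TH. \<theta> 4 * \<theta> 5 \<noteq> 0" by (simp_all add: TH_def)
  have W: "valM z (\<lambda>\<theta>. om \<theta> * iot D * omi \<theta>) (iot D)"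
    using valM_mult[OF valM_mult[OF valM_id valM_const[of z D]] valM_omi[OF s1]] Z(1)[OF fx(1)] by simp
  show k2: "val z (\<lambda>\<theta>. (\<theta> 4)^2) 1"
  proof -
    have "val z (\<lambda>\<theta>. cD (om \<theta> * iot D * omi \<theta>)) 1" using val_c(5)[OF W] by (simp add: c_table)
    then show ?thesis by (rule val_cong) (rule om_D)
  qed
  have v2: "val z (\<lambda>\<theta>. \<theta> 2) 0"
    using val_divide[where f = "\<lambda>\<theta>. (\<theta> 4)^2" and h = "\<lambda>\<theta>. \<theta> 2", OF k2 nz(1) val_c(3)[OF W]] by (simp add: c_table om_D)
  have "val z (\<lambda>\<theta>. - \<theta> 1) 0"
    using val_divide[where f = "\<lambda>\<theta>. (\<theta> 4)^2" and h = "\<lambda>\<theta>. - \<theta> 1", OF k2 nz(1) val_c(7)[OF W]] by (simp add: c_table om_D)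
  then have v1: "val z (\<lambda>\<theta>. \<theta> 1) 0" using val_minus by fastforce
  have "val z (\<lambda>\<theta>. - \<theta> 0) 0"
    using val_divide[where f = "\<lambda>\<theta>. (\<theta> 4)^2" and h = "\<lambda>\<theta>. - \<theta> 0", OF k2 nz(1) val_pE[OF W]] by (simp add: pq_table om_D)
  then have v0: "val z (\<lambda>\<theta>. \<theta> 0) 0" using val_minus by fastforce
  have W': "valM z (\<lambda>\<theta>. omi \<theta> * iot D' * om \<theta>) (iot D')"
    using valM_mult[OF valM_mult[OF valM_omi[OF s1] valM_const[of z D']] valM_id] Z(2)[OF fx(2)] by simp
  have v7: "val z (\<lambda>\<theta>. \<theta> 7) 0"
    using val_divide[where f = "\<lambda>\<theta>. (\<theta> 4)^2" and h = "\<lambda>\<theta>. \<theta> 7", OF k2 nz(1) val_c(4)[OF W']] by (simp add: c_table omi_D')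
  have "val z (\<lambda>\<theta>. - \<theta> 8) 0"
    using val_divide[where f = "\<lambda>\<theta>. (\<theta> 4)^2" and h = "\<lambda>\<theta>. - \<theta> 8", OF k2 nz(1) val_c(8)[OF W']] by (simp add: c_table omi_D')
  then have v8: "val z (\<lambda>\<theta>. \<theta> 8) 0" using val_minus by fastforce
  have "val z (\<lambda>\<theta>. - \<theta> 9) 0"
    using val_divide[where f = "\<lambda>\<theta>. (\<theta> 4)^2" and h = "\<lambda>\<theta>. - \<theta> 9", OF k2 nz(1) val_pE[OF W']] by (simp add: pq_table omi_D')
  then have v9: "val z (\<lambda>\<theta>. \<theta> 9) 0" using val_minus by fastforce
  \<comment> \<open>The stripped factors have value \<open>xe X 0 = 1\<close>, so \<open>mid\<close>
    still has the value \<open>z\<close>.\<close>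
  have "valM z mid (xe E' (- 0) * xe C' (- 0) * xe D' (- 0) * z * xe D (- 0) * xe C (- 0) * xe E (- 0))"
    unfolding mid_eq by (intro valM_mult valM_xe val_minus valM_id v0 v1 v2 v7 v8 v9)
  then have mid: "valM z mid z" by simp
  have "valM z midi (xe E 0 * xe C 0 * xe D 0 * adjm z * xe D' 0 * xe C' 0 * xe E' 0)"
    unfolding midi_eq by (intro valM_mult valM_xe valM_omi s1 v0 v1 v2 v7 v8 v9)
  then have midi: "valM z midi (adjm z)" by simp
  have U: "valM z (\<lambda>\<theta>. mid \<theta> * iot C * midi \<theta>) (iot C)"
    using valM_mult[OF valM_mult[OF mid valM_const[of z C]] midi] Z(1)[OF fx(3)] by simp
  show kl: "val z (\<lambda>\<theta>. \<theta> 4 * \<theta> 5) 1"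
  proof -
    have "val z (\<lambda>\<theta>. cC (mid \<theta> * iot C * midi \<theta>)) 1" using val_c(3)[OF U] by (simp add: c_table)
    then show ?thesis by (rule val_cong) (simp add: mid_C c_table)
  qed
  have "val z (\<lambda>\<theta>. - \<theta> 3) 0"
    using val_divide[where f = "\<lambda>\<theta>. \<theta> 4 * \<theta> 5" and h = "\<lambda>\<theta>. - \<theta> 3", OF kl nz(2) val_c(7)[OF U]] by (simp add: c_table mid_C)
  then have v3: "val z (\<lambda>\<theta>. \<theta> 3) 0" using val_minus by fastforce
  have U': "valM z (\<lambda>\<theta>. midi \<theta> * iot C' * mid \<theta>) (iot C')"
    using valM_mult[OF valM_mult[OF midi valM_const[of z C']] mid] Z(2)[OF fx(4)] by simp
  have "val z (\<lambda>\<theta>. - \<theta> 6) 0"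
    using val_divide[where f = "\<lambda>\<theta>. \<theta> 4 * \<theta> 5" and h = "\<lambda>\<theta>. - \<theta> 6", OF kl nz(2) val_c(8)[OF U']] by (simp add: c_table midi_C')
  then have v6: "val z (\<lambda>\<theta>. \<theta> 6) 0" using val_minus by fastforce
  have "valM z (\<lambda>\<theta>. xe A' (- \<theta> 3) * mid \<theta> * xe A (- \<theta> 6)) (xe A' (- 0) * z * xe A (- 0))"
    by (intro valM_mult valM_xe val_minus mid v3 v6)
  then show "valM z (\<lambda>\<theta>. tr (\<theta> 4) (\<theta> 5)) z"
    by (simp add: mid_def mult.assoc xe_minus_cancel xe_inverse adm nil)
qed

text \<open>\<open>tr\<close> is the sum of the joint weight projections times characters, so only
  the characters of weights that occur have to be evaluated.\<close>

lemma valM_tr: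
  assumes "\<And>a b. P1 a * P2 b \<noteq> 0 \<Longrightarrow> val z (\<lambda>\<theta>. f \<theta> powi a * g \<theta> powi b) 1"
  shows "valM z (\<lambda>\<theta>. tr (f \<theta>) (g \<theta>)) 1"
proof -
  have "valM z (\<lambda>\<theta>. \<Sum>a\<in>S1. \<Sum>b\<in>S2. (f \<theta> powi a * g \<theta> powi b) \<cdot> iot (P1 a * P2 b)) (\<Sum>a\<in>S1. \<Sum>b\<in>S2. iot (P1 a * P2 b))"
  proof (intro valM_sum)
    fix a b
    show "valM z (\<lambda>\<theta>. (f \<theta> powi a * g \<theta> powi b) \<cdot> iot (P1 a * P2 b)) (iot (P1 a * P2 b))"
    proof (cases "P1 a * P2 b = 0")
      case True then show ?thesis using valM_const[of z 0] by (simp del: iot_mult)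
    next
      case False
      from valM_scal[OF assms[OF this] valM_const, of "P1 a * P2 b"] show ?thesis by simp
    qed
  qed
  also have "(\<Sum>a\<in>S1. \<Sum>b\<in>S2. iot (P1 a * P2 b)) = iot ((\<Sum>a\<in>S1. P1 a) * (\<Sum>b\<in>S2. P2 b))"
    by (subst sum_product) (simp only: iot_sum)
  also have "\<dots> = 1" unfolding W1.sum1 W2.sum1 by simp
  also have "(\<lambda>\<theta>. \<Sum>a\<in>S1. \<Sum>b\<in>S2. (f \<theta> powi a * g \<theta> powi b) \<cdot> iot (P1 a * P2 b)) = (\<lambda>\<theta>. tr (f \<theta>) (g \<theta>))"
    by (simp add: tr_def W1.tor_def W2.tor_def sum_product mult.commute)
  finally show ?thesis .
qed

text \<open>Let \<open>k\<close> and \<open>l\<close> be the torus parameters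
  \<open>\<theta> 4\<close> and \<open>\<theta> 5\<close>. At \<open>z\<close> the functions
  \<open>k^2\<close> and \<open>k l\<close>, hence also \<open>l^2\<close>, have value 1. The value
  of \<open>tr k l\<close> is \<open>z\<close>, so that of \<open>tr (k^2) (l^2)\<close> is
  \<open>z * z\<close>; and for even \<open>a + b\<close> the character \<open>k^a l^b\<close> is a
  product of powers of \<open>k^2\<close>, \<open>l^2\<close> and \<open>k l\<close>. Commuting with
  the divided powers of \<open>D\<close> is not a formal consequence of commuting with
  \<open>D\<close>, since \<open>R\<close> may have torsion.\<close>

lemma
  assumes z: "rpoint z" and fx: "z * iot D = iot D * z" "z * iot D' = iot D' * z" "z * iot C = iot C * z" "z * iot C' = iot C' * z"
  shows kernel_commute: "z * iot (dp D m) = iot (dp D m) * z"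
    and kernel_square: "z * z = 1"
    and kernel_adjoint: "(\<And>a b. P1 a * P2 b \<noteq> 0 \<Longrightarrow> even (a + b)) \<Longrightarrow> z = 1"
proof -
  note k2 = val_trivial(1)[OF assms] and kl = val_trivial(2)[OF assms] and tr = val_trivial(3)[OF assms]
  have nz: "\<forall>\<theta>\<in>TH. (\<theta> 4)^2 \<noteq> 0" "\<forall>\<theta>\<in>TH. \<theta> 4 * \<theta> 5 \<noteq> 0" "\<forall>\<theta>\<in>TH. (\<theta> 5)^2 \<noteq> 0"
    and nz': "\<And>\<theta>. \<theta> \<in> TH \<Longrightarrow> \<theta> 4 \<noteq> 0" "\<And>\<theta>. \<theta> \<in> TH \<Longrightarrow> \<theta> 5 \<noteq> 0"
    by (simp_all add: TH_def)
  have "val z (\<lambda>\<theta>. (\<theta> 4 * \<theta> 5)^2) (1^2)" by (rule val_power[OF kl])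
  then have l2: "val z (\<lambda>\<theta>. (\<theta> 5)^2) 1"
    using val_divide[where f = "\<lambda>\<theta>. (\<theta> 4)^2" and g = "\<lambda>\<theta>. (\<theta> 4 * \<theta> 5)^2" and h = "\<lambda>\<theta>. (\<theta> 5)^2" and r = 1, OF k2 nz(1)] by (simp add: power_mult_distrib)
  have "valM z (\<lambda>\<theta>. tr (\<theta> 4) (\<theta> 5) * iot (dp D m)) (z * iot (dp D m))"
    by (intro valM_mult tr valM_const)
  moreover have "valM z (\<lambda>\<theta>. tr (\<theta> 4) (\<theta> 5) * iot (dp D m)) (1 ^ m \<cdot> (iot (dp D m) * z))"
  proof (rule valM_cong)
    show "valM z (\<lambda>\<theta>. ((\<theta> 4)^2) ^ m \<cdot> (iot (dp D m) * tr (\<theta> 4) (\<theta> 5))) (1 ^ m \<cdot> (iot (dp D m) * z))"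
      by (intro valM_scal valM_mult val_power k2 tr valM_const)
    show "((\<theta> 4)^2) ^ m \<cdot> (iot (dp D m) * tr (\<theta> 4) (\<theta> 5)) = tr (\<theta> 4) (\<theta> 5) * iot (dp D m)" if "\<theta> \<in> TH" for \<theta>
      using dp_twist[OF adm(5) tr_twist[OF weight_scal(9,10)], of "\<theta> 4" "\<theta> 5"] nz'[OF that] by simp
  qed
  ultimately show "z * iot (dp D m) = iot (dp D m) * z" using valM_unique[OF z] by fastforce
  have "valM z (\<lambda>\<theta>. tr ((\<theta> 4)^2) ((\<theta> 5)^2)) (z * z)"
    using valM_mult[OF tr tr] by (simp add: tr_mult power2_eq_square)
  moreover have "val z (\<lambda>\<theta>. ((\<theta> 4)^2) powi a * ((\<theta> 5)^2) powi b) 1" for a b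
    using val_mult[OF val_powi[OF k2 nz(1)] val_powi[OF l2 nz(3)], of a b] by simp
  then have "valM z (\<lambda>\<theta>. tr ((\<theta> 4)^2) ((\<theta> 5)^2)) 1" by (rule valM_tr)
  ultimately show "z * z = 1" using valM_unique[OF z] by blast
  show "z = 1" if ev: "\<And>a b. P1 a * P2 b \<noteq> 0 \<Longrightarrow> even (a + b)"
  proof -
    have "val z (\<lambda>\<theta>. \<theta> 4 powi a * \<theta> 5 powi b) 1" if "P1 a * P2 b \<noteq> 0" for a b
    proof -
      have e: "val z (\<lambda>\<theta>. ((\<theta> 4)^2) powi i * ((\<theta> 5)^2) powi j) 1" for i j
        using val_mult[OF val_powi[OF k2 nz(1)] val_powi[OF l2 nz(3)], of i j] by simp
      have dbl: "(x^2) powi i = x powi (2 * i)" for x :: complex and i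
        by (simp add: power_int_mult)
      show ?thesis
      proof (cases "even a")
        case True
        then have "even b" using ev[OF that] by simp
        then obtain i j where "a = 2 * i" "b = 2 * j" using True by (auto elim!: evenE)
        then show ?thesis using e[of i j] by (simp add: dbl)
      next
        case False
        then have "odd b" using ev[OF that] by simp
        then obtain i j where ij: "a = 2 * i + 1" "b = 2 * j + 1" using False by (auto elim!: oddE)
        have "val z (\<lambda>\<theta>. (\<theta> 4 * \<theta> 5) * (((\<theta> 4)^2) powi i * ((\<theta> 5)^2) powi j)) (1 * 1)"
          by (rule val_mult[OF kl e])
        then have "val z (\<lambda>\<theta>. \<theta> 4 powi a * \<theta> 5 powi b) (1 * 1)"
          by (rule val_cong) (simp add: ij dbl power_int_add nz')
        then show ?thesis by simp
      qed
    qed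
    then have "valM z (\<lambda>\<theta>. tr (\<theta> 4) (\<theta> 5)) 1" by (rule valM_tr)
    with tr show ?thesis using valM_unique[OF z] by blast
  qed
qed

end

section \<open>Centralizers of root unipotents\<close>

lemma cj_add: "cj g Y V \<Longrightarrow> cj g Y' V' \<Longrightarrow> cj g (Y + Y') (V + V')"
  by (simp add: cj_def distrib_left distrib_right)
lemma cj_diff: "cj g Y V \<Longrightarrow> cj g Y' V' \<Longrightarrow> cj g (Y - Y') (V - V')"
  by (simp add: cj_def left_diff_distrib right_diff_distrib)
lemma cj_minus: "cj g Y V \<Longrightarrow> cj g (- Y) (- V)"
  by (simp add: cj_def)
lemma cj_scal: "cj g Y V \<Longrightarrow> cj g (c \<cdot> Y) (c \<cdot> V)"
  by (simp add: cj_def)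

lemma cj_br:
  assumes "cj g Y V" "cj g Y' V'" shows "cj g (br Y Y') (br V V')"
proof -
  have a: "g * Y = V * g" "g * Y' = V' * g" using assms by (simp_all add: cj_def)
  have "g * (Y * Y') = (g * Y) * Y'" "g * (Y' * Y) = (g * Y') * Y" by (simp_all add: mult.assoc)
  then have "g * (Y * Y') = V * V' * g" "g * (Y' * Y) = V' * V * g" by (simp_all add: a mult.assoc)
  then show ?thesis by (simp add: cj_def br_def right_diff_distrib left_diff_distrib)
qed

lemma cj_unique:
  assumes "cj g Y V" "cj g Y V'" "g * g' = 1" shows "V = V'"
proof -
  have "V * g * g' = V' * g * g'" using assms by (simp add: cj_def)
  then show ?thesis by (simp add: mult.assoc assms(3))
qed

text \<open>Conjugations by \<open>y\<close> and \<open>s\<close> commute, so a relation for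
  \<open>y\<close> may be transported by \<open>s\<close>.\<close>

lemma cj_commuting:
  assumes "y * s = s * y" "cj s Y Y'" "cj y Y V" "cj s V V'" "s * s' = 1"
  shows "cj y Y' V'"
proof -
  have "y * Y' * s = (y * s) * Y" using assms(2) by (simp add: cj_def mult.assoc)
  also have "\<dots> = s * (y * Y)" by (simp add: assms(1) mult.assoc)
  also have "\<dots> = (s * V) * y" using assms(3) by (simp add: cj_def mult.assoc)
  also have "\<dots> = V' * (s * y)" using assms(4) by (simp add: cj_def mult.assoc)
  also have "\<dots> = V' * y * s" by (simp add: assms(1) mult.assoc)
  finally have "y * Y' * s * s' = V' * y * s * s'" by simp
  then show ?thesis by (simp add: cj_def mult.assoc assms(5))
qed

context c2_wt
begin

text \<open>\<open>w\<close> plays the role of the coweight \<open>(H1 + H2) / 2\<close>.\<close>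

definition half_sum :: "('r::comm_ring_1, 'n) sqm \<Rightarrow> bool" where
  "half_sum w \<longleftrightarrow>
     (\<forall>g Z. rpoint g \<longrightarrow> Z \<in> basis \<longrightarrow> Ad g Z = root_part (Ad g Z) + pE (Ad g Z) \<cdot> iot H1 + qA (Ad g Z) \<cdot> w) \<and>
     cA w = 0 \<and> cA' w = 0 \<and> cC w = 0 \<and> cC' w = 0 \<and> cD w = 0 \<and> cD' w = 0 \<and> cE w = 0 \<and> cE' w = 0 \<and>
     pE w = 0 \<and> qA w = 1 \<and>
     xe A 1 * w = (w - iot A) * xe A 1 \<and> xe A' 1 * w = (w + iot A') * xe A' 1"

lemma half_sum_half:
  fixes h :: "'r::comm_ring_1"
  assumes h: "h * 2 = 1"
  shows "half_sum (h \<cdot> (iot H1 + iot H2))"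
proof -
  have h': "h * (2 * x) = x" for x using h by (metis mult.assoc mult_1_left)
  have "Ad g Z = root_part (Ad g Z) + pE (Ad g Z) \<cdot> iot H1 + qA (Ad g Z) \<cdot> (h \<cdot> (iot H1 + iot H2))"
    if "rpoint g" "Z \<in> basis" for g Z
  proof -
    have "Ad g Z = h \<cdot> (2 \<cdot> Ad g Z)" by (simp add: h)
    also have "\<dots> = root_part (Ad g Z) + pE (Ad g Z) \<cdot> iot H1 + qA (Ad g Z) \<cdot> (h \<cdot> (iot H1 + iot H2))"
      unfolding Ad_twice[OF that] by (simp add: scal.scale_right_distrib h h' mult_ac)
    finally show ?thesis .
  qed
  moreover have "xe A 1 * (h \<cdot> (iot H1 + iot H2)) = (h \<cdot> (iot H1 + iot H2) - iot A) * xe A 1"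
    by (simp add: conj_A distrib_left distrib_right scal.scale_right_distrib left_diff_distrib scal.scale_right_diff_distrib h)
  moreover have "xe A' 1 * (h \<cdot> (iot H1 + iot H2)) = (h \<cdot> (iot H1 + iot H2) + iot A') * xe A' 1"
    by (simp add: conj_A' distrib_left distrib_right scal.scale_right_distrib h)
  ultimately show ?thesis
    unfolding half_sum_def by (auto simp: c_table pq_table h)
qed

lemma half_sum_integral:
  assumes hf: "2 * hf = H1 + H2"
  shows "half_sum (iot hf)"
proof -
  have br2: "2 \<cdot> br X hf = br X (H1 + H2)" "2 \<cdot> br hf X = br (H1 + H2) X" for X
    by (simp_all flip: hf add: br_double numeral_sqm br_scal_left br_scal_right)
  have can: "br X hf = Y" if "br X (H1 + H2) = 2 \<cdot> Y" for X Y
    using that br2(1)[of X] by (simp add: scal_cancel)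
  have b: "br A hf = - A" "br A' hf = A'" "br E hf = 0" "br H1 hf = 0" "br H2 hf = 0"
    by (rule can; simp add: br_simps table numeral_sqm H1_H2)+
  have b': "br hf E = 0" "br hf A = A" using br_flip[OF b(3)] br_flip[OF b(1)] by simp_all
  have w: "br H1 hf = 0 \<cdot> hf" "br H2 hf = 0 \<cdot> hf" using b by simp_all
  have "xe A 1 * iot hf = (iot hf - iot A) * xe A 1"
    using xe_mult_conj[OF adm(1) nil(1) b(1), of 0 1] by (simp add: br_minus_right)
  moreover have "xe A' 1 * iot hf = (iot hf + iot A') * xe A' 1"
    using xe_mult_conj[OF adm(2) nil(2) b(2), of 0 1] by simp
  moreover have "cA (iot hf) = 0" "cA' (iot hf) = 0" "cC (iot hf) = 0" "cC' (iot hf) = 0" "cD (iot hf) = 0"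
    "cD' (iot hf) = 0" "cE (iot hf) = 0" "cE' (iot hf) = 0" "pE (iot hf) = 0" "qA (iot hf) = 1"
    by (simp_all add: c_defs cf_iot[OF w] pE_def qA_def b' cf_iot[OF weight_scal(1,2)] fn flip: iot_br)
  ultimately show ?thesis
    unfolding half_sum_def by (intro conjI allI impI Ad_adjoint[OF _ _ hf])
qed

lemma centralizer:
  fixes y w :: "('r::comm_ring_1, 'n) sqm"
  assumes w: "half_sum w" and y: "rpoint y"
    and S: "\<And>s. s \<in> {xe A 1, xe A' 1, xe C 1, xe E 1, xe D 1} \<Longrightarrow> y * s = s * y"
  obtains b where
    "xe D (- b) * y * iot D = iot D * (xe D (- b) * y)" "xe D (- b) * y * iot D' = iot D' * (xe D (- b) * y)"
    "xe D (- b) * y * iot C = iot C * (xe D (- b) * y)" "xe D (- b) * y * iot C' = iot C' * (xe D (- b) * y)"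
proof -
  have s1: "sdet y = 1" using y by (simp add: rpoint_def)
  have inv: "y * adjm y = 1" "adjm y * y = 1" using mult_adjm[of y] adjm_mult[OF s1] s1 by simp_all
  have cjy: "cj y (iot Z) (Ad y Z)" for Z
    by (simp add: cj_def Ad_def mult.assoc inv)
  have exp: "Ad y Z = root_part (Ad y Z) + pE (Ad y Z) \<cdot> iot H1 + qA (Ad y Z) \<cdot> w" if "Z \<in> basis" for Z
    using w y that unfolding half_sum_def by blast
  have wt: "cA w = 0" "cA' w = 0" "cC w = 0" "cC' w = 0" "cD w = 0" "cD' w = 0" "cE w = 0" "cE' w = 0"
    "pE w = 0" "qA w = 1"
    and conj_w: "xe A 1 * w = (w - iot A) * xe A 1" "xe A' 1 * w = (w + iot A') * xe A' 1"
    using w unfolding half_sum_def by auto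
  have xinv: "xe A 1 * xe A (- 1) = (1 :: ('r, 'n) sqm)" "xe A' 1 * xe A' (- 1) = (1 :: ('r, 'n) sqm)"
    "xe C 1 * xe C (- 1) = (1 :: ('r, 'n) sqm)" "xe E 1 * xe E (- 1) = (1 :: ('r, 'n) sqm)" "xe D 1 * xe D (- 1) = (1 :: ('r, 'n) sqm)"
    by (simp_all add: xe_inverse adm nil)
  have yA: "y * xe A 1 = xe A 1 * y" and yA': "y * xe A' 1 = xe A' 1 * y" and yC: "y * xe C 1 = xe C 1 * y"
    and yE: "y * xe E 1 = xe E 1 * y" and yD: "y * xe D 1 = xe D 1 * y" using S by simp_all
  \<comment> \<open>\<open>y\<close> commutes with \<open>xe A 1\<close> and \<open>xe A' 1\<close>,
    so the image of a vector fixed by both is fixed by both. Coordinates confine it to the span of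
    \<open>D\<close>, \<open>D'\<close> and \<open>H1\<close>.\<close>
  have fixA: "\<exists>d d' p. Ad y Z = d \<cdot> iot D + d' \<cdot> iot D' + p \<cdot> iot H1"
    if Z: "Z \<in> basis" "cj (xe A 1) (iot Z) (iot Z :: ('r, 'n) sqm)" "cj (xe A' 1) (iot Z) (iot Z :: ('r, 'n) sqm)" for Z
  proof -
    define v where "v = Ad y Z"
    define a a' c c' d d' e e' p q where "a = cA v" and "a' = cA' v" and "c = cC v" and "c' = cC' v"
      and "d = cD v" and "d' = cD' v" and "e = cE v" and "e' = cE' v" and "p = pE v" and "q = qA v"
    have v: "v = a \<cdot> iot A + a' \<cdot> iot A' + c \<cdot> iot C + c' \<cdot> iot C' + d \<cdot> iot D + d' \<cdot> iot D' + e \<cdot> iot E + e' \<cdot> iot E'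
      + p \<cdot> iot H1 + q \<cdot> w"
      using exp[OF Z(1)] unfolding root_part_def v_def[symmetric] a_def a'_def c_def c'_def d_def d'_def e_def e'_def p_def q_def .
    define v1 where "v1 = a \<cdot> iot A + a' \<cdot> (iot A' + iot H2 - iot A) + c \<cdot> iot C + c' \<cdot> (iot C' + iot E') + d \<cdot> iot D + d' \<cdot> iot D'
      + e \<cdot> (iot E - iot C) + e' \<cdot> iot E' + p \<cdot> iot H1 + q \<cdot> (w - iot A)"
    define v2 where "v2 = a \<cdot> (iot A - iot H2 - iot A') + a' \<cdot> iot A' + c \<cdot> (iot C - iot E) + c' \<cdot> iot C' + d \<cdot> iot D + d' \<cdot> iot D'
      + e \<cdot> iot E + e' \<cdot> (iot E' + iot C') + p \<cdot> iot H1 + q \<cdot> (w + iot A')"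
    have "cj (xe A 1) v v1" unfolding v v1_def
      by (intro cj_add cj_scal) (simp_all add: cj_def conj_A conj_w)
    then have "cj y (iot Z) v1" using cj_commuting[OF yA Z(2) cjy _ xinv(1)] by (simp add: v_def)
    then have 1: "v = v1" using cj_unique[OF cjy _ inv(1), of Z] by (simp add: v_def)
    have "cj (xe A' 1) v v2" unfolding v v2_def
      by (intro cj_add cj_scal) (simp_all add: cj_def conj_A' conj_w)
    then have "cj y (iot Z) v2" using cj_commuting[OF yA' Z(3) cjy _ xinv(2)] by (simp add: v_def)
    then have 2: "v = v2" using cj_unique[OF cjy _ inv(1), of Z] by (simp add: v_def)
    have f1: "f v = f v1" "f v = f v2" for f :: "('r, 'n) sqm \<Rightarrow> 'r" using 1 2 by simp_all
    have "a' = 0" using f1(1)[of pE] by (simp add: v v1_def pq_table wt)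
    moreover have "c' = 0" using f1(1)[of cE'] by (simp add: v v1_def c_table wt)
    moreover have "e = 0" using f1(1)[of cC] by (simp add: v v1_def c_table wt)
    moreover have "q = 0" using f1(1)[of cA] \<open>a' = 0\<close> by (simp add: v v1_def c_table wt)
    moreover have "a = 0" using f1(2)[of pE] by (simp add: v v2_def pq_table wt)
    moreover have "c = 0" using f1(2)[of cE] by (simp add: v v2_def c_table wt)
    moreover have "e' = 0" using f1(2)[of cC'] by (simp add: v v2_def c_table wt)
    ultimately show ?thesis unfolding v_def[symmetric] by (auto simp: v)
  qed
  have "cj (xe A 1) (iot D') (iot D' :: ('r, 'n) sqm)" "cj (xe A' 1) (iot D') (iot D' :: ('r, 'n) sqm)"
     "cj (xe A 1) (iot D) (iot D :: ('r, 'n) sqm)" "cj (xe A' 1) (iot D) (iot D :: ('r, 'n) sqm)"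
    by (simp_all add: cj_def conj_A conj_A')
  then obtain c a p c2 a2 p2 where v0: "Ad y D' = c \<cdot> iot D + a \<cdot> iot D' + p \<cdot> iot H1"
    and u0: "Ad y D = c2 \<cdot> iot D + a2 \<cdot> iot D' + p2 \<cdot> iot H1"
    using fixA[of D'] fixA[of D] unfolding basis_def by blast
  note v = cjy[of D', unfolded v0] and u = cjy[of D, unfolded u0]
  \<comment> \<open>\<open>xe C 1\<close> fixes \<open>D\<close> as well, hence also its image; this
    leaves a multiple of \<open>D\<close>.\<close>
  have "cj (xe C 1) (c2 \<cdot> iot D + a2 \<cdot> iot D' + p2 \<cdot> iot H1) (c2 \<cdot> iot D + a2 \<cdot> (iot D' + iot E' - iot A) + p2 \<cdot> (iot H1 - iot C))"
    by (intro cj_add cj_scal) (simp_all add: cj_def conj_C)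
  from cj_commuting[OF yC _ u this xinv(3), of "iot D"]
  have "cj y (iot D) (c2 \<cdot> iot D + a2 \<cdot> (iot D' + iot E' - iot A) + p2 \<cdot> (iot H1 - iot C))"
    by (simp add: cj_def conj_C)
  from cj_unique[OF this u inv(1)]
  have e: "f (c2 \<cdot> iot D + a2 \<cdot> (iot D' + iot E' - iot A) + p2 \<cdot> (iot H1 - iot C)) = f (c2 \<cdot> iot D + a2 \<cdot> iot D' + p2 \<cdot> iot H1)"
    for f :: "('r, 'n) sqm \<Rightarrow> 'r" by (rule arg_cong)
  have "a2 = 0" using e[of cE'] by (simp add: c_table)
  moreover have "p2 = 0" using e[of cC] by (simp add: c_table)
  ultimately have uD: "cj y (iot D) (c2 \<cdot> iot D)" using u by simp
  \<comment> \<open>Transporting the relation for \<open>D'\<close> by \<open>xe C 1\<close>, then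
    by \<open>xe D 1\<close>, and taking differences each time isolates \<open>C\<close>.\<close>
  let ?v = "c \<cdot> iot D + a \<cdot> iot D' + p \<cdot> iot H1"
  let ?vC = "c \<cdot> iot D + a \<cdot> (iot D' + iot E' - iot A) + p \<cdot> (iot H1 - iot C)"
  have "cj (xe C 1) ?v ?vC" by (intro cj_add cj_scal) (simp_all add: cj_def conj_C)
  from cj_commuting[OF yC _ v this xinv(3), of "iot D' + iot E' - iot A"]
  have "cj y (iot D' + iot E' - iot A) ?vC" by (simp add: cj_def conj_C)
  from cj_diff[OF this v] have f1: "cj y (iot E' - iot A) (a \<cdot> (iot E' - iot A) - p \<cdot> iot C)"
    by (simp add: scal.scale_right_distrib scal.scale_right_diff_distrib algebra_simps)
  have "cj (xe D 1) (a \<cdot> (iot E' - iot A) - p \<cdot> iot C) (a \<cdot> (iot E' - iot C - iot A) - p \<cdot> iot C)"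
    by (intro cj_diff cj_scal) (simp_all add: cj_def conj_D)
  from cj_commuting[OF yD _ f1 this xinv(5), of "iot E' - iot C - iot A"]
  have "cj y (iot E' - iot C - iot A) (a \<cdot> (iot E' - iot C - iot A) - p \<cdot> iot C)"
    by (simp add: cj_def conj_D right_diff_distrib left_diff_distrib)
  from cj_diff[OF f1 this] have fC: "cj y (iot C) (a \<cdot> iot C)"
    by (simp add: scal.scale_right_diff_distrib)
  \<comment> \<open>The same with \<open>xe E 1\<close> in place of \<open>xe C 1\<close> isolates
    \<open>E\<close>.\<close>
  let ?vE = "c \<cdot> iot D + a \<cdot> (iot D' - iot C' + iot A') + p \<cdot> (iot H1 - iot E)"
  have "cj (xe E 1) ?v ?vE" by (intro cj_add cj_scal) (simp_all add: cj_def conj_E)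
  from cj_commuting[OF yE _ v this xinv(4), of "iot D' - iot C' + iot A'"]
  have "cj y (iot D' - iot C' + iot A') ?vE" by (simp add: cj_def conj_E)
  from cj_diff[OF this v] have f2: "cj y (iot A' - iot C') (a \<cdot> (iot A' - iot C') - p \<cdot> iot E)"
    by (simp add: scal.scale_right_distrib scal.scale_right_diff_distrib algebra_simps)
  have "cj (xe D 1) (a \<cdot> (iot A' - iot C') - p \<cdot> iot E) (a \<cdot> (iot A' - (iot C' + iot E)) - p \<cdot> iot E)"
    by (intro cj_diff cj_scal) (simp_all add: cj_def conj_D)
  from cj_commuting[OF yD _ f2 this xinv(5), of "iot A' - (iot C' + iot E)"]
  have "cj y (iot A' - (iot C' + iot E)) (a \<cdot> (iot A' - (iot C' + iot E)) - p \<cdot> iot E)"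
    by (simp add: cj_def conj_D right_diff_distrib left_diff_distrib)
  from cj_diff[OF f2 this] have fE: "cj y (iot E) (a \<cdot> iot E)"
    by (simp add: scal.scale_right_diff_distrib scal.scale_right_distrib)
  interpret R: c2_table "iot A" "iot A'" "iot C" "iot C'" "iot D" "iot D'" "iot E" "iot E' :: ('r, 'n) sqm"
    by (rule c2_table_iot) (rule c2_table_axioms)
  have RH: "R.H1 = iot H1" "R.H2 = iot H2" by (simp_all add: R.H1_def R.H2_def H1_def H2_def iot_br)
  note Rt = R.table[unfolded RH]
  \<comment> \<open>\<open>[C, D'] = E'\<close>, and \<open>A\<close> is the difference of
    \<open>E'\<close> and \<open>E' - A\<close>.\<close>
  from cj_br[OF fC v] have fE': "cj y (iot E') ((a * a) \<cdot> iot E' - (a * p) \<cdot> iot C)"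
    by (simp add: br_simps Rt scal.scale_right_distrib mult.commute)
  from cj_diff[OF this f1] have fA: "cj y (iot A) ((a * a - a) \<cdot> iot E' + a \<cdot> iot A + (p - a * p) \<cdot> iot C)"
    by (simp add: scal.scale_left_diff_distrib scal.scale_right_diff_distrib algebra_simps)
  \<comment> \<open>\<open>xe D 1\<close> fixes \<open>A\<close> and hence its image, but it moves
    \<open>E'\<close>; so the coefficient of \<open>E'\<close> vanishes.\<close>
  have "cj (xe D 1) ((a * a - a) \<cdot> iot E' + a \<cdot> iot A + (p - a * p) \<cdot> iot C)
     ((a * a - a) \<cdot> (iot E' - iot C) + a \<cdot> iot A + (p - a * p) \<cdot> iot C)"
    by (intro cj_add cj_scal) (simp_all add: cj_def conj_D)
  from cj_commuting[OF yD _ fA this xinv(5), of "iot A"]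
  have "cj y (iot A) ((a * a - a) \<cdot> (iot E' - iot C) + a \<cdot> iot A + (p - a * p) \<cdot> iot C)"
    by (simp add: cj_def conj_D)
  from arg_cong[OF cj_unique[OF this fA inv(1)], of cC]
  have aa: "a * a = a" by (simp add: c_table)
  \<comment> \<open>An idempotent of \<open>R\<close> need not be 0 or 1. Here \<open>y\<close>,
    which is invertible, sends \<open>(1 - a) C\<close> to 0, and \<open>C\<close> has a coordinate
    equal to 1.\<close>
  have "cj y ((1 - a) \<cdot> iot C) ((1 - a) \<cdot> (a \<cdot> iot C))" by (rule cj_scal[OF fC])
  then have "y * ((1 - a) \<cdot> iot C) = 0" by (simp add: cj_def left_diff_distrib aa)
  then have "adjm y * (y * ((1 - a) \<cdot> iot C)) = 0" by simp
  then have "(1 - a) \<cdot> iot C = (0 :: ('r, 'n) sqm)" by (simp add: inv flip: mult.assoc)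
  from arg_cong[OF this, of cC] have a1: "a = 1" by (simp add: c_table)
  have E'1: "cj y (iot E') (iot E' - p \<cdot> iot C)" using fE' by (simp add: a1)
  \<comment> \<open>\<open>[D', E'] = 0\<close> determines \<open>c\<close>; then \<open>y\<close>
    moves \<open>D'\<close> exactly as \<open>xe D p\<close> does.\<close>
  from cj_br[OF v E'1] have "cj y 0 (- ((p * p + c) \<cdot> iot C))"
    by (simp add: a1 br_simps Rt scal.scale_left_distrib scal.scale_right_distrib scal.scale_right_diff_distrib
        algebra_simps)
  from cj_unique[OF this _ inv(1), of 0] have "- ((p * p + c) \<cdot> iot C) = (0 :: ('r, 'n) sqm)"
    by (simp add: cj_def)
  from arg_cong[OF this, of cC] have "c = - (p * p)" by (simp add: c_table add_eq_0_iff)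
  then have v': "cj y (iot D') (iot D' + p \<cdot> iot H1 - p^2 \<cdot> iot D)"
    using v by (simp add: a1 power2_eq_square algebra_simps)
  \<comment> \<open>\<open>[D, E'] = - C\<close>, and \<open>C\<close> is already known to be
    fixed.\<close>
  from cj_br[OF uD E'1] have "cj y (- iot C) (- (c2 \<cdot> iot C))"
    by (simp add: br_simps Rt)
  from cj_unique[OF this cj_minus[OF fC] inv(1)] have "c2 \<cdot> iot C = (iot C :: ('r, 'n) sqm)" by (simp add: a1)
  from arg_cong[OF this, of cC] have c2: "c2 = 1" by (simp add: c_table)
  let ?x = "xe D (- p) :: ('r, 'n) sqm"
  have zD: "cj (?x * y) (iot D) (iot D)"
    by (rule cj_mult[OF uD]) (simp add: cj_def conj_D c2)
  have zC: "cj (?x * y) (iot C) (iot C)"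
    by (rule cj_mult[OF fC]) (simp add: cj_def conj_D a1)
  have zE: "cj (?x * y) (iot E) (iot E)"
    by (rule cj_mult[OF fE]) (simp add: cj_def conj_D a1)
  have zD': "cj (?x * y) (iot D') (iot D')"
  proof (rule cj_mult[OF v'])
    have "cj ?x (iot D' + p \<cdot> iot H1 - p^2 \<cdot> iot D)
      (iot D' + (- p) \<cdot> iot H1 - (- p)^2 \<cdot> iot D + p \<cdot> (iot H1 - (2 * (- p)) \<cdot> iot D) - p^2 \<cdot> iot D)"
      by (intro cj_add cj_diff cj_scal) (simp_all add: cj_def conj_D)
    also have "iot D' + (- p) \<cdot> iot H1 - (- p)^2 \<cdot> iot D + p \<cdot> (iot H1 - (2 * (- p)) \<cdot> iot D) - p^2 \<cdot> iot D = iot D'"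
      by (rule sqm_eqI) (simp add: algebra_simps power2_eq_square)
    finally show "cj ?x (iot D' + p \<cdot> iot H1 - p^2 \<cdot> iot D) (iot D')" .
  qed
  from cj_br[OF zD' zE] have zC': "cj (?x * y) (iot C') (iot C')" by (simp add: Rt)
  show thesis using zD zD' zC zC' by (intro that[of p]) (simp_all add: cj_def)
qed

end

section \<open>Root subgroups as solution sets\<close>

context c2_wt
begin

lemma joint_eigen: "H1 * (P1 a * P2 b) = a \<cdot> (P1 a * P2 b)" "H2 * (P1 a * P2 b) = b \<cdot> (P1 a * P2 b)"
proof -
  show "H1 * (P1 a * P2 b) = a \<cdot> (P1 a * P2 b)"
    using W1.eig[of a] by (simp add: H1_def flip: mult.assoc)
  show "H2 * (P1 a * P2 b) = b \<cdot> (P1 a * P2 b)"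
    using W2.eig[of b] unfolding P1_P2 by (simp add: H2_def flip: mult.assoc)
qed

text \<open>\<open>(H1 + H2) / 2\<close> acts on the joint weight space \<open>(a, b)\<close> by the
  integer \<open>(a + b) / 2\<close>, so it is an integral combination of the projections.\<close>

lemma half_sum_even_weights:
  assumes "\<And>a b. P1 a * P2 b \<noteq> 0 \<Longrightarrow> even (a + b)"
  shows "\<exists>hf. 2 * hf = H1 + H2"
proof
  define hf where "hf = (\<Sum>a\<in>S1. \<Sum>b\<in>S2. ((a + b) div 2) \<cdot> (P1 a * P2 b))"
  have "2 * hf = (\<Sum>a\<in>S1. \<Sum>b\<in>S2. (a + b) \<cdot> (P1 a * P2 b))"
    unfolding hf_def numeral_sqm scal.scale_sum_right
  proof (intro sum.cong refl)
    fix a b show "2 \<cdot> (((a + b) div 2) \<cdot> (P1 a * P2 b)) = (a + b) \<cdot> (P1 a * P2 b)"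
    proof (cases "P1 a * P2 b = 0")
      case False
      then show ?thesis using assms[of a b] by simp
    qed simp
  qed
  also have "\<dots> = (\<Sum>a\<in>S1. \<Sum>b\<in>S2. (H1 + H2) * (P1 a * P2 b))"
    by (simp add: distrib_right joint_eigen scal.scale_left_distrib)
  also have "\<dots> = (H1 + H2) * ((\<Sum>a\<in>S1. P1 a) * (\<Sum>b\<in>S2. P2 b))"
    by (subst sum_product) (simp only: sum_distrib_left)
  finally show "2 * hf = H1 + H2" unfolding W1.sum1 W2.sum1 mult_1_right .
qed

lemma xe_D_commutes:
  "s \<in> {xe A 1, xe A' 1, xe C 1, xe E 1, xe D 1} \<Longrightarrow> xe D t * s = s * xe D t"
  by (auto intro!: xe_xe_commute simp: adm table commute)

lemma long_root_subgroup:
  fixes G :: "('r::comm_ring_1, 'n) sqm set"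
  assumes G: "\<And>g. g \<in> G \<Longrightarrow> rpoint g" "\<And>g h. g \<in> G \<Longrightarrow> h \<in> G \<Longrightarrow> g * h \<in> G" "\<And>t. xe D t \<in> G"
    and type: "(\<forall>a b. P1 a * P2 b \<noteq> 0 \<longrightarrow> even (a + b)) \<or> (2::'r) dvd 1"
  shows "\<exists>e. range (xe D) = {y ^ e | y. y \<in> G \<and>
    (\<forall>s\<in>{xe A 1, xe A' 1, xe C 1, xe E 1, xe D 1}. y * s = s * y)}"
proof -
  let ?S = "{xe A 1, xe A' 1, xe C 1, xe E 1, xe D 1} :: ('r, 'n) sqm set"
  have ex: "\<exists>b z. y = xe D b * z \<and> rpoint z \<and> z * iot D = iot D * z \<and> z * iot D' = iot D' * z
      \<and> z * iot C = iot C * z \<and> z * iot C' = iot C' * z"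
    if w: "half_sum w" and y: "y \<in> G" "\<forall>s\<in>?S. y * s = s * y" for y w :: "('r, 'n) sqm"
  proof -
    obtain b where b: 
      "xe D (- b) * y * iot D = iot D * (xe D (- b) * y)" "xe D (- b) * y * iot D' = iot D' * (xe D (- b) * y)"
      "xe D (- b) * y * iot C = iot C * (xe D (- b) * y)" "xe D (- b) * y * iot C' = iot C' * (xe D (- b) * y)"
      using centralizer[OF w G(1)[OF y(1)]] y(2) by blast
    have "rpoint (xe D (- b) * y)" by (intro G y)
    then show ?thesis using b
      by (intro exI[of _ b] exI[of _ "xe D (- b) * y"]) (simp add: xe_minus_cancel adm nil)
  qed
  show ?thesis
  proof (cases "\<forall>a b. P1 a * P2 b \<noteq> 0 \<longrightarrow> even (a + b)")
    case True
    then obtain hf where "2 * hf = H1 + H2" using half_sum_even_weights by blast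
    then have w: "half_sum (iot hf :: ('r, 'n) sqm)" by (rule half_sum_integral)
    have "y \<in> range (xe D)" if y: "y \<in> G" "\<forall>s\<in>?S. y * s = s * y" for y
    proof -
      obtain b z where "y = xe D b * z" and z: "rpoint z" "z * iot D = iot D * z" "z * iot D' = iot D' * z"
        "z * iot C = iot C * z" "z * iot C' = iot C' * z" using ex[OF w y] by blast
      moreover have "z = 1" using kernel_adjoint[OF z] True by blast
      ultimately show ?thesis by simp
    qed
    moreover have "\<exists>y. xe D t = y \<and> y \<in> G \<and> (\<forall>s\<in>?S. y * s = s * y)" for t
      using G(3) xe_D_commutes by blast
    ultimately show ?thesis by (intro exI[of _ 1]) (simp only: power_one_right, blast)
  next
    case False
    then have "(2::'r) dvd 1" using type by blast
    then obtain h :: 'r where "1 = 2 * h" by (elim dvdE)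
    then have h: "h * 2 = 1" by (simp add: mult.commute)
    note w = half_sum_half[OF h]
    have "y ^ 2 \<in> range (xe D)" if y: "y \<in> G" "\<forall>s\<in>?S. y * s = s * y" for y
    proof -
      obtain b z where yz: "y = xe D b * z" and z: "rpoint z" "z * iot D = iot D * z" "z * iot D' = iot D' * z"
        "z * iot C = iot C * z" "z * iot C' = iot C' * z" using ex[OF w y] by blast
      \<comment> \<open>The divided powers of \<open>D\<close> are the coefficients of
        \<open>xe D b\<close>, hence the use of \<open>kernel_commute\<close>.\<close>
      have "z * xe D b = xe D b * z"
        unfolding xe_def sum_distrib_left sum_distrib_right
        by (rule sum.cong) (simp_all add: kernel_commute[OF z])
      then have "y ^ 2 = (xe D b * xe D b) * (z * z)"
        unfolding yz power2_eq_square by (metis mult.assoc)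
      then have "y ^ 2 = xe D (b + b)"
        by (simp only: kernel_square[OF z] mult_1_right xe_add[OF adm(5) nil(5)])
      then show ?thesis by simp
    qed
    moreover have "\<exists>y. xe D t = y ^ 2 \<and> y \<in> G \<and> (\<forall>s\<in>?S. y * s = s * y)" for t
    proof -
      have "h * t + h * t = t" using h by (metis mult.assoc mult_1_left mult.commute mult_2)
      then have "xe D t = (xe D (h * t)) ^ 2" by (simp add: power2_eq_square adm nil flip: xe_add)
      then show ?thesis using G(3) xe_D_commutes by blast
    qed
    ultimately show ?thesis by (intro exI[of _ 2]) blast
  qed
qed

lemma short_root_subgroup:
  "range (xe C) = {g :: ('r::comm_ring_1, 'n) sqm. (\<exists>a\<in>range (xe A). \<exists>d\<in>range (xe D). xe E 1 * a = a * g * d * xe E 1) \<and>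
     (\<exists>d\<in>range (xe D). \<exists>a\<in>range (xe A). xe E' 1 * d = d * g * a * xe E' 1)}" (is "_ = ?R")
proof
  have 1: "xe E 1 * xe A t = xe A t * xe C t * xe D t * xe E (1 :: 'r)" for t
    by (rule xe_1_mult_xe) (simp_all add: adm nil table)
  have 2: "xe E' 1 * xe D t = xe D t * xe C t * xe A t * xe E' (1 :: 'r)" for t
    by (rule xe_1_mult_xe) (simp_all add: adm nil table)
  show "range (xe C) \<subseteq> ?R" using 1 2 by blast
  show "?R \<subseteq> range (xe C)"
  proof
    fix g assume "g \<in> ?R"
    then obtain t u r v where g: "xe E 1 * xe A t = xe A t * g * xe D u * xe E 1"
      "xe E' 1 * xe D r = xe D r * g * xe A v * xe E' 1" by blast
    have canc: "X = Y" if "P * X * Q = P * Y * Q" "P' * P = 1" "Q * Q' = 1" for P Q P' Q' X Y :: "('r, 'n) sqm"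
    proof -
      have "P' * (P * X * Q) * Q' = P' * (P * Y * Q) * Q'" using that by simp
      then have "(P' * P) * X * (Q * Q') = (P' * P) * Y * (Q * Q')" by (simp only: mult.assoc)
      then show ?thesis by (simp add: that)
    qed
    have dt: "xe D t = xe D (t - u) * xe D (u :: 'r)" for t u by (simp add: adm nil flip: xe_add)
    have at: "xe A t = xe A (t - u) * xe A (u :: 'r)" for t u by (simp add: adm nil flip: xe_add)
    have "xe A t * g * (xe D u * xe E 1) = xe A t * (xe C t * xe D (t - u)) * (xe D u * xe E 1)"
      using g(1) unfolding 1 by (subst (asm) dt[of t u]) (simp only: mult.assoc)
    then have g1: "g = xe C t * xe D (t - u)"
      by (rule canc[of _ _ _ _ "xe A (- t)" "xe E (- 1) * xe D (- u)"])
        (simp_all add: adm nil xe_inverse xe_minus_cancel mult.assoc)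
    have "xe D r * g * (xe A v * xe E' 1) = xe D r * (xe C r * xe A (r - v)) * (xe A v * xe E' 1)"
      using g(2) unfolding 2 by (subst (asm) at[of r v]) (simp only: mult.assoc)
    then have g2: "g = xe C r * xe A (r - v)"
      by (rule canc[of _ _ _ _ "xe D (- r)" "xe E' (- 1) * xe A (- v)"])
        (simp_all add: adm nil xe_inverse xe_minus_cancel mult.assoc)
    \<comment> \<open>The two forms of \<open>g\<close> give
      \<open>xe C c * xe D a = xe A b\<close>. The right side fixes \<open>D'\<close>, while the
      left side adds \<open>a H1\<close> to it, so \<open>a = 0\<close>.\<close>
    define a b c where "a = t - u" and "b = r - v" and "c = t - r"
    have "xe C c * xe D a = xe C (- r) * (xe C t * xe D a)"
      by (simp add: c_def adm nil mult.assoc[symmetric] flip: xe_add)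
    also have "\<dots> = xe C (- r) * (xe C r * xe A b)" using g1 g2 by (simp add: a_def b_def)
    finally have e: "xe C c * xe D a = xe A b" by (simp add: xe_minus_cancel adm nil)
    have "cj (xe C c * xe D a) (iot D') (iot D' + c \<cdot> iot E' - c^2 \<cdot> iot A + a \<cdot> (iot H1 - c \<cdot> iot C) - a^2 \<cdot> iot D)"
    proof (rule cj_mult)
      show "cj (xe D a) (iot D') (iot D' + a \<cdot> iot H1 - a^2 \<cdot> iot D)" by (simp add: cj_def conj_D)
      show "cj (xe C c) (iot D' + a \<cdot> iot H1 - a^2 \<cdot> iot D)
         (iot D' + c \<cdot> iot E' - c^2 \<cdot> iot A + a \<cdot> (iot H1 - c \<cdot> iot C) - a^2 \<cdot> iot D)"
        by (intro cj_add cj_diff cj_scal) (simp_all add: cj_def conj_C)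
    qed
    moreover have "cj (xe A b) (iot D') (iot D')" by (simp add: cj_def conj_A)
    ultimately have "iot D' + c \<cdot> iot E' - c^2 \<cdot> iot A + a \<cdot> (iot H1 - c \<cdot> iot C) - a^2 \<cdot> iot D = iot D'"
      unfolding e using cj_unique xe_inverse(1)[OF adm(1) nil(1), of b] by blast
    from arg_cong[OF this, of pE] have "a = 0" by (simp add: pq_table)
    then show "g \<in> range (xe C)" using g1 by (simp add: a_def)
  qed
qed

end

lemma scal_right_cancel: "a \<cdot> X = b \<cdot> X \<longleftrightarrow> a = b \<or> X = (0 :: ('a::idom, 'n::finite) sqm)"
  using scal_eq_0[of "a - b" X] by (simp add: scal.scale_left_diff_distrib)

text \<open>By the Jacobi identity the signs of five structure constants determine all others.\<close>

lemma c2_normalize: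
  fixes A A' C C' D D' E E' :: "(int, 'n::finite) sqm" and n m k :: int
  assumes sgn: "n \<in> {1, - 1}" "m \<in> {1, - 1}" "k \<in> {1, - 1}"
    and nz: "A \<noteq> 0" "C \<noteq> 0" "D \<noteq> 0"
    and EA: "br E A = C" and EC: "br E C = 2 \<cdot> D" and nC: "br E' A' = n \<cdot> C'" and mD: "br E' C' = (2 * m) \<cdot> D'"
    and kE: "br D C' = k \<cdot> E"
    and zero: "br E D = 0" "br A C = 0" "br A D = 0" "br C D = 0" "br E' D' = 0" "br A' C' = 0" "br A' D' = 0"
      "br C' D' = 0" "br E A' = 0" "br A E' = 0" "br A D' = 0" "br D A' = 0"
    and H: "br D D' = H1" "br A A' = H2" "br C C' = H1 + H2" "br E E' = H1 - H2"
    and w: "br H1 A = 0" "br H2 A = 2 \<cdot> A" "br H1 A' = 0" "br H2 A' = (- 2) \<cdot> A'"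
      "br H1 C = C" "br H2 C = C" "br H1 C' = - C'" "br H2 C' = - C'"
      "br H1 D = 2 \<cdot> D" "br H2 D = 0" "br H1 D' = (- 2) \<cdot> D'" "br H2 D' = 0"
      "br H1 E = E" "br H2 E = - E" "br H1 E' = - E'" "br H2 E' = E'"
  shows "c2_table A A' C C' D D' E E'"
proof -
  note wr = w[THEN br_flip]
  have can: "x = y" if "2 \<cdot> x = 2 \<cdot> y" for x y :: "(int, 'n) sqm"
    using that by (simp add: scal_cancel)
  have CE': "br C E' = - (2 \<cdot> A)"
    using jacobi_left[of E A E'] by (simp add: EA zero H br_simps wr)
  have CA': "br C A' = E"
    using jacobi_left[of E A A'] by (simp add: EA zero H br_simps wr)
  have DE': "br D E' = - C"
  proof (rule can)
    show "2 \<cdot> br D E' = 2 \<cdot> (- C)"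
      using jacobi_left[of E C E'] by (simp add: EC EA CE' H br_simps wr)
  qed
  \<comment> \<open>Expanding \<open>[C, [E', A']]\<close> by the Jacobi identity fixes
    \<open>n\<close>. Expanding \<open>[D, [E', C']]\<close> and testing on \<open>A\<close> and on
    \<open>D\<close> fixes \<open>k\<close> and \<open>m\<close>.\<close>
  have "n \<cdot> (H1 + H2) = br C (br E' A')" by (simp add: nC br_scal_right H)
  also have "\<dots> = - (H1 + H2)"
    unfolding jacobi_right[of C E'] using H(4)[THEN br_flip]
    by (simp add: CE' CA' br_simps H scal_two)
  finally have "br (n \<cdot> (H1 + H2)) C = br (- (H1 + H2)) C" by simp
  then have "(n * 2) \<cdot> C = (- 2) \<cdot> C" by (simp add: br_simps w scal_two flip: scal.scale_scale)
  then have n: "n = - 1" using nz unfolding scal_right_cancel by simp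
  have DC: "(2 * m) \<cdot> H1 = - (H1 + H2) - k \<cdot> (H1 - H2)"
    using jacobi_right[of D E' C'] H(4)[THEN br_flip]
    by (simp add: mD kE DE' br_simps H scal.scale_right_diff_distrib)
  have "br ((2 * m) \<cdot> H1) A = br (- (H1 + H2) - k \<cdot> (H1 - H2)) A" by (simp only: DC)
  then have "(k * 2) \<cdot> A = 2 \<cdot> A" by (simp add: br_simps w)
  then have k: "k = 1" using nz unfolding scal_right_cancel by simp
  have "br ((2 * m) \<cdot> H1) D = br (- (H1 + H2) - k \<cdot> (H1 - H2)) D" by (simp only: DC)
  then have "(2 * m * 2) \<cdot> D = (- 2 - 2) \<cdot> D" unfolding scal.scale_left_diff_distrib by (simp add: br_simps w k)
  then have m: "m = - 1" using nz unfolding scal_right_cancel by simp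
  \<comment> \<open>The remaining brackets follow by writing \<open>C'\<close> and
    \<open>2 D'\<close> as brackets; the factor 2 cancels for integer matrices.\<close>
  have C': "C' = - br E' A'" by (simp add: nC n)
  have D': "2 \<cdot> D' = - br E' C'" by (simp add: mD m)
  have EC': "br E C' = - (2 \<cdot> A')"
    by (subst C') (simp add: br_minus_right jacobi_right[of E E'] H zero br_simps w)
  have ED': "br E D' = - C'"
  proof (rule can)
    have "2 \<cdot> br E D' = br E (- br E' C')" by (simp add: br_scal_right flip: D')
    then show "2 \<cdot> br E D' = 2 \<cdot> (- C')"
      by (simp add: br_minus_right jacobi_right[of E E'] H EC' nC n br_simps w)
  qed
  have AC': "br A C' = E'"
    by (subst C') (simp add: br_minus_right jacobi_right[of A E'] H zero br_simps wr)
  have CD': "br C D' = E'"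
  proof (rule can)
    have "2 \<cdot> br C D' = br C (- br E' C')" by (simp add: br_scal_right flip: D')
    then show "2 \<cdot> br C D' = 2 \<cdot> E'"
      by (simp add: br_minus_right jacobi_right[of C E'] H CE' AC' br_simps wr)
  qed
  show ?thesis
    by unfold_locales (simp_all add: EA EC nC mD kE n m k zero H w CE' CA' DE' EC' ED' AC' CD' numeral_sqm)
qed

section \<open>The root system C2 and its Chevalley basis\<close>

lemma C2_iff:
  "\<alpha> \<in> C2 \<longleftrightarrow> (\<alpha> $ 1, \<alpha> $ 2) \<in> {(1, 1), (1, - 1), (- 1, 1), (- 1, - 1), (2, 0), (- 2, 0), (0, 2), (0, - 2)}"
  by (auto simp: C2_def Let_def vec_eq_iff forall_2 axis_def)

lemma inner_real2: "\<alpha> \<bullet> \<beta> = \<alpha> $ 1 * \<beta> $ 1 + \<alpha> $ 2 * (\<beta> :: real^2) $ 2"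
  by (simp add: inner_vec_def sum_2)

lemma C2_norm: "\<alpha> \<in> C2 \<Longrightarrow> \<alpha> \<bullet> \<alpha> \<in> {2, 4}"
  unfolding C2_iff inner_real2 by (elim insertE emptyE Pair_inject; simp)

lemma C2_minus: "\<alpha> \<in> C2 \<Longrightarrow> - \<alpha> \<in> C2"
  unfolding C2_iff by (elim insertE emptyE Pair_inject; simp)

text \<open>Unless both roots are short, comparing squared lengths forces
  \<open>\<alpha> \<bullet> \<beta> \<le> - 1\<close>, and then \<open>\<beta> - k \<alpha>\<close>
  with \<open>k > 0\<close> is longer than any root.\<close>

lemma C2_string_long:
  assumes "\<alpha> \<in> C2" "\<beta> \<in> C2" "\<alpha> + \<beta> \<in> C2" "\<not> (\<alpha> \<bullet> \<alpha> = 2 \<and> \<beta> \<bullet> \<beta> = 2)"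
  shows "(GREATEST k::nat. \<beta> - of_nat k *\<^sub>R \<alpha> \<in> C2) = 0"
proof (rule Greatest_equality)
  show "\<beta> - of_nat 0 *\<^sub>R \<alpha> \<in> C2" using assms(2) by simp
  fix k assume k: "\<beta> - of_nat k *\<^sub>R \<alpha> \<in> C2"
  have "(\<alpha> + \<beta>) \<bullet> (\<alpha> + \<beta>) = \<alpha> \<bullet> \<alpha> + \<beta> \<bullet> \<beta> + 2 * (\<alpha> \<bullet> \<beta>)"
    by (simp add: inner_add_left inner_add_right inner_commute)
  then have neg: "\<alpha> \<bullet> \<beta> \<le> - 1"
    using C2_norm[OF assms(1)] C2_norm[OF assms(2)] C2_norm[OF assms(3)] assms(4) by auto
  have n: "(\<beta> - of_nat k *\<^sub>R \<alpha>) \<bullet> (\<beta> - of_nat k *\<^sub>R \<alpha>)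
     = \<beta> \<bullet> \<beta> - 2 * (real k * (\<alpha> \<bullet> \<beta>)) + real k * real k * (\<alpha> \<bullet> \<alpha>)"
    by (simp add: inner_diff_left inner_diff_right inner_commute algebra_simps)
  show "k \<le> 0"
  proof (rule ccontr)
    assume "\<not> k \<le> 0"
    then have k1: "real k \<ge> 1" by simp
    then have kn: "real k * (\<alpha> \<bullet> \<beta>) \<le> - 1" using neg mult_mono[of 1 "real k" 1 "- (\<alpha> \<bullet> \<beta>)"] by simp
    have kk: "real k * real k \<ge> 1" using mult_mono[OF k1 k1] by simp
    have "(\<beta> - of_nat k *\<^sub>R \<alpha>) \<bullet> (\<beta> - of_nat k *\<^sub>R \<alpha>) \<le> 4" using C2_norm[OF k] by auto
    moreover have "\<alpha> \<bullet> \<alpha> = 4 \<and> \<beta> \<bullet> \<beta> \<ge> 2 \<or> \<alpha> \<bullet> \<alpha> = 2 \<and> \<beta> \<bullet> \<beta> = 4"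
      using C2_norm[OF assms(1)] C2_norm[OF assms(2)] assms(4) by auto
    ultimately show False unfolding n using kn kk by (elim disjE conjE) simp_all
  qed
qed

text \<open>Two short roots whose sum is a root are orthogonal; their difference is a root too, and
  \<open>\<beta> - k \<alpha>\<close> is too long for \<open>k \<ge> 2\<close>. This is the source
  of the structure constants 2 and -2.\<close>

lemma C2_string_short:
  assumes "\<alpha> \<in> C2" "\<beta> \<in> C2" "\<alpha> + \<beta> \<in> C2" "\<alpha> \<bullet> \<alpha> = 2" "\<beta> \<bullet> \<beta> = 2"
  shows "(GREATEST k::nat. \<beta> - of_nat k *\<^sub>R \<alpha> \<in> C2) = 1"
proof (rule Greatest_equality)
  have short: "v $ 1 \<in> {1, - 1} \<and> v $ 2 \<in> {1, - 1}" if "v \<in> C2" "v \<bullet> v = 2" for v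
    using that by (auto simp: C2_iff inner_real2)
  have *: "\<beta> - \<alpha> \<in> C2 \<and> \<alpha> \<bullet> \<beta> = 0"
    using short[OF assms(1,4)] short[OF assms(2,5)] assms(3)
    by (elim conjE insertE emptyE) (simp_all add: C2_iff inner_real2)
  then show "\<beta> - of_nat 1 *\<^sub>R \<alpha> \<in> C2" by simp
  fix k assume k: "\<beta> - of_nat k *\<^sub>R \<alpha> \<in> C2"
  have n: "(\<beta> - of_nat k *\<^sub>R \<alpha>) \<bullet> (\<beta> - of_nat k *\<^sub>R \<alpha>)
     = \<beta> \<bullet> \<beta> - 2 * (real k * (\<alpha> \<bullet> \<beta>)) + real k * real k * (\<alpha> \<bullet> \<alpha>)"
    by (simp add: inner_diff_left inner_diff_right inner_commute algebra_simps)
  show "k \<le> 1"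
  proof (rule ccontr)
    assume "\<not> k \<le> 1"
    then have "real k \<ge> 2" by simp
    then have "real k * real k \<ge> 2 * 2" by (intro mult_mono) auto
    then show False using n C2_norm[OF k] assms * by auto
  qed
qed

text \<open>The images of \<open>(e\<^sub>1, e\<^sub>2)\<close> under the Weyl group.\<close>

definition frame :: "real^2 \<Rightarrow> real^2 \<Rightarrow> bool" where
  "frame f g \<longleftrightarrow> (f $ 1, f $ 2, g $ 1, g $ 2) \<in>
     {(1, 0, 0, 1), (1, 0, 0, - 1), (- 1, 0, 0, 1), (- 1, 0, 0, - 1),
      (0, 1, 1, 0), (0, 1, - 1, 0), (0, - 1, 1, 0), (0, - 1, - 1, 0)}"

lemma frame_swap: "frame f g \<Longrightarrow> frame g f"
  unfolding frame_def by (elim insertE emptyE Pair_inject; simp)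

lemma frame_roots:
  assumes "frame f g"
  shows "f + g \<in> C2" "- (f + g) \<in> C2" "f - g \<in> C2" "g - f \<in> C2"
    "2 *\<^sub>R f \<in> C2" "- (2 *\<^sub>R f) \<in> C2" "2 *\<^sub>R g \<in> C2" "- (2 *\<^sub>R g) \<in> C2"
  by (insert assms; unfold frame_def; elim insertE emptyE Pair_inject; simp add: C2_iff)+

text \<open>The sums of roots behind the twelve vanishing brackets in
  \<open>frame_sys\<close>.\<close>

lemma frame_nonroots:
  assumes "frame f g"
  shows "3 *\<^sub>R f - g \<notin> C2" "f + 3 *\<^sub>R g \<notin> C2" "2 *\<^sub>R f + 2 *\<^sub>R g \<notin> C2" "3 *\<^sub>R f + g \<notin> C2"
    "- (3 *\<^sub>R f) + g \<notin> C2" "- f - 3 *\<^sub>R g \<notin> C2" "- (2 *\<^sub>R f) - 2 *\<^sub>R g \<notin> C2" "- (3 *\<^sub>R f) - g \<notin> C2"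
    "f - 3 *\<^sub>R g \<notin> C2" "- f + 3 *\<^sub>R g \<notin> C2" "2 *\<^sub>R g - 2 *\<^sub>R f \<notin> C2" "2 *\<^sub>R f - 2 *\<^sub>R g \<notin> C2"
  by (insert assms; unfold frame_def; elim insertE emptyE Pair_inject; simp add: C2_iff)+

lemma frame_cases:
  assumes "frame f g" "\<alpha> \<in> C2"
  shows "\<alpha> \<in> {f + g, - (f + g), f - g, g - f, 2 *\<^sub>R f, - (2 *\<^sub>R f), 2 *\<^sub>R g, - (2 *\<^sub>R g)}"
  using assms unfolding frame_def C2_iff
  by (elim insertE emptyE Pair_inject; simp add: vec_eq_iff forall_2)

lemma frame_inner: "frame f g \<Longrightarrow> f \<bullet> f = 1 \<and> g \<bullet> g = 1 \<and> f \<bullet> g = 0 \<and> g \<bullet> f = 0"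
  unfolding frame_def by (elim insertE emptyE Pair_inject; simp add: inner_real2)

lemma frame_expansion: "frame f g \<Longrightarrow> u = (u \<bullet> f) *\<^sub>R f + (u \<bullet> g) *\<^sub>R g"
  unfolding frame_def by (elim insertE emptyE Pair_inject; simp add: inner_real2 vec_eq_iff forall_2)

text \<open>Vectors of the root lattice have integral coordinates with even sum; passing to a frame
  permutes the coordinates and changes signs, which keeps the parity.\<close>

lemma frame_parity:
  fixes m n :: int
  assumes "frame f g" "of_int m *\<^sub>R f + of_int n *\<^sub>R g \<in> root_lattice C2"
  shows "even (m + n)"
proof -
  have *: "\<exists>i j :: int. v $ 1 = of_int i \<and> v $ 2 = of_int j \<and> even (i + j)" if "v \<in> root_lattice C2" for v
    using that unfolding root_lattice_def
  proof (induction v rule: group_closure.induct)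
    case (base s)
    have "\<exists>i j :: int. s $ 1 = of_int i \<and> s $ 2 = of_int j \<and> even (i + j)"
      if "s $ 1 = of_int i" "s $ 2 = of_int j" "even (i + j)" for i j :: int using that by blast
    from this[of 1 1] this[of 1 "-1"] this[of "-1" 1] this[of "-1" "-1"] this[of 2 0] this[of "-2" 0]
      this[of 0 2] this[of 0 "-2"] this[of 0 0] base show ?case
      by (auto simp: C2_iff)
  next
    case (diff s t)
    then obtain i j k l :: int where "s $ 1 = of_int i" "s $ 2 = of_int j" "even (i + j)"
      "t $ 1 = of_int k" "t $ 2 = of_int l" "even (k + l)" by blast
    then show ?case by (intro exI[of _ "i - k"] exI[of _ "j - l"]) auto
  qed
  from *[OF assms(2)] obtain i j :: int where
    ij: "(of_int m *\<^sub>R f + of_int n *\<^sub>R g) $ 1 = of_int i" "(of_int m *\<^sub>R f + of_int n *\<^sub>R g) $ 2 = of_int j" "even (i + j)"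
    by blast
  have e: "even (m + n)" if "real_of_int i + real_of_int j = of_int (a * m + b * n)" "odd a" "odd b" for a b :: int
  proof -
    have "i + j = a * m + b * n" using that(1) by (simp only: of_int_add[symmetric] of_int_eq_iff)
    then have "even (a * m + b * n)" using ij(3) by simp
    then show ?thesis using that(2,3) by simp
  qed
  have "real_of_int i + real_of_int j = of_int m * (f $ 1 + f $ 2) + of_int n * (g $ 1 + g $ 2)"
    using ij(1,2) by (simp add: algebra_simps)
  moreover have "\<exists>a b :: int. odd a \<and> odd b \<and> f $ 1 + f $ 2 = of_int a \<and> g $ 1 + g $ 2 = of_int b"
  proof -
    have *: "\<exists>a::int. odd a \<and> x = of_int a" if "x \<in> {1, - 1}" for x :: real
      using that by (auto intro: exI[of _ 1] exI[of _ "- 1"])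
    have f: "f $ 1 + f $ 2 \<in> {1, - 1}"
      by (insert assms(1), unfold frame_def, elim insertE emptyE Pair_inject; simp)
    have g: "g $ 1 + g $ 2 \<in> {1, - 1}"
      by (insert assms(1), unfold frame_def, elim insertE emptyE Pair_inject; simp)
    obtain a b :: int where "odd a" "f $ 1 + f $ 2 = of_int a" "odd b" "g $ 1 + g $ 2 = of_int b"
      using *[OF f] *[OF g] by (elim exE conjE)
    then show ?thesis by (intro exI[of _ a] exI[of _ b]) simp
  qed
  ultimately obtain a b :: int where "odd a" "odd b" "real_of_int i + real_of_int j = of_int (a * m + b * n)"
    by (auto simp: mult.commute)
  then show ?thesis using e by blast
qed

section \<open>From a Chevalley basis to the table\<close>

text \<open>The entries of \<open>X ^ k\<close> are divisible by \<open>k!\<close> but bounded by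
  \<open>c ^ k\<close>, so they vanish once \<open>k!\<close> exceeds \<open>c ^ k\<close>.\<close>

lemma admissible_imp_nilpotent:
  fixes X :: "(int, 'n::finite) sqm"
  assumes "adm X" shows "nilp X"
proof -
  define M where "M = (\<Sum>i\<in>UNIV. \<Sum>j\<in>UNIV. \<bar>ent X i j\<bar>)"
  have le: "\<bar>ent X i j\<bar> \<le> M" for i j
  proof -
    have "\<bar>ent X i j\<bar> \<le> (\<Sum>j\<in>UNIV. \<bar>ent X i j\<bar>)" by (rule member_le_sum) auto
    also have "\<dots> \<le> M" unfolding M_def by (rule member_le_sum) (auto intro: sum_nonneg)
    finally show ?thesis .
  qed
  define c where "c = int CARD('n) * M"
  have M0: "M \<ge> 0" unfolding M_def by (intro sum_nonneg) auto
  have bound: "\<bar>ent (X ^ k) i j\<bar> \<le> c ^ k" for k i j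
  proof (induction k arbitrary: i j)
    case (Suc k)
    have "\<bar>ent (X ^ Suc k) i j\<bar> \<le> (\<Sum>l\<in>UNIV. \<bar>ent X i l * ent (X ^ k) l j\<bar>)"
      unfolding power_Suc ent_mult by (rule sum_abs)
    also have "\<dots> \<le> (\<Sum>l\<in>(UNIV::'n set). M * c ^ k)"
      using le Suc M0 by (intro sum_mono) (simp add: abs_mult mult_mono)
    finally show ?case by (simp add: c_def mult.assoc)
  qed (simp add: ent_1)
  have "(\<lambda>k. inverse (fact k) * (real_of_int c) ^ k) \<longlonglongrightarrow> 0"
    by (rule summable_LIMSEQ_zero[OF summable_exp])
  then have "\<forall>\<^sub>F k in sequentially. inverse (fact k) * (real_of_int c) ^ k < 1"
    by (rule order_tendstoD) simp
  then obtain k where "inverse (fact k) * (real_of_int c) ^ k < 1"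
    by (auto simp: eventually_sequentially)
  then have "real_of_int (c ^ k) < real_of_int (fact k)" by (simp add: field_simps)
  then have k: "c ^ k < fact k" by (simp only: of_int_less_iff)
  have "ent (dp X k) i j = 0" for i j
  proof (rule ccontr)
    assume nz: "ent (dp X k) i j \<noteq> 0"
    have "ent (X ^ k) i j = fact k * ent (dp X k) i j"
      by (simp flip: fact_dp[OF assms])
    then have "\<bar>ent (X ^ k) i j\<bar> = fact k * \<bar>ent (dp X k) i j\<bar>" by (simp add: abs_mult)
    moreover have "fact k * \<bar>ent (dp X k) i j\<bar> \<ge> fact k * 1" using nz by (intro mult_left_mono) auto
    ultimately show False using bound[of k i j] k by simp
  qed
  then have "dp X k = 0" by (intro sqm_eqI) simp
  then have "X ^ k = 0" by (simp flip: fact_dp[OF assms])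
  then show ?thesis unfolding nilp_def by (rule nilpotent_power_CARD_int)
qed

lemma mat_power_sqm: "mat_power A k = Rep_sqm (Abs_sqm A ^ k)"
  unfolding mat_power_def
  by (induction k) (simp_all add: times_sqm.rep_eq one_sqm.rep_eq Abs_sqm_inverse)

locale c2_rep = chevalley_basis smul lie C2 C2_base h x
  for smul :: "complex \<Rightarrow> 'l::ab_group_add \<Rightarrow> 'l" and lie and h x :: "real^2 \<Rightarrow> 'l" +
  fixes \<pi> :: "'l \<Rightarrow> complex^'n^'n"
  assumes rep: "lie_representation smul lie \<pi>" and inj: "inj \<pi>"
    and admissible: "admissible C2 (\<lambda>\<alpha>. \<pi> (x \<alpha>))"
begin

definition \<rho> :: "'l \<Rightarrow> (complex, 'n) sqm" where "\<rho> a = Abs_sqm (\<pi> a)"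

lemma \<rho>_add: "\<rho> (a + b) = \<rho> a + \<rho> b"
  and \<rho>_smul: "\<rho> (smul c a) = c \<cdot> \<rho> a"
  and \<rho>_lie: "\<rho> (lie a b) = br (\<rho> a) (\<rho> b)"
proof -
  interpret lin: Vector_Spaces.linear smul "\<lambda>c A. \<chi> i j. c * A $ i $ j" \<pi>
    using rep unfolding lie_representation_def by blast
  show "\<rho> (a + b) = \<rho> a + \<rho> b"
    by (simp add: \<rho>_def lin.add plus_sqm.abs_eq)
  show "\<rho> (smul c a) = c \<cdot> \<rho> a"
    by (rule sqm_eqI) (simp add: \<rho>_def lin.scale ent.abs_eq)
  have "\<pi> (lie a b) = \<pi> a ** \<pi> b - \<pi> b ** \<pi> a"
    using rep unfolding lie_representation_def by blast
  then show "\<rho> (lie a b) = br (\<rho> a) (\<rho> b)"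
    by (simp add: \<rho>_def br_def times_sqm.abs_eq minus_sqm.abs_eq)
qed

lemma \<rho>_0 [simp]: "\<rho> 0 = 0" using \<rho>_smul[of 0 0] by simp

lemma \<rho>_inj: "\<rho> a = \<rho> b \<longleftrightarrow> a = b"
  using inj by (simp add: \<rho>_def Abs_sqm_inject inj_eq)

definition Xi :: "real^2 \<Rightarrow> (int, 'n) sqm" where
  "Xi \<alpha> = msqm (\<lambda>i j. \<lfloor>Re (\<pi> (x \<alpha>) $ i $ j)\<rfloor>)"

lemma divided_power_int:
  assumes "\<alpha> \<in> C2"
  shows "of_int \<lfloor>Re (divided_power (\<pi> (x \<alpha>)) k $ i $ j)\<rfloor> = divided_power (\<pi> (x \<alpha>)) k $ i $ j"
proof -
  have "divided_power (\<pi> (x \<alpha>)) k $ i $ j \<in> \<int>" using admissible assms unfolding admissible_def by blast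
  then obtain m :: int where "divided_power (\<pi> (x \<alpha>)) k $ i $ j = of_int m" by (elim Ints_cases)
  then show ?thesis by simp
qed

lemma divided_power_ent:
  "divided_power (\<pi> (x \<alpha>)) k $ i $ j = ent ((1 / fact k) \<cdot> \<rho> (x \<alpha>) ^ k) i j"
  unfolding ent_scal unfolding divided_power_def vector_scaleR_component mat_power_sqm \<rho>_def ent.rep_eq
  by (simp add: scaleR_conv_of_real)

lemma iot_Xi: "\<alpha> \<in> C2 \<Longrightarrow> iot (Xi \<alpha>) = \<rho> (x \<alpha>)"
  using divided_power_int[of \<alpha> 1] unfolding divided_power_ent
  by (intro sqm_eqI) (simp add: Xi_def \<rho>_def ent.abs_eq)

lemma Xi_dp:
  assumes "\<alpha> \<in> C2"
  shows "adm (Xi \<alpha>)" "ent (dp (Xi \<alpha>) k) i j = \<lfloor>Re (divided_power (\<pi> (x \<alpha>)) k $ i $ j)\<rfloor>"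
proof -
  define W where "W k = msqm (\<lambda>i j. \<lfloor>Re (divided_power (\<pi> (x \<alpha>)) k $ i $ j)\<rfloor>)" for k
  have iW: "iot (W k) = (1 / fact k) \<cdot> \<rho> (x \<alpha>) ^ k" for k
    by (rule sqm_eqI) (simp only: W_def ent_iot ent_msqm divided_power_int[OF assms], rule divided_power_ent)
  have "iot (fact k \<cdot> W k) = (iot (Xi \<alpha> ^ k) :: (complex, 'n) sqm)" for k
    by (simp add: iW iot_Xi assms)
  then have W: "fact k \<cdot> W k = Xi \<alpha> ^ k" for k by (simp only: iot_inj)
  then show "adm (Xi \<alpha>)" unfolding adm_def by blast
  show "ent (dp (Xi \<alpha>) k) i j = \<lfloor>Re (divided_power (\<pi> (x \<alpha>)) k $ i $ j)\<rfloor>"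
    using dp_unique[OF W, of k] by (simp add: W_def)
qed

lemma Xi_nilp: "\<alpha> \<in> C2 \<Longrightarrow> nilp (Xi \<alpha>)"
  by (rule admissible_imp_nilpotent) (rule Xi_dp)

lemma unipotent_eq:
  assumes "\<alpha> \<in> C2"
  shows "unipotent (\<pi> (x \<alpha>)) t = Rep_sqm (xe (Xi \<alpha>) t)"
proof -
  have "unipotent (\<pi> (x \<alpha>)) t $ i $ j = ent (xe (Xi \<alpha>) t) i j" for i j
    by (simp add: unipotent_def xe_def Xi_dp[OF assms])
  then show ?thesis by (simp add: vec_eq_iff ent.rep_eq)
qed

lemma Xi_nonzero: "\<alpha> \<in> C2 \<Longrightarrow> Xi \<alpha> \<noteq> 0"
proof
  assume a: "\<alpha> \<in> C2" "Xi \<alpha> = 0"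
  then have "\<rho> (x \<alpha>) = \<rho> 0" using iot_Xi[of \<alpha>] by simp
  then have "x \<alpha> = 0" by (simp only: \<rho>_inj)
  moreover have "x \<alpha> \<in> case_sum h x ` (C2_base <+> C2)"
    using a(1) by (intro image_eqI[of _ _ "Inr \<alpha>"]) auto
  ultimately show False using independent_basis dependent_zero by metis
qed

lemma Xi_bracket:
  assumes "\<alpha> \<in> C2" "\<beta> \<in> C2" "\<alpha> + \<beta> \<in> C2"
  obtains s :: int where "s \<in> {1, - 1}"
    "br (Xi \<alpha>) (Xi \<beta>) = (s * (if \<alpha> \<bullet> \<alpha> = 2 \<and> \<beta> \<bullet> \<beta> = 2 then 2 else 1)) \<cdot> Xi (\<alpha> + \<beta>)"
proof -
  define N :: int where "N = (if \<alpha> \<bullet> \<alpha> = 2 \<and> \<beta> \<bullet> \<beta> = 2 then 2 else 1)"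
  define r where "r = (GREATEST k::nat. \<beta> - of_nat k *\<^sub>R \<alpha> \<in> C2)"
  have "int (r + 1) = N"
    using C2_string_long[OF assms] C2_string_short[OF assms] by (auto simp: r_def N_def)
  then have N: "of_nat (r + 1) = (of_int N :: complex)" by (metis of_int_of_nat_eq)
  from lie_root_root[OF assms r_def]
  obtain s :: int where s: "s \<in> {1, - 1}" "lie (x \<alpha>) (x \<beta>) = smul (of_int (s * N)) (x (\<alpha> + \<beta>))"
  proof
    assume "lie (x \<alpha>) (x \<beta>) = smul (of_nat (r + 1)) (x (\<alpha> + \<beta>))"
    then show thesis using that[of 1] N by simp
  next
    assume "lie (x \<alpha>) (x \<beta>) = smul (- of_nat (r + 1)) (x (\<alpha> + \<beta>))"
    moreover have "- of_nat (r + 1) = (of_int (- 1 * N) :: complex)" unfolding N by simp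
    ultimately show thesis using that[of "- 1"] by (simp only: insert_iff simp_thms)
  qed
  have "iot (br (Xi \<alpha>) (Xi \<beta>)) = (iot ((s * N) \<cdot> Xi (\<alpha> + \<beta>)) :: (complex, 'n) sqm)"
    using s(2) by (simp add: iot_br iot_Xi assms flip: \<rho>_lie) (simp add: \<rho>_smul)
  then show thesis using that[OF s(1)] by (simp only: iot_inj N_def)
qed

lemma Xi_commute:
  assumes "\<alpha> \<in> C2" "\<beta> \<in> C2" "\<alpha> + \<beta> \<notin> C2" "\<alpha> + \<beta> \<noteq> 0"
  shows "br (Xi \<alpha>) (Xi \<beta>) = 0"
proof -
  have "iot (br (Xi \<alpha>) (Xi \<beta>)) = (0 :: (complex, 'n) sqm)"
    using lie_root_nonroot[OF assms] by (simp add: iot_br iot_Xi assms flip: \<rho>_lie)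
  then show ?thesis by (simp only: iot_eq_0)
qed

text \<open>The element of the Cartan subalgebra on which the functional \<open>\<mu>\<close> takes the value \<open>\<mu> \<bullet> u\<close>.\<close>

definition hv :: "real^2 \<Rightarrow> 'l" where
  "hv u = smul (of_real (u $ 1)) (h (axis 1 1 - axis 2 1)) + smul (of_real (u $ 1 + u $ 2)) (h (2 *\<^sub>R axis 2 1))"

lemma hv_add: "hv (u + v) = hv u + hv v"
  by (simp add: hv_def scale_left_distrib)

lemma hv_scale: "hv (r *\<^sub>R u) = smul (of_real r) (hv u)"
  by (simp add: hv_def scale_right_distrib flip: distrib_left)

lemma base_coroot: "coroot (axis 1 1 - axis 2 1 :: real^2) = axis 1 1 - axis 2 1"
  "coroot (2 *\<^sub>R axis 2 1 :: real^2) = axis 2 1"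
  by (simp_all add: coroot_def inner_real2 axis_def vec_eq_iff forall_2)

lemma base_distinct: "axis 1 1 - axis 2 1 \<noteq> (2 *\<^sub>R axis 2 1 :: real^2)"
  by (simp add: vec_eq_iff forall_2 axis_def)

lemma hv_base: "\<delta> \<in> C2_base \<Longrightarrow> h \<delta> = hv (coroot \<delta>)"
  unfolding C2_base_def by (auto simp: base_coroot) (simp_all add: hv_def axis_def)

lemma lie_opposite_hv:
  assumes "\<alpha> \<in> C2" shows "lie (x \<alpha>) (x (- \<alpha>)) = hv (coroot \<alpha>)"
proof -
  obtain c :: "real^2 \<Rightarrow> int" where c: "coroot \<alpha> = (\<Sum>\<delta>\<in>C2_base. of_int (c \<delta>) *\<^sub>R coroot \<delta>)"
    "lie (x \<alpha>) (x (- \<alpha>)) = (\<Sum>\<delta>\<in>C2_base. smul (of_int (c \<delta>)) (h \<delta>))"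
    using lie_opposite[OF assms] by blast
  let ?a = "axis 1 1 - axis 2 1 :: real^2" and ?b = "2 *\<^sub>R axis 2 1 :: real^2"
  have "coroot \<alpha> = of_int (c ?a) *\<^sub>R ?a + of_int (c ?b) *\<^sub>R axis 2 1"
    using c(1) base_distinct by (simp add: C2_base_def base_coroot)
  then have "coroot \<alpha> $ 1 = of_int (c ?a)" "coroot \<alpha> $ 1 + coroot \<alpha> $ 2 = of_int (c ?b)"
    by (simp_all add: axis_def)
  then show ?thesis using c(2) base_distinct by (simp add: C2_base_def hv_def)
qed

lemma lie_add_left: "lie (a + b) c = lie a c + lie b c"
  and lie_smul_left: "lie (smul r a) c = smul r (lie a c)"
proof -
  interpret l: Vector_Spaces.linear smul smul "\<lambda>a. lie a c" by (rule lie_linear_left)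
  show "lie (a + b) c = lie a c + lie b c" "lie (smul r a) c = smul r (lie a c)"
    by (rule l.add, rule l.scale)
qed

lemma lie_hv:
  assumes "\<beta> \<in> C2" shows "lie (hv u) (x \<beta>) = smul (of_real (\<beta> \<bullet> u)) (x \<beta>)"
proof -
  let ?a = "axis 1 1 - axis 2 1 :: real^2" and ?b = "2 *\<^sub>R axis 2 1 :: real^2"
  have "lie (h ?a) (x \<beta>) = smul (of_real (\<beta> \<bullet> coroot ?a)) (x \<beta>)"
    "lie (h ?b) (x \<beta>) = smul (of_real (\<beta> \<bullet> coroot ?b)) (x \<beta>)"
    by (rule lie_h_root; simp add: C2_base_def assms)+
  then have "lie (hv u) (x \<beta>) = smul (of_real (u $ 1 * (\<beta> \<bullet> coroot ?a) + (u $ 1 + u $ 2) * (\<beta> \<bullet> coroot ?b))) (x \<beta>)"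
    by (simp add: hv_def lie_add_left lie_smul_left scale_left_distrib distrib_right)
  also have "u $ 1 * (\<beta> \<bullet> coroot ?a) + (u $ 1 + u $ 2) * (\<beta> \<bullet> coroot ?b) = \<beta> \<bullet> u"
    unfolding base_coroot by (simp add: inner_real2 axis_def algebra_simps)
  finally show ?thesis .
qed

lemma iot_opposite: "\<alpha> \<in> C2 \<Longrightarrow> iot (br (Xi \<alpha>) (Xi (- \<alpha>))) = \<rho> (hv (coroot \<alpha>))"
  by (simp add: iot_br iot_Xi C2_minus lie_opposite_hv flip: \<rho>_lie)

lemma Xi_cartan:
  assumes "\<alpha> \<in> C2" "\<beta> \<in> C2" "\<beta> \<bullet> coroot \<alpha> = of_int m"
  shows "br (br (Xi \<alpha>) (Xi (- \<alpha>))) (Xi \<beta>) = m \<cdot> Xi \<beta>"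
proof -
  have "iot (br (br (Xi \<alpha>) (Xi (- \<alpha>))) (Xi \<beta>)) = (iot (m \<cdot> Xi \<beta>) :: (complex, 'n) sqm)"
    using assms by (simp add: iot_br[of _ "Xi \<beta>"] iot_opposite iot_Xi lie_hv \<rho>_smul flip: \<rho>_lie)
  then show ?thesis by (simp only: iot_inj)
qed

lemma Xi_opposite_add:
  assumes "\<alpha> \<in> C2" "\<beta> \<in> C2" "\<gamma> \<in> C2" "coroot \<gamma> = coroot \<alpha> + coroot \<beta>"
  shows "br (Xi \<gamma>) (Xi (- \<gamma>)) = br (Xi \<alpha>) (Xi (- \<alpha>)) + br (Xi \<beta>) (Xi (- \<beta>))"
proof -
  have "iot (br (Xi \<gamma>) (Xi (- \<gamma>))) = (iot (br (Xi \<alpha>) (Xi (- \<alpha>)) + br (Xi \<beta>) (Xi (- \<beta>))) :: (complex, 'n) sqm)"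
    by (simp only: iot_add iot_opposite assms hv_add \<rho>_add)
  then show ?thesis by (simp only: iot_inj)
qed

end

lemma frame_sum_nonzero:
  assumes "frame f g" "(i, j) \<noteq> (0, 0)"
  shows "i *\<^sub>R f + j *\<^sub>R g \<noteq> 0"
proof
  assume e: "i *\<^sub>R f + j *\<^sub>R g = 0"
  have "f \<bullet> (i *\<^sub>R f + j *\<^sub>R g) = i" "g \<bullet> (i *\<^sub>R f + j *\<^sub>R g) = j"
    using frame_inner[OF assms(1)] by (simp_all add: inner_add_right)
  then show False using e assms(2) by simp
qed

lemma frame_coroot:
  assumes "frame f g"
  shows "coroot (2 *\<^sub>R f) = f" "coroot (2 *\<^sub>R g) = g" "coroot (f + g) = f + g" "coroot (f - g) = f - g"
  using frame_inner[OF assms]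
  by (simp_all add: coroot_def inner_add_left inner_add_right inner_diff_left inner_diff_right)

context c2_rep
begin

lemma frame_bracket:
  assumes "frame f g"
    and "\<alpha> = i *\<^sub>R f + j *\<^sub>R g" "\<beta> = k *\<^sub>R f + l *\<^sub>R g" "\<alpha> \<in> C2" "\<beta> \<in> C2" "\<gamma> \<in> C2" "\<gamma> = (i + k) *\<^sub>R f + (j + l) *\<^sub>R g"
  obtains s :: int where "s \<in> {1, - 1}"
    "br (Xi \<alpha>) (Xi \<beta>) = (s * (if i^2 + j^2 = 2 \<and> k^2 + l^2 = 2 then 2 else 1)) \<cdot> Xi \<gamma>"
proof -
  have s: "\<alpha> + \<beta> = \<gamma>" using assms by (simp add: algebra_simps)
  have n: "\<alpha> \<bullet> \<alpha> = i^2 + j^2" "\<beta> \<bullet> \<beta> = k^2 + l^2"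
    using frame_inner[OF assms(1)] assms(2,3) by (simp_all add: inner_add_left inner_add_right power2_eq_square)
  show thesis
    using Xi_bracket[OF assms(4,5)] s assms(6) that unfolding n by blast
qed

lemma frame_commute:
  assumes "frame f g"
    and "\<alpha> = i *\<^sub>R f + j *\<^sub>R g" "\<beta> = k *\<^sub>R f + l *\<^sub>R g" "\<alpha> \<in> C2" "\<beta> \<in> C2"
    and "(i + k) *\<^sub>R f + (j + l) *\<^sub>R g \<notin> C2" "(i + k, j + l) \<noteq> (0, 0)"
  shows "br (Xi \<alpha>) (Xi \<beta>) = 0"
proof -
  have s: "\<alpha> + \<beta> = (i + k) *\<^sub>R f + (j + l) *\<^sub>R g" using assms by (simp add: algebra_simps)
  show ?thesis
    using assms(6) frame_sum_nonzero[OF assms(1,7)] by (intro Xi_commute assms(4,5)) (simp_all only: s not_False_eq_True)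
qed

lemma frame_cartan:
  assumes fr: "frame f g" and b: "\<beta> \<in> C2" "\<beta> = of_int i *\<^sub>R f + of_int j *\<^sub>R g"
  shows "br (br (Xi (2 *\<^sub>R f)) (Xi (- (2 *\<^sub>R f)))) (Xi \<beta>) = i \<cdot> Xi \<beta>"
    "br (br (Xi (2 *\<^sub>R g)) (Xi (- (2 *\<^sub>R g)))) (Xi \<beta>) = j \<cdot> Xi \<beta>"
proof -
  show "br (br (Xi (2 *\<^sub>R f)) (Xi (- (2 *\<^sub>R f)))) (Xi \<beta>) = i \<cdot> Xi \<beta>"
    using frame_inner[OF fr] by (intro Xi_cartan frame_roots[OF fr] b(1)) (simp add: frame_coroot[OF fr] b(2) inner_add_left)
  show "br (br (Xi (2 *\<^sub>R g)) (Xi (- (2 *\<^sub>R g)))) (Xi \<beta>) = j \<cdot> Xi \<beta>"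
    using frame_inner[OF fr] by (intro Xi_cartan frame_roots[OF fr] b(1)) (simp add: frame_coroot[OF fr] b(2) inner_add_left)
qed

text \<open>\<open>\<sigma>\<close> and \<open>\<tau>\<close> normalize the brackets
  \<open>[E, A]\<close> and \<open>[E, C]\<close>. Opposite root vectors receive the same sign,
  which leaves the coroots unchanged; \<open>c2_normalize\<close> settles the remaining
  signs.\<close>

lemma frame_sys:
  assumes fr: "frame f g"
  obtains \<sigma> \<tau> :: int where "\<sigma> \<in> {1, - 1}" "\<tau> \<in> {1, - 1}"
    "c2_sys (Xi (2 *\<^sub>R g)) (Xi (- (2 *\<^sub>R g))) (\<sigma> \<cdot> Xi (f + g)) (\<sigma> \<cdot> Xi (- (f + g)))
       (\<tau> \<cdot> Xi (2 *\<^sub>R f)) (\<tau> \<cdot> Xi (- (2 *\<^sub>R f))) (Xi (f - g)) (Xi (g - f))"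
proof -
  note R = frame_roots[OF fr] and N = frame_nonroots[OF fr] and Ci = frame_coroot[OF fr]
  define a a' c c' d d' e e' where "a = Xi (2 *\<^sub>R g)" and "a' = Xi (- (2 *\<^sub>R g))" and "c = Xi (f + g)"
    and "c' = Xi (- (f + g))" and "d = Xi (2 *\<^sub>R f)" and "d' = Xi (- (2 *\<^sub>R f))" and "e = Xi (f - g)" and "e' = Xi (g - f)"
  note defs = a_def a'_def c_def c'_def d_def d'_def e_def e'_def
  obtain s1 where s1: "s1 \<in> {1, - 1}" "br e a = s1 \<cdot> c" unfolding defs
    by (rule frame_bracket[OF fr, of "f - g" 1 "-1" "2 *\<^sub>R g" 0 2 "f + g"]) (use R in simp_all)
  obtain s2 where s2: "s2 \<in> {1, - 1}" "br e c = (s2 * 2) \<cdot> d" unfolding defs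
    by (rule frame_bracket[OF fr, of "f - g" 1 "-1" "f + g" 1 1 "2 *\<^sub>R f"]) (use R in simp_all)
  obtain s3 where s3: "s3 \<in> {1, - 1}" "br e' a' = s3 \<cdot> c'" unfolding defs
    by (rule frame_bracket[OF fr, of "g - f" "-1" 1 "- (2 *\<^sub>R g)" 0 "-2" "- (f + g)"]) (use R in simp_all)
  obtain s4 where s4: "s4 \<in> {1, - 1}" "br e' c' = (s4 * 2) \<cdot> d'" unfolding defs
    by (rule frame_bracket[OF fr, of "g - f" "-1" 1 "- (f + g)" "-1" "-1" "- (2 *\<^sub>R f)"]) (use R in simp_all)
  obtain s5 where s5: "s5 \<in> {1, - 1}" "br d c' = s5 \<cdot> e" unfolding defs
    by (rule frame_bracket[OF fr, of "2 *\<^sub>R f" 2 0 "- (f + g)" "-1" "-1" "f - g"]) (use R in simp_all)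
  have zero: "br e d = 0" "br a c = 0" "br a d = 0" "br c d = 0" "br e' d' = 0" "br a' c' = 0" "br a' d' = 0"
    "br c' d' = 0" "br e a' = 0" "br a e' = 0" "br a d' = 0" "br d a' = 0"
  proof -
    show "br e d = 0" unfolding defs by (rule frame_commute[OF fr, of _ 1 "-1" _ 2 0]) (use R N in simp_all)
    show "br a c = 0" unfolding defs by (rule frame_commute[OF fr, of _ 0 2 _ 1 1]) (use R N in simp_all)
    show "br a d = 0" unfolding defs by (rule frame_commute[OF fr, of _ 0 2 _ 2 0]) (use R N in simp_all)
    show "br c d = 0" unfolding defs by (rule frame_commute[OF fr, of _ 1 1 _ 2 0]) (use R N in simp_all)
    show "br e' d' = 0" unfolding defs by (rule frame_commute[OF fr, of _ "-1" 1 _ "-2" 0]) (use R N in simp_all)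
    show "br a' c' = 0" unfolding defs by (rule frame_commute[OF fr, of _ 0 "-2" _ "-1" "-1"]) (use R N in simp_all)
    show "br a' d' = 0" unfolding defs by (rule frame_commute[OF fr, of _ 0 "-2" _ "-2" 0]) (use R N in simp_all)
    show "br c' d' = 0" unfolding defs by (rule frame_commute[OF fr, of _ "-1" "-1" _ "-2" 0]) (use R N in simp_all)
    show "br e a' = 0" unfolding defs by (rule frame_commute[OF fr, of _ 1 "-1" _ 0 "-2"]) (use R N in simp_all)
    show "br a e' = 0" unfolding defs by (rule frame_commute[OF fr, of _ 0 2 _ "-1" 1]) (use R N in simp_all)
    show "br a d' = 0" unfolding defs by (rule frame_commute[OF fr, of _ 0 2 _ "-2" 0]) (use R N in simp_all)
    show "br d a' = 0" unfolding defs by (rule frame_commute[OF fr, of _ 2 0 _ 0 "-2"]) (use R N in simp_all)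
  qed
  have H: "br c c' = br d d' + br a a'" "br e e' = br d d' - br a a'"
  proof -
    show "br c c' = br d d' + br a a'" unfolding defs
      by (rule Xi_opposite_add) (use R Ci in simp_all)
    have "br d d' = br a a' + br e e'" unfolding defs
      using Xi_opposite_add[of "2 *\<^sub>R g" "f - g" "2 *\<^sub>R f"] R Ci by simp
    then show "br e e' = br d d' - br a a'" by simp
  qed
  have w: "br (br d d') a = 0" "br (br a a') a = 2 \<cdot> a" "br (br d d') a' = 0" "br (br a a') a' = (- 2) \<cdot> a'"
    "br (br d d') c = c" "br (br a a') c = c" "br (br d d') c' = - c'" "br (br a a') c' = - c'"
    "br (br d d') d = 2 \<cdot> d" "br (br a a') d = 0" "br (br d d') d' = (- 2) \<cdot> d'" "br (br a a') d' = 0"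
    "br (br d d') e = e" "br (br a a') e = - e" "br (br d d') e' = - e'" "br (br a a') e' = e'"
  proof -
    show "br (br d d') a = 0" "br (br a a') a = 2 \<cdot> a"
      using frame_cartan[OF fr R(7), of 0 2] unfolding defs[symmetric] by simp_all
    show "br (br d d') a' = 0" "br (br a a') a' = (- 2) \<cdot> a'"
      using frame_cartan[OF fr R(8), of 0 "-2"] unfolding defs[symmetric] by simp_all
    show "br (br d d') c = c" "br (br a a') c = c"
      using frame_cartan[OF fr R(1), of 1 1] unfolding defs[symmetric] by simp_all
    show "br (br d d') c' = - c'" "br (br a a') c' = - c'"
      using frame_cartan[OF fr R(2), of "-1" "-1"] unfolding defs[symmetric] by simp_all
    show "br (br d d') d = 2 \<cdot> d" "br (br a a') d = 0"
      using frame_cartan[OF fr R(5), of 2 0] unfolding defs[symmetric] by simp_all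
    show "br (br d d') d' = (- 2) \<cdot> d'" "br (br a a') d' = 0"
      using frame_cartan[OF fr R(6), of "-2" 0] unfolding defs[symmetric] by simp_all
    show "br (br d d') e = e" "br (br a a') e = - e"
      using frame_cartan[OF fr R(3), of 1 "-1"] unfolding defs[symmetric] by simp_all
    show "br (br d d') e' = - e'" "br (br a a') e' = e'"
      using frame_cartan[OF fr R(4), of "-1" 1] unfolding defs[symmetric] by simp_all
  qed
  define \<sigma> \<tau> where "\<sigma> = s1" and "\<tau> = s1 * s2"
  have sg: "\<sigma> \<in> {1, - 1}" "\<tau> \<in> {1, - 1}" using s1(1) s2(1) by (auto simp: \<sigma>_def \<tau>_def)
  then have sq: "\<sigma> * \<sigma> = 1" "\<tau> * \<tau> = 1" "\<sigma> * (\<sigma> * z) = z" "\<tau> * (\<tau> * z) = z" for z by auto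
  have s12: "s1 = \<sigma>" "s2 = \<sigma> * \<tau>" using s1(1) by (auto simp: \<sigma>_def \<tau>_def)
  have nz: "a \<noteq> 0" "a' \<noteq> 0" "c \<noteq> 0" "c' \<noteq> 0" "d \<noteq> 0" "d' \<noteq> 0" "e \<noteq> 0" "e' \<noteq> 0" 
    unfolding defs by (rule Xi_nonzero[OF R(7)] Xi_nonzero[OF R(8)] Xi_nonzero[OF R(1)] Xi_nonzero[OF R(2)]
      Xi_nonzero[OF R(5)] Xi_nonzero[OF R(6)] Xi_nonzero[OF R(3)] Xi_nonzero[OF R(4)])+
  have sz: "\<sigma> \<noteq> 0" "\<tau> \<noteq> 0" using sg by auto
  have an: "adm a" "adm a'" "adm c" "adm c'" "adm d" "adm d'" "adm e" "adm e'"
    "nilp a" "nilp a'" "nilp c" "nilp c'" "nilp d" "nilp d'" "nilp e" "nilp e'"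
    unfolding defs by (intro Xi_dp Xi_nilp R)+
  have "c2_table a a' (\<sigma> \<cdot> c) (\<sigma> \<cdot> c') (\<tau> \<cdot> d) (\<tau> \<cdot> d') e e'"
  proof (rule c2_normalize[where n = "s3 * \<sigma>" and m = "\<sigma> * s4 * \<tau>" and k = "\<tau> * \<sigma> * s5"
      and ?H1.0 = "br d d'" and ?H2.0 = "br a a'"])
    show "s3 * \<sigma> \<in> {1, - 1}" "\<sigma> * s4 * \<tau> \<in> {1, - 1}" "\<tau> * \<sigma> * s5 \<in> {1, - 1}"
      using sg s3(1) s4(1) s5(1) by auto
    show "\<sigma> \<cdot> c \<noteq> 0" "\<tau> \<cdot> d \<noteq> 0" using nz sz by (simp_all add: scal_eq_0)
qed (simp_all only: br_scal_left br_scal_right s1(2) s2(2) s3(2) s4(2) s5(2) s12 zero H w nz scal.scale_zero_right simp_thms not_False_eq_True,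
    simp_all add: sq mult_ac scal.scale_right_distrib)
  then have "c2_sys a a' (\<sigma> \<cdot> c) (\<sigma> \<cdot> c') (\<tau> \<cdot> d) (\<tau> \<cdot> d') e e'"
    unfolding c2_sys_def c2_sys_axioms_def using nz sz
    by (auto simp: scal_eq_0 an intro!: adm_scal nilp_scal)
  then show thesis using that sg unfolding defs by blast
qed

end

section \<open>Integral points and the Chevalley group\<close>

text \<open>A change of sign of the root vector is absorbed by the parameter.\<close>

lemma xe_sign:
  assumes "\<sigma> \<in> {1, - 1}" "adm X"
  shows "range (xe (\<sigma> \<cdot> X)) = range (xe X :: 'r::comm_ring_1 \<Rightarrow> _)"
    and "\<exists>u. xe X t = xe (\<sigma> \<cdot> X) (u :: 'r)"
proof -
  have *: "xe (\<sigma> \<cdot> X) (of_int \<sigma> * u) = xe X u" "xe X (of_int \<sigma> * u) = xe (\<sigma> \<cdot> X) u" for u :: 'r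
    using assms(1) by (auto simp: xe_scal[OF assms(2)])
  then show "range (xe (\<sigma> \<cdot> X)) = range (xe X :: 'r \<Rightarrow> _)"
    by (intro subset_antisym image_subsetI) (metis rangeI)+
  show "\<exists>u. xe X t = xe (\<sigma> \<cdot> X) (u :: 'r)"
    using * by metis
qed

lemma ipoly_compose:
  fixes F :: "(complex, 'n::finite) sqm \<Rightarrow> (complex, 'n) sqm" and F' :: "('r::comm_ring_1, 'n) sqm \<Rightarrow> ('r, 'n) sqm"
  assumes "ipoly f f'" "ipolyM F F'"
  shows "ipoly (\<lambda>g. f (F g)) (\<lambda>g. f' (F' g))"
proof -
  obtain p where p: "\<And>g. f g = entry_poly_eval p (Rep_sqm g)" "\<And>g. f' g = entry_poly_eval p (Rep_sqm g)"
    using assms(1) unfolding ipoly_def by blast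
  show ?thesis unfolding p entry_poly_eval_def using assms(2)
    by (intro ipoly_sum ipoly_cmult ipoly_prod ipoly_power) (simp add: ipolyM_def ent.rep_eq)
qed

context c2_wt
begin

lemma words_mult: "v \<in> words \<Longrightarrow> w \<in> words \<Longrightarrow> w * v \<in> words"
  by (induction v rule: words.induct) (auto intro: words.intros simp flip: mult.assoc)

lemma words_xe: "X \<in> {A, A', C, C', D, D', E, E'} \<Longrightarrow> xe X t \<in> words"
  using words.step[OF words.one] by simp

end

lemma Abs_sqm_mult: "Abs_sqm (a ** b) = Abs_sqm a * Abs_sqm b"
  and Abs_sqm_one: "Abs_sqm (mat 1) = 1"
  by (simp_all add: times_sqm.abs_eq one_sqm.abs_eq)

lemma m_inv_matrix:
  fixes M :: "('r::comm_ring_1^'n^'n, 'b) monoid_scheme"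
  assumes M: "mult M = (**)" "one M = mat 1" and y: "Abs_sqm g * y = 1" "Rep_sqm y \<in> carrier M"
  shows "inv\<^bsub>M\<^esub> g = Rep_sqm y"
  unfolding m_inv_def M
proof (rule the_equality)
  note y' = right_inverse_imp_left_inverse[OF y(1)]
  have "Abs_sqm (g ** Rep_sqm y) = Abs_sqm (mat 1)" "Abs_sqm (Rep_sqm y ** g) = Abs_sqm (mat 1)"
    by (simp_all add: Abs_sqm_mult Rep_sqm_inverse Abs_sqm_one y y')
  then show "Rep_sqm y \<in> carrier M \<and> g ** Rep_sqm y = mat 1 \<and> Rep_sqm y ** g = mat 1"
    using y(2) by (simp add: Abs_sqm_inject)
  fix z assume "z \<in> carrier M \<and> g ** z = mat 1 \<and> z ** g = mat 1"
  then have "Abs_sqm g * Abs_sqm z = 1" by (simp flip: Abs_sqm_mult Abs_sqm_one)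
  then have "y * (Abs_sqm g * Abs_sqm z) = y" by simp
  then have "Abs_sqm z = y" by (simp add: y' flip: mult.assoc)
  then show "z = Rep_sqm y" by (metis Abs_sqm_inverse UNIV_I)
qed

section \<open>Elementary group, Chevalley group and weights of the representation\<close>

context c2_rep
begin

lemma frame_wt:
  assumes fr: "frame f g"
  obtains \<sigma> \<tau> :: int and P1 S1 P2 S2 where "\<sigma> \<in> {1, - 1}" "\<tau> \<in> {1, - 1}"
    "c2_wt (Xi (2 *\<^sub>R g)) (Xi (- (2 *\<^sub>R g))) (\<sigma> \<cdot> Xi (f + g)) (\<sigma> \<cdot> Xi (- (f + g)))
       (\<tau> \<cdot> Xi (2 *\<^sub>R f)) (\<tau> \<cdot> Xi (- (2 *\<^sub>R f))) (Xi (f - g)) (Xi (g - f)) P1 S1 P2 S2"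
proof -
  obtain \<sigma> \<tau> :: int where st: "\<sigma> \<in> {1, - 1}" "\<tau> \<in> {1, - 1}" and
    s: "c2_sys (Xi (2 *\<^sub>R g)) (Xi (- (2 *\<^sub>R g))) (\<sigma> \<cdot> Xi (f + g)) (\<sigma> \<cdot> Xi (- (f + g)))
       (\<tau> \<cdot> Xi (2 *\<^sub>R f)) (\<tau> \<cdot> Xi (- (2 *\<^sub>R f))) (Xi (f - g)) (Xi (g - f))"
    by (rule frame_sys[OF fr])
  interpret s: c2_sys "Xi (2 *\<^sub>R g)" "Xi (- (2 *\<^sub>R g))" "\<sigma> \<cdot> Xi (f + g)" "\<sigma> \<cdot> Xi (- (f + g))"
    "\<tau> \<cdot> Xi (2 *\<^sub>R f)" "\<tau> \<cdot> Xi (- (2 *\<^sub>R f))" "Xi (f - g)" "Xi (g - f)" by (rule s)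
  interpret d: sl2 "\<tau> \<cdot> Xi (2 *\<^sub>R f)" "\<tau> \<cdot> Xi (- (2 *\<^sub>R f))" by (rule s.sl2_D)
  interpret a: sl2 "Xi (2 *\<^sub>R g)" "Xi (- (2 *\<^sub>R g))" by (rule s.sl2_A)
  obtain P1 S1 where "weight_projections d.H P1 S1" by (rule d.torus)
  moreover obtain P2 S2 where "weight_projections a.H P2 S2" by (rule a.torus)
  ultimately show thesis using that[OF st] s unfolding c2_wt_def d.H_def a.H_def by blast
qed

text \<open>The inverse of a root unipotent is a root unipotent, so closure of \<open>W\<close>
  under products suffices.\<close>

lemma elementary_group_words:
  assumes W: "1 \<in> W" "\<And>v w. v \<in> W \<Longrightarrow> w \<in> W \<Longrightarrow> v * w \<in> W" "\<And>\<alpha> t. \<alpha> \<in> C2 \<Longrightarrow> xe (Xi \<alpha>) t \<in> W"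
    and c: "c \<in> (elementary_group C2 (\<lambda>\<alpha>. \<pi> (x \<alpha>)) :: (complex^'n^'n) set)"
  shows "Abs_sqm c \<in> W"
proof -
  have xe_inv: "inv\<^bsub>SL\<^esub> (Rep_sqm (xe (Xi \<alpha>) t)) = Rep_sqm (xe (Xi \<alpha>) (- t))" if "\<alpha> \<in> C2" for \<alpha> and t :: complex
  proof -
    have an: "adm (Xi \<alpha>)" "nilp (Xi \<alpha>)" using that by (rule Xi_dp, rule Xi_nilp)
    show ?thesis using sdet_xe[OF an, of "- t"]
      by (intro m_inv_matrix) (simp_all add: SL_def xe_inverse an Rep_sqm_inverse sdet_def)
  qed
  from c show ?thesis unfolding elementary_group_def
  proof (induction rule: generate.induct)
    case one
    then show ?case using W(1) by (simp add: SL_def Abs_sqm_one)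
  next
    case (incl h)
    then show ?case using W(3) by (auto simp: root_subgroup_def unipotent_eq Rep_sqm_inverse)
  next
    case (inv h)
    then show ?case using W(3) by (auto simp: root_subgroup_def unipotent_eq xe_inv Rep_sqm_inverse)
  next
    case (eng h1 h2)
    then show ?case using W(2) by (simp add: SL_def Abs_sqm_mult)
  qed
qed

lemma unipotent_elementary:
  "\<alpha> \<in> C2 \<Longrightarrow> Rep_sqm (xe (Xi \<alpha>) t) \<in> elementary_group C2 (\<lambda>\<alpha>. \<pi> (x \<alpha>))"
  unfolding elementary_group_def root_subgroup_def
  by (rule generate.incl) (auto simp: unipotent_eq)

lemma elementary_mult:
  "Rep_sqm a \<in> elementary_group C2 (\<lambda>\<alpha>. \<pi> (x \<alpha>)) \<Longrightarrow> Rep_sqm b \<in> elementary_group C2 (\<lambda>\<alpha>. \<pi> (x \<alpha>))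
    \<Longrightarrow> Rep_sqm (a * b) \<in> elementary_group C2 (\<lambda>\<alpha>. \<pi> (x \<alpha>))"
  unfolding elementary_group_def using generate.eng[of _ SL] by (fastforce simp: SL_def times_sqm.rep_eq)

lemma elementary_inverse:
  assumes "c \<in> (elementary_group C2 (\<lambda>\<alpha>. \<pi> (x \<alpha>)) :: (complex^'n^'n) set)"
  shows "Rep_sqm (adjm (Abs_sqm c)) \<in> elementary_group C2 (\<lambda>\<alpha>. \<pi> (x \<alpha>))"
proof -
  let ?E = "elementary_group C2 (\<lambda>\<alpha>. \<pi> (x \<alpha>)) :: (complex^'n^'n) set"
  let ?W = "{v. sdet v = 1 \<and> (\<exists>v'. v * v' = 1 \<and> Rep_sqm v' \<in> ?E)}"
  have "Abs_sqm c \<in> ?W"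
  proof (rule elementary_group_words[OF _ _ _ assms])
    have "mat 1 \<in> ?E" unfolding elementary_group_def using generate.one[of SL] by (simp add: SL_def)
    then show "1 \<in> ?W" by (auto simp: one_sqm.rep_eq intro!: exI[of _ 1])
    show "v * w \<in> ?W" if vw: "v \<in> ?W" "w \<in> ?W" for v w
    proof -
      obtain v' w' where v': "v * v' = 1" "Rep_sqm v' \<in> ?E" and w': "w * w' = 1" "Rep_sqm w' \<in> ?E"
        using vw by blast
      have "(v * w) * (w' * v') = v * (w * w') * v'" by (simp only: mult.assoc)
      then have "(v * w) * (w' * v') = 1" by (simp add: v' w')
      then show ?thesis using elementary_mult[OF w'(2) v'(2)] vw by (auto simp: sdet_mult)
    qed
    show "xe (Xi \<alpha>) t \<in> ?W" if "\<alpha> \<in> C2" for \<alpha> t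
      using unipotent_elementary[OF that, of "- t"] xe_inverse[of "Xi \<alpha>" t] sdet_xe[of "Xi \<alpha>" t] Xi_dp[OF that] Xi_nilp[OF that]
      by blast
  qed
  then obtain v' where v': "sdet (Abs_sqm c) = 1" "Abs_sqm c * v' = 1" "Rep_sqm v' \<in> ?E" by blast
  then show ?thesis using adjm_eq_inverse[OF v'(2)] by simp
qed

text \<open>The adjugate inverts the complex elementary group, so composing an equation of that
  group with the adjugate gives another equation of it.\<close>

lemma chevalley_inverse:
  fixes g :: "'r::comm_ring_1^'n^'n"
  assumes "g \<in> carrier (chevalley_group C2 (\<lambda>\<alpha>. \<pi> (x \<alpha>)))"
  shows "Rep_sqm (adjm (Abs_sqm g)) \<in> carrier (chevalley_group C2 (\<lambda>\<alpha>. \<pi> (x \<alpha>)))" "Abs_sqm g * adjm (Abs_sqm g) = 1"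
proof -
  have g: "det g = 1" "\<And>p. (\<forall>c\<in>elementary_group C2 (\<lambda>\<alpha>. \<pi> (x \<alpha>)) :: (complex^'n^'n) set. entry_poly_eval p c = 0) \<Longrightarrow> entry_poly_eval p g = 0"
    using assms by (auto simp: chevalley_group_def SL_def)
  have s: "sdet (Abs_sqm g) = 1" by (simp add: sdet_def Abs_sqm_inverse g(1))
  then show 1: "Abs_sqm g * adjm (Abs_sqm g) = 1" by (simp add: mult_adjm)
  have "entry_poly_eval p (Rep_sqm (adjm (Abs_sqm g))) = 0"
    if p: "\<forall>c\<in>elementary_group C2 (\<lambda>\<alpha>. \<pi> (x \<alpha>)) :: (complex^'n^'n) set. entry_poly_eval p c = 0" for p
  proof -
    have "ipoly (\<lambda>g. entry_poly_eval p (Rep_sqm g) :: complex) (\<lambda>g. entry_poly_eval p (Rep_sqm g) :: 'r)"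
      unfolding ipoly_def by blast
    from ipoly_compose[OF this ipolyM_adjm[OF ipolyM_id]] obtain q where
      q: "\<And>g. entry_poly_eval p (Rep_sqm (adjm g)) = (entry_poly_eval q (Rep_sqm g) :: complex)"
        "\<And>g. entry_poly_eval p (Rep_sqm (adjm g)) = (entry_poly_eval q (Rep_sqm g) :: 'r)"
      unfolding ipoly_def by blast
    have "entry_poly_eval q c = 0" if "c \<in> (elementary_group C2 (\<lambda>\<alpha>. \<pi> (x \<alpha>)) :: (complex^'n^'n) set)" for c
      using p elementary_inverse[OF that] q(1)[of "Abs_sqm c"] by (simp add: Abs_sqm_inverse)
    then show ?thesis using g(2) q(2)[of "Abs_sqm g"] by (simp add: Abs_sqm_inverse)
  qed
  moreover have "det (Rep_sqm (adjm (Abs_sqm g))) = 1"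
    using arg_cong[OF 1, of sdet] by (simp add: sdet_mult s) (simp add: sdet_def)
  ultimately show "Rep_sqm (adjm (Abs_sqm g)) \<in> carrier (chevalley_group C2 (\<lambda>\<alpha>. \<pi> (x \<alpha>)))"
    by (simp add: chevalley_group_def SL_def)
qed

text \<open>\<open>subgroup\<close> speaks of \<open>inv\<close> in the Chevalley monoid, a definite
  description. It evaluates to the adjugate because that lies in the carrier.\<close>

lemma large_subgroup_group:
  fixes G :: "('r::comm_ring_1^'n^'n) set"
  assumes "large_subgroup C2 (\<lambda>\<alpha>. \<pi> (x \<alpha>)) G"
  shows "group ((chevalley_group C2 (\<lambda>\<alpha>. \<pi> (x \<alpha>)))\<lparr>carrier := G\<rparr>)" (is "group ?G")
    and "\<And>a b. a \<in> G \<Longrightarrow> b \<in> G \<Longrightarrow> a ** b \<in> G"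
proof -
  let ?M = "chevalley_group C2 (\<lambda>\<alpha>. \<pi> (x \<alpha>)) :: ('r^'n^'n) monoid"
  have M: "mult ?M = (**)" "one ?M = mat 1" by (simp_all add: chevalley_group_def SL_def)
  have "subgroup G ?M" using assms by (simp add: large_subgroup_def)
  then interpret s: subgroup G ?M .
  show m: "\<And>a b. a \<in> G \<Longrightarrow> b \<in> G \<Longrightarrow> a ** b \<in> G" using s.m_closed by (simp add: M)
  show "group ?G"
  proof (rule groupI)
    fix g assume g: "g \<in> carrier ?G"
    then have c: "g \<in> carrier ?M" using s.subset by auto
    note i = chevalley_inverse[OF c]
    have "inv\<^bsub>?M\<^esub> g = Rep_sqm (adjm (Abs_sqm g))" by (rule m_inv_matrix[OF M i(2,1)])
    moreover have "inv\<^bsub>?M\<^esub> g \<in> G" using g by (intro s.m_inv_closed) simp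
    moreover have "Abs_sqm (Rep_sqm (adjm (Abs_sqm g)) ** g) = Abs_sqm (mat 1)"
      by (simp add: Abs_sqm_mult Rep_sqm_inverse Abs_sqm_one right_inverse_imp_left_inverse[OF i(2)])
    ultimately show "\<exists>y\<in>carrier ?G. y \<otimes>\<^bsub>?G\<^esub> g = \<one>\<^bsub>?G\<^esub>"
      by (intro bexI[of _ "Rep_sqm (adjm (Abs_sqm g))"]) (simp_all add: M Abs_sqm_inject)
  qed (use m s.one_closed in \<open>simp_all add: M matrix_mul_assoc\<close>)
qed

text \<open>A nonzero column of \<open>V\<close> is a weight vector of weight
  \<open>a f + b g\<close>, which lies in the root lattice.\<close>

lemma frame_even_weight:
  fixes V :: "(int, 'n) sqm"
  assumes fr: "frame f g" and lat: "weight_lattice C2_base h \<pi> = root_lattice C2"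
    and V: "V \<noteq> 0" "br (Xi (2 *\<^sub>R f)) (Xi (- (2 *\<^sub>R f))) * V = a \<cdot> V"
      "br (Xi (2 *\<^sub>R g)) (Xi (- (2 *\<^sub>R g))) * V = b \<cdot> V"
  shows "even (a + b)"
proof -
  define \<mu> where "\<mu> = of_int a *\<^sub>R f + of_int b *\<^sub>R g"
  have "\<exists>i j. ent V i j \<noteq> 0"
  proof (rule ccontr)
    assume "\<nexists>i j. ent V i j \<noteq> 0"
    then have "V = 0" by (intro sqm_eqI) simp
    then show False using V(1) by simp
  qed
  then obtain i j where ij: "ent V i j \<noteq> 0" by blast
  define v :: "complex^'n" where "v = (\<chi> k. of_int (ent V k j))"
  have v0: "v \<noteq> 0"
  proof
    assume "v = 0"
    then have "v $ i = 0" by simp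
    then show False using ij by (simp add: v_def)
  qed
  have hf: "\<rho> (hv f) * iot V = of_int a \<cdot> iot V"
    using arg_cong[OF V(2), of "iot :: _ \<Rightarrow> (complex, 'n) sqm"]
    by (simp add: iot_opposite frame_roots[OF fr] frame_coroot[OF fr])
  have hg: "\<rho> (hv g) * iot V = of_int b \<cdot> iot V"
    using arg_cong[OF V(3), of "iot :: _ \<Rightarrow> (complex, 'n) sqm"]
    by (simp add: iot_opposite frame_roots[OF fr] frame_coroot[OF fr])
  have hu: "\<rho> (hv u) * iot V = of_real (\<mu> \<bullet> u) \<cdot> iot V" for u
  proof -
    have "\<rho> (hv u) = of_real (u \<bullet> f) \<cdot> \<rho> (hv f) + of_real (u \<bullet> g) \<cdot> \<rho> (hv g)"
      by (subst frame_expansion[OF fr, of u]) (simp only: hv_add hv_scale \<rho>_add \<rho>_smul)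
    then have "\<rho> (hv u) * iot V = (of_real (u \<bullet> f) * of_int a + of_real (u \<bullet> g) * of_int b) \<cdot> iot V"
      by (simp add: distrib_right hf hg scal.scale_left_distrib)
    moreover have "\<mu> \<bullet> u = (u \<bullet> f) * of_int a + (u \<bullet> g) * of_int b"
      by (simp add: \<mu>_def inner_add_left inner_commute[of u f] inner_commute[of u g] mult.commute)
    ultimately show ?thesis by simp
  qed
  have "\<pi> (h \<delta>) *v v = of_real (\<mu> \<bullet> coroot \<delta>) *s v" if "\<delta> \<in> C2_base" for \<delta>
  proof -
    have "ent (\<rho> (hv (coroot \<delta>)) * iot V) k j = ent (of_real (\<mu> \<bullet> coroot \<delta>) \<cdot> iot V :: (complex, 'n) sqm) k j" for k
      by (simp only: hu)
    then show ?thesis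
      by (simp add: vec_eq_iff matrix_vector_mult_def v_def ent_mult \<rho>_def ent.abs_eq hv_base[OF that])
  qed
  then have "\<mu> \<in> weights C2_base h \<pi>" using v0 unfolding weights_def by blast
  then have "\<mu> \<in> root_lattice C2" unfolding lat[symmetric] weight_lattice_def by (intro group_closure.base insertI2)
  then show ?thesis using frame_parity[OF fr] by (simp add: \<mu>_def)
qed

end

section \<open>Diophantine sets\<close>

definition gw_eqn :: "'a gword \<Rightarrow> 'a gword \<Rightarrow> 'a gword" where
  "gw_eqn u v = Mul u (Inv v)"

text \<open>Group words have no letter for the unit; \<open>a\<close> will be the unit of the group,
  taken as a constant.\<close>

primrec gw_pow :: "'a \<Rightarrow> 'a gword \<Rightarrow> nat \<Rightarrow> 'a gword" where
  "gw_pow a w 0 = Const a"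
| "gw_pow a w (Suc e) = Mul (gw_pow a w e) w"

lemma gw_pow_simps [simp]:
  "gw_consts (gw_pow a w e) \<subseteq> insert a (gw_consts w)" "gw_vars (gw_pow a w e) \<subseteq> gw_vars w"
  by (induction e) auto

lemma gw_eval_pow: "gw_eval G y (gw_pow \<one>\<^bsub>G\<^esub> w e) = gw_eval G y w [^]\<^bsub>G\<^esub> e"
  by (induction e) simp_all

context group
begin

lemma gw_eval_closed:
  "gw_consts w \<subseteq> carrier G \<Longrightarrow> (\<And>i. i \<in> gw_vars w \<Longrightarrow> y i \<in> carrier G) \<Longrightarrow> gw_eval G y w \<in> carrier G"
  by (induction w) auto

lemma diophantine_inI:
  assumes "\<And>u v. (u, v) \<in> set es \<Longrightarrow> gw_consts u \<union> gw_consts v \<subseteq> carrier G \<and> gw_vars u \<union> gw_vars v \<subseteq> {0..n}"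
    and "\<And>g. g \<in> H \<longleftrightarrow> g \<in> carrier G \<and> (\<exists>y. (\<forall>i\<in>{1..n}. y i \<in> carrier G) \<and>
      (\<forall>(u, v)\<in>set es. gw_eval G (y(0 := g)) u = gw_eval G (y(0 := g)) v))"
  shows "diophantine_in H G"
proof -
  have *: "gw_eval G y' (gw_eqn u v) = \<one> \<longleftrightarrow> gw_eval G y' u = gw_eval G y' v"
    if uv: "(u, v) \<in> set es" and y': "\<And>i. i \<le> n \<Longrightarrow> y' i \<in> carrier G" for u v y'
  proof -
    have c: "gw_eval G y' u \<in> carrier G" "gw_eval G y' v \<in> carrier G"
      using assms(1)[OF uv] y' by (auto intro!: gw_eval_closed)
    then show ?thesis using inv_solve_right[of \<one> "gw_eval G y' u" "gw_eval G y' v"] by (auto simp: gw_eqn_def)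
  qed
  have "H = {g \<in> carrier G. \<exists>y. (\<forall>i\<in>{1..n}. y i \<in> carrier G) \<and>
      (\<forall>w\<in>set (map (case_prod gw_eqn) es). gw_eval G (y(0 := g)) w = \<one>)}"
  proof (rule Set.set_eqI)
    fix g
    show "g \<in> H \<longleftrightarrow> g \<in> {g \<in> carrier G. \<exists>y. (\<forall>i\<in>{1..n}. y i \<in> carrier G) \<and>
      (\<forall>w\<in>set (map (case_prod gw_eqn) es). gw_eval G (y(0 := g)) w = \<one>)}"
      unfolding assms(2) mem_Collect_eq
    proof (intro conj_cong refl ex_cong1)
      fix y assume g: "g \<in> carrier G" and y: "\<forall>i\<in>{1..n}. y i \<in> carrier G"
      then have "(y(0 := g)) i \<in> carrier G" if "i \<le> n" for i using that by auto
      note e = *[of _ _ "y(0 := g)", OF _ this]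
      show "(\<forall>(u, v)\<in>set es. gw_eval G (y(0 := g)) u = gw_eval G (y(0 := g)) v) \<longleftrightarrow>
        (\<forall>w\<in>set (map (case_prod gw_eqn) es). gw_eval G (y(0 := g)) w = \<one>)"
        unfolding set_map ball_simps by (intro ball_cong refl) (auto simp: e)
    qed
  qed
  moreover have "\<forall>w\<in>set (map (case_prod gw_eqn) es). gw_consts w \<subseteq> carrier G \<and> gw_vars w \<subseteq> {0..n}"
    using assms(1) by (fastforce simp: gw_eqn_def)
  ultimately show ?thesis unfolding diophantine_in_def by blast
qed

text \<open>The form in which long root subgroups appear; one auxiliary variable describes it by
  equations.\<close>

definition centralizer_powers :: "'a set \<Rightarrow> nat \<Rightarrow> 'a set" where
  "centralizer_powers S e = {y [^] e | y. y \<in> carrier G \<and> (\<forall>s\<in>S. y \<otimes> s = s \<otimes> y)}"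

lemma diophantine_centralizer_powers:
  assumes "finite S" "S \<subseteq> carrier G"
  shows "diophantine_in (centralizer_powers S e) G"
proof -
  obtain Ss where Ss: "set Ss = S" using finite_list[OF assms(1)] by blast
  define es where "es = (Var 0, gw_pow \<one> (Var 1) e) # map (\<lambda>s. (Mul (Var 1) (Const s), Mul (Const s) (Var 1))) Ss"
  show ?thesis
  proof (rule diophantine_inI)
    show "gw_consts u \<union> gw_consts v \<subseteq> carrier G \<and> gw_vars u \<union> gw_vars v \<subseteq> {0..1}" if "(u, v) \<in> set es" for u v
      using that assms(2) gw_pow_simps[of \<one> "Var 1" e] by (auto simp: es_def Ss)
    show "g \<in> centralizer_powers S e \<longleftrightarrow> g \<in> carrier G \<and> (\<exists>y. (\<forall>i\<in>{1..1}. y i \<in> carrier G) \<and>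
      (\<forall>(u, v)\<in>set es. gw_eval G (y(0 := g)) u = gw_eval G (y(0 := g)) v))" for g
    proof -
      have "(\<exists>y. y \<in> carrier G \<and> g = y [^] e \<and> (\<forall>s\<in>S. y \<otimes> s = s \<otimes> y)) \<longleftrightarrow>
        (\<exists>y :: nat \<Rightarrow> 'a. y 1 \<in> carrier G \<and> g = y 1 [^] e \<and> (\<forall>s\<in>S. y 1 \<otimes> s = s \<otimes> y 1))"
      proof
        assume "\<exists>y. y \<in> carrier G \<and> g = y [^] e \<and> (\<forall>s\<in>S. y \<otimes> s = s \<otimes> y)"
        then obtain y where "y \<in> carrier G \<and> g = y [^] e \<and> (\<forall>s\<in>S. y \<otimes> s = s \<otimes> y)" by blast
        then show "\<exists>y :: nat \<Rightarrow> 'a. y 1 \<in> carrier G \<and> g = y 1 [^] e \<and> (\<forall>s\<in>S. y 1 \<otimes> s = s \<otimes> y 1)"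
          by (intro exI[of _ "\<lambda>_. y"])
      qed blast
      then show ?thesis
        by (auto simp: centralizer_powers_def es_def Ss gw_eval_pow)
    qed
  qed
qed

text \<open>Quantifying over \<open>A\<close> and \<open>D\<close> is unfolded into four variables:
  \<open>e\<close>-th powers of the variables 1 and 4 run through \<open>A\<close>,
  \<open>f\<close>-th powers of 2 and 3 through \<open>D\<close>.\<close>

lemma diophantine_commutator_equations:
  fixes e f :: nat
  assumes S: "finite S" "S \<subseteq> carrier G" and T: "finite T" "T \<subseteq> carrier G" and pq: "p \<in> carrier G" "q \<in> carrier G"
  defines "A \<equiv> centralizer_powers S e" and "D \<equiv> centralizer_powers T f"
  shows "diophantine_in {g \<in> carrier G. (\<exists>a\<in>A. \<exists>d\<in>D. p \<otimes> a = a \<otimes> g \<otimes> d \<otimes> p) \<and>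
     (\<exists>d\<in>D. \<exists>a\<in>A. q \<otimes> d = d \<otimes> g \<otimes> a \<otimes> q)} G"
proof -
  obtain Ss Ts where Ss: "set Ss = S" and Ts: "set Ts = T" using finite_list S T by metis
  define cm where "cm i s = (Mul (Var i) (Const s), Mul (Const s) (Var i))" for i and s :: 'a
  define po where "po i k = gw_pow \<one> (Var i) k" for i k
  define es where "es = [(Mul (Const p) (po 1 e), Mul (Mul (Mul (po 1 e) (Var 0)) (po 2 f)) (Const p)),
     (Mul (Const q) (po 3 f), Mul (Mul (Mul (po 3 f) (Var 0)) (po 4 e)) (Const q))]
     @ map (cm 1) Ss @ map (cm 2) Ts @ map (cm 3) Ts @ map (cm 4) Ss"
  have po: "gw_consts (po i k) \<subseteq> carrier G" "gw_vars (po i k) \<subseteq> {i}" "gw_eval G y (po i k) = y i [^] k" for i k y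
    using gw_pow_simps[of \<one> "Var i" k] by (auto simp: po_def gw_eval_pow)
  have es: "(\<forall>(u, v)\<in>set es. gw_eval G (y(0 := g)) u = gw_eval G (y(0 := g)) v) \<longleftrightarrow>
      p \<otimes> y 1 [^] e = y 1 [^] e \<otimes> g \<otimes> y 2 [^] f \<otimes> p \<and> q \<otimes> y 3 [^] f = y 3 [^] f \<otimes> g \<otimes> y 4 [^] e \<otimes> q \<and>
      (\<forall>s\<in>S. y 1 \<otimes> s = s \<otimes> y 1) \<and> (\<forall>s\<in>T. y 2 \<otimes> s = s \<otimes> y 2) \<and>
      (\<forall>s\<in>T. y 3 \<otimes> s = s \<otimes> y 3) \<and> (\<forall>s\<in>S. y 4 \<otimes> s = s \<otimes> y 4)" for y g
    by (simp add: es_def po Ss Ts cm_def ball_Un)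
  have n: "{1..4::nat} = {1, 2, 3, 4}" by auto
  show ?thesis
  proof (rule diophantine_inI)
    show "gw_consts u \<union> gw_consts v \<subseteq> carrier G \<and> gw_vars u \<union> gw_vars v \<subseteq> {0..4}" if "(u, v) \<in> set es" for u v
      using that S(2) T(2) pq by (auto simp: es_def Ss Ts cm_def dest!: subsetD[OF po(1)] subsetD[OF po(2)])
    fix g
    show "g \<in> {g \<in> carrier G. (\<exists>a\<in>A. \<exists>d\<in>D. p \<otimes> a = a \<otimes> g \<otimes> d \<otimes> p) \<and> (\<exists>d\<in>D. \<exists>a\<in>A. q \<otimes> d = d \<otimes> g \<otimes> a \<otimes> q)} \<longleftrightarrow>
      g \<in> carrier G \<and> (\<exists>y. (\<forall>i\<in>{1..4}. y i \<in> carrier G) \<and>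
      (\<forall>(u, v)\<in>set es. gw_eval G (y(0 := g)) u = gw_eval G (y(0 := g)) v))" (is "?l \<longleftrightarrow> ?r")
    proof
      assume ?l
      then obtain y1 y2 y3 y4 where y: "y1 \<in> carrier G" "y2 \<in> carrier G" "y3 \<in> carrier G" "y4 \<in> carrier G"
        "p \<otimes> y1 [^] e = y1 [^] e \<otimes> g \<otimes> y2 [^] f \<otimes> p" "q \<otimes> y3 [^] f = y3 [^] f \<otimes> g \<otimes> y4 [^] e \<otimes> q"
        "\<forall>s\<in>S. y1 \<otimes> s = s \<otimes> y1" "\<forall>s\<in>T. y2 \<otimes> s = s \<otimes> y2"
        "\<forall>s\<in>T. y3 \<otimes> s = s \<otimes> y3" "\<forall>s\<in>S. y4 \<otimes> s = s \<otimes> y4"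
        unfolding A_def D_def centralizer_powers_def by blast
      then show ?r using \<open>?l\<close> unfolding es n
        by (intro conjI exI[of _ "\<lambda>i::nat. if i = 1 then y1 else if i = 2 then y2 else if i = 3 then y3 else y4"]) simp_all
    next
      assume ?r
      then obtain y where g: "g \<in> carrier G" and y0: "\<forall>i\<in>{1..4}. y i \<in> carrier G"
        "\<forall>(u, v)\<in>set es. gw_eval G (y(0 := g)) u = gw_eval G (y(0 := g)) v" by blast
      have y: "y 1 \<in> carrier G" "y 2 \<in> carrier G" "y 3 \<in> carrier G" "y 4 \<in> carrier G" using y0(1) by simp_all
      note e = y0(2)[unfolded es]
      have "y 1 [^] e \<in> A" "y 2 [^] f \<in> D" "y 3 [^] f \<in> D" "y 4 [^] e \<in> A"
        unfolding A_def D_def centralizer_powers_def using y e by blast+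
      with g e show ?l by blast
    qed
  qed
qed

end

section \<open>Root subgroups of a large subgroup\<close>

text \<open>The Weyl group is transitive on roots of each length, so two cases cover all
  roots.\<close>

lemma C2_frame:
  assumes "\<gamma> \<in> C2"
  obtains f g where "frame f g" "\<gamma> = 2 *\<^sub>R f \<or> \<gamma> = f + g"
proof -
  have c: "\<gamma> = (\<gamma> $ 1) *\<^sub>R axis 1 1 + (\<gamma> $ 2) *\<^sub>R axis 2 1"
    by (simp add: vec_eq_iff forall_2 axis_def)
  from assms consider
    "frame ((\<gamma> $ 1) *\<^sub>R axis 1 1) ((\<gamma> $ 2) *\<^sub>R axis 2 1)"
    | "frame ((\<gamma> $ 1 / 2) *\<^sub>R axis 1 1) (axis 2 1)" "\<gamma> $ 2 = 0"
    | "frame ((\<gamma> $ 2 / 2) *\<^sub>R axis 2 1) (axis 1 1)" "\<gamma> $ 1 = 0"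
    unfolding C2_iff frame_def by (elim insertE emptyE Pair_inject) (simp_all add: axis_def)
  then show thesis
  proof cases
    case 1 then show thesis using that c by blast
  next
    case 2 then show thesis using that[OF 2(1)] c by simp
  next
    case 3 then show thesis using that[OF 3(1)] c by simp
  qed
qed

context c2_rep
begin

lemma root_subgroup_eq: "\<alpha> \<in> C2 \<Longrightarrow> root_subgroup (\<pi> (x \<alpha>)) = Rep_sqm ` range (xe (Xi \<alpha>))"
  by (auto simp: root_subgroup_def unipotent_eq)

text \<open>Up to the sign of its parameter, every complex root unipotent is a generator of
  \<open>words\<close>; so an equation valid on \<open>words\<close> is among those defining the
  Chevalley group.\<close>

lemma frame_rpoint:
  assumes "c2_wt (Xi (2 *\<^sub>R g)) (Xi (- (2 *\<^sub>R g))) (\<sigma> \<cdot> Xi (f + g)) (\<sigma> \<cdot> Xi (- (f + g)))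
       (\<tau> \<cdot> Xi (2 *\<^sub>R f)) (\<tau> \<cdot> Xi (- (2 *\<^sub>R f))) (Xi (f - g)) (Xi (g - f)) P1 S1 P2 S2"
    and fr: "frame f g" and st: "\<sigma> \<in> {1, - 1}" "\<tau> \<in> {1, - 1}"
    and z: "z \<in> carrier (chevalley_group C2 (\<lambda>\<alpha>. \<pi> (x \<alpha>)) :: ('r::comm_ring_1^'n^'n) monoid)"
  shows "c2_wt.rpoint (Xi (2 *\<^sub>R g)) (Xi (- (2 *\<^sub>R g))) (\<sigma> \<cdot> Xi (f + g)) (\<sigma> \<cdot> Xi (- (f + g)))
       (\<tau> \<cdot> Xi (2 *\<^sub>R f)) (\<tau> \<cdot> Xi (- (2 *\<^sub>R f))) (Xi (f - g)) (Xi (g - f)) (Abs_sqm z)"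
proof -
  interpret S: c2_wt "Xi (2 *\<^sub>R g)" "Xi (- (2 *\<^sub>R g))" "\<sigma> \<cdot> Xi (f + g)" "\<sigma> \<cdot> Xi (- (f + g))"
    "\<tau> \<cdot> Xi (2 *\<^sub>R f)" "\<tau> \<cdot> Xi (- (2 *\<^sub>R f))" "Xi (f - g)" "Xi (g - f)" P1 S1 P2 S2 by fact
  have xw: "xe (Xi \<alpha>) t \<in> S.words" if a: "\<alpha> \<in> C2" for \<alpha> t
  proof -
    obtain u u' where u: "xe (Xi \<alpha>) t = xe (\<sigma> \<cdot> Xi \<alpha>) u" "xe (Xi \<alpha>) t = xe (\<tau> \<cdot> Xi \<alpha>) u'"
      using xe_sign(2)[OF st(1) Xi_dp(1)[OF a]] xe_sign(2)[OF st(2) Xi_dp(1)[OF a]] by blast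
    from frame_cases[OF fr a]
    consider "Xi \<alpha> \<in> {Xi (2 *\<^sub>R g), Xi (- (2 *\<^sub>R g)), Xi (f - g), Xi (g - f)}"
      | "\<sigma> \<cdot> Xi \<alpha> \<in> {\<sigma> \<cdot> Xi (f + g), \<sigma> \<cdot> Xi (- (f + g))}"
      | "\<tau> \<cdot> Xi \<alpha> \<in> {\<tau> \<cdot> Xi (2 *\<^sub>R f), \<tau> \<cdot> Xi (- (2 *\<^sub>R f))}" by blast
    then show ?thesis
    proof cases
      case 1 then show ?thesis by (intro S.words_xe) blast
    next
      case 2 then show ?thesis unfolding u(1) by (intro S.words_xe) blast
    next
      case 3 then show ?thesis unfolding u(2) by (intro S.words_xe) blast
    qed
  qed
  have w: "Abs_sqm c \<in> S.words" if "c \<in> elementary_group C2 (\<lambda>\<alpha>. \<pi> (x \<alpha>))" for c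
    by (rule elementary_group_words[OF S.words.one S.words_mult xw that])
  show ?thesis unfolding S.rpoint_def
  proof (intro conjI allI impI)
    show "sdet (Abs_sqm z) = 1" using z by (simp add: sdet_def Abs_sqm_inverse chevalley_group_def SL_def)
    fix F :: "(complex, 'n) sqm \<Rightarrow> complex" and F' :: "('r, 'n) sqm \<Rightarrow> 'r"
    assume F: "ipoly F F'" "\<forall>w\<in>S.words. F w = 0"
    then obtain p where p: "\<And>g. F g = entry_poly_eval p (Rep_sqm g)" "\<And>g. F' g = entry_poly_eval p (Rep_sqm g)"
      unfolding ipoly_def by blast
    have "entry_poly_eval p c = 0" if "c \<in> (elementary_group C2 (\<lambda>\<alpha>. \<pi> (x \<alpha>)) :: (complex^'n^'n) set)" for c
      using F(2) w[OF that] p(1)[of "Abs_sqm c"] by (simp add: Abs_sqm_inverse)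
    then show "F' (Abs_sqm z) = 0" using z p(2)[of "Abs_sqm z"]
      by (simp add: Abs_sqm_inverse chevalley_group_def)
  qed
qed

context
  fixes G :: "('r::comm_ring_1^'n^'n) set"
  assumes type: "weight_lattice C2_base h \<pi> = root_lattice C2 \<or> (2::'r) dvd 1"
    and large: "large_subgroup C2 (\<lambda>\<alpha>. \<pi> (x \<alpha>)) G"
begin

abbreviation GG where "GG \<equiv> (chevalley_group C2 (\<lambda>\<alpha>. \<pi> (x \<alpha>)))\<lparr>carrier := G\<rparr>"

lemma GG_simps: "mult GG = (**)" "one GG = mat 1"
  by (simp_all add: chevalley_group_def SL_def)

lemma group_GG: "group GG" by (rule large_subgroup_group(1)[OF large])

lemma GG_pow: "y [^]\<^bsub>GG\<^esub> (e::nat) = Rep_sqm (Abs_sqm y ^ e)"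
proof (induction e)
  case 0
  then show ?case by (simp add: one_sqm.rep_eq chevalley_group_def SL_def)
next
  case (Suc e)
  have "y [^]\<^bsub>GG\<^esub> Suc e = y [^]\<^bsub>GG\<^esub> e ** y" by (simp add: chevalley_group_def SL_def)
  then show ?case unfolding Suc power_Suc2 times_sqm.rep_eq by (simp add: Abs_sqm_inverse)
qed

lemma xe_large: "\<alpha> \<in> C2 \<Longrightarrow> Rep_sqm (xe (Xi \<alpha>) t) \<in> G"
  using unipotent_elementary large unfolding large_subgroup_def by blast

lemma long_root_group:
  assumes fr: "frame f g"
  obtains S e where "finite S" "S \<subseteq> G" "root_subgroup (\<pi> (x (2 *\<^sub>R f))) = group.centralizer_powers GG S e"
proof -
  obtain \<sigma> \<tau> :: int and P1 S1 P2 S2 where st: "\<sigma> \<in> {1, - 1}" "\<tau> \<in> {1, - 1}" and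
    wt: "c2_wt (Xi (2 *\<^sub>R g)) (Xi (- (2 *\<^sub>R g))) (\<sigma> \<cdot> Xi (f + g)) (\<sigma> \<cdot> Xi (- (f + g)))
       (\<tau> \<cdot> Xi (2 *\<^sub>R f)) (\<tau> \<cdot> Xi (- (2 *\<^sub>R f))) (Xi (f - g)) (Xi (g - f)) P1 S1 P2 S2"
    by (rule frame_wt[OF fr])
  interpret S: c2_wt "Xi (2 *\<^sub>R g)" "Xi (- (2 *\<^sub>R g))" "\<sigma> \<cdot> Xi (f + g)" "\<sigma> \<cdot> Xi (- (f + g))"
    "\<tau> \<cdot> Xi (2 *\<^sub>R f)" "\<tau> \<cdot> Xi (- (2 *\<^sub>R f))" "Xi (f - g)" "Xi (g - f)" P1 S1 P2 S2 by (rule wt)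
  note R = frame_roots[OF fr]
  have sx: "Rep_sqm (xe (\<sigma>' \<cdot> Xi \<alpha>) t) \<in> G" if "\<alpha> \<in> C2" for \<sigma>' \<alpha> t
    using xe_large[OF that] by (simp add: xe_scal Xi_dp[OF that])
  have G: "S.rpoint z" if "z \<in> Abs_sqm ` G" for z
    using that large subgroup.subset[of G] frame_rpoint[OF wt fr st] by (auto simp: large_subgroup_def)
  have m: "z * w \<in> Abs_sqm ` G" if "z \<in> Abs_sqm ` G" "w \<in> Abs_sqm ` G" for z w
    using that large_subgroup_group(2)[OF large] by (auto simp flip: Abs_sqm_mult)
  have d: "xe (\<tau> \<cdot> Xi (2 *\<^sub>R f)) t \<in> Abs_sqm ` G" for t
    using sx[OF R(5)] by (metis Rep_sqm_inverse imageI)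
  have even: "(\<forall>a b. P1 a * P2 b \<noteq> 0 \<longrightarrow> even (a + b)) \<or> (2::'r) dvd 1"
  proof (cases "(2::'r) dvd 1")
    case False
    then have lat: "weight_lattice C2_base h \<pi> = root_lattice C2" using type by blast
    have "\<tau> * \<tau> = 1" using st by auto
    \<comment> \<open>The two factors \<open>\<tau>\<close> cancel in the bracket.\<close>
    then have H: "S.H1 = br (Xi (2 *\<^sub>R f)) (Xi (- (2 *\<^sub>R f)))" "S.H2 = br (Xi (2 *\<^sub>R g)) (Xi (- (2 *\<^sub>R g)))"
      by (simp_all add: S.H1_def S.H2_def br_scal_left br_scal_right)
    show ?thesis
      using frame_even_weight[OF fr lat] S.joint_eigen unfolding H by blast
  qed simp
  define S0 where "S0 = {xe (Xi (2 *\<^sub>R g)) 1, xe (Xi (- (2 *\<^sub>R g))) 1, xe (\<sigma> \<cdot> Xi (f + g)) 1, xe (Xi (f - g)) 1,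
    xe (\<tau> \<cdot> Xi (2 *\<^sub>R f)) (1 :: 'r)}"
  obtain e where e: "range (xe (\<tau> \<cdot> Xi (2 *\<^sub>R f))) = {y ^ e | y. y \<in> Abs_sqm ` G \<and> (\<forall>s\<in>S0. y * s = s * y)}"
    using S.long_root_subgroup[OF G m d even] unfolding S0_def by blast
  have c: "y \<otimes>\<^bsub>GG\<^esub> Rep_sqm s = Rep_sqm s \<otimes>\<^bsub>GG\<^esub> y \<longleftrightarrow> Abs_sqm y * s = s * Abs_sqm y" for y s
  proof -
    have "y ** Rep_sqm s = Rep_sqm s ** y \<longleftrightarrow> Abs_sqm (y ** Rep_sqm s) = Abs_sqm (Rep_sqm s ** y)"
      by (simp add: Abs_sqm_inject)
    then show ?thesis by (simp add: GG_simps Abs_sqm_mult Rep_sqm_inverse)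
  qed
  have "root_subgroup (\<pi> (x (2 *\<^sub>R f))) = Rep_sqm ` {y ^ e | y. y \<in> Abs_sqm ` G \<and> (\<forall>s\<in>S0. y * s = s * y)}"
    by (simp only: root_subgroup_eq[OF R(5)] xe_sign(1)[OF st(2) Xi_dp(1)[OF R(5)]] flip: e)
  also have "\<dots> = group.centralizer_powers GG (Rep_sqm ` S0) e"
    unfolding group.centralizer_powers_def[OF group_GG] ball_simps c GG_pow by auto
  finally show thesis
    using that[of "Rep_sqm ` S0" e] sx[OF R(1)] sx[OF R(5)] xe_large R by (simp add: S0_def)
qed

lemma short_root_group:
  assumes fr: "frame f g"
  shows "diophantine_in (root_subgroup (\<pi> (x (f + g)))) GG"
proof -
  obtain \<sigma> \<tau> :: int and P1 S1 P2 S2 where st: "\<sigma> \<in> {1, - 1}" "\<tau> \<in> {1, - 1}" and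
    wt: "c2_wt (Xi (2 *\<^sub>R g)) (Xi (- (2 *\<^sub>R g))) (\<sigma> \<cdot> Xi (f + g)) (\<sigma> \<cdot> Xi (- (f + g)))
       (\<tau> \<cdot> Xi (2 *\<^sub>R f)) (\<tau> \<cdot> Xi (- (2 *\<^sub>R f))) (Xi (f - g)) (Xi (g - f)) P1 S1 P2 S2"
    by (rule frame_wt[OF fr])
  interpret S: c2_wt "Xi (2 *\<^sub>R g)" "Xi (- (2 *\<^sub>R g))" "\<sigma> \<cdot> Xi (f + g)" "\<sigma> \<cdot> Xi (- (f + g))"
    "\<tau> \<cdot> Xi (2 *\<^sub>R f)" "\<tau> \<cdot> Xi (- (2 *\<^sub>R f))" "Xi (f - g)" "Xi (g - f)" P1 S1 P2 S2 by (rule wt)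
  note R = frame_roots[OF fr]
  \<comment> \<open>In the swapped frame \<open>2 g\<close> takes the place of
    \<open>2 f\<close>.\<close>
  obtain S e where S: "finite S" "S \<subseteq> G" "root_subgroup (\<pi> (x (2 *\<^sub>R g))) = group.centralizer_powers GG S e"
    by (rule long_root_group[OF frame_swap[OF fr]])
  obtain T k where T: "finite T" "T \<subseteq> G" "root_subgroup (\<pi> (x (2 *\<^sub>R f))) = group.centralizer_powers GG T k"
    by (rule long_root_group[OF fr])
  let ?p = "xe (Xi (f - g)) (1 :: 'r)" and ?q = "xe (Xi (g - f)) (1 :: 'r)"
  have A: "group.centralizer_powers GG S e = Rep_sqm ` range (xe (Xi (2 *\<^sub>R g)))"
    by (simp only: root_subgroup_eq[OF R(7)] flip: S(3))
  have D: "group.centralizer_powers GG T k = Rep_sqm ` range (xe (Xi (2 *\<^sub>R f)))"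
    by (simp only: root_subgroup_eq[OF R(5)] flip: T(3))
  have C: "z \<in> root_subgroup (\<pi> (x (f + g))) \<longleftrightarrow> Abs_sqm z \<in> range (xe (Xi (f + g)))" for z :: "'r^'n^'n"
  proof -
    have "z = Rep_sqm (Abs_sqm z)" by (simp add: Abs_sqm_inverse)
    then show ?thesis unfolding root_subgroup_eq[OF R(1)] by (auto simp: Rep_sqm_inverse)
  qed
  have eq: "Rep_sqm p ** Rep_sqm a = Rep_sqm a ** z ** Rep_sqm d ** Rep_sqm p \<longleftrightarrow> p * a = a * Abs_sqm z * d * p" for p a d z
  proof -
    have "Rep_sqm p ** Rep_sqm a = Rep_sqm a ** z ** Rep_sqm d ** Rep_sqm p \<longleftrightarrow>
      Abs_sqm (Rep_sqm p ** Rep_sqm a) = Abs_sqm (Rep_sqm a ** z ** Rep_sqm d ** Rep_sqm p)"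
      by (simp add: Abs_sqm_inject)
    then show ?thesis by (simp add: Abs_sqm_mult Rep_sqm_inverse)
  qed
  have sub: "root_subgroup (\<pi> (x (f + g))) \<subseteq> G"
    using xe_large R(1) by (auto simp: root_subgroup_eq)
  have short: "range (xe (Xi (f + g))) = {z :: ('r, 'n) sqm.
      (\<exists>a\<in>range (xe (Xi (2 *\<^sub>R g))). \<exists>d\<in>range (xe (Xi (2 *\<^sub>R f))). ?p * a = a * z * d * ?p) \<and>
      (\<exists>d\<in>range (xe (Xi (2 *\<^sub>R f))). \<exists>a\<in>range (xe (Xi (2 *\<^sub>R g))). ?q * d = d * z * a * ?q)}"
    unfolding xe_sign(1)[OF st(1) Xi_dp(1)[OF R(1)], symmetric] xe_sign(1)[OF st(2) Xi_dp(1)[OF R(5)], symmetric]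
    by (rule S.short_root_subgroup)
  have "root_subgroup (\<pi> (x (f + g))) = {z \<in> carrier GG.
     (\<exists>a\<in>group.centralizer_powers GG S e. \<exists>d\<in>group.centralizer_powers GG T k.
        Rep_sqm ?p \<otimes>\<^bsub>GG\<^esub> a = a \<otimes>\<^bsub>GG\<^esub> z \<otimes>\<^bsub>GG\<^esub> d \<otimes>\<^bsub>GG\<^esub> Rep_sqm ?p) \<and>
     (\<exists>d\<in>group.centralizer_powers GG T k. \<exists>a\<in>group.centralizer_powers GG S e.
        Rep_sqm ?q \<otimes>\<^bsub>GG\<^esub> d = d \<otimes>\<^bsub>GG\<^esub> z \<otimes>\<^bsub>GG\<^esub> a \<otimes>\<^bsub>GG\<^esub> Rep_sqm ?q)}"
  proof (rule Set.set_eqI)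
    fix z :: "'r^'n^'n"
    have "Abs_sqm z \<in> range (xe (Xi (f + g))) \<longleftrightarrow>
      (\<exists>a\<in>range (xe (Xi (2 *\<^sub>R g))). \<exists>d\<in>range (xe (Xi (2 *\<^sub>R f))). ?p * a = a * Abs_sqm z * d * ?p) \<and>
      (\<exists>d\<in>range (xe (Xi (2 *\<^sub>R f))). \<exists>a\<in>range (xe (Xi (2 *\<^sub>R g))). ?q * d = d * Abs_sqm z * a * ?q)"
      unfolding short by blast
    then show "z \<in> root_subgroup (\<pi> (x (f + g))) \<longleftrightarrow> z \<in> {z \<in> carrier GG.
       (\<exists>a\<in>group.centralizer_powers GG S e. \<exists>d\<in>group.centralizer_powers GG T k.
          Rep_sqm ?p \<otimes>\<^bsub>GG\<^esub> a = a \<otimes>\<^bsub>GG\<^esub> z \<otimes>\<^bsub>GG\<^esub> d \<otimes>\<^bsub>GG\<^esub> Rep_sqm ?p) \<and>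
       (\<exists>d\<in>group.centralizer_powers GG T k. \<exists>a\<in>group.centralizer_powers GG S e.
          Rep_sqm ?q \<otimes>\<^bsub>GG\<^esub> d = d \<otimes>\<^bsub>GG\<^esub> z \<otimes>\<^bsub>GG\<^esub> a \<otimes>\<^bsub>GG\<^esub> Rep_sqm ?q)}"
      unfolding A D GG_simps mem_Collect_eq bex_simps(7) eq
      using C[of z] sub by auto
  qed
  then show ?thesis
    using group.diophantine_commutator_equations[OF group_GG, of S T "Rep_sqm ?p" "Rep_sqm ?q" e k] S T xe_large R(3,4)
    by simp
qed

lemma root_group_diophantine:
  assumes "\<gamma> \<in> C2"
  shows "diophantine_in (root_subgroup (\<pi> (x \<gamma>))) GG"
proof -
  obtain f g where fr: "frame f g" and "\<gamma> = 2 *\<^sub>R f \<or> \<gamma> = f + g" by (rule C2_frame[OF assms])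
  then show ?thesis
  proof (elim disjE)
    assume \<gamma>: "\<gamma> = 2 *\<^sub>R f"
    obtain S e where S: "finite S" "S \<subseteq> G" "root_subgroup (\<pi> (x (2 *\<^sub>R f))) = group.centralizer_powers GG S e"
      by (rule long_root_group[OF fr])
    then show ?thesis
      using group.diophantine_centralizer_powers[OF group_GG, of S e] by (simp add: \<gamma>)
  next
    assume "\<gamma> = f + g" then show ?thesis using short_root_group[OF fr] by simp
  qed
qed

end

end

theorem proposition4:
  fixes smul :: "complex \<Rightarrow> 'l::ab_group_add \<Rightarrow> 'l"
    and lie :: "'l \<Rightarrow> 'l \<Rightarrow> 'l"
    and h x :: "real^2 \<Rightarrow> 'l"
    and \<pi> :: "'l \<Rightarrow> complex^'n^'n"
    and G :: "('r::comm_ring_1^'n^'n) set"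
    and \<gamma> :: "real^2"
  assumes "chevalley_basis smul lie C2 C2_base h x"
    and "lie_representation smul lie \<pi>"
    and "inj \<pi>"
    and "admissible C2 (\<lambda>\<alpha>. \<pi> (x \<alpha>))"
    and "weight_lattice C2_base h \<pi> = root_lattice C2 \<or> (2::'r) dvd 1"
    and "large_subgroup C2 (\<lambda>\<alpha>. \<pi> (x \<alpha>)) G"
    and "\<gamma> \<in> C2"
  shows "diophantine_in (root_subgroup (\<pi> (x \<gamma>)))
           ((chevalley_group C2 (\<lambda>\<alpha>. \<pi> (x \<alpha>)))\<lparr>carrier := G\<rparr>)"
proof -
  have "c2_rep smul lie h x \<pi>"
    using assms(1-4) unfolding c2_rep_def c2_rep_axioms_def by blast
  then show ?thesis by (rule c2_rep.root_group_diophantine) (rule assms)+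
qed

end
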